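(* Let $f:[0,1]\to[0,1]$ be continuous and let $B$ be a basic set of $f$. Then the following statements are true. 1) For any $l\in\mathbb N$ the set of CO-measures in $M_{f|B}$ concentrated on cycles of minimal period $p\ge l$ is dense in $M_{f|B}$. 2) The set of ergodic non-atomic invariant measures $\mu$ with $\mathrm{supp}\,\mu=B$ is residual in $M_{f|B}$. 3) The set of all invariant measures which are not strongly mixing is a residual subset of $M_{f|B}$. 4) Let $V\subset M_{f|B}$ be a non-empty closed connected set. Then the set of all points $x\in B$ such that $V_f(x)=V$ is dense in $B$ (in particular, every measure $\mu\in M_{f|B}$ has generic points). 5) The set of points with maximal oscillation for $f|B$ is residual in $B$.
   Context: A closed interval $I$ is periodic of period $m$ if $I,fI,\dots,f^{m-1}I$ are pairwise disjoint and $f^mI=I$; $\mathrm{orb}\,I=\bigcup_{i=0}^{m-1}f^iI$. For a set $U$, $\mathrm{orb}\,U=\bigcup_{i\ge0}f^iU$. With $M=\mathrm{orb}\,I$, the set $\{x\in M:\overline{\mathrm{orb}\,U}=M$ for every relative neighborhood $U$ of $x$ in $M\}$, if infinite, is called a basic set and denoted $B(\mathrm{orb}\,I,f)$; it is a closed invariant set. $M_{f|B}$ is the set of $f$-invariant Borel probability measures on $B$ with the weak topology. A CO-measure is an invariant probability measure whose support is a single periodic orbit (cycle). A measure is non-atomic if it vanishes on points; it is strongly mixing if $\lim_{n\to\infty}\mu(A\cap f^{-n}C)=\mu(A)\mu(C)$ for all measurable $A,C$. $V_f(x)$ is the set of weak limit measures, as $N\to\infty$, of $N^{-1}\sum_{j=0}^{N-1}f^j_*\delta_x$.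 A point $x\in B$ has maximal oscillation for $f|B$ if $V_f(x)=M_{f|B}$, and is generic for $\mu$ if $V_f(x)=\{\mu\}$. A set is residual if it contains a dense $G_\delta$-set. *)

theory Defs
  imports "HOL-Probability.Probability"
begin

definition periodic_interval :: "(real \<Rightarrow> real) \<Rightarrow> real set \<Rightarrow> nat \<Rightarrow> bool" where
  "periodic_interval f I m \<longleftrightarrow>
     (\<exists>a b. a \<le> b \<and> I = {a..b}) \<and> I \<subseteq> {0..1} \<and> m > 0 \<and>
     disjoint_family_on (\<lambda>i. (f ^^ i) ` I) {..<m} \<and> (f ^^ m) ` I = I"

definition orb :: "(real \<Rightarrow> real) \<Rightarrow> real set \<Rightarrow> real set" where
  "orb f U = (\<Union>i. (f ^^ i) ` U)"

text \<open>\<open>basic_points f M\<close> is only called a basic set when \<open>M\<close> is the orbit of a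
  periodic interval and the set is infinite, see \<open>basic_set\<close>.\<close>

definition basic_points :: "(real \<Rightarrow> real) \<Rightarrow> real set \<Rightarrow> real set" where
  "basic_points f M =
     {x \<in> M. \<forall>U. openin (top_of_set M) U \<and> x \<in> U \<longrightarrow> closure (orb f U) = M}"

definition basic_set :: "(real \<Rightarrow> real) \<Rightarrow> real set \<Rightarrow> bool" where
  "basic_set f B \<longleftrightarrow>
     (\<exists>I m. periodic_interval f I m \<and> B = basic_points f (\<Union>i<m. (f ^^ i) ` I)) \<and> infinite B"

definition dense_in :: "'a topology \<Rightarrow> 'a set \<Rightarrow> bool" where
  "dense_in X S \<longleftrightarrow> S \<subseteq> topspace X \<and> X closure_of S = topspace X"

definition residual_in :: "'a topology \<Rightarrow> 'a set \<Rightarrow> bool" where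
  "residual_in X S \<longleftrightarrow> S \<subseteq> topspace X \<and> (\<exists>G. gdelta_in X G \<and> dense_in X G \<and> G \<subseteq> S)"

text \<open>A Borel measure on \<open>B\<close> is a measure whose underlying measurable space is \<open>B\<close>
  itself, not a measure on the line that is concentrated on \<open>B\<close>.\<close>

definition prob_measures_on :: "real set \<Rightarrow> real measure set" where
  "prob_measures_on B = {\<mu>. sets \<mu> = sets (restrict_space borel B) \<and> prob_space \<mu>}"

text \<open>The coarsest topology for which all integrals of bounded continuous functions depend
  continuously on the measure.\<close>

definition weak_topology :: "real set \<Rightarrow> real measure topology" where
  "weak_topology B = topology_generated_by
     {{\<mu> \<in> prob_measures_on B. (\<integral>x. \<phi> x \<partial>\<mu>) \<in> W} | (\<phi> :: real \<Rightarrow> real) W.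
        continuous_on B \<phi> \<and> bounded (\<phi> ` B) \<and> open W}"

definition invariant_measures :: "(real \<Rightarrow> real) \<Rightarrow> real set \<Rightarrow> real measure set" where
  "invariant_measures f B =
     {\<mu> \<in> prob_measures_on B. f \<in> measurable \<mu> \<mu> \<and> distr \<mu> \<mu> f = \<mu>}"

definition invariant_space :: "(real \<Rightarrow> real) \<Rightarrow> real set \<Rightarrow> real measure topology" where
  "invariant_space f B = subtopology (weak_topology B) (invariant_measures f B)"

definition supp :: "real measure \<Rightarrow> real set" where
  "supp \<mu> = {x \<in> space \<mu>. \<forall>U. open U \<and> x \<in> U \<longrightarrow> emeasure \<mu> (U \<inter> space \<mu>) > 0}"

definition minimal_period :: "(real \<Rightarrow> real) \<Rightarrow> real \<Rightarrow> nat \<Rightarrow> bool" where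
  "minimal_period f x p \<longleftrightarrow>
     p > 0 \<and> (f ^^ p) x = x \<and> (\<forall>q. 0 < q \<and> q < p \<longrightarrow> (f ^^ q) x \<noteq> x)"

definition CO_measure :: "(real \<Rightarrow> real) \<Rightarrow> real set \<Rightarrow> nat \<Rightarrow> real measure \<Rightarrow> bool" where
  "CO_measure f B p \<mu> \<longleftrightarrow> \<mu> \<in> invariant_measures f B \<and>
     (\<exists>x. minimal_period f x p \<and> supp \<mu> = (\<lambda>i. (f ^^ i) x) ` {..<p})"

definition ergodic :: "(real \<Rightarrow> real) \<Rightarrow> real measure \<Rightarrow> bool" where
  "ergodic f \<mu> \<longleftrightarrow>
     (\<forall>A\<in>sets \<mu>. f -` A \<inter> space \<mu> = A \<longrightarrow> measure \<mu> A = 0 \<or> measure \<mu> A = 1)"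

definition non_atomic :: "real measure \<Rightarrow> bool" where
  "non_atomic \<mu> \<longleftrightarrow> (\<forall>x\<in>space \<mu>. measure \<mu> {x} = 0)"

definition strongly_mixing :: "(real \<Rightarrow> real) \<Rightarrow> real measure \<Rightarrow> bool" where
  "strongly_mixing f \<mu> \<longleftrightarrow> (\<forall>A\<in>sets \<mu>. \<forall>C\<in>sets \<mu>.
     (\<lambda>n. measure \<mu> (A \<inter> ((f ^^ n) -` C \<inter> space \<mu>))) \<longlonglongrightarrow> measure \<mu> A * measure \<mu> C)"

text \<open>The measure \<open>1/N * (\<Sum>j<N. f\<^sup>j\<^sub>* \<delta>\<^sub>x)\<close> on \<open>B\<close>, with \<open>return _ x\<close> for the Dirac measure
  and \<open>distr\<close> for the push-forward; meant for \<open>x \<in> B\<close>, \<open>f ` B \<subseteq> B\<close> and \<open>N > 0\<close>.\<close>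

definition empirical_measure :: "(real \<Rightarrow> real) \<Rightarrow> real set \<Rightarrow> real \<Rightarrow> nat \<Rightarrow> real measure" where
  "empirical_measure f B x N =
     (let R = restrict_space borel B in
      measure_of B (sets R)
        (\<lambda>A. inverse (of_nat N) * (\<Sum>j<N. emeasure (distr (return R x) R (f ^^ j)) A)))"

definition limit_measures :: "(real \<Rightarrow> real) \<Rightarrow> real set \<Rightarrow> real \<Rightarrow> real measure set" where
  "limit_measures f B x =
     {\<mu>. \<exists>r. strict_mono r \<and>
        limitin (weak_topology B) (\<lambda>k. empirical_measure f B x (r k)) \<mu> sequentially}"

definition maximal_oscillation :: "(real \<Rightarrow> real) \<Rightarrow> real set \<Rightarrow> real \<Rightarrow> bool" where
  "maximal_oscillation f B x \<longleftrightarrow> x \<in> B \<and> limit_measures f B x = invariant_measures f B"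

definition generic_point :: "(real \<Rightarrow> real) \<Rightarrow> real set \<Rightarrow> real measure \<Rightarrow> real \<Rightarrow> bool" where
  "generic_point f B \<mu> x \<longleftrightarrow> x \<in> B \<and> limit_measures f B x = {\<mu>}"

end

theory Submission imports Defs begin

text \<open>Call an interval big if its orbit is dense in \<open>M = orb I\<close>. A dense orbit of an interval
  either swallows a fixed point, and then it covers everything off that point, or \<open>f\<close> interchanges the two
  sides of the point and one passes to the second iterate. So a big interval eventually covers every
  interval off a finite set. In particular all big intervals cover a common core, a big interval
  that covers itself. Around a point of \<open>B\<close> one finds big intervals that shadow its orbit for a
  prescribed time, are reached from the core and return to it with bounded delay. Blocks of this kind
  can be linked into periodic orbits and into infinite orbits in \<open>B\<close>. The finitely many points where
  shadowing may fail carry no mass unless they are periodic, and periodic points are treated separately.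

  The cycles obtained in this way have almost the integral of any given invariant measure on any given continuous
  function. Two cycles can be mixed in any proportion, so a Frank-Wolfe argument on moments shows that
  cycles are dense, also with the requirement to visit given places. Long cycles are ergodic, have
  small atoms and are periodic under \<open>f\<close>, hence the residual statements follow by Baire category from
  open conditions that hold on them. Finally, a connected set \<open>V\<close> of measures is traversed by a sequence with steps
  tending to 0, each term approximated by a cycle, and an orbit that shadows these cycles for
  rapidly growing times has \<open>V\<close> as its set of limit measures.\<close>

section \<open>Transitive interval maps\<close>

text \<open>The weak topology is handled in coordinates: since \<open>B\<close> lies in [0,1], a
  measure is determined by its moments, and closeness means closeness of finitely many of them. What
  shapes the dynamical half is that being covered is weaker than lying in \<open>B\<close>:
  preimages and fixed points given by the intermediate value theorem may fall outside
  \<open>B\<close>. They are taken at extremal positions, where a one-sided neighbourhood can be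
  pushed over a big interval. For fixed points this works on increasing branches, whence cycles run
  through their itinerary twice; it is also why the right end of the core belongs to
  \<open>B\<close> and is big from the left. Two kinds of shadowing are needed. A cycle can be
  shadowed at every instant, even if it meets the exceptional set, with delays independent of the
  duration. An arbitrary orbit can be shadowed only while it stays away from finitely many bad
  points; the lost instants are paid for by a penalty of twice a bound of the test function, on a
  set of small measure. Once cycles with large integrals are available, the first kind
  suffices.\<close>

lemma funpow_image_add: "(g ^^ (n + k)) ` A = (g ^^ n) ` ((g ^^ k) ` A)"
  by (simp add: funpow_add image_comp)

lemma funpow_image_subset: "g ` T \<subseteq> T \<Longrightarrow> (g ^^ n) ` T \<subseteq> (T :: 'a set)"
  by (induction n) (auto simp: image_subset_iff)

lemma funpow_mem: "g ` T \<subseteq> T \<Longrightarrow> x \<in> T \<Longrightarrow> (g ^^ n) x \<in> (T :: 'a set)"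
  by (rule subsetD[OF funpow_image_subset[of g T n] imageI])

lemma funpow_image_eq: "g ` T = T \<Longrightarrow> (g ^^ n) ` T = (T :: 'a set)"
proof (induction n)
  case (Suc n)
  assume "g ` T = T"
  then show ?case using Suc funpow_image_add[where g = g and n = 1 and k = n and A = T] by simp
qed simp

lemma funpow_continuous_on:
  fixes T :: "'a::topological_space set"
  assumes "continuous_on T g" "g ` T \<subseteq> T"
  shows "continuous_on T (g ^^ n)"
proof (induction n)
  case (Suc n)
  have "continuous_on ((g ^^ n) ` T) g"
    by (rule continuous_on_subset[OF assms(1) funpow_image_subset[OF assms(2)]])
  then show ?case using continuous_on_compose [OF Suc] by (simp add: comp_def)
qed (simp add: id_def)

lemma funpow_fixed: "g c = c \<Longrightarrow> (g ^^ n) c = c" by (induction n) auto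

lemma orb_superset: "A \<subseteq> orb g A"
proof
  fix x assume "x \<in> A"
  then have "x \<in> (g ^^ 0) ` A" by simp
  then show "x \<in> orb g A" unfolding orb_def by blast
qed

lemma orb_mono: "A \<subseteq> A' \<Longrightarrow> orb g A \<subseteq> orb g A'"
  unfolding orb_def by blast

lemma orb_invariant_subset: "g ` T \<subseteq> T \<Longrightarrow> A \<subseteq> T \<Longrightarrow> orb g A \<subseteq> T"
  unfolding orb_def using funpow_mem[of g T] by blast

lemma orb_iterate_subset: "orb g ((g ^^ i) ` A) \<subseteq> orb g A"
  unfolding orb_def funpow_image_add [symmetric] by blast

lemma orb_iterate: "orb g ((g ^^ i) ` A) = (g ^^ i) ` orb g A"
proof -
  have "(g ^^ n) ` (g ^^ i) ` A = (g ^^ i) ` (g ^^ n) ` A" for n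
    by (metis funpow_image_add add.commute)
  then show ?thesis unfolding orb_def by (simp add: image_UN)
qed

text \<open>A continuous onto map sends dense sets to dense sets, and the orbit of an iterate of
  \<open>A\<close> is the same iterate of the orbit of \<open>A\<close>. Hence the first images may
  be discarded without losing density.\<close>

lemma tail_dense:
  fixes T :: "real set"
  assumes "closed T" "continuous_on T g" "g ` T = T" "A \<subseteq> T" "closure (orb g A) = T"
  shows "closure (orb g ((g ^^ i) ` A)) = T"
proof
  have sub: "orb g A \<subseteq> T" by (rule orb_invariant_subset) (use assms in auto)
  have "(g ^^ i) ` closure (orb g A) \<subseteq> closure ((g ^^ i) ` orb g A)"
  proof (rule image_closure_subset)
    show "continuous_on (closure (orb g A)) (g ^^ i)"
      unfolding assms(5) by (rule funpow_continuous_on) (use assms in auto)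
  qed (simp_all add: closure_subset)
  then have "(g ^^ i) ` T \<subseteq> closure ((g ^^ i) ` orb g A)" unfolding assms(5) .
  then show "T \<subseteq> closure (orb g ((g ^^ i) ` A))"
    unfolding funpow_image_eq[OF assms(3)] orb_iterate .
  show "closure (orb g ((g ^^ i) ` A)) \<subseteq> T"
    using closure_mono[OF orb_iterate_subset[of g i A]] assms(5) by simp
qed

lemma dense_meets_open:
  fixes O' :: "real set"
  assumes "closure O' = T" "open U" "x \<in> U" "x \<in> T"
  shows "\<exists>y\<in>O'. y \<in> U"
proof -
  have "U \<inter> closure O' \<noteq> {}" using assms by blast
  then have "U \<inter> O' \<noteq> {}" using open_Int_closure_eq_empty[OF assms(2), of O'] by simp
  then show ?thesis by blast
qed

lemma in_closureI:
  fixes x :: "'a::metric_space"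
  assumes "\<And>U. open U \<Longrightarrow> x \<in> U \<Longrightarrow> \<exists>y\<in>S. y \<in> U"
  shows "x \<in> closure S" unfolding closure_approachable
proof (intro allI impI)
  fix e :: real assume "e > 0"
  then obtain y where "y \<in> S" "y \<in> ball x e" using assms[of "ball x e"] by auto
  then show "\<exists>y\<in>S. dist y x < e" by (auto simp: dist_commute)
qed

text \<open>Once an image contains the fixed point \<open>c\<close>, all later ones do, and they are
  connected. The target avoids \<open>c\<close> and lies strictly inside the interval, so density
  supplies an orbit point beyond its far end, and the image containing this point and
  \<open>c\<close> contains everything between.\<close>

lemma cover_from_fixed_point:
  fixes g :: "real \<Rightarrow> real"
  assumes cont: "continuous_on {a..b} g" and onto: "g ` {a..b} = {a..b}"
    and A: "A \<subseteq> {a..b}" "connected A" "closure (orb g A) = {a..b}"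
    and c: "g c = c" "c \<in> orb g A"
    and L: "l1 \<le> l2" "{l1..l2} \<subseteq> {a<..<b} - {c}"
  shows "\<exists>n. {l1..l2} \<subseteq> (g ^^ n) ` A"
proof -
  obtain i where i: "c \<in> (g ^^ i) ` A" using c(2) by (auto simp: orb_def)
  have conn: "connected ((g ^^ n) ` A)" for n
  proof (rule connected_continuous_image[OF _ A(2)])
    show "continuous_on A (g ^^ n)"
      by (rule continuous_on_subset[OF funpow_continuous_on[OF cont] A(1)]) (simp add: onto)
  qed
  have ci: "c \<in> (g ^^ (n + i)) ` A" for n
  proof -
    have "(g ^^ n) c \<in> (g ^^ n) ` ((g ^^ i) ` A)" using i by (rule imageI)
    then show ?thesis unfolding funpow_fixed[of g c n, OF c(1)] funpow_image_add .
  qed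
  have dense: "closure (orb g ((g ^^ i) ` A)) = {a..b}"
    using tail_dense[OF _ cont onto A(1,3)] by simp
  have cover: "\<exists>n. {l1..l2} \<subseteq> (g ^^ n) ` A"
    if x: "x \<in> orb g ((g ^^ i) ` A)" and "c < l1 \<and> l2 < x \<or> x < l1 \<and> l2 < c" for x
  proof -
    obtain n where "x \<in> (g ^^ (n + i)) ` A" using x by (auto simp: orb_def funpow_image_add)
    then have x': "{c..x} \<subseteq> (g ^^ (n + i)) ` A" "{x..c} \<subseteq> (g ^^ (n + i)) ` A"
      using ci[of n] connected_contains_Icc[OF conn[of "n + i"]] by auto
    have "{l1..l2} \<subseteq> {c..x} \<or> {l1..l2} \<subseteq> {x..c}" using that(2) by auto
    then show ?thesis using x' by blast
  qed
  have ab: "a < l1" "l2 < b" using L by auto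
  have "c \<notin> {l1..l2}" using L(2) by blast
  then have "c < l1 \<or> l2 < c" by auto
  then show ?thesis
  proof
    assume "c < l1"
    obtain x where "x \<in> orb g ((g ^^ i) ` A)" "x \<in> {l2<..<b}"
      using dense_meets_open[OF dense, of "{l2<..<b}" "(l2+b)/2"] ab L(1) by auto
    then show ?thesis using cover \<open>c < l1\<close> by auto
  next
    assume "l2 < c"
    obtain x where "x \<in> orb g ((g ^^ i) ` A)" "x \<in> {a<..<l1}"
      using dense_meets_open[OF dense, of "{a<..<l1}" "(a+l1)/2"] ab L(1) by auto
    then show ?thesis using cover \<open>l2 < c\<close> by auto
  qed
qed

text \<open>A missing point leaves each link on one side of it; consecutive links meet, so the side
  never changes.\<close>

lemma connected_chain_UN:
  fixes E :: "nat \<Rightarrow> real set"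
  assumes conn: "\<And>l. connected (E l)" and meet: "\<And>l. E l \<inter> E (Suc l) \<noteq> {}"
  shows "connected (\<Union>l. E l)"
proof -
  have side: "(\<forall>l. E l \<subseteq> {t<..}) \<or> (\<forall>l. E l \<subseteq> {..<t})" if t: "\<And>l. t \<notin> E l" for t
  proof -
    have one: "E l \<subseteq> {t<..} \<or> E l \<subseteq> {..<t}" for l
    proof (rule ccontr)
      assume "\<not> (E l \<subseteq> {t<..} \<or> E l \<subseteq> {..<t})"
      then obtain p q where "p \<in> E l" "p \<le> t" "q \<in> E l" "t \<le> q" by fastforce
      then have "t \<in> E l" using connected_contains_Icc[OF conn, of p l q] by auto
      then show False using t by blast
    qed
    have "(E 0 \<subseteq> {t<..} \<longrightarrow> E l \<subseteq> {t<..}) \<and> (E 0 \<subseteq> {..<t} \<longrightarrow> E l \<subseteq> {..<t})" for l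
    proof (induction l)
      case (Suc l)
      obtain z where "z \<in> E l" "z \<in> E (Suc l)" using meet[of l] by blast
      then show ?case using Suc one[of "Suc l"] by fastforce
    qed simp
    then show ?thesis using one[of 0] by blast
  qed
  have "t \<in> (\<Union>l. E l)" if "p \<in> (\<Union>l. E l)" "q \<in> (\<Union>l. E l)" "p \<le> t" "t \<le> q" for p q t
    using side[of t] that by fastforce
  then have "is_interval (\<Union>l. E l)" unfolding is_interval_1 by blast
  then show ?thesis by (simp add: is_interval_connected_1)
qed

text \<open>If the orbit of a nondegenerate interval is dense but misses an interior fixed point \<open>c\<close>,
  then it splits into finitely many chains of intervals, all adherent to \<open>c\<close>. Chains on
  the same side of \<open>c\<close> overlap, so their images lie on a common side.\<close>

lemma swap_if_fixed_point_missed: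
  fixes g :: "real \<Rightarrow> real"
  assumes cont: "continuous_on {a..b} g" and onto: "g ` {a..b} = {a..b}"
    and c: "a < c" "c < b" "g c = c"
    and A: "{u..v} \<subseteq> {a..b}" "u < v" "closure (orb g {u..v}) = {a..b}"
    and miss: "c \<notin> orb g {u..v}"
  shows "g ` {a..c} \<subseteq> {c..b} \<and> g ` {c..b} \<subseteq> {a..c}"
proof -
  define E where "E n = (g ^^ n) ` {u..v}" for n
  have E_sub: "E n \<subseteq> {a..b}" for n
    unfolding E_def using funpow_mem[of g "{a..b}" _ n] A(1) onto by blast
  have E_conn: "connected (E n)" for n unfolding E_def
  proof (rule connected_continuous_image)
    show "continuous_on {u..v} (g ^^ n)"
      by (rule continuous_on_subset[OF funpow_continuous_on[OF cont] A(1)]) (simp add: onto)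
  qed simp
  have E_add: "E (n + k) = (g ^^ n) ` E k" for n k unfolding E_def by (rule funpow_image_add)
  have orbE: "orb g {u..v} = (\<Union>n. E n)" unfolding orb_def E_def ..
  \<comment> \<open>The orbit of the first image is still dense, hence some \<open>E k\<close> with
    \<open>k \<ge> 1\<close> returns to the open interval.\<close>
  obtain k where k: "k \<ge> 1" "E 0 \<inter> E k \<noteq> {}"
  proof -
    have "closure (orb g ((g ^^ 1) ` {u..v})) = {a..b}"
      by (rule tail_dense) (use cont onto A in auto)
    from dense_meets_open[OF this, of "{u<..<v}" "(u+v)/2"]
    obtain y where y: "y \<in> orb g ((g ^^ 1) ` {u..v})" "y \<in> {u<..<v}" using A by auto
    then obtain n where "y \<in> (g ^^ n) ` ((g ^^ 1) ` {u..v})" unfolding orb_def by blast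
    then have "y \<in> E (n + 1)" unfolding E_def funpow_image_add .
    moreover have "y \<in> E 0" using y unfolding E_def by auto
    ultimately show thesis using that[of "n+1"] by auto
  qed
  \<comment> \<open>\<open>W j\<close> collects the images with indices \<open>j\<close>,
    \<open>j + k\<close>, \<open>j + 2 * k\<close> and so on; iterates of a common point of
    \<open>E 0\<close> and \<open>E k\<close> show that successive ones meet.\<close>
  define W where "W j = (\<Union>l. E (j + l * k))" for j
  have W_conn: "connected (W j)" for j unfolding W_def
  proof (rule connected_chain_UN)
    show "connected (E (j + l * k))" for l by (rule E_conn)
    show "E (j + l * k) \<inter> E (j + Suc l * k) \<noteq> {}" for l
    proof -
      obtain z where "z \<in> E 0" "z \<in> E k" using k by blast
      then have "(g ^^ (j + l * k)) z \<in> E ((j + l*k) + 0)" "(g ^^ (j + l * k)) z \<in> E ((j + l*k) + k)"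
        unfolding E_add by auto
      moreover have "(j + l*k) + k = j + Suc l * k" by simp
      ultimately show ?thesis by auto
    qed
  qed
  have W_shift: "W (j + l * k) \<subseteq> W j" for j l
  proof -
    have "E (j + l * k + l' * k) \<subseteq> W j" for l'
      unfolding W_def using UN_upper[of "l + l'" UNIV "\<lambda>l. E (j + l * k)"]
      by (simp add: algebra_simps)
    then show ?thesis unfolding W_def[of "j + l*k"] by blast
  qed
  have W_step: "g ` W j = W (Suc j)" for j unfolding W_def using E_add[of 1] by (simp add: image_UN)
  have W_orb: "W j \<subseteq> orb g {u..v}" for j unfolding orbE W_def by blast
  have W_ne: "W j \<noteq> {}" for j unfolding W_def E_def using A by auto
  have cW: "c \<notin> W j" for j using miss W_orb by blast
  have orbW: "orb g {u..v} = (\<Union>j<k. W j)"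
  proof
    show "orb g {u..v} \<subseteq> (\<Union>j<k. W j)"
    proof
      fix x assume "x \<in> orb g {u..v}"
      then obtain n where "x \<in> E n" unfolding orbE by blast
      then have "x \<in> E (n mod k + (n div k) * k)" by simp
      then have "x \<in> W (n mod k)" unfolding W_def by blast
      then show "x \<in> (\<Union>j<k. W j)" using k(1) by (intro UN_I[of "n mod k"]) auto
    qed
  qed (use W_orb in blast)
  \<comment> \<open>The orbit is a finite union of chains, so \<open>c\<close> is adherent to one of
    them. As \<open>c\<close> is fixed, continuity carries this to all later chains, and later
    chains of the same residue are contained in earlier ones.\<close>
  have ccl: "c \<in> closure (W j)" for j
  proof -
    have "closure (\<Union>j<k. W j) \<subseteq> (\<Union>j<k. closure (W j))"
      by (intro closure_minimal closed_UN) (use closure_subset in blast)+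
    moreover have "c \<in> closure (\<Union>j<k. W j)" using A(3) c unfolding orbW by simp
    ultimately have "c \<in> (\<Union>j<k. closure (W j))" by (rule subsetD)
    then obtain j0 where j0: "c \<in> closure (W j0)" by blast
    have "c \<in> closure (W (i + j0))" for i
    proof (induction i)
      case (Suc i)
      have sub: "closure (W (i + j0)) \<subseteq> {a..b}" using closure_mono[OF W_orb] A(3) by blast
      have "g ` closure (W (i + j0)) \<subseteq> closure (g ` W (i + j0))"
        by (rule image_closure_subset[OF continuous_on_subset[OF cont sub]]) (simp_all add: closure_subset)
      then show ?case using Suc c(3) unfolding W_step by force
    qed (use j0 in simp)
    moreover have "j + j0 * (k - 1) + j0 = j + j0 * k" using k(1) by (cases k) auto
    ultimately have "c \<in> closure (W (j + j0 * k))" by metis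
    then show ?thesis using closure_mono[OF W_shift] by blast
  qed
  have right: "t \<in> W j" if h: "x \<in> W j" "c < t" "t \<le> x" for j x t
  proof -
    obtain z where "z \<in> W j" "z < t"
      using dense_meets_open[OF refl, of "{..<t}" c "W j"] ccl[of j] h by auto
    then show ?thesis using connected_contains_Icc[OF W_conn[of j], of z x] that by auto
  qed
  have left: "t \<in> W j" if h: "x \<in> W j" "t < c" "x \<le> t" for j x t
  proof -
    obtain z where "z \<in> W j" "t < z"
      using dense_meets_open[OF refl, of "{t<..}" c "W j"] ccl[of j] h by auto
    then show ?thesis using connected_contains_Icc[OF W_conn[of j], of x z] that by auto
  qed
  have side: "W j \<subseteq> {c<..} \<or> W j \<subseteq> {..<c}" for j
  proof (rule ccontr)
    assume "\<not> ?thesis"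
    then obtain p q where "p \<in> W j" "p \<le> c" "q \<in> W j" "c \<le> q" by fastforce
    then have "c \<in> W j" using connected_contains_Icc[OF W_conn, of p j q] by auto
    then show False using cW by blast
  qed
  define S where "S j \<longleftrightarrow> W j \<subseteq> {c<..}" for j
  have S_iff: "S j \<longleftrightarrow> x > c" if "x \<in> W j" for j x
    using side[of j] that unfolding S_def by force
  \<comment> \<open>Two chains on the same side of \<open>c\<close> are connected and adherent to
    \<open>c\<close>, so they overlap near \<open>c\<close>; a common point has a common
    image.\<close>
  have same: "S (Suc i) = S (Suc j)" if "S i = S j" for i j
  proof -
    obtain x y where xy: "x \<in> W i" "y \<in> W j" using W_ne by blast
    then have "x \<noteq> c" "y \<noteq> c" using cW by blast+
    have "\<exists>t. t \<in> W i \<and> t \<in> W j"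
    proof (cases "S i")
      case True
      then have "c < min x y" using S_iff xy that by auto
      then have "min x y \<in> W i \<and> min x y \<in> W j" using right xy by (meson min.cobounded1 min.cobounded2)
      then show ?thesis by blast
    next
      case False
      then have "max x y < c" using S_iff xy that \<open>x \<noteq> c\<close> \<open>y \<noteq> c\<close> by force
      then have "max x y \<in> W i \<and> max x y \<in> W j" using left xy by (meson max.cobounded1 max.cobounded2)
      then show ?thesis by blast
    qed
    then obtain t where "g t \<in> W (Suc i)" "g t \<in> W (Suc j)" using W_step by blast
    then show ?thesis using S_iff by metis
  qed
  have S_shift: "S (j + l * k) = S j" for j l
    using W_shift[of j l] W_ne[of "j + l*k"] S_iff by blast
  have meets: "\<exists>j. \<exists>x\<in>W j. x \<in> U" if "open U" "x \<in> U" "x \<in> {a..b}" for U x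
    using dense_meets_open[OF A(3) that] unfolding orbW by blast
  obtain jr where jr: "S jr" using meets[of "{c<..}" b] c S_iff by auto
  obtain jl where jl: "\<not> S jl" using meets[of "{..<c}" a] c S_iff by force
  \<comment> \<open>If one step kept the side, all later ones would, and by \<open>S_shift\<close>
    every chain would lie on that side, although the dense orbit visits both sides.\<close>
  have flip: "S (Suc i) = (\<not> S i)" for i
  proof (rule ccontr)
    assume "\<not> ?thesis"
    then have eq: "S (Suc i) = S i" by simp
    have "S (n + i) = S i" for n
    proof (induction n)
      case (Suc n)
      then show ?case using same[of "n + i" i] eq by simp
    qed simp
    then have const: "S n = S i" if "n \<ge> i" for n using that by (metis le_add_diff_inverse2)
    have ge: "j + i * k \<ge> i" for j using k(1) by (metis add.commute le_add1 le_trans mult.right_neutral mult_le_mono2)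
    show False using const[OF ge[of jr]] const[OF ge[of jl]] jr jl unfolding S_shift by simp
  qed
  have O_image: "g x \<le> c" if x: "x \<in> orb g {u..v}" "c < x" for x
  proof -
    obtain j where "x \<in> W j" using x orbW by blast
    then have "S j" "g x \<in> W (Suc j)" using S_iff x W_step by blast+
    then show ?thesis using flip S_iff by (metis not_less)
  qed
  have O_image': "g x \<ge> c" if x: "x \<in> orb g {u..v}" "x < c" for x
  proof -
    obtain j where "x \<in> W j" using x orbW by blast
    then have "\<not> S j" "g x \<in> W (Suc j)" using S_iff x W_step by force+
    then show ?thesis using flip S_iff by (metis less_imp_le)
  qed
  have gab: "g x \<in> {a..b}" if "x \<in> {a..b}" for x using onto that by blast
  \<comment> \<open>Transfers an inequality for \<open>g\<close> from the orbit to whole closed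
    intervals, by density and continuity.\<close>
  have extend: "g ` {p..q} \<subseteq> T"
    if "p < q" "{p..q} \<subseteq> {a..b}" "closed T" "\<And>x. x \<in> {p<..<q} \<inter> orb g {u..v} \<Longrightarrow> g x \<in> T" for p q T
  proof -
    have "{p<..<q} \<subseteq> closure ({p<..<q} \<inter> orb g {u..v})"
      using open_Int_closure_subset[of "{p<..<q}" "orb g {u..v}"] A(3) that(2) by force
    then have "closure {p<..<q} \<subseteq> closure ({p<..<q} \<inter> orb g {u..v})"
      by (simp add: closure_minimal)
    then have eq: "{p..q} = closure ({p<..<q} \<inter> orb g {u..v})"
      using that(1) closure_mono[of "{p<..<q} \<inter> orb g {u..v}" "{p<..<q}"] by auto
    have "continuous_on (closure ({p<..<q} \<inter> orb g {u..v})) g"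
      using continuous_on_subset[OF cont that(2)] eq by simp
    then have "g ` closure ({p<..<q} \<inter> orb g {u..v}) \<subseteq> T"
      by (rule image_closure_subset[OF _ that(3)]) (use that(4) in blast)
    then show ?thesis using eq by simp
  qed
  have "g ` {a..c} \<subseteq> {c..}" by (rule extend) (use c O_image' in auto)
  moreover have "g ` {c..b} \<subseteq> {..c}" by (rule extend) (use c O_image in auto)
  moreover have "g ` {a..c} \<subseteq> {a..b}" "g ` {c..b} \<subseteq> {a..b}" using gab c by auto
  ultimately show ?thesis by (auto simp: image_subset_iff)
qed

text \<open>Isabelle's \<open>{u..v}\<close> with \<open>u < v\<close> in place of an arbitrary connected set: a transitive
  point is connected and has a dense orbit, but its images cover no interval.\<close>

lemma swap_or_common_fixed_point:
  fixes g :: "real \<Rightarrow> real"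
  assumes ab: "a < b" and cont: "continuous_on {a..b} g" and onto: "g ` {a..b} = {a..b}"
  shows "(\<exists>c\<in>{a..b}. g c = c \<and>
            (\<forall>u v. u < v \<longrightarrow> {u..v} \<subseteq> {a..b} \<longrightarrow> closure (orb g {u..v}) = {a..b} \<longrightarrow> c \<in> orb g {u..v})) \<or>
         (\<exists>c. a < c \<and> c < b \<and> g c = c \<and> g ` {a..c} \<subseteq> {c..b} \<and> g ` {c..b} \<subseteq> {a..c})"
proof (rule ccontr)
  assume neg: "\<not> ?thesis"
  have gab: "g x \<in> {a..b}" if "x \<in> {a..b}" for x using onto that by blast
  have miss: "\<exists>u v. u < v \<and> {u..v} \<subseteq> {a..b} \<and> closure (orb g {u..v}) = {a..b} \<and> c \<notin> orb g {u..v}"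
    if "c \<in> {a..b}" "g c = c" for c using neg that by blast
  have nofix: "g c \<noteq> c" if c: "a < c" "c < b" for c
  proof
    assume "g c = c"
    then obtain u v where "u < v" "{u..v} \<subseteq> {a..b}" "closure (orb g {u..v}) = {a..b}" "c \<notin> orb g {u..v}"
      using miss[of c] c by auto
    then have "g ` {a..c} \<subseteq> {c..b} \<and> g ` {c..b} \<subseteq> {a..c}"
      using swap_if_fixed_point_missed[OF cont onto c \<open>g c = c\<close>] by blast
    then show False using neg c \<open>g c = c\<close> by blast
  qed
  have contd: "continuous_on {p..q} (\<lambda>x. g x - x)" if "{p..q} \<subseteq> {a..b}" for p q
    by (intro continuous_intros continuous_on_subset[OF cont that])
  define m where "m = (a + b) / 2"
  have m: "a < m" "m < b" unfolding m_def using ab by auto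
  consider "g m > m" | "g m < m" using nofix[OF m] by linarith
  then show False
  proof cases
    case 1
    \<comment> \<open>Without interior fixed points the graph stays above the diagonal. Then only
      \<open>a\<close> itself can be mapped to \<open>a\<close>, and an interval whose orbit misses
      \<open>a\<close> would stay trapped in \<open>{u..b}\<close>, against density.\<close>
    have up: "g x > x" if x: "a < x" "x < b" for x
    proof (rule ccontr)
      assume "\<not> g x > x"
      then have le: "g x - x \<le> 0" by simp
      have "\<exists>y. min m x \<le> y \<and> y \<le> max m x \<and> g y - y = 0"
      proof (cases "m \<le> x")
        case True
        then show ?thesis using IVT2'[of "\<lambda>x. g x - x" x 0 m] le 1 contd[of m x] x m by auto
      next
        case False
        then show ?thesis using IVT'[of "\<lambda>x. g x - x" x 0 m] le 1 contd[of x m] x m by auto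
      qed
      then obtain y where y: "min m x \<le> y" "y \<le> max m x" "g y - y = 0" by blast
      then have "a < y" "y < b" using x m by (auto simp: min_def max_def split: if_splits)
      then show False using nofix y by simp
    qed
    have "a \<in> g ` {a..b}" unfolding onto using ab by simp
    then obtain x where x: "x \<in> {a..b}" "g x = a" by (metis imageE)
    have gb: "g b \<ge> b"
    proof -
      have "continuous_on {m..b} (\<lambda>x. g x - x)" using contd m by auto
      moreover have "closure {m<..<b} = {m..b}" using m by simp
      ultimately have "0 \<le> g b - b"
        using up m by (intro continuous_ge_on_closure[of "{m<..<b}" "\<lambda>x. g x - x" b 0]) (auto simp: less_imp_le)
      then show ?thesis by simp
    qed
    have "x = a" using x up[of x] gb ab by (cases "x = a"; cases "x = b") auto
    then have "g a = a" using x by simp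
    then obtain u v where uv: "u < v" "{u..v} \<subseteq> {a..b}" "closure (orb g {u..v}) = {a..b}" "a \<notin> orb g {u..v}"
      using miss[of a] ab by auto
    have "u \<in> orb g {u..v}" using uv(1) by (intro subsetD[OF orb_superset]) simp
    then have "u \<noteq> a" using uv(4) by blast
    then have "a < u" using uv by auto
    have "g x \<in> {u..b}" if "x \<in> {u..b}" for x
      using that up[of x] gb gab[of x] \<open>a < u\<close> by (cases "x = b") auto
    then have "orb g {u..v} \<subseteq> {u..b}" by (intro orb_invariant_subset) (use uv in auto)
    then have "{a..b} \<subseteq> {u..b}" using closure_mono[of "orb g {u..v}" "{u..b}"] uv(3) by simp
    then show False using \<open>a < u\<close> ab by auto
  next
    case 2
    have down: "g x < x" if x: "a < x" "x < b" for x
    proof (rule ccontr)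
      assume "\<not> g x < x"
      then have le: "g x - x \<ge> 0" by simp
      have "\<exists>y. min m x \<le> y \<and> y \<le> max m x \<and> g y - y = 0"
      proof (cases "m \<le> x")
        case True
        then show ?thesis using IVT'[of "\<lambda>x. g x - x" m 0 x] le 2 contd[of m x] x m by auto
      next
        case False
        then show ?thesis using IVT2'[of "\<lambda>x. g x - x" m 0 x] le 2 contd[of x m] x m by auto
      qed
      then obtain y where y: "min m x \<le> y" "y \<le> max m x" "g y - y = 0" by blast
      then have "a < y" "y < b" using x m by (auto simp: min_def max_def split: if_splits)
      then show False using nofix y by simp
    qed
    have "b \<in> g ` {a..b}" unfolding onto using ab by simp
    then obtain x where x: "x \<in> {a..b}" "g x = b" by (metis imageE)
    have ga: "g a \<le> a"
    proof -
      have "continuous_on {a..m} (\<lambda>x. g x - x)" using contd m by auto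
      moreover have "closure {a<..<m} = {a..m}" using m by simp
      ultimately have "g a - a \<le> 0"
        using down m by (intro continuous_le_on_closure[of "{a<..<m}" "\<lambda>x. g x - x" a 0]) (auto simp: less_imp_le)
      then show ?thesis by simp
    qed
    have "x = b" using x down[of x] ga ab by (cases "x = a"; cases "x = b") auto
    then have "g b = b" using x by simp
    then obtain u v where uv: "u < v" "{u..v} \<subseteq> {a..b}" "closure (orb g {u..v}) = {a..b}" "b \<notin> orb g {u..v}"
      using miss[of b] ab by auto
    have "v \<in> orb g {u..v}" using uv(1) by (intro subsetD[OF orb_superset]) simp
    then have "v \<noteq> b" using uv(4) by blast
    then have "v < b" using uv by auto
    have "g x \<in> {a..v}" if "x \<in> {a..v}" for x
      using that down[of x] ga gab[of x] \<open>v < b\<close> by (cases "x = a") auto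
    then have "orb g {u..v} \<subseteq> {a..v}" by (intro orb_invariant_subset) (use uv in auto)
    then have "{a..b} \<subseteq> {a..v}" using closure_mono[of "orb g {u..v}" "{a..v}"] uv(3) by simp
    then show False using \<open>v < b\<close> ab by auto
  qed
qed

text \<open>Were the image one point \<open>p\<close>, its dense orbit would re-enter the interval,
  whose image is \<open>p\<close> again. So \<open>p\<close> would be periodic, and a finite orbit
  would be dense in an infinite set.\<close>

lemma image_not_degenerate:
  fixes g :: "real \<Rightarrow> real"
  assumes T: "closed T" "infinite T" and cont: "continuous_on T g" and onto: "g ` T = T"
    and A: "{u..v} \<subseteq> T" "u < v" "closure (orb g {u..v}) = T"
  shows "g ` {u..v} \<noteq> {p}"
proof
  assume p: "g ` {u..v} = {p}"
  have "closure (orb g ((g ^^ 1) ` {u..v})) = T" by (rule tail_dense) (use T cont onto A in auto)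
  then have dense: "closure (orb g {p}) = T" using p by simp
  obtain y where "y \<in> orb g {p}" "y \<in> {u<..<v}"
  proof -
    have "(u+v)/2 \<in> T" using A(1,2) by (intro subsetD[OF A(1)]) auto
    then show thesis using dense_meets_open[OF dense, of "{u<..<v}" "(u+v)/2"] A(2) that by auto
  qed
  then obtain j where "(g ^^ j) p \<in> {u<..<v}" unfolding orb_def by blast
  then have "g ((g ^^ j) p) \<in> g ` {u..v}" by (intro imageI) auto
  then have per: "(g ^^ Suc j) p = p" unfolding p by simp
  have "orb g {p} \<subseteq> (\<lambda>i. (g ^^ i) p) ` {..<Suc j}"
  proof
    fix x assume "x \<in> orb g {p}"
    then obtain i where "x = (g ^^ i) p" unfolding orb_def by auto
    then have "x = (g ^^ (i mod Suc j)) p" using funpow_mod_eq[OF per, of i] by simp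
    then show "x \<in> (\<lambda>i. (g ^^ i) p) ` {..<Suc j}" by (intro image_eqI[of _ _ "i mod Suc j"]) auto
  qed
  then have "finite (orb g {p})" by (rule finite_subset) simp
  then have "closure (orb g {p}) = orb g {p}" by (simp add: finite_imp_closed)
  then show False using dense T \<open>finite (orb g {p})\<close> by simp
qed

text \<open>Odd iterates of \<open>A\<close> fall into \<open>T'\<close>, which misses the open
  interval, so density there is due to the even iterates alone.\<close>

lemma half_orbit_dense:
  fixes g :: "real \<Rightarrow> real"
  assumes pq: "p < q" "{p..q} \<subseteq> closure (orb g A)" "A \<subseteq> {p..q}"
    and T': "g ` {p..q} \<subseteq> T'" "g ` T' \<subseteq> {p..q}" "{p<..<q} \<inter> T' = {}"
  shows "closure (orb (g ^^ 2) A) = {p..q}"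
proof
  have sub: "(g ^^ 2) ` {p..q} \<subseteq> {p..q}" using T' by (auto simp: numeral_2_eq_2)
  then have orb_sub: "orb (g ^^ 2) A \<subseteq> {p..q}" using orb_invariant_subset pq(3) by blast
  then show "closure (orb (g ^^ 2) A) \<subseteq> {p..q}" by (simp add: closure_minimal)
  have "{p<..<q} \<subseteq> closure (orb (g ^^ 2) A)"
  proof
    fix x assume x: "x \<in> {p<..<q}"
    have "\<exists>y\<in>orb (g ^^ 2) A. y \<in> U" if U: "open U" "x \<in> U" for U
    proof -
      obtain y where y: "y \<in> orb g A" "y \<in> U" "y \<in> {p<..<q}"
        using dense_meets_open[OF refl, of "U \<inter> {p<..<q}" x "orb g A"] U x pq(2)
          subsetD[OF pq(2), of x] by (auto simp: open_Int)
      then obtain n z where n: "z \<in> A" "y = (g ^^ n) z" unfolding orb_def by blast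
      have even_mem: "(g ^^ (2 * i)) z \<in> {p..q}" for i
        using funpow_mem[OF sub, of z i] n(1) pq(3) by (auto simp: funpow_mult)
      have "even n"
      proof (rule ccontr)
        assume "odd n"
        then obtain i where "n = Suc (2 * i)" by (metis oddE Suc_eq_plus1)
        then have "y \<in> T'" using even_mem[of i] n(2) T'(1) by auto
        then show False using y(3) T'(3) by blast
      qed
      then obtain i where "n = 2 * i" by blast
      then have "y \<in> ((g ^^ 2) ^^ i) ` A" using n by (simp add: funpow_mult)
      then show ?thesis using y unfolding orb_def by blast
    qed
    then show "x \<in> closure (orb (g ^^ 2) A)" by (rule in_closureI)
  qed
  then have "closure {p<..<q} \<subseteq> closure (orb (g ^^ 2) A)" by (simp add: closure_minimal)
  then show "{p..q} \<subseteq> closure (orb (g ^^ 2) A)" using pq by simp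
qed

text \<open>The exceptional set is the common fixed point in the first alternative. In the second it
  consists of the centre \<open>c\<close> and of one fixed point of the second iterate for each
  half.\<close>

lemma covers_off_finite_set:
  fixes g :: "real \<Rightarrow> real"
  assumes ab: "a < b" and cont: "continuous_on {a..b} g" and onto: "g ` {a..b} = {a..b}"
  shows "\<exists>F. finite F \<and> (\<forall>u v l1 l2. u < v \<longrightarrow> {u..v} \<subseteq> {a..b} \<longrightarrow> closure (orb g {u..v}) = {a..b}
           \<longrightarrow> l1 \<le> l2 \<longrightarrow> {l1..l2} \<subseteq> {a<..<b} - F \<longrightarrow> (\<exists>n. {l1..l2} \<subseteq> (g ^^ n) ` {u..v}))"
  using swap_or_common_fixed_point[OF ab cont onto]
proof
  assume "\<exists>c\<in>{a..b}. g c = c \<and>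
    (\<forall>u v. u < v \<longrightarrow> {u..v} \<subseteq> {a..b} \<longrightarrow> closure (orb g {u..v}) = {a..b} \<longrightarrow> c \<in> orb g {u..v})"
  then obtain c where c: "g c = c"
    "\<And>u v. u < v \<Longrightarrow> {u..v} \<subseteq> {a..b} \<Longrightarrow> closure (orb g {u..v}) = {a..b} \<Longrightarrow> c \<in> orb g {u..v}"
    by blast
  show ?thesis
  proof (intro exI[of _ "{c}"] conjI allI impI)
    fix u v l1 l2 :: real
    assume *: "u < v" "{u..v} \<subseteq> {a..b}" "closure (orb g {u..v}) = {a..b}" "l1 \<le> l2" "{l1..l2} \<subseteq> {a<..<b} - {c}"
    show "\<exists>n. {l1..l2} \<subseteq> (g ^^ n) ` {u..v}"
      by (rule cover_from_fixed_point[OF cont onto *(2) _ *(3) c(1) c(2)[OF *(1-3)] *(4,5)]) simp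
  qed simp
next
  assume "\<exists>c. a < c \<and> c < b \<and> g c = c \<and> g ` {a..c} \<subseteq> {c..b} \<and> g ` {c..b} \<subseteq> {a..c}"
  then obtain c where c: "a < c" "c < b" "g c = c" and swap: "g ` {a..c} \<subseteq> {c..b}" "g ` {c..b} \<subseteq> {a..c}"
    by blast
  have swap_eq: "g ` {a..c} = {c..b}" "g ` {c..b} = {a..c}"
  proof -
    have pre: "\<exists>z\<in>{a..b}. g z = y" if "y \<in> {a..b}" for y using onto that by (metis imageE)
    have "y \<in> g ` {a..c}" if y: "y \<in> {c..b}" for y
    proof -
      obtain z where z: "z \<in> {a..b}" "g z = y" using pre[of y] y c by auto
      show ?thesis
      proof (cases "z \<le> c")
        case False
        then have "g z \<in> {a..c}" using z swap(2) by (intro subsetD[OF swap(2)] imageI) auto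
        then have "y = g c" using y z c by auto
        then show ?thesis by (intro image_eqI[of _ _ c]) (use c in auto)
      qed (use z in auto)
    qed
    then show "g ` {a..c} = {c..b}" using swap by blast
    have "y \<in> g ` {c..b}" if y: "y \<in> {a..c}" for y
    proof -
      obtain z where z: "z \<in> {a..b}" "g z = y" using pre[of y] y c by auto
      show ?thesis
      proof (cases "z \<ge> c")
        case False
        then have "g z \<in> {c..b}" using z swap(2) by (intro subsetD[OF swap(1)] imageI) auto
        then have "y = g c" using y z c by auto
        then show ?thesis by (intro image_eqI[of _ _ c]) (use c in auto)
      qed (use z in auto)
    qed
    then show "g ` {c..b} = {a..c}" using swap by blast
  qed
  \<comment> \<open>On a half the second iterate cannot interchange two sides again, because it
    fixes the endpoint \<open>c\<close>. So the first alternative applies to it.\<close>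
  have half: "\<exists>d. \<forall>u v l1 l2. u < v \<longrightarrow> {u..v} \<subseteq> {p..q} \<longrightarrow> closure (orb (g ^^ 2) {u..v}) = {p..q}
           \<longrightarrow> l1 \<le> l2 \<longrightarrow> {l1..l2} \<subseteq> {p<..<q} - {d} \<longrightarrow> (\<exists>n. {l1..l2} \<subseteq> ((g ^^ 2) ^^ n) ` {u..v})"
    if pq: "p < q" "{p..q} \<subseteq> {a..b}" "(g ^^ 2) ` {p..q} = {p..q}" and e: "c = p \<or> c = q" for p q
  proof -
    have cont2: "continuous_on {p..q} (g ^^ 2)"
      by (rule continuous_on_subset[OF funpow_continuous_on[OF cont] pq(2)]) (simp add: onto)
    have c2: "(g ^^ 2) c = c" by (rule funpow_fixed) (rule c)
    have "\<not> (\<exists>d. p < d \<and> d < q \<and> (g ^^ 2) d = d \<and> (g ^^ 2) ` {p..d} \<subseteq> {d..q} \<and> (g ^^ 2) ` {d..q} \<subseteq> {p..d})"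
    proof
      assume "\<exists>d. p < d \<and> d < q \<and> (g ^^ 2) d = d \<and> (g ^^ 2) ` {p..d} \<subseteq> {d..q} \<and> (g ^^ 2) ` {d..q} \<subseteq> {p..d}"
      then obtain d where d: "p < d" "d < q" "(g ^^ 2) ` {p..d} \<subseteq> {d..q}" "(g ^^ 2) ` {d..q} \<subseteq> {p..d}" by blast
      from e show False
      proof
        assume "c = p"
        then have "(g ^^ 2) c \<in> {d..q}" by (intro subsetD[OF d(3)] imageI) (use d in auto)
        then show False using c2 d \<open>c = p\<close> by simp
      next
        assume "c = q"
        then have "(g ^^ 2) c \<in> {p..d}" by (intro subsetD[OF d(4)] imageI) (use d in auto)
        then show False using c2 d \<open>c = q\<close> by simp
      qed
    qed
    then obtain d where d: "(g ^^ 2) d = d"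
      "\<And>u v. u < v \<Longrightarrow> {u..v} \<subseteq> {p..q} \<Longrightarrow> closure (orb (g ^^ 2) {u..v}) = {p..q} \<Longrightarrow> d \<in> orb (g ^^ 2) {u..v}"
      using swap_or_common_fixed_point[OF pq(1) cont2 pq(3)] by blast
    show ?thesis
    proof (intro exI[of _ d] allI impI)
      fix u v l1 l2 :: real
      assume *: "u < v" "{u..v} \<subseteq> {p..q}" "closure (orb (g ^^ 2) {u..v}) = {p..q}" "l1 \<le> l2" "{l1..l2} \<subseteq> {p<..<q} - {d}"
      show "\<exists>n. {l1..l2} \<subseteq> ((g ^^ 2) ^^ n) ` {u..v}"
        by (rule cover_from_fixed_point[OF cont2 pq(3) *(2) _ *(3) d(1) d(2)[OF *(1-3)] *(4,5)]) simp
    qed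
  qed
  have sq: "(g ^^ 2) ` X = g ` g ` X" for X by (simp add: numeral_2_eq_2 image_comp)
  obtain dl where dl: "\<And>u v l1 l2. u < v \<Longrightarrow> {u..v} \<subseteq> {a..c} \<Longrightarrow> closure (orb (g ^^ 2) {u..v}) = {a..c}
           \<Longrightarrow> l1 \<le> l2 \<Longrightarrow> {l1..l2} \<subseteq> {a<..<c} - {dl} \<Longrightarrow> \<exists>n. {l1..l2} \<subseteq> ((g ^^ 2) ^^ n) ` {u..v}"
  proof -
    have "{a..c} \<subseteq> {a..b}" "(g ^^ 2) ` {a..c} = {a..c}" using c unfolding sq swap_eq by auto
    from half[OF c(1) this] show thesis using that by blast
  qed
  obtain dr where dr: "\<And>u v l1 l2. u < v \<Longrightarrow> {u..v} \<subseteq> {c..b} \<Longrightarrow> closure (orb (g ^^ 2) {u..v}) = {c..b}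
           \<Longrightarrow> l1 \<le> l2 \<Longrightarrow> {l1..l2} \<subseteq> {c<..<b} - {dr} \<Longrightarrow> \<exists>n. {l1..l2} \<subseteq> ((g ^^ 2) ^^ n) ` {u..v}"
  proof -
    have "{c..b} \<subseteq> {a..b}" "(g ^^ 2) ` {c..b} = {c..b}" using c unfolding sq swap_eq by auto
    from half[OF c(2) this] show thesis using that by blast
  qed
  show ?thesis
  proof (intro exI[of _ "{c, dl, dr}"] conjI allI impI)
    fix u v l1 l2 :: real
    assume *: "u < v" "{u..v} \<subseteq> {a..b}" "closure (orb g {u..v}) = {a..b}" "l1 \<le> l2"
      "{l1..l2} \<subseteq> {a<..<b} - {c, dl, dr}"
    show "\<exists>n. {l1..l2} \<subseteq> (g ^^ n) ` {u..v}"
    proof (cases "c \<in> orb g {u..v}")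
      case True
      show ?thesis
        by (rule cover_from_fixed_point[OF cont onto *(2) _ *(3) c(3) True *(4)]) (use *(5) in auto)
    next
      case False
      \<comment> \<open>The interval lies on one side of \<open>c\<close> and its image on the
        other; the one on the side of the target is then moved by the second iterate within its
        half.\<close>
      then have cA: "c \<notin> {u..v}" using orb_superset[of "{u..v}" g] by blast
      obtain u' v' where img: "g ` {u..v} = {u'..v'}" "u' \<le> v'"
        using continuous_image_closed_interval[of u v g] *(1) continuous_on_subset[OF cont *(2)] by auto
      have "u' \<noteq> v'"
        using image_not_degenerate[of "{a..b}" g u v u'] cont onto * ab img by auto
      then have nd: "u' < v'" using img by simp
      have sub': "{u'..v'} \<subseteq> {a..b}" unfolding img(1)[symmetric] using *(2) onto by blast
      have dense': "closure (orb g {u'..v'}) = {a..b}"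
        using tail_dense[OF _ cont onto *(2,3), of 1] img by simp
      have right: "\<exists>n. {l1..l2} \<subseteq> (g ^^ n) ` {s..t}"
        if h: "s < t" "{s..t} \<subseteq> {c..b}" "closure (orb g {s..t}) = {a..b}" "c < l1" for s t
      proof -
        have "closure (orb (g ^^ 2) {s..t}) = {c..b}"
          by (rule half_orbit_dense[where T' = "{a..c}"]) (use h c swap in auto)
        then obtain n where "{l1..l2} \<subseteq> ((g ^^ 2) ^^ n) ` {s..t}"
          using dr[OF h(1,2) _ *(4)] h(4) *(5) by (auto simp: subset_iff)
        then show ?thesis unfolding funpow_mult by blast
      qed
      have left: "\<exists>n. {l1..l2} \<subseteq> (g ^^ n) ` {s..t}"
        if h: "s < t" "{s..t} \<subseteq> {a..c}" "closure (orb g {s..t}) = {a..b}" "l2 < c" for s t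
      proof -
        have "closure (orb (g ^^ 2) {s..t}) = {a..c}"
          by (rule half_orbit_dense[where T' = "{c..b}"]) (use h c swap in auto)
        then obtain n where "{l1..l2} \<subseteq> ((g ^^ 2) ^^ n) ` {s..t}"
          using dl[OF h(1,2) _ *(4)] h(4) *(5) by (auto simp: subset_iff)
        then show ?thesis unfolding funpow_mult by blast
      qed
      have via: "\<exists>n. {l1..l2} \<subseteq> (g ^^ n) ` {u..v}" if h: "\<exists>n. {l1..l2} \<subseteq> (g ^^ n) ` {u'..v'}"
      proof -
        obtain n where "{l1..l2} \<subseteq> (g ^^ n) ` ((g ^^ 1) ` {u..v})" using h img by auto
        then show ?thesis unfolding funpow_image_add[symmetric] by blast
      qed
      have "c \<notin> {l1..l2}" using *(5) by blast
      then have L: "c < l1 \<or> l2 < c" by auto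
      have "c < u \<or> v < c" using cA by auto
      then show ?thesis
      proof
        assume "c < u"
        then have A': "{u..v} \<subseteq> {c..b}" using *(2) by auto
        then have "{u'..v'} \<subseteq> {a..c}" using img swap by blast
        then show ?thesis using right[OF *(1) A' *(3)] left[OF nd _ dense'] via L by blast
      next
        assume "v < c"
        then have A': "{u..v} \<subseteq> {a..c}" using *(2) by auto
        then have "{u'..v'} \<subseteq> {c..b}" using img swap by blast
        then show ?thesis using left[OF *(1) A' *(3)] right[OF nd _ dense'] via L by blast
      qed
    qed
  qed simp
qed

section \<open>The basic set and big intervals\<close>

lemma infinite_subset_card:
  fixes X :: "real set"
  assumes "infinite X"
  shows "\<exists>T s e. T \<subseteq> X \<and> s \<in> X \<and> e \<in> X \<and> finite T \<and> card T = k \<and> s < e \<and> T \<subseteq> {s<..<e}"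
proof -
  obtain T where T: "T \<subseteq> X" "finite T" "card T = k + 2"
    using infinite_arbitrarily_large[OF assms] by blast
  define s e where "s = Min T" and "e = Max T"
  have ne: "T \<noteq> {}" using T by auto
  have se: "s \<in> T" "e \<in> T" unfolding s_def e_def using T ne by auto
  have bd: "s \<le> x" "x \<le> e" if "x \<in> T" for x unfolding s_def e_def using T that by auto
  have "s \<noteq> e"
  proof
    assume "s = e"
    then have "T \<subseteq> {s}" using bd by fastforce
    then have "card T \<le> 1" using card_mono[of "{s}" T] by simp
    then show False using T by simp
  qed
  then have "s < e" using bd[OF se(1)] by simp
  have "card (T - {s, e}) = k"
    using card_Diff_subset[of "{s,e}" T] se T \<open>s \<noteq> e\<close> by simp
  moreover have "T - {s,e} \<subseteq> {s<..<e}" using bd by fastforce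
  ultimately show ?thesis using T se \<open>s < e\<close> by (intro exI[of _ "T - {s,e}"] exI[of _ s] exI[of _ e]) auto
qed

lemma last_level_point:
  fixes h :: "real \<Rightarrow> real"
  assumes cont: "continuous_on {p..q} h" and "p \<le> q" "h p \<le> b" "b < h q"
  shows "\<exists>x. p \<le> x \<and> x < q \<and> h x = b \<and> (\<forall>t. x < t \<longrightarrow> t \<le> q \<longrightarrow> b < h t)"
proof -
  define S where "S = {p..q} \<inter> h -` {..b}"
  have "closed S" unfolding S_def by (rule continuous_closed_preimage[OF cont]) auto
  then have comp: "compact S" unfolding S_def using compact_Int_closed[of "{p..q}" S] by (simp add: S_def Int_assoc[symmetric])
  have "p \<in> S" unfolding S_def using assms by simp
  then obtain x where x: "x \<in> S" "\<And>t. t \<in> S \<Longrightarrow> t \<le> x"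
    using compact_attains_sup[OF comp] by blast
  have px: "p \<le> x" "x \<le> q" "h x \<le> b" using x(1) unfolding S_def by auto
  have above: "b < h t" if "x < t" "t \<le> q" for t
    using x(2)[of t] that px unfolding S_def by force
  have "x < q" using px assms(4) by (cases "x = q") auto
  have "h x = b"
  proof (rule ccontr)
    assume "h x \<noteq> b"
    then obtain t where t: "x \<le> t" "t \<le> q" "h t = b"
      using IVT'[of h x b q] px assms continuous_on_subset[OF cont, of "{x..q}"] by auto
    then show False using above[of t] \<open>h x \<noteq> b\<close> by (cases "t = x") auto
  qed
  then show ?thesis using px \<open>x < q\<close> above by blast
qed

lemma first_level_point:
  fixes h :: "real \<Rightarrow> real"
  assumes cont: "continuous_on {p..q} h" and "p \<le> q" "b < h p" "h q \<le> b"
  shows "\<exists>x. p < x \<and> x \<le> q \<and> h x = b \<and> (\<forall>t. p \<le> t \<longrightarrow> t < x \<longrightarrow> b < h t)"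
proof -
  have "continuous_on {-q..-p} (\<lambda>t. h (-t))"
    by (rule continuous_on_compose2[OF cont]) (auto intro!: continuous_intros)
  then obtain x where x: "-q \<le> x" "x < -p" "h (-x) = b" "\<forall>t. x < t \<longrightarrow> t \<le> -p \<longrightarrow> b < h (-t)"
    using last_level_point[of "-q" "-p" "\<lambda>t. h (-t)" b] assms by auto
  have "b < h t" if "p \<le> t" "t < -x" for t using x(4)[rule_format, of "-t"] that by simp
  then show ?thesis using x by (intro exI[of _ "-x"]) auto
qed

lemma image_interval_superset:
  fixes h :: "real \<Rightarrow> real"
  assumes "continuous_on {u..v} h" "p \<in> {u..v}" "q \<in> {u..v}"
  shows "{h p..h q} \<subseteq> h ` {u..v}"
  using connected_contains_Icc[OF connected_continuous_image[OF assms(1)], of "h p" "h q"] assms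
  by simp

text \<open>Among the points of level \<open>b\<close>, those at the border of the region above
  \<open>b\<close> are the useful ones: arbitrarily small intervals at such a point are mapped over
  a right neighbourhood of \<open>b\<close>. The last level point before \<open>q\<close>, or the
  first one after it, qualifies.\<close>

lemma level_boundary_point:
  fixes h :: "real \<Rightarrow> real"
  assumes cont: "continuous_on {u..v} h" and pq: "p \<in> {u..v}" "q \<in> {u..v}" "h p = b" "b < h q"
  shows "\<exists>x\<in>{u..v}. h x = b \<and>
     (\<forall>d>0. \<exists>s t. x \<in> {s..t} \<and> {s..t} \<subseteq> {u..v} \<inter> {x - d..x + d} \<and> (\<exists>z\<in>{s..t}. b < h z))"
proof (cases "p \<le> q")
  case True
  then obtain x where x: "p \<le> x" "x < q" "h x = b" "\<And>t. x < t \<Longrightarrow> t \<le> q \<Longrightarrow> b < h t"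
    using last_level_point[of p q h b] pq continuous_on_subset[OF cont, of "{p..q}"] by auto
  have "\<exists>s t. x \<in> {s..t} \<and> {s..t} \<subseteq> {u..v} \<inter> {x - d..x + d} \<and> (\<exists>z\<in>{s..t}. b < h z)" if "d > 0" for d
    using x(4)[of "min q (x + d)"] x(1,2) pq that
    by (intro exI[of _ x] exI[of _ "min q (x + d)"] conjI bexI[of _ "min q (x + d)"]) auto
  then show ?thesis using x pq by (intro bexI[of _ x]) auto
next
  case False
  then obtain x where x: "q < x" "x \<le> p" "h x = b" "\<And>t. q \<le> t \<Longrightarrow> t < x \<Longrightarrow> b < h t"
    using first_level_point[of q p h b] pq continuous_on_subset[OF cont, of "{q..p}"] by auto
  have "\<exists>s t. x \<in> {s..t} \<and> {s..t} \<subseteq> {u..v} \<inter> {x - d..x + d} \<and> (\<exists>z\<in>{s..t}. b < h z)" if "d > 0" for d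
    using x(4)[of "max q (x - d)"] x(1,2) pq that
    by (intro exI[of _ x] exI[of _ "max q (x - d)"] conjI bexI[of _ "max q (x - d)"]) auto
  then show ?thesis using x pq by (intro bexI[of _ x]) auto
qed

text \<open>\<open>M\<close> stands for the orbit of the periodic interval. All that is used of the dynamics is \<open>covers\<close>:
  an interval with dense orbit covers every interval that avoids the finite exceptional set \<open>F\<close>.\<close>

locale basic_system =
  fixes f :: "real \<Rightarrow> real" and M F :: "real set" and \<rho> :: real
  assumes M_compact: "compact M"
    and M_sub: "M \<subseteq> {0..1}"
    and cont: "continuous_on M f"
    and onto: "f ` M = M"
    and F_finite: "finite F"
    and rho_pos: "0 < \<rho>"
    and local_interval: "\<And>x d. x \<in> M \<Longrightarrow> 0 < d \<Longrightarrow> d \<le> \<rho> \<Longrightarrow>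
       \<exists>u v. u < v \<and> u \<le> x \<and> x \<le> v \<and> M \<inter> {x - d..x + d} = {u..v}"
    and covers: "\<And>u v l1 l2. u < v \<Longrightarrow> {u..v} \<subseteq> M \<Longrightarrow> closure (orb f {u..v}) = M \<Longrightarrow>
       l1 \<le> l2 \<Longrightarrow> {l1..l2} \<subseteq> M - F \<Longrightarrow> \<exists>n. {l1..l2} \<subseteq> (f ^^ n) ` {u..v}"
    and B_infinite: "infinite (basic_points f M)"
begin

definition B where "B = basic_points f M"

definition big :: "real \<Rightarrow> real \<Rightarrow> bool" where
  "big u v \<longleftrightarrow> u < v \<and> {u..v} \<subseteq> M \<and> closure (orb f {u..v}) = M"

lemma M_closed: "closed M" using M_compact by (rule compact_imp_closed)

lemma f_mem: "x \<in> M \<Longrightarrow> f x \<in> M" using onto by blast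

lemma fn_cont: "continuous_on M (f ^^ n)" by (rule funpow_continuous_on[OF cont]) (simp add: onto)

lemma fn_cont_on: "A \<subseteq> M \<Longrightarrow> continuous_on A (f ^^ n)"
  by (rule continuous_on_subset[OF fn_cont])

lemma orb_sub_M: "A \<subseteq> M \<Longrightarrow> closure (orb f A) \<subseteq> M"
  by (intro closure_minimal M_closed orb_invariant_subset) (simp add: onto)

text \<open>Bigness is inherited by anything that is eventually mapped over a big interval; this is
  how membership in \<open>B\<close> is pulled back.\<close>

lemma big_if_image_big:
  assumes "big s t" "{s..t} \<subseteq> (f ^^ n) ` {u..v}" "{u..v} \<subseteq> M"
  shows "big u v"
proof -
  have "infinite ((f ^^ n) ` {u..v})"
    using assms(1,2) infinite_super[of "{s..t}"] unfolding big_def by (simp add: infinite_Icc)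
  then have "infinite {u..v}" using finite_imageI by blast
  then have "u < v" by (simp add: infinite_Icc_iff)
  have "orb f {s..t} \<subseteq> orb f {u..v}"
    using orb_mono[OF assms(2)] orb_iterate_subset by blast
  then have "M \<subseteq> closure (orb f {u..v})"
    using closure_mono assms(1) unfolding big_def by metis
  then show ?thesis unfolding big_def using \<open>u < v\<close> assms(3) orb_sub_M[OF assms(3)] by blast
qed

text \<open>Trades relative neighbourhoods for the sets \<open>M \<inter> {x - d..x + d}\<close>
  with \<open>d \<le> \<rho>\<close>, which are intervals by \<open>local_interval\<close>.\<close>

lemma mem_B_iff:
  "x \<in> B \<longleftrightarrow> x \<in> M \<and> (\<forall>d. 0 < d \<longrightarrow> d \<le> \<rho> \<longrightarrow> closure (orb f (M \<inter> {x - d..x + d})) = M)"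
proof
  assume x: "x \<in> B"
  then have xM: "x \<in> M" unfolding B_def basic_points_def by simp
  have "closure (orb f (M \<inter> {x - d..x + d})) = M" if "0 < d" for d
  proof -
    have "openin (top_of_set M) (M \<inter> ball x d)" by (simp add: openin_open_Int)
    then have "closure (orb f (M \<inter> ball x d)) = M"
      using x xM that unfolding B_def basic_points_def by auto
    moreover have "M \<inter> ball x d \<subseteq> M \<inter> {x - d..x + d}" by (auto simp: dist_real_def)
    ultimately have "M \<subseteq> closure (orb f (M \<inter> {x - d..x + d}))"
      using closure_mono orb_mono by metis
    then show ?thesis using orb_sub_M[of "M \<inter> {x - d..x + d}"] by blast
  qed
  then show "x \<in> M \<and> (\<forall>d. 0 < d \<longrightarrow> d \<le> \<rho> \<longrightarrow> closure (orb f (M \<inter> {x - d..x + d})) = M)"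
    using xM by blast
next
  assume x: "x \<in> M \<and> (\<forall>d. 0 < d \<longrightarrow> d \<le> \<rho> \<longrightarrow> closure (orb f (M \<inter> {x - d..x + d})) = M)"
  have "closure (orb f U) = M" if U: "openin (top_of_set M) U" "x \<in> U" for U
  proof -
    obtain e where e: "e > 0" "ball x e \<inter> M \<subseteq> U"
      using U unfolding openin_contains_ball by blast
    define d where "d = min \<rho> (e / 2)"
    have d: "0 < d" "d \<le> \<rho>" "d < e" unfolding d_def using e rho_pos by auto
    have "M \<inter> {x - d..x + d} \<subseteq> U" using d by (intro order_trans[OF _ e(2)]) (auto simp: dist_real_def)
    then have "M \<subseteq> closure (orb f U)" using x d closure_mono orb_mono by metis
    moreover have "U \<subseteq> M" using U openin_imp_subset by blast
    ultimately show ?thesis using orb_sub_M[of U] by blast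
  qed
  then show "x \<in> B" unfolding B_def basic_points_def using x by blast
qed

lemma B_sub_M: "B \<subseteq> M" using mem_B_iff by blast

lemma infinite_B: "infinite B" unfolding B_def by (rule B_infinite)

lemma big_around:
  assumes "x \<in> B" "u < x" "x < v" "{u..v} \<subseteq> M"
  shows "big u v"
proof -
  define d where "d = min \<rho> (min (x - u) (v - x))"
  have d: "0 < d" "d \<le> \<rho>" "{x-d..x+d} \<subseteq> {u..v}" unfolding d_def using assms rho_pos by auto
  have "closure (orb f (M \<inter> {x - d..x + d})) = M" using assms(1) mem_B_iff d by blast
  moreover have "orb f (M \<inter> {x - d..x + d}) \<subseteq> orb f {u..v}" by (rule orb_mono) (use d in blast)
  ultimately have "M \<subseteq> closure (orb f {u..v})" using closure_mono by metis
  then show ?thesis unfolding big_def using assms orb_sub_M[OF assms(4)] by auto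
qed

text \<open>The big intervals may miss \<open>x\<close>: each neighbourhood of \<open>x\<close>
  contains one of them and inherits its dense orbit.\<close>

lemma mem_B_if_near_big:
  assumes "x \<in> M" "\<And>d. d > 0 \<Longrightarrow> \<exists>u v. big u v \<and> {u..v} \<subseteq> {x - d..x + d}"
  shows "x \<in> B" unfolding mem_B_iff
proof (intro conjI allI impI)
  fix d assume "0 < d" "d \<le> \<rho>"
  then obtain u v where uv: "big u v" "{u..v} \<subseteq> {x - d..x + d}" using assms(2) by blast
  then have "orb f {u..v} \<subseteq> orb f (M \<inter> {x - d..x + d})" by (intro orb_mono) (auto simp: big_def)
  then have "M \<subseteq> closure (orb f (M \<inter> {x - d..x + d}))"
    using closure_mono uv(1) unfolding big_def by metis
  then show "closure (orb f (M \<inter> {x - d..x + d})) = M" using orb_sub_M[of "M \<inter> {x - d..x + d}"] by blast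
qed (rule assms(1))

lemma near_big:
  assumes "x \<in> B" "d > 0"
  shows "\<exists>u v. big u v \<and> u \<le> x \<and> x \<le> v \<and> {u..v} = M \<inter> {x - min \<rho> d..x + min \<rho> d}"
proof -
  define e where "e = min \<rho> d"
  have e: "0 < e" "e \<le> \<rho>" unfolding e_def using assms rho_pos by auto
  obtain u v where uv: "u < v" "u \<le> x" "x \<le> v" "M \<inter> {x - e..x + e} = {u..v}"
    using local_interval[OF _ e] assms B_sub_M by blast
  then have "closure (orb f {u..v}) = M" using mem_B_iff assms(1) e by metis
  then show ?thesis unfolding big_def e_def[symmetric] using uv by blast
qed

lemma B_closed: "closed B"
proof -
  have "x \<in> B" if x: "x \<in> closure B" for x
  proof (rule mem_B_if_near_big)
    show "x \<in> M" using x closure_minimal[OF B_sub_M M_closed] by blast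
    fix d :: real assume "d > 0"
    then obtain y where y: "y \<in> B" "y \<in> ball x (d/2)"
      using dense_meets_open[OF refl, of "ball x (d/2)" x B] x by auto
    obtain u v where "big u v" "{u..v} = M \<inter> {y - min \<rho> (d/2)..y + min \<rho> (d/2)}"
      using near_big[OF y(1), of "d/2"] \<open>d > 0\<close> by auto
    moreover have "{y - min \<rho> (d/2)..y + min \<rho> (d/2)} \<subseteq> {x - d..x + d}"
    proof -
      define e where "e = min \<rho> (d/2)"
      have "\<bar>x - y\<bar> < d/2" "e \<le> d/2" using y(2) by (auto simp: e_def dist_real_def)
      then show ?thesis unfolding e_def[symmetric] by (auto simp: abs_if split: if_splits)
    qed
    ultimately show "\<exists>u v. big u v \<and> {u..v} \<subseteq> {x - d..x + d}" by blast
  qed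
  then show ?thesis using closure_subset_eq by blast
qed

lemma B_compact: "compact B"
  using compact_Int_closed[OF M_compact B_closed] B_sub_M by (simp add: Int_absorb1)

text \<open>The image of a neighbourhood of \<open>x\<close> has a dense orbit as well and fits into
  any prescribed neighbourhood of \<open>f x\<close>.\<close>

lemma f_B: "x \<in> B \<Longrightarrow> f x \<in> B"
proof (rule mem_B_if_near_big)
  assume x: "x \<in> B"
  then have xM: "x \<in> M" using B_sub_M by blast
  then show "f x \<in> M" by (rule f_mem)
  fix d :: real assume "d > 0"
  define d' where "d' = min \<rho> d"
  have "d' > 0" unfolding d'_def using \<open>d > 0\<close> rho_pos by simp
  obtain e where e: "e > 0" "\<And>y. y \<in> M \<Longrightarrow> dist y x < e \<Longrightarrow> dist (f y) (f x) < d'"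
    using cont xM \<open>d' > 0\<close> unfolding continuous_on_iff by metis
  obtain u v where uv: "big u v" "{u..v} = M \<inter> {x - min \<rho> (e/2)..x + min \<rho> (e/2)}"
    using near_big[OF x, of "e/2"] e by auto
  obtain u' v' where img: "u' < v'" "M \<inter> {f x - d'..f x + d'} = {u'..v'}"
    using local_interval[of "f x" d'] f_mem[OF xM] \<open>d' > 0\<close> by (auto simp: d'_def)
  have "f ` {u..v} \<subseteq> {u'..v'}"
  proof
    fix z assume "z \<in> f ` {u..v}"
    then obtain y where y: "z = f y" "y \<in> M" "y \<in> {x - min \<rho> (e/2)..x + min \<rho> (e/2)}" using uv by blast
    then have "dist y x < e" using e(1) by (auto simp: dist_real_def)
    then have "dist z (f x) < d'" using e(2) y by blast
    then show "z \<in> {u'..v'}" unfolding img(2)[symmetric] using y f_mem by (auto simp: dist_real_def)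
  qed
  then have "orb f (f ` {u..v}) \<subseteq> orb f {u'..v'}" by (rule orb_mono)
  moreover have "closure (orb f (f ` {u..v})) = M"
    using tail_dense[OF M_closed cont onto, of "{u..v}" 1] uv(1) by (simp add: big_def)
  ultimately have "M \<subseteq> closure (orb f {u'..v'})" using closure_mono by metis
  moreover have sub: "{u'..v'} \<subseteq> M" using img by blast
  ultimately have "big u' v'" unfolding big_def using img orb_sub_M[OF sub] by blast
  moreover have "{u'..v'} \<subseteq> {f x - d..f x + d}" unfolding img(2)[symmetric] d'_def by auto
  ultimately show "\<exists>u v. big u v \<and> {u..v} \<subseteq> {f x - d..f x + d}" by blast
qed

lemma fn_B: "x \<in> B \<Longrightarrow> (f ^^ n) x \<in> B"
  by (rule funpow_mem[of f B]) (auto intro: f_B)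

text \<open>Near an accumulation point \<open>p\<close> of \<open>B\<close> the set \<open>F\<close>
  contains at most \<open>p\<close> itself, and infinitely many points of \<open>B\<close> lie on
  one side of \<open>p\<close>; two of them serve as ends of the interval.\<close>

lemma many_B_in_interval:
  "\<exists>s e T. s < e \<and> {s..e} \<subseteq> M - F \<and> T \<subseteq> B \<and> finite T \<and> card T = k \<and> T \<subseteq> {s<..<e}"
proof -
  obtain p where p: "p \<in> B" "p islimpt B"
    using B_compact infinite_B unfolding compact_eq_Bolzano_Weierstrass by blast
  obtain d where d: "d > 0" "\<And>x. x \<in> F \<Longrightarrow> x \<noteq> p \<Longrightarrow> d \<le> dist p x"
    using finite_set_avoid[OF F_finite] by metis
  define e where "e = min \<rho> (d/2)"
  have e: "0 < e" "e \<le> \<rho>" "e < d" unfolding e_def using rho_pos d by auto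
  obtain u v where uv: "M \<inter> {p - e..p + e} = {u..v}"
    using local_interval[OF _ e(1,2)] p B_sub_M by blast
  have "infinite (B \<inter> ball p e)" using p(2) e unfolding islimpt_eq_infinite_ball by blast
  moreover have "B \<inter> ball p e \<subseteq> B \<inter> {u..v}"
    unfolding uv[symmetric] using B_sub_M by (auto simp: dist_real_def)
  ultimately have "infinite (B \<inter> {u..v})" by (meson finite_subset)
  moreover have "B \<inter> {u..v} \<subseteq> (B \<inter> {u..v} \<inter> {..<p}) \<union> {p} \<union> (B \<inter> {u..v} \<inter> {p<..})" by auto
  ultimately have "infinite (B \<inter> {u..v} \<inter> {..<p}) \<or> infinite (B \<inter> {u..v} \<inter> {p<..})"
    by (metis finite.emptyI finite_UnI finite_insert finite_subset)
  moreover have "B \<inter> {u..v} \<inter> Y \<subseteq> B" "B \<inter> {u..v} \<inter> Y \<subseteq> {u..v}" "B \<inter> {u..v} \<inter> Y \<subseteq> Y" for Y by auto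
  ultimately obtain X where X: "infinite X" "X \<subseteq> B" "X \<subseteq> {u..v}" "X \<subseteq> {..<p} \<or> X \<subseteq> {p<..}" by metis
  obtain T s t where T: "T \<subseteq> X" "s \<in> X" "t \<in> X" "finite T" "card T = k" "s < t" "T \<subseteq> {s<..<t}"
    using infinite_subset_card[OF X(1)] by blast
  have "{s..t} \<subseteq> {u..v}" using T X by auto
  moreover have "p \<notin> {s..t}" using T X by fastforce
  moreover have "y \<notin> F" if "y \<in> {u..v}" "y \<noteq> p" for y
  proof
    assume "y \<in> F"
    then have "d \<le> \<bar>p - y\<bar>" using d that by (auto simp: dist_real_def)
    moreover have "y \<in> {p - e..p + e}" using that uv by blast
    ultimately show False using e by (auto simp: abs_le_iff)
  qed
  moreover have "{u..v} \<subseteq> M" using uv by blast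
  ultimately have "{s..t} \<subseteq> M - F" by blast
  then show ?thesis using T X by blast
qed

lemma two_B_in_interval:
  obtains s e b1 b2 where "{s..e} \<subseteq> M - F" "b1 \<in> B" "b2 \<in> B" "s < b1" "b1 < b2" "b2 < e"
proof -
  obtain s e T where T: "s < e" "{s..e} \<subseteq> M - F" "T \<subseteq> B" "finite T" "card T = 2" "T \<subseteq> {s<..<e}"
    using many_B_in_interval[of 2] by blast
  obtain x y where "T = {x, y}" "x \<noteq> y" using T(5) by (auto simp: card_2_iff)
  then have xy: "x \<in> B" "y \<in> B" "s < x" "s < y" "x < e" "y < e" "x < y \<or> y < x" using T by auto
  then show thesis using that[OF T(2) xy(1,2)] that[OF T(2) xy(2,1)] by blast
qed

section \<open>One-sided bigness and lifting of basic points through iterates\<close>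

definition rbig :: "real \<Rightarrow> bool" where "rbig x \<longleftrightarrow> (\<forall>t>x. \<exists>t'\<le>t. big x t')"

definition lbig :: "real \<Rightarrow> bool" where "lbig x \<longleftrightarrow> (\<forall>t<x. \<exists>t'\<ge>t. big t' x)"

text \<open>Some image of a neighbourhood of \<open>x\<close> contains two adjacent big intervals
  \<open>{s..mid}\<close> and \<open>{mid..e}\<close>. Wherever \<open>x\<close> itself goes, one of
  the two lies between its image and the image of some \<open>z\<close>, so the half of the
  neighbourhood containing \<open>z\<close> is mapped over a big interval and is itself big.\<close>

lemma B_sides:
  assumes "x \<in> B"
  shows "rbig x \<or> lbig x"
proof (rule ccontr)
  assume "\<not> ?thesis"
  then obtain t1 t2 where t1: "t1 > x" "\<And>t'. t' \<le> t1 \<Longrightarrow> \<not> big x t'"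
    and t2: "t2 < x" "\<And>t'. t' \<ge> t2 \<Longrightarrow> \<not> big t' x"
    unfolding rbig_def lbig_def by blast
  define d where "d = min (t1 - x) (x - t2)"
  have d: "d > 0" "x + d \<le> t1" "x - d \<ge> t2" unfolding d_def using t1 t2 by auto
  obtain u v where uv: "big u v" "u \<le> x" "x \<le> v" "{u..v} = M \<inter> {x - min \<rho> d..x + min \<rho> d}"
    using near_big[OF assms d(1)] by blast
  have uvM0: "{u..v} \<subseteq> M" using uv(1) unfolding big_def by blast
  have "u \<in> {u..v}" "v \<in> {u..v}" using uv(2,3) by auto
  then have bd: "v \<le> t1" "u \<ge> t2" unfolding uv(4) using d by auto
  have uvM: "{u..v} \<subseteq> M" "{u..x} \<subseteq> M" "{x..v} \<subseteq> M"
    by (rule uvM0, rule order_trans[OF _ uvM0], use uv(2,3) in simp, rule order_trans[OF _ uvM0], use uv(2,3) in simp)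
  obtain s e b1 b2 where se: "{s..e} \<subseteq> M - F" "b1 \<in> B" "b2 \<in> B" "s < b1" "b1 < b2" "b2 < e"
    by (rule two_B_in_interval)
  obtain n where n: "{s..e} \<subseteq> (f ^^ n) ` {u..v}"
  proof -
    have "s \<le> e" using se by simp
    then show thesis using covers[OF _ _ _ _ se(1)] uv(1) that unfolding big_def by blast
  qed
  define mid where "mid = (b1 + b2) / 2"
  have mid: "b1 < mid" "mid < b2" unfolding mid_def using se by auto
  have "{s..mid} \<subseteq> {s..e}" "{mid..e} \<subseteq> {s..e}" using se mid by auto
  then have "{s..mid} \<subseteq> M" "{mid..e} \<subseteq> M" using se(1) by blast+
  then have bigs: "big s mid" "big mid e"
    using big_around[OF se(2), of s mid] big_around[OF se(3), of mid e] se mid by auto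
  have no: "\<not> {s..mid} \<subseteq> (f ^^ n) ` {x..v}" "\<not> {mid..e} \<subseteq> (f ^^ n) ` {x..v}"
    "\<not> {s..mid} \<subseteq> (f ^^ n) ` {u..x}" "\<not> {mid..e} \<subseteq> (f ^^ n) ` {u..x}"
    using big_if_image_big[OF bigs(1) _ uvM(3)] big_if_image_big[OF bigs(2) _ uvM(3)]
      big_if_image_big[OF bigs(1) _ uvM(2)] big_if_image_big[OF bigs(2) _ uvM(2)]
      t1(2)[OF bd(1)] t2(2)[OF bd(2)] by metis+
  show False
  proof (cases "(f ^^ n) x \<le> mid")
    case True
    have "e \<in> (f ^^ n) ` {u..v}" by (rule subsetD[OF n]) (use se in auto)
    then obtain z where z: "z \<in> {u..v}" "(f ^^ n) z = e" by blast
    have sub: "{mid..e} \<subseteq> {(f ^^ n) x..(f ^^ n) z}" using True z(2) by auto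
    show False
    proof (cases "x \<le> z")
      case True
      then have "{(f ^^ n) x..(f ^^ n) z} \<subseteq> (f ^^ n) ` {x..v}"
        by (intro image_interval_superset fn_cont_on uvM) (use z(1) uv(2,3) True in simp_all)
      then show False using sub no by blast
    next
      case False
      then have "{(f ^^ n) x..(f ^^ n) z} \<subseteq> (f ^^ n) ` {u..x}"
        by (intro image_interval_superset fn_cont_on uvM) (use z(1) uv(2,3) False in simp_all)
      then show False using sub no by blast
    qed
  next
    case False
    have "s \<in> (f ^^ n) ` {u..v}" by (rule subsetD[OF n]) (use se in auto)
    then obtain z where z: "z \<in> {u..v}" "(f ^^ n) z = s" by blast
    have sub: "{s..mid} \<subseteq> {(f ^^ n) z..(f ^^ n) x}" using False z(2) by auto
    show False
    proof (cases "x \<le> z")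
      case True
      then have "{(f ^^ n) z..(f ^^ n) x} \<subseteq> (f ^^ n) ` {x..v}"
        by (intro image_interval_superset fn_cont_on uvM) (use z(1) uv(2,3) True in simp_all)
      then show False using sub no by blast
    next
      case False
      then have "{(f ^^ n) z..(f ^^ n) x} \<subseteq> (f ^^ n) ` {u..x}"
        by (intro image_interval_superset fn_cont_on uvM) (use z(1) uv(2,3) False in simp_all)
      then show False using sub no by blast
    qed
  qed
qed

text \<open>At a border point of the level set, small intervals are mapped over big intervals to the
  right of \<open>b\<close> and are therefore big, which puts the point into
  \<open>B\<close>.\<close>

lemma lift_right:
  assumes "{u..v} \<subseteq> M" "p \<in> {u..v}" "q \<in> {u..v}" "(f ^^ n) p = b" "b < (f ^^ n) q" "rbig b"
  shows "\<exists>x\<in>{u..v} \<inter> B. (f ^^ n) x = b"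
proof -
  obtain x where x: "x \<in> {u..v}" "(f ^^ n) x = b"
    "\<And>d. d > 0 \<Longrightarrow> \<exists>s t. x \<in> {s..t} \<and> {s..t} \<subseteq> {u..v} \<inter> {x - d..x + d} \<and> (\<exists>z\<in>{s..t}. b < (f ^^ n) z)"
    using level_boundary_point[OF fn_cont_on[OF assms(1)] assms(2-5)] by blast
  have "x \<in> B"
  proof (rule mem_B_if_near_big)
    show "x \<in> M" using x assms(1) by blast
    fix d :: real assume "d > 0"
    then obtain s t z where st: "x \<in> {s..t}" "{s..t} \<subseteq> {u..v} \<inter> {x - d..x + d}" "z \<in> {s..t}" "b < (f ^^ n) z"
      using x(3) by blast
    then have stM: "{s..t} \<subseteq> M" using assms(1) by blast
    obtain t' where t': "t' \<le> (f ^^ n) z" "big b t'" using assms(6) st(4) unfolding rbig_def by blast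
    have sub: "{(f ^^ n) x..(f ^^ n) z} \<subseteq> (f ^^ n) ` {s..t}"
      by (rule image_interval_superset[OF fn_cont_on[OF stM] st(1,3)])
    have "{b..t'} \<subseteq> (f ^^ n) ` {s..t}" by (rule order_trans[OF _ sub]) (use x(2) t'(1) in auto)
    then show "\<exists>u v. big u v \<and> {u..v} \<subseteq> {x - d..x + d}"
      using big_if_image_big[OF t'(2) _ stM] st(2) by blast
  qed
  then show ?thesis using x by blast
qed

lemma lift_left:
  assumes "{u..v} \<subseteq> M" "p \<in> {u..v}" "q \<in> {u..v}" "(f ^^ n) p = b" "(f ^^ n) q < b" "lbig b"
  shows "\<exists>x\<in>{u..v} \<inter> B. (f ^^ n) x = b"
proof -
  have "continuous_on {u..v} (\<lambda>x. - (f ^^ n) x)" by (intro continuous_intros fn_cont_on assms(1))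
  then obtain x where x: "x \<in> {u..v}" "- (f ^^ n) x = -b"
    "\<And>d. d > 0 \<Longrightarrow> \<exists>s t. x \<in> {s..t} \<and> {s..t} \<subseteq> {u..v} \<inter> {x - d..x + d} \<and> (\<exists>z\<in>{s..t}. -b < - (f ^^ n) z)"
    using level_boundary_point[of u v "\<lambda>x. - (f ^^ n) x" p q "-b"] assms(2-5) by auto
  have "x \<in> B"
  proof (rule mem_B_if_near_big)
    show "x \<in> M" using x assms(1) by blast
    fix d :: real assume "d > 0"
    then obtain s t z where st: "x \<in> {s..t}" "{s..t} \<subseteq> {u..v} \<inter> {x - d..x + d}" "z \<in> {s..t}" "(f ^^ n) z < b"
      using x(3)[of d] by auto
    then have stM: "{s..t} \<subseteq> M" using assms(1) by blast
    obtain t' where t': "t' \<ge> (f ^^ n) z" "big t' b" using assms(6) st(4) unfolding lbig_def by blast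
    have sub: "{(f ^^ n) z..(f ^^ n) x} \<subseteq> (f ^^ n) ` {s..t}"
      by (rule image_interval_superset[OF fn_cont_on[OF stM] st(3,1)])
    have "{t'..b} \<subseteq> (f ^^ n) ` {s..t}" by (rule order_trans[OF _ sub]) (use x(2) t'(1) in auto)
    then show "\<exists>u v. big u v \<and> {u..v} \<subseteq> {x - d..x + d}"
      using big_if_image_big[OF t'(2) _ stM] st(2) by blast
  qed
  then show ?thesis using x by auto
qed

text \<open>Values on both sides of \<open>b\<close> are attained, so whichever side of
  \<open>b\<close> is big can be used.\<close>

lemma lift_interior:
  assumes "{u..v} \<subseteq> M" "{s..e} \<subseteq> (f ^^ n) ` {u..v}" "b \<in> B" "s < b" "b < e"
  shows "\<exists>x\<in>{u..v} \<inter> B. (f ^^ n) x = b"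
proof -
  have "s \<in> (f ^^ n) ` {u..v}" "b \<in> (f ^^ n) ` {u..v}" "e \<in> (f ^^ n) ` {u..v}"
    by (rule subsetD[OF assms(2)], use assms(4,5) in simp)+
  then obtain p q q' where "p \<in> {u..v}" "(f ^^ n) p = b" "q \<in> {u..v}" "(f ^^ n) q = s" "q' \<in> {u..v}" "(f ^^ n) q' = e"
    by blast
  then show ?thesis
    using B_sides[OF assms(3)] lift_right[OF assms(1), of p q' n b] lift_left[OF assms(1), of p q n b] assms(4,5)
    by blast
qed

text \<open>Any finite number of points of \<open>B\<close> inside a target interval lifts to as
  many points of \<open>B\<close> in the big interval.\<close>

lemma big_infinite:
  assumes "big u v"
  shows "infinite (B \<inter> {u..v})"
proof
  assume fin: "finite (B \<inter> {u..v})"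
  have uvM: "{u..v} \<subseteq> M" using assms unfolding big_def by blast
  obtain s e T where T: "s < e" "{s..e} \<subseteq> M - F" "T \<subseteq> B" "finite T" "card T = card (B \<inter> {u..v}) + 1" "T \<subseteq> {s<..<e}"
    using many_B_in_interval by blast
  obtain n where n: "{s..e} \<subseteq> (f ^^ n) ` {u..v}"
    using covers[OF _ _ _ less_imp_le[OF T(1)] T(2)] assms unfolding big_def by blast
  have "\<exists>x\<in>{u..v} \<inter> B. (f ^^ n) x = b" if "b \<in> T" for b
  proof (rule lift_interior[OF uvM n])
    show "b \<in> B" using T(3) that by blast
    have "b \<in> {s<..<e}" using T(6) that by blast
    then show "s < b" "b < e" by auto
  qed
  then have "T \<subseteq> (f ^^ n) ` (B \<inter> {u..v})" by blast
  then have "card T \<le> card ((f ^^ n) ` (B \<inter> {u..v}))" by (intro card_mono finite_imageI fin)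
  also have "\<dots> \<le> card (B \<inter> {u..v})" by (rule card_image_le[OF fin])
  finally have "card T \<le> card (B \<inter> {u..v})" .
  then show False using T(5) by simp
qed

lemma big_if_infinite:
  assumes "{u..v} \<subseteq> M" "infinite (B \<inter> {u..v})"
  shows "big u v"
proof -
  obtain T s e where T: "T \<subseteq> B \<inter> {u..v}" "s \<in> B \<inter> {u..v}" "e \<in> B \<inter> {u..v}" "finite T" "card T = 1" "s < e" "T \<subseteq> {s<..<e}"
    using infinite_subset_card[OF assms(2), of 1] by blast
  obtain x where "T = {x}" using T(5) by (rule card_1_singletonE)
  then have "x \<in> B" "u < x" "x < v" using T(1-3,7) by auto
  then show ?thesis using big_around assms(1) by blast
qed

lemma rbig_infinite: "rbig x \<Longrightarrow> x < t \<Longrightarrow> infinite (B \<inter> {x<..<t})"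
proof
  assume *: "rbig x" "x < t" "finite (B \<inter> {x<..<t})"
  have "x < (x + t) / 2" using * by simp
  then obtain t' where t': "t' \<le> (x + t) / 2" "big x t'" using *(1) unfolding rbig_def by blast
  have "B \<inter> {x..t'} \<subseteq> insert x (B \<inter> {x<..<t})" using t' *(2) by auto
  then have "finite (B \<inter> {x..t'})" by (rule finite_subset) (use *(3) in simp)
  then show False using big_infinite[OF t'(2)] by blast
qed

lemma lbig_infinite: "lbig x \<Longrightarrow> t < x \<Longrightarrow> infinite (B \<inter> {t<..<x})"
proof
  assume *: "lbig x" "t < x" "finite (B \<inter> {t<..<x})"
  have "(x + t) / 2 < x" using * by simp
  then obtain t' where t': "t' \<ge> (x + t) / 2" "big t' x" using *(1) unfolding lbig_def by blast
  have "B \<inter> {t'..x} \<subseteq> insert x (B \<inter> {t<..<x})" using t' *(2) by auto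
  then have "finite (B \<inter> {t'..x})" by (rule finite_subset) (use *(3) in simp)
  then show False using big_infinite[OF t'(2)] by blast
qed

text \<open>The right end has to lie in \<open>B\<close> and be big from the left, for the later
  search for fixed points in \<open>B\<close>. If \<open>b2\<close> fails, it has a gap of
  \<open>B\<close> on its left, and the other end \<open>d\<close> of this gap cannot be big from
  the right, hence is big from the left. The core is placed off \<open>F\<close> so that every big
  interval covers it.\<close>

lemma core_exists:
  "\<exists>c1 c2 r. {c1..c2} \<subseteq> M - F \<and> c2 \<in> B \<and> lbig c2 \<and> big c1 c2 \<and> 0 < r \<and> {c1..c2} \<subseteq> (f ^^ r) ` {c1..c2}"
proof -
  obtain s e b1 b2 where se: "{s..e} \<subseteq> M - F" "b1 \<in> B" "b2 \<in> B" "s < b1" "b1 < b2" "b2 < e"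
    by (rule two_B_in_interval)
  obtain c2 where c2: "c2 \<in> B" "s < c2" "c2 < e" "lbig c2"
  proof (cases "lbig b2")
    case True
    then show thesis using that se by auto
  next
    case False
    then obtain t0 where t0: "t0 < b2" "\<And>t'. t' \<ge> t0 \<Longrightarrow> \<not> big t' b2" unfolding lbig_def by blast
    define t where "t = max t0 b1"
    have t: "t < b2" "\<And>t'. t' \<ge> t \<Longrightarrow> \<not> big t' b2" "b1 \<le> t" unfolding t_def using t0 se by auto
    have gap: "y \<notin> B" if "t < y" "y < b2" for y
    proof
      assume "y \<in> B"
      moreover have "{t..b2} \<subseteq> {s..e}" using t se by auto
      ultimately have "big t b2" using big_around[of y t b2] that se(1) by blast
      then show False using t(2) by blast
    qed
    have "compact (B \<inter> {b1..t})" by (intro compact_Int_closed B_compact) simp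
    moreover have "b1 \<in> B \<inter> {b1..t}" using se t by simp
    ultimately obtain d where d: "d \<in> B \<inter> {b1..t}" "\<And>y. y \<in> B \<inter> {b1..t} \<Longrightarrow> y \<le> d"
      using compact_attains_sup[of "B \<inter> {b1..t}"] by blast
    have "B \<inter> {d<..<b2} = {}"
    proof -
      have "y \<notin> B" if "d < y" "y < b2" for y
        using gap[of y] d(2)[of y] d(1) that by (cases "y \<le> t") auto
      then show ?thesis by auto
    qed
    then have "\<not> rbig d" using rbig_infinite[of d b2] d(1) t(1) by auto
    then have "lbig d" using B_sides d(1) by blast
    then show thesis using that[of d] d(1) se t(1) by auto
  qed
  have "(s + c2) / 2 < c2" using c2 by simp
  then obtain c1 where c1: "c1 \<ge> (s + c2) / 2" "big c1 c2" using c2(4) unfolding lbig_def by blast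
  have sub: "s < c1" "{c1..c2} \<subseteq> {s..e}" using c1 c2 by auto
  have "s \<le> e" using c2 by simp
  then obtain r where r: "{s..e} \<subseteq> (f ^^ r) ` {c1..c2}"
    using covers[OF _ _ _ _ se(1)] c1(2) unfolding big_def by blast
  have "r \<noteq> 0"
  proof
    assume "r = 0"
    then have "s \<in> {c1..c2}" using subsetD[OF r, of s] \<open>s \<le> e\<close> by simp
    then show False using sub by simp
  qed
  then show ?thesis using order_trans[OF sub(2) r] order_trans[OF sub(2) se(1)] c1(2) c2(1,4)
    by (intro exI[of _ c1] exI[of _ c2] exI[of _ r]) simp
qed

end

section \<open>Chains of intervals and the core\<close>

text \<open>Taking the first arrival at \<open>l2\<close> and then the last visit to
  \<open>l1\<close> before it leaves no room for values outside of \<open>{l1..l2}\<close>.\<close>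

lemma exact_subinterval_up:
  fixes h :: "real \<Rightarrow> real"
  assumes cont: "continuous_on {p..q} h" and "p \<le> q" "h p = l1" "h q = l2" "l1 \<le> l2"
  shows "\<exists>p' q'. p \<le> p' \<and> p' \<le> q' \<and> q' \<le> q \<and> h p' = l1 \<and> h q' = l2 \<and> h ` {p'..q'} = {l1..l2}"
proof (cases "l1 = l2")
  case True
  then show ?thesis using assms by (intro exI[of _ p]) auto
next
  case False
  have "continuous_on {p..q} (\<lambda>t. - h t)" by (intro continuous_intros cont)
  then obtain q' where q': "p < q'" "q' \<le> q" "h q' = l2" "\<And>t. p \<le> t \<Longrightarrow> t < q' \<Longrightarrow> h t < l2"
    using first_level_point[of p q "\<lambda>t. - h t" "-l2"] assms False by auto
  have cont': "continuous_on {p..q'} h" by (rule continuous_on_subset[OF cont]) (use q' in auto)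
  then obtain p' where p': "p \<le> p'" "p' < q'" "h p' = l1" "\<And>t. p' < t \<Longrightarrow> t \<le> q' \<Longrightarrow> l1 < h t"
    using last_level_point[of p q' h l1] assms False q' by auto
  have "h ` {p'..q'} \<subseteq> {l1..l2}"
  proof
    fix y assume "y \<in> h ` {p'..q'}"
    then obtain t where t: "p' \<le> t" "t \<le> q'" "y = h t" by auto
    have "l1 \<le> h t" using p'(3) p'(4)[of t] t by (cases "t = p'") auto
    moreover have "h t \<le> l2" using q'(3) q'(4)[of t] t p'(1) by (cases "t = q'") auto
    ultimately show "y \<in> {l1..l2}" using t by simp
  qed
  moreover have "{h p'..h q'} \<subseteq> h ` {p'..q'}" by (rule image_interval_superset)
      (use p' q' in \<open>auto intro!: continuous_on_subset[OF cont']\<close>)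
  ultimately show ?thesis using p' q' by (intro exI[of _ p'] exI[of _ q']) auto
qed

lemma exact_subinterval_down:
  fixes h :: "real \<Rightarrow> real"
  assumes cont: "continuous_on {q..p} h" and "q \<le> p" "h p = l1" "h q = l2" "l1 \<le> l2"
  shows "\<exists>p' q'. q \<le> q' \<and> q' \<le> p' \<and> p' \<le> p \<and> h p' = l1 \<and> h q' = l2 \<and> h ` {q'..p'} = {l1..l2}"
proof -
  have "continuous_on {-p..-q} (\<lambda>t. h (-t))"
    by (rule continuous_on_compose2[OF cont]) (auto intro!: continuous_intros)
  then obtain p' q' where *: "-p \<le> p'" "p' \<le> q'" "q' \<le> -q" "h (-p') = l1" "h (-q') = l2"
    "(\<lambda>t. h (-t)) ` {p'..q'} = {l1..l2}"
    using exact_subinterval_up[of "-p" "-q" "\<lambda>t. h (-t)" l1 l2] assms by auto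
  have "h ` {-q'..-p'} = {l1..l2}"
    unfolding *(6)[symmetric] image_image[of h uminus, symmetric] by simp
  then show ?thesis using * by (intro exI[of _ "-p'"] exI[of _ "-q'"]) auto
qed

text \<open>Passing from a covering image to an exact one is what allows covering relations to be
  composed into itineraries.\<close>

lemma exact_subinterval:
  fixes h :: "real \<Rightarrow> real"
  assumes cont: "continuous_on {u..v} h" and "l1 \<le> l2" "{l1..l2} \<subseteq> h ` {u..v}"
  shows "\<exists>u' v'. u' \<le> v' \<and> {u'..v'} \<subseteq> {u..v} \<and> h ` {u'..v'} = {l1..l2}"
proof -
  have "l1 \<in> h ` {u..v}" "l2 \<in> h ` {u..v}" by (rule subsetD[OF assms(3)], use assms(2) in simp)+
  then obtain p q where pq: "p \<in> {u..v}" "h p = l1" "q \<in> {u..v}" "h q = l2" by blast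
  show ?thesis
  proof (cases "p \<le> q")
    case True
    have "continuous_on {p..q} h" by (rule continuous_on_subset[OF cont]) (use pq in auto)
    from exact_subinterval_up[OF this True pq(2,4) assms(2)]
    obtain p' q' where "p \<le> p'" "p' \<le> q'" "q' \<le> q" "h ` {p'..q'} = {l1..l2}" by blast
    then show ?thesis using pq by (intro exI[of _ p'] exI[of _ q']) auto
  next
    case False
    then have "q \<le> p" by simp
    have "continuous_on {q..p} h" by (rule continuous_on_subset[OF cont]) (use pq in auto)
    from exact_subinterval_down[OF this \<open>q \<le> p\<close> pq(2,4) assms(2)]
    obtain p' q' where "q \<le> q'" "q' \<le> p'" "p' \<le> p" "h ` {q'..p'} = {l1..l2}" by blast
    then show ?thesis using pq by (intro exI[of _ q'] exI[of _ p']) auto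
  qed
qed

context basic_system
begin

text \<open>The last image is exact, which lets the induction append the next interval.\<close>

lemma finite_chain:
  assumes sub: "\<And>j. {U j..V j} \<subseteq> M" and le: "\<And>j. U j \<le> V j"
    and step: "\<And>j. j < J \<Longrightarrow> {U (Suc j)..V (Suc j)} \<subseteq> (f ^^ n j) ` {U j..V j}"
  shows "\<exists>u v. u \<le> v \<and> {u..v} \<subseteq> {U 0..V 0} \<and> (f ^^ (\<Sum>i<J. n i)) ` {u..v} = {U J..V J} \<and>
    (\<forall>j\<le>J. (f ^^ (\<Sum>i<j. n i)) ` {u..v} \<subseteq> {U j..V j})" using step
proof (induction J)
  case 0
  then show ?case using le[of 0] by (intro exI[of _ "U 0"] exI[of _ "V 0"]) auto
next
  case (Suc J)
  then obtain u v where uv: "u \<le> v" "{u..v} \<subseteq> {U 0..V 0}" "(f ^^ (\<Sum>i<J. n i)) ` {u..v} = {U J..V J}"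
    "\<And>j. j \<le> J \<Longrightarrow> (f ^^ (\<Sum>i<j. n i)) ` {u..v} \<subseteq> {U j..V j}" by auto
  have uvM: "{u..v} \<subseteq> M" using uv(2) sub by blast
  have "(\<Sum>i<Suc J. n i) = n J + (\<Sum>i<J. n i)" by simp
  then have "{U (Suc J)..V (Suc J)} \<subseteq> (f ^^ (\<Sum>i<Suc J. n i)) ` {u..v}"
    using Suc.prems[of J] uv(3) by (simp only: funpow_image_add lessI)
  from exact_subinterval[OF fn_cont_on[OF uvM] le this]
  obtain u' v' where u'v': "u' \<le> v'" "{u'..v'} \<subseteq> {u..v}" "(f ^^ (\<Sum>i<Suc J. n i)) ` {u'..v'} = {U (Suc J)..V (Suc J)}"
    by blast
  have "(f ^^ (\<Sum>i<j. n i)) ` {u'..v'} \<subseteq> {U j..V j}" if "j \<le> Suc J" for j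
  proof (cases "j = Suc J")
    case False
    then have "j \<le> J" using that by simp
    then show ?thesis by (rule order_trans[OF image_mono[OF u'v'(2)] uv(4)])
  qed (use u'v' in simp)
  then show ?case using u'v'(1,3) order_trans[OF u'v'(2) uv(2)] by blast
qed

text \<open>Any finite piece of the itinerary is realised in \<open>B\<close>, since a point of
  \<open>B\<close> inside the last big interval lifts to \<open>B\<close>; compactness of
  \<open>B\<close> gives the infinite itinerary.\<close>

lemma infinite_chain:
  assumes big: "\<And>j. big (U j) (V j)"
    and step: "\<And>j. {U (Suc j)..V (Suc j)} \<subseteq> (f ^^ n j) ` {U j..V j}"
  shows "\<exists>y\<in>B \<inter> {U 0..V 0}. \<forall>j. (f ^^ (\<Sum>i<j. n i)) y \<in> {U j..V j}"
proof -
  have sub: "{U j..V j} \<subseteq> M" and le: "U j \<le> V j" for j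
    using big[of j] unfolding big_def by auto
  define Z where "Z J = B \<inter> {U 0..V 0} \<inter> (\<Inter>j\<in>{..J}. M \<inter> (f ^^ (\<Sum>i<j. n i)) -` {U j..V j})" for J
  have comp: "compact (Z J)" for J
    unfolding Z_def by (intro compact_Int_closed B_compact closed_INT ballI continuous_closed_preimage fn_cont M_closed) auto
  have ne: "Z J \<noteq> {}" for J
  proof -
    obtain u v where uv: "u \<le> v" "{u..v} \<subseteq> {U 0..V 0}" "(f ^^ (\<Sum>i<J. n i)) ` {u..v} = {U J..V J}"
      "\<And>j. j \<le> J \<Longrightarrow> (f ^^ (\<Sum>i<j. n i)) ` {u..v} \<subseteq> {U j..V j}"
      using finite_chain[of U V J n] sub le step by blast
    have uvM: "{u..v} \<subseteq> M" using uv(2) sub by blast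
    obtain T s e where T: "T \<subseteq> B \<inter> {U J..V J}" "s \<in> B \<inter> {U J..V J}" "e \<in> B \<inter> {U J..V J}" "finite T" "card T = 1" "s < e" "T \<subseteq> {s<..<e}"
      using infinite_subset_card[OF big_infinite[OF big[of J]], of 1] by blast
    obtain b where b: "T = {b}" using T(5) by (rule card_1_singletonE)
    then have b: "b \<in> B" "U J < b" "b < V J" using T(1-3,7) by auto
    have cov: "{U J..V J} \<subseteq> (f ^^ (\<Sum>i<J. n i)) ` {u..v}" using uv(3) by simp
    obtain y where y: "y \<in> {u..v}" "y \<in> B" using lift_interior[OF uvM cov b] by blast
    have "y \<in> Z J" unfolding Z_def
    proof (intro IntI INT_I)
      show "y \<in> {U 0..V 0}" using y(1) uv(2) by blast
      show "y \<in> M" using y(2) B_sub_M by blast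
      show "y \<in> (f ^^ (\<Sum>i<j. n i)) -` {U j..V j}" if "j \<in> {..J}" for j
        using uv(4)[of j] y(1) that by blast
    qed (rule y(2))
    then show ?thesis by blast
  qed
  have dec: "Z m \<subseteq> Z k" if "k \<le> m" for k m
  proof -
    have "{..k} \<subseteq> {..m}" using that by auto
    then show ?thesis unfolding Z_def by (intro Int_mono INT_anti_mono order_refl)
  qed
  have "\<Inter> (range Z) \<noteq> {}" using compact_nest[OF comp ne dec] .
  then obtain y where y: "\<And>J. y \<in> Z J" by blast
  have "y \<in> B \<inter> {U 0..V 0}" "(f ^^ (\<Sum>i<j. n i)) y \<in> {U j..V j}" for j
    using y[of j] unfolding Z_def by simp_all
  then show ?thesis by blast
qed

end

text \<open>\<open>C_sub\<close> makes the core a target for every big interval, and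
  \<open>C_big\<close> makes every interval of \<open>M\<close> off \<open>F\<close> a target for
  the core. \<open>c2_B\<close> and \<open>c2_lbig\<close> serve the fixed point argument for
  cycles.\<close>

locale core_system = basic_system +
  fixes c1 c2 :: real and r :: nat
  assumes C_sub: "{c1..c2} \<subseteq> M - F"
    and c2_B: "c2 \<in> B" and c2_lbig: "lbig c2" and C_big: "big c1 c2"
    and r_pos: "0 < r" and C_return: "{c1..c2} \<subseteq> (f ^^ r) ` {c1..c2}"
begin

lemma C_M: "{c1..c2} \<subseteq> M" using C_sub by blast

lemma c1_less_c2: "c1 < c2" using C_big unfolding big_def by blast

lemma reach_C: "big u v \<Longrightarrow> \<exists>n. {c1..c2} \<subseteq> (f ^^ n) ` {u..v}"
  using covers[OF _ _ _ less_imp_le[OF c1_less_c2] C_sub] unfolding big_def by blast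

lemma return_multiple: "{c1..c2} \<subseteq> (f ^^ (j * r)) ` {c1..c2}"
proof (induction j)
  case (Suc j)
  have "(f ^^ r) ` {c1..c2} \<subseteq> (f ^^ r) ` ((f ^^ (j * r)) ` {c1..c2})" by (rule image_mono[OF Suc])
  then show ?case unfolding mult_Suc funpow_image_add by (rule order_trans[OF C_return])
qed simp

text \<open>The core covers itself after \<open>r\<close> steps, so one can wait there.\<close>

lemma reach_C_late:
  assumes "{c1..c2} \<subseteq> (f ^^ n) ` A"
  shows "\<exists>b. N \<le> b \<and> b \<le> max N n + r \<and> {c1..c2} \<subseteq> (f ^^ b) ` A"
proof -
  define j where "j = (N - n) div r + 1"
  define b where "b = j * r + n"
  have "(N - n) div r * r + (N - n) mod r = N - n" by simp
  moreover have "(N - n) mod r < r" using r_pos by simp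
  moreover have "j * r = (N - n) div r * r + r" unfolding j_def by simp
  ultimately have *: "N - n < j * r" "j * r \<le> N - n + r" by linarith+
  have "{c1..c2} \<subseteq> (f ^^ (j * r)) ` ((f ^^ n) ` A)"
    by (rule order_trans[OF return_multiple image_mono[OF assms]])
  then have "{c1..c2} \<subseteq> (f ^^ b) ` A" unfolding b_def funpow_image_add .
  moreover have "N \<le> b" "b \<le> max N n + r" using * unfolding b_def by auto
  ultimately show ?thesis by blast
qed

text \<open>A neighbourhood that avoids \<open>F\<close> is a legitimate target of the covering
  property, applied to the core.\<close>

lemma accessible:
  assumes "x \<in> M - F"
  shows "\<exists>d n. 0 < d \<and> d \<le> \<rho> \<and> M \<inter> {x - d..x + d} \<subseteq> (f ^^ n) ` {c1..c2}"
proof -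
  obtain e where e: "e > 0" "\<And>y. y \<in> F \<Longrightarrow> y \<noteq> x \<Longrightarrow> e \<le> dist x y"
    using finite_set_avoid[OF F_finite] by metis
  define d where "d = min \<rho> (e / 2)"
  have d: "0 < d" "d \<le> \<rho>" "d < e" unfolding d_def using rho_pos e by auto
  obtain u v where uv: "u \<le> v" "M \<inter> {x - d..x + d} = {u..v}"
    using local_interval[OF _ d(1,2)] assms by (meson Diff_iff less_imp_le)
  have "y \<notin> F" if "y \<in> {u..v}" for y
  proof
    assume "y \<in> F"
    moreover have "y \<in> {x - d..x + d}" using that uv(2) by blast
    ultimately have "y = x" using e(2)[of y] d(3)
      by (cases "y = x") (auto simp: dist_real_def abs_if split: if_splits)
    then show False using assms \<open>y \<in> F\<close> by blast
  qed
  moreover have "{u..v} \<subseteq> M" using uv(2) by blast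
  ultimately have "{u..v} \<subseteq> M - F" by blast
  then obtain n where "{u..v} \<subseteq> (f ^^ n) ` {c1..c2}"
    using covers[OF _ _ _ uv(1)] C_big unfolding big_def by blast
  then show ?thesis using d(1,2) uv(2) by (intro exI[of _ d] exI[of _ n]) simp
qed

text \<open>Unless \<open>v = c2\<close>, the fixed point is the last one before \<open>v\<close>.
  To the right of it \<open>G t > t\<close>, so iterates of any \<open>t0 > x\<close> increase until
  they pass \<open>v\<close>. A small interval \<open>{x..t0}\<close> is thus mapped over
  \<open>{x..c2}\<close>, which is big because points of \<open>B\<close> accumulate at
  \<open>c2\<close> from the left.\<close>

lemma increasing_branch_fixed_point:
  assumes uv: "u \<le> v" "{u..v} \<subseteq> {c1..c2}" and G: "(f ^^ k) u = c1" "(f ^^ k) v = c2"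
  shows "\<exists>y\<in>B \<inter> {u..v}. (f ^^ k) y = y"
proof (cases "v = c2")
  case True
  then show ?thesis using c2_B uv G by (intro bexI[of _ v]) auto
next
  case False
  define G where "G = f ^^ k"
  have uvM: "{u..v} \<subseteq> M" using uv(2) C_M by blast
  have bd: "c1 \<le> u" "v \<le> c2" using uv by auto
  have contG: "continuous_on {u..v} G" unfolding G_def by (rule fn_cont_on[OF uvM])
  have "continuous_on {u..v} (\<lambda>t. G t - t)" by (intro continuous_intros contG)
  then obtain x where x: "u \<le> x" "x < v" "G x = x" "\<And>t. x < t \<Longrightarrow> t \<le> v \<Longrightarrow> t < G t"
    using last_level_point[of u v "\<lambda>t. G t - t" 0] uv(1) bd False assms(3,4) unfolding G_def by auto
  have xM: "x \<in> M" using uvM x by auto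
  have "x \<in> B"
  proof (rule mem_B_if_near_big[OF xM])
    fix d :: real assume "d > 0"
    define t0 where "t0 = min v (x + d)"
    have t0: "x < t0" "t0 \<le> v" "t0 \<le> x + d" unfolding t0_def using x \<open>d > 0\<close> by auto
    have t0M: "{x..t0} \<subseteq> M" by (rule order_trans[OF _ uvM]) (use x t0 in auto)
    have stretch: "{x..G t} \<subseteq> G ` {x..t}" if "x < t" "t \<le> v" for t
    proof -
      have "continuous_on {x..t} G" by (rule continuous_on_subset[OF contG]) (use x that in auto)
      from image_interval_superset[OF this, of x t] show ?thesis using that x(3) by simp
    qed
    \<comment> \<open>Otherwise the increasing orbit of \<open>t0\<close> stays below
      \<open>v\<close> and converges to a fixed point of \<open>G\<close> beyond
      \<open>x\<close>.\<close>
    have "\<exists>j. {x..v} \<subseteq> (G ^^ j) ` {x..t0}"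
    proof (rule ccontr)
      assume no: "\<not> ?thesis"
      define e where "e j = (G ^^ j) t0" for j
      have e: "x < e j \<and> e j < v \<and> {x..e j} \<subseteq> (G ^^ j) ` {x..t0}" for j
      proof (induction j)
        case 0
        have "t0 \<noteq> v" using no[simplified, rule_format, of 0] by auto
        then show ?case using t0 unfolding e_def by simp
      next
        case (Suc j)
        have eq: "e (Suc j) = G (e j)" unfolding e_def by simp
        have up: "e j < G (e j)" using Suc x(4) by simp
        have "{x..G (e j)} \<subseteq> G ` {x..e j}" using stretch Suc by simp
        also have "\<dots> \<subseteq> G ` ((G ^^ j) ` {x..t0})" using Suc by (intro image_mono) simp
        finally have cov: "{x..e (Suc j)} \<subseteq> (G ^^ Suc j) ` {x..t0}"
          unfolding eq by (simp add: image_comp)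
        have "e (Suc j) < v"
        proof (rule ccontr)
          assume "\<not> e (Suc j) < v"
          then have "{x..v} \<subseteq> {x..e (Suc j)}" by auto
          then show False using cov no by (meson order_trans)
        qed
        then show ?case using cov up Suc eq by auto
      qed
      have "e j \<le> e (Suc j)" for j using x(4)[of "e j"] e[of j] unfolding e_def by auto
      then have inc: "incseq e" by (rule incseq_SucI)
      obtain L where L: "e \<longlonglongrightarrow> L"
        using incseq_convergent[OF inc, of v] e by (meson less_imp_le)
      have "e 0 \<le> L" using incseq_le[OF inc L] .
      moreover have "L \<le> v"
        by (rule LIMSEQ_le_const2[OF L]) (use e in \<open>auto intro: less_imp_le\<close>)
      ultimately have "e 0 \<le> L" "L \<le> v" .
      then have Luv: "x < L" "L \<le> v" "L \<in> {u..v}" using e[of 0] x by auto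
      have "(\<lambda>j. G (e j)) \<longlonglongrightarrow> G L"
        using continuous_on_tendsto_compose[OF contG L Luv(3)] e x(1) by (auto intro: less_imp_le order_trans simp: eventually_sequentially) (meson dual_order.trans less_imp_le)
      moreover have "(\<lambda>j. G (e j)) = (\<lambda>j. e (Suc j))" unfolding e_def by simp
      moreover have "(\<lambda>j. e (Suc j)) \<longlonglongrightarrow> L" using L by (rule LIMSEQ_Suc)
      ultimately have "G L = L" using LIMSEQ_unique by metis
      then show False using x(4)[of L] Luv by simp
    qed
    then obtain j where "{x..v} \<subseteq> (G ^^ j) ` {x..t0}" by blast
    then have "G ` {x..v} \<subseteq> G ` ((G ^^ j) ` {x..t0})" by (rule image_mono)
    then have "G ` {x..v} \<subseteq> (G ^^ Suc j) ` {x..t0}" by (simp add: image_comp)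
    moreover have "{x..c2} \<subseteq> G ` {x..v}" using stretch[of v] x(2) assms(4) unfolding G_def by simp
    ultimately have "{x..c2} \<subseteq> (G ^^ Suc j) ` {x..t0}" by (rule order_trans[rotated])
    then have cov: "{x..c2} \<subseteq> (f ^^ (k * Suc j)) ` {x..t0}" unfolding G_def funpow_mult .
    have "{x..c2} \<subseteq> M" by (rule order_trans[OF _ C_M]) (use x bd in auto)
    moreover have "infinite (B \<inter> {x..c2})"
    proof -
      have "B \<inter> {x<..<c2} \<subseteq> B \<inter> {x..c2}" by auto
      moreover have "infinite (B \<inter> {x<..<c2})" using lbig_infinite[OF c2_lbig, of x] x bd by simp
      ultimately show ?thesis using finite_subset by blast
    qed
    ultimately have "big x c2" by (rule big_if_infinite)
    then have "big x t0" using big_if_image_big cov t0M by blast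
    then show "\<exists>u v. big u v \<and> {u..v} \<subseteq> {x - d..x + d}"
      using t0 \<open>d > 0\<close> by (intro exI[of _ x] exI[of _ t0]) auto
  qed
  then show ?thesis using x unfolding G_def by auto
qed

text \<open>If the branch is traversed upwards, a fixed point of \<open>f ^^ n\<close> is found
  directly. If downwards, a subinterval on which two downward passages follow each other is an
  upward branch of \<open>f ^^ (2 * n)\<close>. Period \<open>2 * n\<close> covers both cases, and
  \<open>(f ^^ n) y \<in> {u..v}\<close> ensures that both halves of the orbit have the same
  itinerary.\<close>

lemma periodic_in_branch:
  assumes uv: "{u..v} \<subseteq> {c1..c2}" and img: "(f ^^ n) ` {u..v} = {c1..c2}"
  shows "\<exists>y\<in>B \<inter> {u..v}. (f ^^ (2 * n)) y = y \<and> (f ^^ n) y \<in> {u..v}"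
proof -
  have uvM: "{u..v} \<subseteq> M" using uv C_M by blast
  have cont_n: "continuous_on {s..t} (f ^^ n)" if "{s..t} \<subseteq> {u..v}" for s t
    by (rule fn_cont_on) (use that uvM in blast)
  have "c1 \<in> (f ^^ n) ` {u..v}" "c2 \<in> (f ^^ n) ` {u..v}" unfolding img using c1_less_c2 by auto
  then obtain p q where pq: "p \<in> {u..v}" "(f ^^ n) p = c1" "q \<in> {u..v}" "(f ^^ n) q = c2" by blast
  have twice: "(f ^^ (2 * n)) y = (f ^^ n) ((f ^^ n) y)" for y by (simp add: mult_2 funpow_add)
  show ?thesis
  proof (cases "p \<le> q")
    case True
    have sub: "{p..q} \<subseteq> {u..v}" using pq by auto
    obtain y where y: "y \<in> B \<inter> {p..q}" "(f ^^ n) y = y"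
      using increasing_branch_fixed_point[OF True order_trans[OF sub uv] pq(2,4)] by blast
    then show ?thesis using sub by (intro bexI[of _ y]) (auto simp: twice)
  next
    case False
    then have qp: "q \<le> p" by simp
    have sub: "{q..p} \<subseteq> {u..v}" using pq by auto
    obtain p' q' where p': "q \<le> q'" "q' \<le> p'" "p' \<le> p" "(f ^^ n) p' = c1" "(f ^^ n) q' = c2"
      "(f ^^ n) ` {q'..p'} = {c1..c2}"
      using exact_subinterval_down[OF cont_n[OF sub] qp pq(2,4)] c1_less_c2 by auto
    have sub': "{q'..p'} \<subseteq> {u..v}" using sub p' by auto
    then have q'C: "c1 \<le> q'" "p' \<le> c2" using uv p'(2) by auto
    \<comment> \<open>Inside \<open>{q'..p'}\<close> a piece is selected that \<open>f ^^ n\<close>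
      maps downwards onto \<open>{q'..p'}\<close>. Its left end goes to \<open>p'\<close> and on to
      \<open>c1\<close>, its right end to \<open>q'\<close> and on to \<open>c2\<close>.\<close>
    obtain s where s: "q' \<le> s" "s \<le> p'" "(f ^^ n) s = p'"
      using IVT2'[of "f ^^ n" p' p' q'] p'(2,4,5) q'C cont_n[OF sub'] by auto
    have sub_s: "{s..p'} \<subseteq> {u..v}" using s sub' by auto
    obtain t where t: "s \<le> t" "t \<le> p'" "(f ^^ n) t = q'"
      using IVT2'[of "f ^^ n" p' q' s] s p'(2,4,5) q'C cont_n[OF sub_s] by auto
    have sub_t: "{s..t} \<subseteq> {u..v}" using t sub_s by auto
    obtain t' s' where t': "s \<le> s'" "s' \<le> t'" "t' \<le> t" "(f ^^ n) t' = q'" "(f ^^ n) s' = p'"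
      "(f ^^ n) ` {s'..t'} = {q'..p'}"
      using exact_subinterval_down[OF cont_n[OF sub_t] t(1,3) s(3) p'(2)] by blast
    have sub2: "{s'..t'} \<subseteq> {u..v}" using t' sub_t by auto
    obtain y where y: "y \<in> B \<inter> {s'..t'}" "(f ^^ (2 * n)) y = y"
      using increasing_branch_fixed_point[OF t'(2) order_trans[OF sub2 uv], of "2 * n"] t'(4,5) p'(4,5)
      by (auto simp: twice)
    have "(f ^^ n) y \<in> (f ^^ n) ` {s'..t'}" using y(1) by blast
    then have "(f ^^ n) y \<in> {u..v}" unfolding t'(6) using sub' by blast
    then show ?thesis using y sub2 by blast
  qed
qed

text \<open>The cycle and its shift by half of the stated period both start in the subinterval that
  realises the itinerary, so the itinerary is run through twice.\<close>

lemma periodic_chain: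
  assumes big: "\<And>j. big (U j) (V j)"
    and step: "\<And>j. j < J \<Longrightarrow> {U (Suc j)..V (Suc j)} \<subseteq> (f ^^ n j) ` {U j..V j}"
    and ends: "U 0 = c1" "V 0 = c2" "U J = c1" "V J = c2"
  shows "\<exists>y\<in>B. (f ^^ (2 * (\<Sum>i<J. n i))) y = y \<and>
    (\<forall>j\<le>J. (f ^^ (\<Sum>i<j. n i)) y \<in> {U j..V j} \<and> (f ^^ ((\<Sum>i<J. n i) + (\<Sum>i<j. n i))) y \<in> {U j..V j})"
proof -
  have sub: "{U j..V j} \<subseteq> M" and le: "U j \<le> V j" for j
    using big[of j] unfolding big_def by auto
  obtain u v where uv: "u \<le> v" "{u..v} \<subseteq> {c1..c2}" "(f ^^ (\<Sum>i<J. n i)) ` {u..v} = {c1..c2}"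
    "\<And>j. j \<le> J \<Longrightarrow> (f ^^ (\<Sum>i<j. n i)) ` {u..v} \<subseteq> {U j..V j}"
    using finite_chain[where U = U and V = V and J = J and n = n, OF sub le step] ends by auto
  obtain y where y: "y \<in> B" "y \<in> {u..v}" "(f ^^ (2 * (\<Sum>i<J. n i))) y = y" "(f ^^ (\<Sum>i<J. n i)) y \<in> {u..v}"
    using periodic_in_branch[OF uv(2,3)] by blast
  have "(f ^^ (\<Sum>i<j. n i)) z \<in> {U j..V j}" if "j \<le> J" "z \<in> {u..v}" for j z
    using subsetD[OF uv(4)[OF that(1)] imageI[OF that(2)]] .
  moreover have "(f ^^ ((\<Sum>i<J. n i) + k)) y = (f ^^ k) ((f ^^ (\<Sum>i<J. n i)) y)" for k
    by (metis add.commute comp_apply funpow_add)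
  ultimately show ?thesis using y by (intro bexI[of _ y]) auto
qed

end

section \<open>Shadowing blocks\<close>

context basic_system
begin

text \<open>By compactness, a point reached for all larger radii is reached at radius
  \<open>\<tau>\<close>. Because of this the critical radius below is attained.\<close>

lemma shrink_preimage:
  assumes "x \<in> M" "0 \<le> \<tau>" "p \<notin> (f ^^ i) ` (M \<inter> {x - \<tau>..x + \<tau>})"
  shows "\<exists>e>0. p \<notin> (f ^^ i) ` (M \<inter> {x - (\<tau> + e)..x + (\<tau> + e)})"
proof (rule ccontr)
  assume neg: "\<not> ?thesis"
  define K where "K k = {x - (\<tau> + 1 / Suc k)..x + (\<tau> + 1 / Suc k)} \<inter> (M \<inter> (f ^^ i) -` {p})" for k
  have "compact (K k)" for k
    unfolding K_def by (intro compact_Int_closed continuous_closed_preimage fn_cont M_closed) auto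
  moreover have "K k \<noteq> {}" for k
    using neg[simplified, rule_format, of "1 / Suc k"] unfolding K_def by auto
  moreover have "K m \<subseteq> K k" if "k \<le> m" for k m
  proof -
    have "1 / real (Suc m) \<le> 1 / real (Suc k)" using that by (intro divide_left_mono) auto
    then show ?thesis unfolding K_def by auto
  qed
  ultimately have "\<Inter> (range K) \<noteq> {}" by (rule compact_nest)
  then obtain y where y: "\<And>k. y \<in> K k" by blast
  have lim: "(\<lambda>k. \<tau> + 1 / real (Suc k)) \<longlonglongrightarrow> \<tau> + 0"
    by (intro tendsto_add tendsto_const LIMSEQ_Suc[OF lim_1_over_n])
  have "\<bar>y - x\<bar> \<le> \<tau> + 1 / real (Suc k)" for k using y[of k] unfolding K_def by (auto simp: abs_le_iff)
  then have "\<bar>y - x\<bar> \<le> \<tau> + 0" by (intro LIMSEQ_le_const[OF lim]) auto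
  moreover have "y \<in> M" "(f ^^ i) y = p" using y[of 0] unfolding K_def by auto
  ultimately show False using assms(3) by (auto simp: abs_le_iff image_iff)
qed

text \<open>Enlarge a neighbourhood of \<open>x\<close> until one of its first \<open>N\<close> images contains one of
  finitely many given intervals. At the critical radius no image has jumped over any of them.\<close>

lemma critical_radius:
  assumes x: "x \<in> M" and d: "0 < d" "d \<le> \<rho>" and P: "finite P" "\<And>s t. (s, t) \<in> P \<Longrightarrow> s < t"
  shows "\<exists>\<tau>. 0 < \<tau> \<and> \<tau> \<le> d \<and>
    (\<tau> = d \<or> (\<exists>i\<le>N. \<exists>(s, t)\<in>P. {s..t} \<subseteq> (f ^^ i) ` (M \<inter> {x - \<tau>..x + \<tau>}))) \<and>
    (\<forall>y\<in>M \<inter> {x - \<tau>..x + \<tau>}. \<forall>i\<le>N. \<forall>(s, t)\<in>P.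
      \<not> ((f ^^ i) x < s \<and> t < (f ^^ i) y) \<and> \<not> ((f ^^ i) y < s \<and> t < (f ^^ i) x))"
proof -
  define Nb where "Nb \<tau> = M \<inter> {x - \<tau>..x + \<tau>}" for \<tau>
  define H where "H \<tau> \<longleftrightarrow> (\<exists>i\<le>N. \<exists>(s, t)\<in>P. {s..t} \<subseteq> (f ^^ i) ` Nb \<tau>)" for \<tau>
  have Nb_mono: "Nb \<tau> \<subseteq> Nb \<tau>'" if "\<tau> \<le> \<tau>'" for \<tau> \<tau>'
    unfolding Nb_def using that by auto
  have H_mono: "H \<tau>'" if "\<tau> \<le> \<tau>'" "H \<tau>" for \<tau> \<tau>'
  proof -
    obtain i s t where "i \<le> N" "(s, t) \<in> P" "{s..t} \<subseteq> (f ^^ i) ` Nb \<tau>" using \<open>H \<tau>\<close> unfolding H_def by auto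
    moreover have "(f ^^ i) ` Nb \<tau> \<subseteq> (f ^^ i) ` Nb \<tau>'" by (rule image_mono[OF Nb_mono[OF that(1)]])
    ultimately show ?thesis unfolding H_def by (meson case_prodI order_trans)
  qed
  \<comment> \<open>Non-covering survives a small enlargement of the radius, hence covering holds at
    the infimum of the covering radii and not merely beyond it.\<close>
  have H_right: "\<exists>e>0. \<not> H (\<tau> + e)" if h: "\<not> H \<tau>" "0 \<le> \<tau>" for \<tau>
  proof -
    have "\<forall>i\<in>{..N}. \<forall>q\<in>P. eventually (\<lambda>e. \<not> {fst q..snd q} \<subseteq> (f ^^ i) ` Nb (\<tau> + e)) (at_right 0)"
    proof (intro ballI)
      fix i q assume iq: "i \<in> {..N}" "q \<in> P"
      then have "\<not> {fst q..snd q} \<subseteq> (f ^^ i) ` Nb \<tau>"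
        using h(1) unfolding H_def by (auto simp: case_prod_beta)
      then obtain p where p: "p \<in> {fst q..snd q}" "p \<notin> (f ^^ i) ` Nb \<tau>" by blast
      obtain e0 where e0: "e0 > 0" "p \<notin> (f ^^ i) ` Nb (\<tau> + e0)"
        using shrink_preimage[OF x h(2)] p(2) unfolding Nb_def by blast
      have "\<not> {fst q..snd q} \<subseteq> (f ^^ i) ` Nb (\<tau> + e)" if "0 < e" "e < e0" for e
      proof
        assume "{fst q..snd q} \<subseteq> (f ^^ i) ` Nb (\<tau> + e)"
        then have "p \<in> (f ^^ i) ` Nb (\<tau> + e)" using p(1) by (rule subsetD)
        moreover have "(f ^^ i) ` Nb (\<tau> + e) \<subseteq> (f ^^ i) ` Nb (\<tau> + e0)"
          by (intro image_mono Nb_mono) (use that in simp)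
        ultimately show False using e0(2) by (meson subsetD)
      qed
      then show "eventually (\<lambda>e. \<not> {fst q..snd q} \<subseteq> (f ^^ i) ` Nb (\<tau> + e)) (at_right 0)"
        unfolding eventually_at_right_field using e0(1) by blast
    qed
    then have "eventually (\<lambda>e. \<forall>i\<in>{..N}. \<forall>q\<in>P. \<not> {fst q..snd q} \<subseteq> (f ^^ i) ` Nb (\<tau> + e)) (at_right 0)"
      by (intro eventually_ball_finite P(1) ballI) auto
    then have "eventually (\<lambda>e. \<not> H (\<tau> + e)) (at_right 0)"
      by eventually_elim (auto simp: H_def case_prod_beta)
    then obtain b where "b > 0" "\<And>y. y > 0 \<Longrightarrow> y < b \<Longrightarrow> \<not> H (\<tau> + y)"
      unfolding eventually_at_right_field by blast
    then show ?thesis by (intro exI[of _ "b/2"]) auto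
  qed
  have "\<not> H 0"
  proof
    assume "H 0"
    then obtain i s t where "(s, t) \<in> P" "{s..t} \<subseteq> (f ^^ i) ` Nb 0" unfolding H_def by auto
    moreover have "finite (Nb 0)" unfolding Nb_def by auto
    ultimately have "finite {s..t}" "s < t" using finite_subset P(2) by blast+
    then show False by (simp add: infinite_Icc)
  qed
  obtain \<tau> where \<tau>: "0 < \<tau>" "\<tau> \<le> d" "\<tau> = d \<or> H \<tau>" "\<And>\<tau>'. \<tau>' < \<tau> \<Longrightarrow> 0 \<le> \<tau>' \<Longrightarrow> \<not> H \<tau>'"
  proof (cases "H d")
    case False
    then show thesis using that[of d] d H_mono by (metis less_imp_le order_refl)
  next
    case True
    define S where "S = {\<tau>. 0 \<le> \<tau> \<and> H \<tau>}"
    have S: "d \<in> S" "bdd_below S" unfolding S_def using True d by (auto intro!: bdd_belowI[of _ 0])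
    define \<tau> where "\<tau> = Inf S"
    have le: "\<tau> \<le> d" unfolding \<tau>_def by (rule cInf_lower[OF S])
    have ge: "0 \<le> \<tau>" unfolding \<tau>_def by (rule cInf_greatest) (use S in \<open>auto simp: S_def\<close>)
    have below: "\<not> H \<tau>'" if "\<tau>' < \<tau>" "0 \<le> \<tau>'" for \<tau>'
      using cInf_lower[OF _ S(2), of \<tau>'] that unfolding \<tau>_def S_def by auto
    have "H \<tau>"
    proof (rule ccontr)
      assume "\<not> H \<tau>"
      then obtain e where e: "e > 0" "\<not> H (\<tau> + e)" using H_right ge by blast
      have "\<tau> + e \<le> Inf S"
      proof (rule cInf_greatest)
        fix s assume "s \<in> S"
        then show "\<tau> + e \<le> s" using H_mono[of s "\<tau> + e"] e(2) unfolding S_def by force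
      qed (use S in blast)
      then show False using e(1) unfolding \<tau>_def by simp
    qed
    then have "\<tau> \<noteq> 0" using \<open>\<not> H 0\<close> by auto
    then show thesis using that[of \<tau>] le ge \<open>H \<tau>\<close> below by auto
  qed
  \<comment> \<open>Let a point move from \<open>x\<close> to \<open>y\<close>. Before it arrives it
    stays within a radius smaller than \<open>\<tau>\<close>, where jumping over an interval of
    \<open>P\<close> would mean covering it; the limit excludes a jump at \<open>y\<close>.\<close>
  have no_jump: "\<not> ((f ^^ i) x < s \<and> t < (f ^^ i) y) \<and> \<not> ((f ^^ i) y < s \<and> t < (f ^^ i) x)"
    if h: "y \<in> Nb \<tau>" "i \<le> N" "(s, t) \<in> P" for y i s t
  proof -
    define g where "g \<theta> = (f ^^ i) (x + \<theta> * (y - x))" for \<theta>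
    obtain u v where uv: "u \<le> x" "x \<le> v" "M \<inter> {x - \<tau>..x + \<tau>} = {u..v}"
      using local_interval[OF x \<tau>(1)] \<tau>(2) d(2) by auto
    have uvM: "{u..v} \<subseteq> M" using uv(3) by blast
    have yuv: "y \<in> {u..v}" using h(1) uv(3) unfolding Nb_def by simp
    have seg: "x + \<theta> * (y - x) \<in> {u..v}" if "\<theta> \<in> {0..1}" for \<theta>
    proof -
      have "x + \<theta> * (y - x) = (1 - \<theta>) *\<^sub>R x + \<theta> *\<^sub>R y" by (simp add: algebra_simps)
      also have "\<dots> \<in> {u..v}"
        by (rule convexD[OF convex_real_interval(5)]) (use that uv yuv in auto)
      finally show ?thesis .
    qed
    have contg: "continuous_on {0..1} g" unfolding g_def
      by (rule continuous_on_compose2[OF fn_cont_on[OF uvM]]) (use seg in \<open>auto intro!: continuous_intros\<close>)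
    have lim: "(g \<longlongrightarrow> g 1) (at 1 within {0..1})"
      using contg unfolding continuous_on by auto
    have ev: "eventually (\<lambda>\<theta>. \<theta> \<in> {0<..<1}) (at 1 within {0..(1::real)})"
      unfolding eventually_at by (intro exI[of _ 1]) (auto simp: dist_real_def)
    have nontriv: "at 1 within {0..(1::real)} \<noteq> bot" by (simp add: at_within_Icc_at_left)
    have g1: "g 1 = (f ^^ i) y" unfolding g_def by simp
    have inside: "{s..t} \<subseteq> (f ^^ i) ` Nb (\<theta> * \<tau>)"
      if \<theta>: "\<theta> \<in> {0<..<1}" "(f ^^ i) x < s \<and> t < g \<theta> \<or> g \<theta> < s \<and> t < (f ^^ i) x" for \<theta>
    proof -
      have "\<theta> * \<tau> \<le> \<tau>" by (rule mult_left_le_one_le) (use \<theta>(1) \<tau>(1) in auto)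
      then have "\<theta> * \<tau> \<le> \<rho>" using \<tau>(2) d(2) by linarith
      moreover have "\<theta> * \<tau> > 0" using \<theta>(1) \<tau>(1) by simp
      ultimately have "\<theta> * \<tau> > 0" "\<theta> * \<tau> \<le> \<rho>" by blast+
      then obtain u' v' where u'v': "u' \<le> x" "x \<le> v'" "Nb (\<theta> * \<tau>) = {u'..v'}"
        using local_interval[OF x] unfolding Nb_def by metis
      have "\<bar>y - x\<bar> \<le> \<tau>" using h(1) unfolding Nb_def by (auto simp: abs_le_iff)
      then have "\<bar>\<theta> * (y - x)\<bar> \<le> \<theta> * \<tau>" using \<theta>(1) by (simp add: abs_mult)
      then have "x + \<theta> * (y - x) \<in> Nb (\<theta> * \<tau>)"
        using subsetD[OF uvM seg[of \<theta>]] \<theta>(1) unfolding Nb_def by (auto simp: abs_le_iff)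
      then have mem: "x + \<theta> * (y - x) \<in> {u'..v'}" unfolding u'v'(3) .
      have "{u'..v'} \<subseteq> M" unfolding u'v'(3)[symmetric] Nb_def by blast
      then have ct: "continuous_on {u'..v'} (f ^^ i)" by (rule fn_cont_on)
      have xm: "x \<in> {u'..v'}" using u'v' by auto
      have "{(f ^^ i) x..g \<theta>} \<subseteq> (f ^^ i) ` {u'..v'}" "{g \<theta>..(f ^^ i) x} \<subseteq> (f ^^ i) ` {u'..v'}"
        unfolding g_def by (rule image_interval_superset[OF ct], use xm mem in simp_all)+
      moreover have "{s..t} \<subseteq> {(f ^^ i) x..g \<theta>} \<or> {s..t} \<subseteq> {g \<theta>..(f ^^ i) x}" using \<theta>(2) by auto
      ultimately show ?thesis unfolding u'v'(3) by (meson order_trans)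
    qed
    have noth: "\<not> ((f ^^ i) x < s \<and> t < g \<theta> \<or> g \<theta> < s \<and> t < (f ^^ i) x)" if "\<theta> \<in> {0<..<1}" for \<theta>
    proof
      assume "(f ^^ i) x < s \<and> t < g \<theta> \<or> g \<theta> < s \<and> t < (f ^^ i) x"
      then have "H (\<theta> * \<tau>)" unfolding H_def using inside[OF that] h(2,3) by auto
      moreover have "\<theta> * \<tau> < \<tau>" "0 \<le> \<theta> * \<tau>" using that \<tau>(1) by auto
      ultimately show False using \<tau>(4) by blast
    qed
    have "\<not> ((f ^^ i) x < s \<and> t < g 1)"
    proof
      assume *: "(f ^^ i) x < s \<and> t < g 1"
      then have "eventually (\<lambda>\<theta>. t < g \<theta>) (at 1 within {0..1})" using order_tendstoD(1)[OF lim] by blast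
      with ev have "eventually (\<lambda>\<theta>. False) (at 1 within {0..(1::real)})"
        by eventually_elim (use noth * in blast)
      then show False using nontriv by simp
    qed
    moreover have "\<not> (g 1 < s \<and> t < (f ^^ i) x)"
    proof
      assume *: "g 1 < s \<and> t < (f ^^ i) x"
      then have "eventually (\<lambda>\<theta>. g \<theta> < s) (at 1 within {0..1})" using order_tendstoD(2)[OF lim] by blast
      with ev have "eventually (\<lambda>\<theta>. False) (at 1 within {0..(1::real)})"
        by eventually_elim (use noth * in blast)
      then show False using nontriv by simp
    qed
    ultimately show ?thesis unfolding g1 by blast
  qed
  show ?thesis
    by (rule exI[of _ \<tau>]) (use \<tau>(1-3) no_jump in \<open>auto simp: H_def Nb_def\<close>)
qed

lemma fn_close:
  assumes "x \<in> M" "e > 0"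
  shows "\<exists>d>0. \<forall>y\<in>M. \<bar>y - x\<bar> \<le> d \<longrightarrow> (\<forall>i\<le>N. \<bar>(f ^^ i) y - (f ^^ i) x\<bar> \<le> e)"
proof (induction N)
  case 0
  then show ?case using assms by auto
next
  case (Suc N)
  then obtain d1 where d1: "d1 > 0" "\<And>y i. y \<in> M \<Longrightarrow> \<bar>y - x\<bar> \<le> d1 \<Longrightarrow> i \<le> N \<Longrightarrow> \<bar>(f ^^ i) y - (f ^^ i) x\<bar> \<le> e" by blast
  obtain d2 where d2: "d2 > 0" "\<And>y. y \<in> M \<Longrightarrow> dist y x < d2 \<Longrightarrow> dist ((f ^^ Suc N) y) ((f ^^ Suc N) x) < e"
    using fn_cont[of "Suc N"] assms unfolding continuous_on_iff by metis
  have "\<bar>(f ^^ i) y - (f ^^ i) x\<bar> \<le> e" if "y \<in> M" "\<bar>y - x\<bar> \<le> min d1 (d2/2)" "i \<le> Suc N" for y i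
  proof (cases "i = Suc N")
    case True
    have "dist y x < d2" using that(2) d2(1) by (auto simp: dist_real_def)
    then show ?thesis using d2(2)[OF that(1)] True by (simp add: dist_real_def less_imp_le)
  next
    case False
    then show ?thesis using d1(2)[of y i] that by simp
  qed
  then show ?case using d1(1) d2(1) by (intro exI[of _ "min d1 (d2/2)"]) auto
qed

lemma big_nbhd:
  assumes "x \<in> B" "0 < d" "d \<le> \<rho>"
  obtains u v where "big u v" "u \<le> x" "x \<le> v" "{u..v} = M \<inter> {x - d..x + d}"
  using near_big[OF assms(1,2)] assms(3) that by (auto simp: min_absorb2)

lemma big_inside_open_interval:
  assumes "x \<in> B" "s < x" "x < e"
  shows "\<exists>u v. big u v \<and> s < u \<and> v < e"
proof -
  define d where "d = min \<rho> (min ((x - s)/2) ((e - x)/2))"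
  have d: "0 < d" "d \<le> \<rho>" "s < x - d" "x + d < e"
    unfolding d_def using assms rho_pos by (auto simp: min_def field_simps)
  obtain u v where uv: "big u v" "u \<le> x" "x \<le> v" "{u..v} = M \<inter> {x - d..x + d}"
    using big_nbhd[OF assms(1) d(1,2)] .
  have "u \<in> {u..v}" "v \<in> {u..v}" using uv(2,3) by auto
  then have "x - d \<le> u" "v \<le> x + d" unfolding uv(4) by auto
  then show ?thesis using uv(1) d by (intro exI[of _ u] exI[of _ v]) auto
qed

lemma B_orbit_compact:
  "compact {x \<in> B \<inter> {s..e}. \<forall>i\<in>I. (f ^^ k i) x \<in> {l i..h i}}"
proof -
  have "{x \<in> B \<inter> {s..e}. \<forall>i\<in>I. (f ^^ k i) x \<in> {l i..h i}} =
      B \<inter> {s..e} \<inter> (\<Inter>i\<in>I. M \<inter> (f ^^ k i) -` {l i..h i})"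
    using B_sub_M by auto
  also have "compact \<dots>" by (intro compact_Int_closed B_compact closed_INT ballI)
      (auto intro!: continuous_closed_preimage fn_cont M_closed)
  finally show ?thesis .
qed

end

section \<open>Points off the exceptional set that shadow a cycle\<close>

context core_system
begin

lemma periodic_add: "(f ^^ p) w = w \<Longrightarrow> (f ^^ (i + j * p)) w = (f ^^ i) w"
proof -
  assume "(f ^^ p) w = w"
  then have "(f ^^ (j * p)) w = w" by (induction j) (simp_all add: funpow_add)
  then show ?thesis by (simp add: funpow_add)
qed

text \<open>The core need not reach \<open>w\<close> itself when \<open>w\<close> lies in
  \<open>F\<close>. A nearby point \<open>z\<close> of \<open>B\<close> off \<open>F\<close> is
  reached instead and lifted to a point of \<open>B\<close> in the core.\<close>

lemma tracking_point_reachable: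
  assumes w: "w \<in> B" and e: "e > 0"
  shows "\<exists>n. \<exists>x\<in>B \<inter> {c1..c2}. \<forall>i\<le>N. \<bar>(f ^^ (n + i)) x - (f ^^ i) w\<bar> \<le> e"
proof -
  have wM: "w \<in> M" using w B_sub_M by blast
  obtain d where d: "d > 0" "\<And>y i. y \<in> M \<Longrightarrow> \<bar>y - w\<bar> \<le> d \<Longrightarrow> i \<le> N \<Longrightarrow> \<bar>(f ^^ i) y - (f ^^ i) w\<bar> \<le> e"
    using fn_close[OF wM e] by blast
  define d' where "d' = min \<rho> d"
  have d': "0 < d'" "d' \<le> \<rho>" "d' \<le> d" unfolding d'_def using d rho_pos by auto
  obtain u v where uv: "big u v" "u \<le> w" "w \<le> v" "{u..v} = M \<inter> {w - d'..w + d'}"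
    using big_nbhd[OF w d'(1,2)] .
  have "infinite (B \<inter> {u..v} - (F \<union> {u, v}))"
    using big_infinite[OF uv(1)] F_finite by (simp add: Diff_infinite_finite)
  then have "B \<inter> {u..v} - (F \<union> {u, v}) \<noteq> {}" by (metis finite.emptyI)
  then obtain z where z: "z \<in> B" "z \<in> {u..v}" "z \<notin> F" "z \<noteq> u" "z \<noteq> v" by blast
  then have zuv: "u < z" "z < v" by auto
  obtain d2 n where d2: "0 < d2" "M \<inter> {z - d2..z + d2} \<subseteq> (f ^^ n) ` {c1..c2}"
    using accessible[of z] z(1,3) B_sub_M by blast
  have uvM: "{u..v} \<subseteq> M" using uv(1) unfolding big_def by blast
  have "{max u (z - d2)..min v (z + d2)} \<subseteq> {u..v} \<inter> {z - d2..z + d2}" by auto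
  then have "{max u (z - d2)..min v (z + d2)} \<subseteq> M \<inter> {z - d2..z + d2}" using uvM by blast
  then have "{max u (z - d2)..min v (z + d2)} \<subseteq> (f ^^ n) ` {c1..c2}" by (rule order_trans[OF _ d2(2)])
  from lift_interior[OF C_M this z(1)] obtain x where x: "x \<in> {c1..c2} \<inter> B" "(f ^^ n) x = z"
    using zuv d2(1) by auto
  have "z \<in> M \<inter> {w - d'..w + d'}" using z(2) uv(4) by simp
  then have zM: "z \<in> M" "\<bar>z - w\<bar> \<le> d" using d'(3) by (auto simp: abs_le_iff)
  have "(f ^^ (n + i)) x = (f ^^ i) z" for i using x(2) by (metis add.commute comp_apply funpow_add)
  then show ?thesis using x(1) d(2)[OF zM] by (intro exI[of _ n] bexI[of _ x]) auto
qed

text \<open>Take the first times at which points of the core arrive in longer and longer Bowen balls of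
  \<open>w\<close>. If they are bounded, a limit of the core points tracks \<open>w\<close>. Otherwise, going back
  along the orbits by multiples of the period and passing to the limit gives pairwise different
  points that eventually track \<open>w\<close>, and one of them lies outside of the finite set \<open>F\<close>.\<close>

lemma tracking_point_off_F:
  assumes w: "w \<in> B" and p: "0 < p" "(f ^^ p) w = w" and e: "e > 0"
  shows "\<exists>u\<in>B - F. \<exists>k. \<forall>i. \<bar>(f ^^ (k + i)) u - (f ^^ i) w\<bar> \<le> e"
proof -
  \<comment> \<open>Choosing \<open>\<epsilon>\<close> off these finitely many distances excludes
    that a point of \<open>F\<close> is at distance exactly \<open>\<epsilon>\<close> from the
    cycle, which closes the limit argument at the end.\<close>
  define D where "D = (\<lambda>(x, i). \<bar>(f ^^ i) x - (f ^^ i) w\<bar>) ` (F \<times> {..<p})"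
  have "finite D" unfolding D_def using F_finite by simp
  then have "infinite ({0<..e} - D)" using e by (simp add: Diff_infinite_finite infinite_Ioc)
  then have "{0<..e} - D \<noteq> {}" by (metis finite.emptyI)
  then obtain \<epsilon> where "\<epsilon> \<in> {0<..e} - D" by blast
  then have \<epsilon>: "0 < \<epsilon>" "\<epsilon> \<le> e" "\<epsilon> \<notin> D" by auto
  define Q where "Q n N \<longleftrightarrow> (\<exists>x\<in>B \<inter> {c1..c2}. \<forall>i\<le>N. \<bar>(f ^^ (n + i)) x - (f ^^ i) w\<bar> \<le> \<epsilon>)" for n N
  have Q_ex: "\<exists>n. Q n N" for N
    unfolding Q_def using tracking_point_reachable[OF w \<epsilon>(1)] by blast
  have Q_dec: "Q n N" if "Q n N'" "N \<le> N'" for n N N'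
    using that unfolding Q_def by (meson order_trans)
  have "\<exists>u\<in>B - F. \<exists>k. \<forall>i. \<bar>(f ^^ (k + i)) u - (f ^^ i) w\<bar> \<le> \<epsilon>"
  proof (cases "\<exists>n. \<forall>N. Q n N")
    case True
    then obtain n where n: "\<And>N. Q n N" by blast
    define K where "K N = {x \<in> B \<inter> {c1..c2}. \<forall>i\<in>{..N}. (f ^^ (n + i)) x \<in> {(f ^^ i) w - \<epsilon>..(f ^^ i) w + \<epsilon>}}" for N
    have "compact (K N)" for N unfolding K_def by (rule B_orbit_compact)
    moreover have "K N \<noteq> {}" for N
      using n[of N] unfolding Q_def K_def by (auto simp: abs_le_iff algebra_simps)
    moreover have "K m \<subseteq> K k" if "k \<le> m" for k m unfolding K_def using that by auto
    ultimately have "\<Inter> (range K) \<noteq> {}" by (rule compact_nest)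
    then obtain x where x: "\<And>N. x \<in> K N" by blast
    have "\<bar>(f ^^ (n + i)) x - (f ^^ i) w\<bar> \<le> \<epsilon>" for i
      using x[of i] unfolding K_def by (auto simp: abs_le_iff algebra_simps)
    moreover have "x \<in> B - F" using x[of 0] C_sub unfolding K_def by blast
    ultimately show ?thesis by blast
  next
    case False
    \<comment> \<open>One more than \<open>card F\<close>, so that \<open>J\<close> different points
      cannot all lie in \<open>F\<close>.\<close>
    define J where "J = card F + 1"
    have "\<exists>N. \<forall>n<J * p. \<not> Q n N"
    proof -
      have "\<exists>N. \<not> Q n N" for n using False by blast
      then obtain g where g: "\<And>n. \<not> Q n (g n)" by metis
      have "\<not> Q n (\<Sum>i<J * p. g i)" if "n < J * p" for n
        using Q_dec[of n "\<Sum>i<J * p. g i" "g n"] g[of n] member_le_sum[of n "{..<J * p}" g] that by auto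
      then show ?thesis by blast
    qed
    then obtain N0 where N0: "\<And>n. n < J * p \<Longrightarrow> \<not> Q n N0" by blast
    have late: "J * p \<le> n" if "Q n N" "N0 \<le> N" for n N
      using N0[of n] Q_dec[OF that] by force
    \<comment> \<open>Membership in \<open>A i\<close> records that shadowing fails at offset
      \<open>i\<close> if it is started one period earlier. The inequalities are weak to keep the
      set closed.\<close>
    define A where "A i = {y \<in> B \<inter> {0..1}. (f ^^ ((J - 1) * p + i)) y \<le> (f ^^ i) w - \<epsilon> \<or> (f ^^ ((J - 1) * p + i)) y \<ge> (f ^^ i) w + \<epsilon>}" for i
    define K where "K N = {y \<in> B \<inter> {0..1}. \<forall>i\<in>{..N}. (f ^^ (J * p + i)) y \<in> {(f ^^ i) w - \<epsilon>..(f ^^ i) w + \<epsilon>}} \<inter> (\<Union>i<p. A i)" for N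
    have B01: "B \<subseteq> {0..1}" using B_sub_M M_sub by blast
    have Aeq: "A i = (B \<inter> {0..1} \<inter> (M \<inter> (f ^^ ((J - 1) * p + i)) -` {..(f ^^ i) w - \<epsilon>})) \<union>
      (B \<inter> {0..1} \<inter> (M \<inter> (f ^^ ((J - 1) * p + i)) -` {(f ^^ i) w + \<epsilon>..}))" for i
      unfolding A_def using B_sub_M by auto
    have "closed (A i)" for i
      unfolding Aeq by (intro closed_Un closed_Int B_closed continuous_closed_preimage fn_cont M_closed) auto
    then have cA: "closed (\<Union>i<p. A i)" by (intro closed_UN) auto
    have "compact (K N)" for N unfolding K_def by (intro compact_Int_closed B_orbit_compact cA)
    moreover have "K N \<noteq> {}" for N
    proof -
      define N' where "N' = max N N0"
      \<comment> \<open>The arrival time is minimal, so a start one period earlier fails at some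
        offset. This offset is below \<open>p\<close>, since from \<open>p\<close> on both
        comparisons coincide by periodicity.\<close>
      define n where "n = (LEAST n. Q n N')"
      have Qn: "Q n N'" unfolding n_def by (rule LeastI_ex[OF Q_ex])
      have n_le: "n \<le> n'" if "Q n' N'" for n' unfolding n_def using that by (rule Least_le[of "\<lambda>n. Q n N'"])
      obtain x where x: "x \<in> B" "x \<in> {c1..c2}" "\<And>i. i \<le> N' \<Longrightarrow> \<bar>(f ^^ (n + i)) x - (f ^^ i) w\<bar> \<le> \<epsilon>"
        using Qn unfolding Q_def by blast
      have nJ: "J * p \<le> n" by (rule late[OF Qn]) (simp add: N'_def)
      define y where "y = (f ^^ (n - J * p)) x"
      have shift: "(f ^^ k) y = (f ^^ (n - J * p + k)) x" for k
        unfolding y_def by (metis add.commute comp_apply funpow_add)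
      have yB: "y \<in> B \<inter> {0..1}" unfolding y_def using fn_B[OF x(1)] B01 by blast
      have "(f ^^ (J * p + i)) y = (f ^^ (n + i)) x" for i
        unfolding shift using nJ by (simp add: add.assoc[symmetric])
      then have "(f ^^ (J * p + i)) y \<in> {(f ^^ i) w - \<epsilon>..(f ^^ i) w + \<epsilon>}" if "i \<le> N" for i
        using x(3)[of i] that unfolding N'_def by (auto simp: abs_le_iff algebra_simps)
      moreover have "y \<in> (\<Union>i<p. A i)"
      proof -
        have pn: "p \<le> n" using nJ unfolding J_def by (simp add: algebra_simps)
        have "\<not> Q (n - p) N'" using n_le[of "n - p"] p(1) pn by auto
        then obtain i where i: "i \<le> N'" "\<not> \<bar>(f ^^ (n - p + i)) x - (f ^^ i) w\<bar> \<le> \<epsilon>"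
          unfolding Q_def using x(1,2) by blast
        have "i < p"
        proof (rule ccontr)
          assume "\<not> i < p"
          then have "n - p + i = n + (i - p)" "i = (i - p) + 1 * p" using pn by auto
          then have "(f ^^ (n - p + i)) x - (f ^^ i) w = (f ^^ (n + (i - p))) x - (f ^^ (i - p)) w"
            using periodic_add[OF p(2), of "i - p" 1] by metis
          then show False using i x(3)[of "i - p"] by simp
        qed
        have idx: "n - J * p + ((J - 1) * p + i) = n - p + i"
          using nJ unfolding J_def by (simp add: algebra_simps)
        have "(f ^^ ((J - 1) * p + i)) y = (f ^^ (n - p + i)) x" by (simp only: shift idx)
        then have "y \<in> A i" unfolding A_def using i(2) yB by (auto simp: abs_le_iff algebra_simps)
        then show ?thesis using \<open>i < p\<close> by blast
      qed
      ultimately show ?thesis unfolding K_def using yB by auto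
    qed
    moreover have "K m \<subseteq> K k" if "k \<le> m" for k m unfolding K_def using that by auto
    ultimately have "\<Inter> (range K) \<noteq> {}" by (rule compact_nest)
    then obtain z where z: "\<And>N. z \<in> K N" by blast
    have zB: "z \<in> B" using z[of 0] unfolding K_def by blast
    have track: "\<bar>(f ^^ (J * p + i)) z - (f ^^ i) w\<bar> \<le> \<epsilon>" for i
      using z[of i] unfolding K_def by (auto simp: abs_le_iff algebra_simps)
    obtain i0 where i0: "i0 < p" "\<bar>(f ^^ ((J - 1) * p + i0)) z - (f ^^ i0) w\<bar> \<ge> \<epsilon>"
      using z[of 0] unfolding K_def A_def by (auto simp: abs_if algebra_simps)
    define U where "U j = (f ^^ (j * p)) z" for j
    have U_add: "(f ^^ (i + j' * p)) (U j) = (f ^^ ((j + j') * p + i)) z" for i j j'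
      unfolding U_def by (metis (no_types, lifting) add.commute add.left_commute comp_apply distrib_right funpow_add)
    have "\<exists>j<J. U j \<notin> F"
    proof (rule ccontr)
      assume "\<not> ?thesis"
      then have UF: "U ` {..<J} \<subseteq> F" by auto
      then have "card (U ` {..<J}) < card {..<J}" using card_mono[OF F_finite UF] unfolding J_def by simp
      then have "\<not> inj_on U {..<J}" by (rule pigeonhole)
      then obtain a b where ab: "a < b" "b < J" "U a = U b"
        unfolding inj_on_def by (metis lessThan_iff nat_neq_iff)
      define q where "q = b - a"
      have per: "(f ^^ (q * p)) (U a) = U a" using U_add[of 0 q a] ab unfolding q_def U_def by simp
      define x where "x = U (J - 1)"
      have x_alt: "x = (f ^^ ((J - 1 - a) * p)) (U a)"
        using U_add[of 0 "J - 1 - a" a] ab unfolding x_def U_def by simp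
      have per': "(f ^^ (q * p)) x = x"
        unfolding x_alt using per by (metis add.commute comp_apply funpow_add)
      have "(f ^^ i0) x = (f ^^ (i0 + q * p)) x" using per' by (simp add: funpow_add)
      also have "\<dots> = (f ^^ ((J - 1 + q) * p + i0)) z" unfolding x_def by (rule U_add)
      also have "(J - 1 + q) * p + i0 = J * p + (i0 + (q - 1) * p)"
        using ab unfolding q_def J_def by (cases "b - a") (simp_all add: algebra_simps)
      finally have eq: "(f ^^ i0) x = (f ^^ (J * p + (i0 + (q - 1) * p))) z" .
      have "\<bar>(f ^^ i0) x - (f ^^ i0) w\<bar> \<le> \<epsilon>"
        unfolding eq using track[of "i0 + (q - 1) * p"] periodic_add[OF p(2), of i0 "q - 1"] by simp
      moreover have "(f ^^ i0) x = (f ^^ ((J - 1) * p + i0)) z"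
        using U_add[of i0 0 "J - 1"] unfolding x_def by simp
      ultimately have "\<bar>(f ^^ i0) x - (f ^^ i0) w\<bar> = \<epsilon>" using i0(2) by simp
      moreover have "x \<in> F" unfolding x_def by (rule subsetD[OF UF]) (simp add: J_def)
      ultimately have "\<epsilon> \<in> D" unfolding D_def using i0(1) by force
      then show False using \<epsilon>(3) by blast
    qed
    then obtain j where j: "j < J" "U j \<notin> F" by blast
    have "\<bar>(f ^^ ((J - j) * p + i)) (U j) - (f ^^ i) w\<bar> \<le> \<epsilon>" for i
      using track[of i] U_add[of i "J - j" j] j(1) by (simp add: add.commute)
    moreover have "U j \<in> B" unfolding U_def by (rule fn_B[OF zB])
    ultimately show ?thesis using j(2) by blast
  qed
  then show ?thesis using \<epsilon>(2) by (meson order_trans)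
qed

end

section \<open>Walls of big intervals around points of the basic set\<close>

context basic_system
begin

text \<open>If \<open>B\<close> has a gap to the right of \<open>x\<close>, the choice of
  \<open>e\<close> leaves no \<open>y\<close> to be separated. Otherwise there is a point of
  \<open>B\<close> within \<open>\<eta> / 2\<close>, a short big interval at it is the wall, and
  \<open>\<eta>'\<close> keeps \<open>a\<close> on the near side of the wall.\<close>

lemma right_cage:
  assumes "x \<in> B"
  shows "\<exists>e>0. \<forall>\<eta>>0. \<exists>P \<eta>'. finite P \<and> (\<forall>(s, t)\<in>P. big s t) \<and> 0 < \<eta>' \<and>
    (\<forall>a y. a \<le> x + \<eta>' \<longrightarrow> y \<in> B \<longrightarrow> y \<le> x + e \<longrightarrow> x + \<eta> < y \<longrightarrow> (\<exists>(s, t)\<in>P. a < s \<and> t < y))"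
proof (cases "\<exists>e>0. B \<inter> {x<..x + e} = {}")
  case True
  then obtain e where e: "e > 0" "B \<inter> {x<..x + e} = {}" by blast
  have "y \<notin> B" if "x + \<eta> < y" "y \<le> x + e" "0 < \<eta>" for y \<eta> using e(2) that by fastforce
  then show ?thesis using e(1) by (intro exI[of _ e] conjI allI impI exI[of _ "{}"] exI[of _ 1]) auto
next
  case False
  have "\<exists>P \<eta>'. finite P \<and> (\<forall>(s, t)\<in>P. big s t) \<and> 0 < \<eta>' \<and>
    (\<forall>a y. a \<le> x + \<eta>' \<longrightarrow> y \<in> B \<longrightarrow> y \<le> x + 1 \<longrightarrow> x + \<eta> < y \<longrightarrow> (\<exists>(s, t)\<in>P. a < s \<and> t < y))"
    if \<eta>: "\<eta> > 0" for \<eta>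
  proof -
    have "B \<inter> {x<..x + \<eta>/2} \<noteq> {}" using False \<eta> by (meson half_gt_zero)
    then obtain b where b: "b \<in> B" "x < b" "b \<le> x + \<eta>/2" by auto
    obtain s t where st: "big s t" "x < s" "t < x + \<eta>"
      using big_inside_open_interval[OF b(1,2), of "x + \<eta>"] b(3) \<eta> by auto
    show ?thesis
      by (rule exI[of _ "{(s, t)}"], rule exI[of _ "(s - x) / 2"]) (use st in \<open>auto simp: field_simps\<close>)
  qed
  then show ?thesis by (intro exI[of _ 1]) simp
qed

lemma left_cage:
  assumes "x \<in> B"
  shows "\<exists>e>0. \<forall>\<eta>>0. \<exists>P \<eta>'. finite P \<and> (\<forall>(s, t)\<in>P. big s t) \<and> 0 < \<eta>' \<and>
    (\<forall>a y. x - \<eta>' \<le> a \<longrightarrow> y \<in> B \<longrightarrow> x - e \<le> y \<longrightarrow> y < x - \<eta> \<longrightarrow> (\<exists>(s, t)\<in>P. y < s \<and> t < a))"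
proof (cases "\<exists>e>0. B \<inter> {x - e..<x} = {}")
  case True
  then obtain e where e: "e > 0" "B \<inter> {x - e..<x} = {}" by blast
  have "y \<notin> B" if "y < x - \<eta>" "x - e \<le> y" "0 < \<eta>" for y \<eta> using e(2) that by fastforce
  then show ?thesis using e(1) by (intro exI[of _ e] conjI allI impI exI[of _ "{}"] exI[of _ 1]) auto
next
  case False
  have "\<exists>P \<eta>'. finite P \<and> (\<forall>(s, t)\<in>P. big s t) \<and> 0 < \<eta>' \<and>
    (\<forall>a y. x - \<eta>' \<le> a \<longrightarrow> y \<in> B \<longrightarrow> x - 1 \<le> y \<longrightarrow> y < x - \<eta> \<longrightarrow> (\<exists>(s, t)\<in>P. y < s \<and> t < a))"
    if \<eta>: "\<eta> > 0" for \<eta>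
  proof -
    have "B \<inter> {x - \<eta>/2..<x} \<noteq> {}" using False \<eta> by (meson half_gt_zero)
    then obtain b where b: "b \<in> B" "b < x" "x - \<eta>/2 \<le> b" by auto
    obtain s t where st: "big s t" "x - \<eta> < s" "t < x"
      using big_inside_open_interval[OF b(1), of "x - \<eta>" x] b(2,3) \<eta> by auto
    show ?thesis
      by (rule exI[of _ "{(s, t)}"], rule exI[of _ "(x - t) / 2"]) (use st in \<open>auto simp: field_simps\<close>)
  qed
  then show ?thesis by (intro exI[of _ 1]) simp
qed

text \<open>A cage exists if \<open>e\<close> is smaller than the gaps of \<open>B\<close> adjacent to \<open>x\<close>.\<close>

definition caged :: "real \<Rightarrow> real \<Rightarrow> real \<Rightarrow> (real \<times> real) set \<Rightarrow> real \<Rightarrow> bool" where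
  "caged x e \<eta> P \<eta>' \<longleftrightarrow> finite P \<and> (\<forall>(s, t)\<in>P. big s t) \<and> 0 < \<eta>' \<and>
    (\<forall>a y. \<bar>a - x\<bar> \<le> \<eta>' \<longrightarrow> y \<in> B \<longrightarrow> \<bar>y - x\<bar> \<le> e \<longrightarrow> \<eta> < \<bar>y - x\<bar> \<longrightarrow>
      (\<exists>(s, t)\<in>P. a < s \<and> t < y \<or> y < s \<and> t < a))"

lemma cage:
  assumes "x \<in> B"
  shows "\<exists>e>0. \<forall>\<eta>>0. \<exists>P \<eta>'. caged x e \<eta> P \<eta>'"
proof -
  obtain e1 where e1: "e1 > 0" "\<And>\<eta>. \<eta> > 0 \<Longrightarrow> \<exists>P \<eta>'. finite P \<and> (\<forall>(s, t)\<in>P. big s t) \<and> 0 < \<eta>' \<and>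
    (\<forall>a y. a \<le> x + \<eta>' \<longrightarrow> y \<in> B \<longrightarrow> y \<le> x + e1 \<longrightarrow> x + \<eta> < y \<longrightarrow> (\<exists>(s, t)\<in>P. a < s \<and> t < y))"
    using right_cage[OF assms] by blast
  obtain e2 where e2: "e2 > 0" "\<And>\<eta>. \<eta> > 0 \<Longrightarrow> \<exists>P \<eta>'. finite P \<and> (\<forall>(s, t)\<in>P. big s t) \<and> 0 < \<eta>' \<and>
    (\<forall>a y. x - \<eta>' \<le> a \<longrightarrow> y \<in> B \<longrightarrow> x - e2 \<le> y \<longrightarrow> y < x - \<eta> \<longrightarrow> (\<exists>(s, t)\<in>P. y < s \<and> t < a))"
    using left_cage[OF assms] by blast
  have "\<exists>P \<eta>'. caged x (min e1 e2) \<eta> P \<eta>'" if \<eta>: "\<eta> > 0" for \<eta>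
  proof -
    obtain P1 \<eta>1 where 1: "finite P1" "\<forall>(s, t)\<in>P1. big s t" "0 < \<eta>1"
      "\<And>a y. a \<le> x + \<eta>1 \<Longrightarrow> y \<in> B \<Longrightarrow> y \<le> x + e1 \<Longrightarrow> x + \<eta> < y \<Longrightarrow> \<exists>(s, t)\<in>P1. a < s \<and> t < y"
      using e1(2)[OF \<eta>] by blast
    obtain P2 \<eta>2 where 2: "finite P2" "\<forall>(s, t)\<in>P2. big s t" "0 < \<eta>2"
      "\<And>a y. x - \<eta>2 \<le> a \<Longrightarrow> y \<in> B \<Longrightarrow> x - e2 \<le> y \<Longrightarrow> y < x - \<eta> \<Longrightarrow> \<exists>(s, t)\<in>P2. y < s \<and> t < a"
      using e2(2)[OF \<eta>] by blast
    have "\<exists>(s, t)\<in>P1 \<union> P2. a < s \<and> t < y \<or> y < s \<and> t < a"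
      if h: "\<bar>a - x\<bar> \<le> min \<eta>1 \<eta>2" "y \<in> B" "\<bar>y - x\<bar> \<le> min e1 e2" "\<eta> < \<bar>y - x\<bar>" for a y
    proof (cases "x < y")
      case True
      then have "\<exists>(s, t)\<in>P1. a < s \<and> t < y" using 1(4)[of a y] h by (auto simp: abs_if split: if_splits)
      then show ?thesis by blast
    next
      case False
      then have "\<exists>(s, t)\<in>P2. y < s \<and> t < a" using 2(4)[of a y] h by (auto simp: abs_if split: if_splits)
      then show ?thesis by blast
    qed
    then have "caged x (min e1 e2) \<eta> (P1 \<union> P2) (min \<eta>1 \<eta>2)"
      unfolding caged_def using 1(1-3) 2(1-3) by auto
    then show ?thesis by blast
  qed
  then show ?thesis using e1(1) e2(1) by (intro exI[of _ "min e1 e2"]) auto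
qed

lemma uniform_step:
  assumes "e > 0"
  shows "\<exists>d>0. \<forall>x\<in>M. \<forall>y\<in>M. \<bar>x - y\<bar> \<le> d \<longrightarrow> \<bar>f x - f y\<bar> \<le> e"
proof -
  obtain d where d: "d > 0" "\<And>x y. x \<in> M \<Longrightarrow> y \<in> M \<Longrightarrow> dist y x < d \<Longrightarrow> dist (f y) (f x) < e"
    using compact_uniformly_continuous[OF cont M_compact] assms unfolding uniformly_continuous_on_def by metis
  have "\<bar>f x - f y\<bar> \<le> e" if "x \<in> M" "y \<in> M" "\<bar>x - y\<bar> \<le> d / 2" for x y
    using d(2)[of y x] that d(1) by (auto simp: dist_real_def)
  then show ?thesis using d(1) by (intro exI[of _ "d/2"]) auto
qed

end

context core_system
begin

lemma reach_C_finite: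
  assumes "finite P" "\<forall>(s, t)\<in>P. big s t"
  shows "\<exists>G. \<forall>(s, t)\<in>P. \<exists>n\<le>G. {c1..c2} \<subseteq> (f ^^ n) ` {s..t}"
  using assms
proof (induction P)
  case (insert q P)
  obtain G where G: "\<forall>(s, t)\<in>P. \<exists>n\<le>G. {c1..c2} \<subseteq> (f ^^ n) ` {s..t}" using insert by auto
  obtain n where n: "{c1..c2} \<subseteq> (f ^^ n) ` {fst q..snd q}" using reach_C[of "fst q" "snd q"] insert.prems by auto
  have step: "\<exists>n'\<le>max G n. {c1..c2} \<subseteq> (f ^^ n') ` {s..t}" if h: "(s, t) \<in> insert q P" for s t
  proof (cases "(s, t) = q")
    case True
    then show ?thesis using n by (intro exI[of _ n]) auto
  next
    case False
    then obtain n' where "n' \<le> G" "{c1..c2} \<subseteq> (f ^^ n') ` {s..t}" using G h by auto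
    then show ?thesis by (intro exI[of _ n']) auto
  qed
  show ?case by (rule exI[of _ "max G n"]) (use step in blast)
qed simp

text \<open>Once a big interval is covered early, the core is covered after a bounded further time,
  and waiting there postpones the return past \<open>N\<close>.\<close>

lemma leave_block:
  assumes "{s..t} \<subseteq> (f ^^ i) ` A" "{c1..c2} \<subseteq> (f ^^ n) ` {s..t}" "n \<le> G" "i \<le> N"
  shows "\<exists>b. N \<le> b \<and> b \<le> N + G + r \<and> {c1..c2} \<subseteq> (f ^^ b) ` A"
proof -
  have "{c1..c2} \<subseteq> (f ^^ (n + i)) ` A"
    unfolding funpow_image_add by (rule order_trans[OF assms(2) image_mono[OF assms(1)]])
  from reach_C_late[OF this, of N] obtain b where "N \<le> b" "b \<le> max N (n + i) + r" "{c1..c2} \<subseteq> (f ^^ b) ` A" by blast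
  then show ?thesis using assms(3,4) by (intro exI[of _ b]) auto
qed

text \<open>The neighbourhood of a tracking point \<open>x\<close> is enlarged to its critical
  radius with respect to the walls around the cycle. A cycle is finite, so finitely many walls
  suffice, and \<open>G\<close> and \<open>k\<close> do not depend on the duration \<open>N\<close>.
  As no wall is jumped, points of \<open>B\<close> in the block cannot lose the closeness
  \<open>\<eta>\<close> to the cycle.\<close>

lemma periodic_block:
  assumes w: "w \<in> B" and p: "0 < p" "(f ^^ p) w = w" and \<epsilon>: "\<epsilon> > 0"
  shows "\<exists>G k. \<forall>N. \<exists>u v a b. big u v \<and> {u..v} \<subseteq> (f ^^ a) ` {c1..c2} \<and> {c1..c2} \<subseteq> (f ^^ b) ` {u..v} \<and>
    a \<le> G \<and> k + N \<le> b \<and> b \<le> N + G \<and> (\<forall>y\<in>B \<inter> {u..v}. \<forall>i<N. \<bar>(f ^^ (k + i)) y - (f ^^ i) w\<bar> \<le> \<epsilon>)"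
proof -
  have wi: "(f ^^ i) w \<in> B" for i by (rule fn_B[OF w])
  obtain e0 where e0: "\<And>x. x \<in> B \<Longrightarrow> e0 x > 0" "\<And>x \<eta>. x \<in> B \<Longrightarrow> \<eta> > 0 \<Longrightarrow> \<exists>P \<eta>'. caged x (e0 x) \<eta> P \<eta>'"
    using cage by metis
  \<comment> \<open>At most the size of every cage along the cycle, so that the cage property
    applies to points of \<open>B\<close> within \<open>\<epsilon>0\<close> of the cycle.\<close>
  define \<epsilon>0 where "\<epsilon>0 = Min (insert \<epsilon> ((\<lambda>i. e0 ((f ^^ i) w)) ` {..<p}))"
  have \<epsilon>0: "\<epsilon>0 > 0" "\<epsilon>0 \<le> \<epsilon>" "\<And>i. i < p \<Longrightarrow> \<epsilon>0 \<le> e0 ((f ^^ i) w)"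
    unfolding \<epsilon>0_def using \<epsilon> e0(1)[OF wi] by (auto simp: Min_gr_iff)
  obtain \<eta>1 where \<eta>1: "\<eta>1 > 0" "\<And>x y. x \<in> M \<Longrightarrow> y \<in> M \<Longrightarrow> \<bar>x - y\<bar> \<le> \<eta>1 \<Longrightarrow> \<bar>f x - f y\<bar> \<le> \<epsilon>0"
    using uniform_step[OF \<epsilon>0(1)] by blast
  define \<eta> where "\<eta> = min \<eta>1 \<epsilon>0"
  have \<eta>: "\<eta> > 0" "\<eta> \<le> \<epsilon>0" "\<eta> \<le> \<eta>1" unfolding \<eta>_def using \<eta>1 \<epsilon>0 by auto
  obtain P0 h0 where cg: "\<And>x. x \<in> B \<Longrightarrow> caged x (e0 x) \<eta> (P0 x) (h0 x)"
    using e0(2)[OF _ \<eta>(1)] by metis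
  have P0: "finite (P0 x)" "\<forall>(s, t)\<in>P0 x. big s t" "0 < h0 x"
    "\<And>a y. \<bar>a - x\<bar> \<le> h0 x \<Longrightarrow> y \<in> B \<Longrightarrow> \<bar>y - x\<bar> \<le> e0 x \<Longrightarrow> \<eta> < \<bar>y - x\<bar> \<Longrightarrow>
      \<exists>(s, t)\<in>P0 x. a < s \<and> t < y \<or> y < s \<and> t < a" if "x \<in> B" for x
    using cg[OF that] unfolding caged_def by blast+
  define P where "P = (\<Union>i<p. P0 ((f ^^ i) w))"
  define \<eta>' where "\<eta>' = Min (insert (\<eta> / 2) ((\<lambda>i. h0 ((f ^^ i) w)) ` {..<p}))"
  have \<eta>': "\<eta>' > 0" "\<eta>' < \<eta>" "\<And>i. i < p \<Longrightarrow> \<eta>' \<le> h0 ((f ^^ i) w)"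
  proof -
    show "\<eta>' > 0" unfolding \<eta>'_def using \<eta> P0(3)[OF wi] by (auto simp: Min_gr_iff)
    have "\<eta>' \<le> \<eta> / 2" unfolding \<eta>'_def by (rule Min_le) auto
    then show "\<eta>' < \<eta>" using \<eta>(1) by simp
    show "\<And>i. i < p \<Longrightarrow> \<eta>' \<le> h0 ((f ^^ i) w)" unfolding \<eta>'_def by (rule Min_le) auto
  qed
  have finP: "finite P" unfolding P_def using P0(1)[OF wi] by auto
  have bigP: "\<forall>(s, t)\<in>P. big s t" unfolding P_def using P0(2)[OF wi] by auto
  have caged: "\<exists>(s, t)\<in>P. a < s \<and> t < y \<or> y < s \<and> t < a"
    if "\<bar>a - (f ^^ i) w\<bar> \<le> \<eta>'" "y \<in> B" "\<bar>y - (f ^^ i) w\<bar> \<le> \<epsilon>0" "\<eta> < \<bar>y - (f ^^ i) w\<bar>" for a y i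
  proof -
    define i' where "i' = i mod p"
    have i': "i' < p" "(f ^^ i) w = (f ^^ i') w"
      unfolding i'_def using p(1) funpow_mod_eq[OF p(2), of i] by auto
    have "\<exists>(s, t)\<in>P0 ((f ^^ i') w). a < s \<and> t < y \<or> y < s \<and> t < a"
      using P0(4)[OF wi, of a i' y] that \<epsilon>0(3)[OF i'(1)] \<eta>'(3)[OF i'(1)] unfolding i'(2) by simp
    then show ?thesis unfolding P_def using i'(1) by auto
  qed
  obtain x k where x: "x \<in> B" "x \<notin> F" "\<And>i. \<bar>(f ^^ (k + i)) x - (f ^^ i) w\<bar> \<le> \<eta>'"
    using tracking_point_off_F[OF w p \<eta>'(1)] by blast
  have xM: "x \<in> M" using x(1) B_sub_M by blast
  obtain d1 a where d1: "0 < d1" "d1 \<le> \<rho>" "M \<inter> {x - d1..x + d1} \<subseteq> (f ^^ a) ` {c1..c2}"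
    using accessible[of x] x(2) xM by blast
  \<comment> \<open>Makes the whole neighbourhood \<open>\<eta>\<close>-close to the cycle at time
    \<open>k\<close>: the tracking point contributes \<open>\<eta>'\<close>, the size of the
    neighbourhood the rest.\<close>
  obtain d2 where d2: "0 < d2" "\<And>y. y \<in> M \<Longrightarrow> \<bar>y - x\<bar> \<le> d2 \<Longrightarrow> \<bar>(f ^^ k) y - (f ^^ k) x\<bar> \<le> \<eta> - \<eta>'"
    using fn_close[OF xM, of "\<eta> - \<eta>'" k] \<eta>'(2) by auto
  define d where "d = min d1 d2"
  have d: "0 < d" "d \<le> \<rho>" "d \<le> d1" "d \<le> d2" unfolding d_def using d1 d2 by auto
  obtain ud vd where uvd: "big ud vd" "ud \<le> x" "x \<le> vd" "{ud..vd} = M \<inter> {x - d..x + d}"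
    using big_nbhd[OF x(1) d(1,2)] .
  obtain nd where nd: "{c1..c2} \<subseteq> (f ^^ nd) ` {ud..vd}" using reach_C[OF uvd(1)] by blast
  obtain G1 where G1: "\<forall>(s, t)\<in>P. \<exists>n\<le>G1. {c1..c2} \<subseteq> (f ^^ n) ` {s..t}"
    using reach_C_finite[OF finP bigP] by blast
  define G where "G = a + k + nd + G1 + r"
  have "\<exists>u v a b. big u v \<and> {u..v} \<subseteq> (f ^^ a) ` {c1..c2} \<and> {c1..c2} \<subseteq> (f ^^ b) ` {u..v} \<and>
    a \<le> G \<and> k + N \<le> b \<and> b \<le> N + G \<and> (\<forall>y\<in>B \<inter> {u..v}. \<forall>i<N. \<bar>(f ^^ (k + i)) y - (f ^^ i) w\<bar> \<le> \<epsilon>)" for N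
  proof -
    have Plt: "s < t" if "(s, t) \<in> P" for s t using bigP that unfolding big_def by auto
    obtain \<tau> where \<tau>: "0 < \<tau>" "\<tau> \<le> d"
      "\<tau> = d \<or> (\<exists>i\<le>k + N. \<exists>(s, t)\<in>P. {s..t} \<subseteq> (f ^^ i) ` (M \<inter> {x - \<tau>..x + \<tau>}))"
      and nj: "\<forall>y\<in>M \<inter> {x - \<tau>..x + \<tau>}. \<forall>i\<le>k + N. \<forall>(s, t)\<in>P.
        \<not> ((f ^^ i) x < s \<and> t < (f ^^ i) y) \<and> \<not> ((f ^^ i) y < s \<and> t < (f ^^ i) x)"
      using critical_radius[OF xM d(1,2) finP Plt, of "k + N"] by blast
    have \<tau>r: "\<tau> \<le> \<rho>" using \<tau>(2) d(2) by simp
    obtain u v where uv: "big u v" "u \<le> x" "x \<le> v" "{u..v} = M \<inter> {x - \<tau>..x + \<tau>}"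
      using big_nbhd[OF x(1) \<tau>(1) \<tau>r] .
    have "M \<inter> {x - \<tau>..x + \<tau>} \<subseteq> M \<inter> {x - d1..x + d1}" using \<tau>(2) d(3) by auto
    then have acc: "{u..v} \<subseteq> (f ^^ a) ` {c1..c2}" unfolding uv(4) using d1(3) by (rule order_trans)
    have "\<exists>b. k + N \<le> b \<and> b \<le> k + N + (nd + G1) + r \<and> {c1..c2} \<subseteq> (f ^^ b) ` {u..v}"
      using \<tau>(3)
    proof
      assume "\<tau> = d"
      then have "{ud..vd} \<subseteq> (f ^^ 0) ` {u..v}" using uvd(4) uv(4) by simp
      from leave_block[OF this nd, of "nd + G1" "k + N"] show ?thesis by simp
    next
      assume "\<exists>i\<le>k + N. \<exists>(s, t)\<in>P. {s..t} \<subseteq> (f ^^ i) ` (M \<inter> {x - \<tau>..x + \<tau>})"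
      then obtain i s t where *: "i \<le> k + N" "(s, t) \<in> P" "{s..t} \<subseteq> (f ^^ i) ` {u..v}" unfolding uv(4) by auto
      obtain n where "n \<le> G1" "{c1..c2} \<subseteq> (f ^^ n) ` {s..t}" using G1 *(2) by auto
      then show ?thesis using leave_block[OF *(3), of n "nd + G1" "k + N"] *(1) by simp
    qed
    then obtain b where b: "k + N \<le> b" "b \<le> k + N + (nd + G1) + r" "{c1..c2} \<subseteq> (f ^^ b) ` {u..v}" by blast
    \<comment> \<open>One application of \<open>f\<close> widens the distance from
      \<open>\<eta>\<close> to at most \<open>\<epsilon>0\<close>. A point of \<open>B\<close> in
      that range but farther than \<open>\<eta>\<close> would be separated from the orbit of
      \<open>x\<close> by a wall, which is a forbidden jump.\<close>
    have track: "\<bar>(f ^^ (k + i)) y - (f ^^ i) w\<bar> \<le> \<eta>" if y: "y \<in> B \<inter> {u..v}" and i: "i \<le> N" for y i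
      using i
    proof (induction i)
      case 0
      have "y \<in> M" "\<bar>y - x\<bar> \<le> d2" using y \<tau>(2) d(4) unfolding uv(4) by (auto simp: abs_le_iff)
      then have "\<bar>(f ^^ k) y - (f ^^ k) x\<bar> \<le> \<eta> - \<eta>'" by (rule d2(2))
      moreover have "\<bar>(f ^^ k) x - w\<bar> \<le> \<eta>'" using x(3)[of 0] by simp
      ultimately show ?case by simp
    next
      case (Suc i)
      have yB: "(f ^^ n) y \<in> B" for n using fn_B y by blast
      have "\<bar>(f ^^ (k + i)) y - (f ^^ i) w\<bar> \<le> \<eta>1" using Suc \<eta>(3) by simp
      then have "\<bar>f ((f ^^ (k + i)) y) - f ((f ^^ i) w)\<bar> \<le> \<epsilon>0"
        using \<eta>1(2) yB wi B_sub_M by blast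
      then have close: "\<bar>(f ^^ (k + Suc i)) y - (f ^^ Suc i) w\<bar> \<le> \<epsilon>0" by simp
      show ?case
      proof (rule ccontr)
        assume "\<not> ?thesis"
        then have "\<eta> < \<bar>(f ^^ (k + Suc i)) y - (f ^^ Suc i) w\<bar>" by simp
        from caged[OF x(3)[of "Suc i"] yB close this] obtain s t where st: "(s, t) \<in> P"
          "(f ^^ (k + Suc i)) x < s \<and> t < (f ^^ (k + Suc i)) y \<or> (f ^^ (k + Suc i)) y < s \<and> t < (f ^^ (k + Suc i)) x"
          by blast
        have "y \<in> M \<inter> {x - \<tau>..x + \<tau>}" using y uv(4) by blast
        moreover have "k + Suc i \<le> k + N" using Suc.prems by simp
        ultimately show False using nj st by blast
      qed
    qed
    have "\<forall>y\<in>B \<inter> {u..v}. \<forall>i<N. \<bar>(f ^^ (k + i)) y - (f ^^ i) w\<bar> \<le> \<epsilon>"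
    proof (intro ballI allI impI)
      fix y i assume "y \<in> B \<inter> {u..v}" "i < N"
      then have "\<bar>(f ^^ (k + i)) y - (f ^^ i) w\<bar> \<le> \<eta>" by (intro track) auto
      then show "\<bar>(f ^^ (k + i)) y - (f ^^ i) w\<bar> \<le> \<epsilon>" using \<eta>(2) \<epsilon>0(2) by simp
    qed
    moreover have "a \<le> G" "b \<le> N + G" using b(2) unfolding G_def by auto
    ultimately show ?thesis using uv(1) acc b(1,3) by blast
  qed
  then show ?thesis by blast
qed

end

section \<open>Linking blocks\<close>

lemma sum_lessThan_add:
  fixes h :: "nat \<Rightarrow> 'a::comm_monoid_add"
  shows "(\<Sum>i<m + n. h i) = (\<Sum>i<m. h i) + (\<Sum>i<n. h (m + i))"
  by (induction n) (simp_all add: add.assoc)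

text \<open>Window \<open>j\<close> occupies \<open>N j\<close> instants from \<open>s j\<close> on;
  all instants outside of windows are estimated by the lower bound \<open>- K\<close>.\<close>

lemma window_sum_lower:
  fixes h :: "nat \<Rightarrow> real"
  assumes low: "\<And>i. - K \<le> h i" and sep: "\<And>j. j < J \<Longrightarrow> s j + N j \<le> s (Suc j)"
    and g: "\<And>j i. j < J \<Longrightarrow> i < N j \<Longrightarrow> g j i \<le> h (s j + i)"
  shows "(\<Sum>j<J. \<Sum>i<N j. g j i) - K * (real (s J) - (\<Sum>j<J. real (N j))) \<le> (\<Sum>i<s J. h i)"
  using sep g
proof (induction J)
  case 0
  have "(\<Sum>i<s 0. - K) \<le> (\<Sum>i<s 0. h i)" by (intro sum_mono low)
  then show ?case by (simp add: mult.commute)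
next
  case (Suc J)
  define m where "m = s (Suc J) - (s J + N J)"
  have m: "s (Suc J) = s J + N J + m" unfolding m_def using Suc.prems(1)[of J] by simp
  have IH: "(\<Sum>j<J. \<Sum>i<N j. g j i) - K * (real (s J) - (\<Sum>j<J. real (N j))) \<le> (\<Sum>i<s J. h i)"
    using Suc by simp
  have "(\<Sum>i<N J. g J i) \<le> (\<Sum>i<N J. h (s J + i))" by (intro sum_mono Suc.prems(2)) auto
  moreover have "(\<Sum>i<m. - K) \<le> (\<Sum>i<m. h (s J + N J + i))" by (intro sum_mono low)
  ultimately have "(\<Sum>j<Suc J. \<Sum>i<N j. g j i) - K * (real (s J) - (\<Sum>j<J. real (N j))) - K * real m \<le> (\<Sum>i<s (Suc J). h i)"
    using IH unfolding m sum_lessThan_add by (simp add: mult.commute)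
  then show ?case unfolding m by (simp add: algebra_simps)
qed

context basic_system
begin

lemma funpow_add_apply: "(f ^^ (m + n)) x = (f ^^ n) ((f ^^ m) x)"
  by (metis add.commute comp_apply funpow_add)

text \<open>Endpoints of long gaps on a fixed side are \<open>\<epsilon>\<close>-separated, and
  \<open>B\<close> is bounded.\<close>

lemma finite_gap_endpoints:
  assumes "\<epsilon> > 0"
  shows "finite {x \<in> B. B \<inter> {x<..<x + \<epsilon>} = {} \<or> B \<inter> {x - \<epsilon><..<x} = {}}"
proof -
  define h where "h x = \<lfloor>x / \<epsilon>\<rfloor>" for x :: real
  have "finite X" if X: "X \<subseteq> B" "\<And>x y. x \<in> X \<Longrightarrow> y \<in> X \<Longrightarrow> x < y \<Longrightarrow> x + \<epsilon> \<le> y" for X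
  proof (rule finite_imageD)
    have B01: "B \<subseteq> {0..1}" using B_sub_M M_sub by blast
    have "h ` X \<subseteq> {0..\<lfloor>1 / \<epsilon>\<rfloor>}"
    proof
      fix i assume "i \<in> h ` X"
      then obtain x where x: "x \<in> {0..1}" "i = \<lfloor>x / \<epsilon>\<rfloor>" using X(1) B01 unfolding h_def by blast
      have "0 \<le> x / \<epsilon>" "x / \<epsilon> \<le> 1 / \<epsilon>" using x(1) assms by (auto simp: divide_right_mono)
      then show "i \<in> {0..\<lfloor>1 / \<epsilon>\<rfloor>}" unfolding x(2) by (auto intro: floor_mono)
    qed
    then show "finite (h ` X)" by (rule finite_subset) simp
    have ne: "h x \<noteq> h y" if "x \<in> X" "y \<in> X" "x < y" for x y
    proof -
      have "(x + \<epsilon>) / \<epsilon> \<le> y / \<epsilon>"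
        by (rule divide_right_mono[OF X(2)[OF that]]) (use assms in simp)
      then have "x / \<epsilon> + 1 \<le> y / \<epsilon>" using assms by (simp add: add_divide_distrib)
      then have "\<lfloor>x / \<epsilon>\<rfloor> + 1 \<le> \<lfloor>y / \<epsilon>\<rfloor>" by linarith
      then show ?thesis unfolding h_def by simp
    qed
    show "inj_on h X"
    proof (rule inj_onI)
      fix x y assume "x \<in> X" "y \<in> X" "h x = h y"
      then show "x = y" using ne[of x y] ne[of y x] by (cases x y rule: linorder_cases) auto
    qed
  qed
  then have fin: "finite X" if "X \<subseteq> B" "\<And>x y. x \<in> X \<Longrightarrow> y \<in> X \<Longrightarrow> x < y \<Longrightarrow> x + \<epsilon> \<le> y" for X
    using that by blast
  have "finite {x \<in> B. B \<inter> {x<..<x + \<epsilon>} = {}}"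
  proof (rule fin)
    fix x y assume "x \<in> {x \<in> B. B \<inter> {x<..<x + \<epsilon>} = {}}" "y \<in> {x \<in> B. B \<inter> {x<..<x + \<epsilon>} = {}}" "x < y"
    then have "y \<notin> {x<..<x + \<epsilon>}" by blast
    then show "x + \<epsilon> \<le> y" using \<open>x < y\<close> by simp
  qed blast
  moreover have "finite {x \<in> B. B \<inter> {x - \<epsilon><..<x} = {}}"
  proof (rule fin)
    fix x y assume "x \<in> {x \<in> B. B \<inter> {x - \<epsilon><..<x} = {}}" "y \<in> {x \<in> B. B \<inter> {x - \<epsilon><..<x} = {}}" "x < y"
    then have "x \<notin> {y - \<epsilon><..<y}" by blast
    then show "x + \<epsilon> \<le> y" using \<open>x < y\<close> by simp
  qed blast
  moreover have "{x \<in> B. B \<inter> {x<..<x + \<epsilon>} = {} \<or> B \<inter> {x - \<epsilon><..<x} = {}} =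
    {x \<in> B. B \<inter> {x<..<x + \<epsilon>} = {}} \<union> {x \<in> B. B \<inter> {x - \<epsilon><..<x} = {}}" by blast
  ultimately show ?thesis by simp
qed

end

context core_system
begin

text \<open>Away from \<open>O'\<close> every point has points of \<open>B\<close> within
  \<open>\<epsilon>\<close> on both sides, hence walls on both sides, and compactness leaves
  finitely many. Unlike cages, these walls separate all points farther than
  \<open>\<epsilon>\<close>: after an excursion of the orbit of \<open>z\<close> into
  \<open>O'\<close> the shadowing resumes by itself, because no wall was jumped meanwhile.\<close>

lemma generic_block:
  assumes O: "open O'" "F \<subseteq> O'" and \<epsilon>: "\<epsilon> > 0"
    and gap: "\<And>x. x \<in> B - O' \<Longrightarrow> B \<inter> {x<..<x + \<epsilon>} \<noteq> {} \<and> B \<inter> {x - \<epsilon><..<x} \<noteq> {}"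
  shows "\<exists>G. \<forall>N. \<forall>z\<in>B - O'. \<exists>u v a b. big u v \<and> {u..v} \<subseteq> (f ^^ a) ` {c1..c2} \<and> {c1..c2} \<subseteq> (f ^^ b) ` {u..v} \<and>
    a \<le> G \<and> N \<le> b \<and> b \<le> N + G \<and>
    (\<forall>y\<in>{u..v}. \<forall>i<N. (f ^^ i) z \<notin> O' \<longrightarrow> \<bar>(f ^^ i) y - (f ^^ i) z\<bar> \<le> 2 * \<epsilon>)"
proof -
  define X where "X = B - O'"
  have X: "compact X" unfolding X_def by (rule compact_diff[OF B_compact O(1)])
  have XM: "x \<in> M" "x \<in> B" "x \<in> M - F" if "x \<in> X" for x
    using that O(2) B_sub_M unfolding X_def by auto
  define ok where "ok x d n P \<longleftrightarrow> 0 < d \<and> d \<le> \<epsilon> \<and> 2 * d \<le> \<rho> \<and> M \<inter> {x - 2 * d..x + 2 * d} \<subseteq> (f ^^ n) ` {c1..c2} \<and>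
      finite P \<and> (\<forall>(s, t)\<in>P. big s t) \<and>
      (\<forall>a y. \<bar>a - x\<bar> < d \<longrightarrow> \<epsilon> < \<bar>y - x\<bar> \<longrightarrow> (\<exists>(s, t)\<in>P. a < s \<and> t < y \<or> y < s \<and> t < a))" for x d n P
  have ex: "\<exists>d n P. ok x d n P" if x: "x \<in> X" for x
  proof -
    obtain d0 n where d0: "0 < d0" "d0 \<le> \<rho>" "M \<inter> {x - d0..x + d0} \<subseteq> (f ^^ n) ` {c1..c2}"
      using accessible[OF XM(3)[OF x]] by blast
    obtain y1 y2 where y: "y1 \<in> B" "x < y1" "y1 < x + \<epsilon>" "y2 \<in> B" "x - \<epsilon> < y2" "y2 < x"
      using gap[of x] x unfolding X_def by fastforce
    obtain s1 t1 where 1: "big s1 t1" "x < s1" "t1 < x + \<epsilon>"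
      using big_inside_open_interval[OF y(1-3)] by blast
    obtain s2 t2 where 2: "big s2 t2" "x - \<epsilon> < s2" "t2 < x"
      using big_inside_open_interval[OF y(4-6)] by blast
    define d where "d = min (d0 / 2) (min \<epsilon> (min (s1 - x) (x - t2)))"
    have "d \<le> d0 / 2" unfolding d_def by (rule min.cobounded1)
    moreover have "0 < d" "d \<le> \<epsilon>" "d \<le> s1 - x" "d \<le> x - t2"
      unfolding d_def using d0 \<epsilon> 1 2 by auto
    ultimately have d: "0 < d" "d \<le> \<epsilon>" "2 * d \<le> d0" "d \<le> s1 - x" "d \<le> x - t2" by linarith+
    have "M \<inter> {x - 2 * d..x + 2 * d} \<subseteq> M \<inter> {x - d0..x + d0}" using d(3) by auto
    then have "M \<inter> {x - 2 * d..x + 2 * d} \<subseteq> (f ^^ n) ` {c1..c2}" using d0(3) by (rule order_trans)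
    moreover have "\<exists>(s, t)\<in>{(s1, t1), (s2, t2)}. a < s \<and> t < y \<or> y < s \<and> t < a"
      if "\<bar>a - x\<bar> < d" "\<epsilon> < \<bar>y - x\<bar>" for a y
      using that d 1 2 by (auto simp: abs_if split: if_splits)
    ultimately have "ok x d n {(s1, t1), (s2, t2)}" unfolding ok_def using d d0(2) 1(1) 2(1) by auto
    then show ?thesis by blast
  qed
  obtain d n P where dnP: "\<And>x. x \<in> X \<Longrightarrow> ok x (d x) (n x) (P x)" using ex by metis
  have okD: "0 < d x" "d x \<le> \<epsilon>" "2 * d x \<le> \<rho>" "M \<inter> {x - 2 * d x..x + 2 * d x} \<subseteq> (f ^^ n x) ` {c1..c2}"
      "finite (P x)" "\<forall>(s, t)\<in>P x. big s t"
      "\<And>a y. \<bar>a - x\<bar> < d x \<Longrightarrow> \<epsilon> < \<bar>y - x\<bar> \<Longrightarrow> \<exists>(s, t)\<in>P x. a < s \<and> t < y \<or> y < s \<and> t < a"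
    if "x \<in> X" for x using dnP[OF that] unfolding ok_def by blast+
  have "X \<subseteq> (\<Union>x\<in>X. ball x (d x))" using okD(1) by auto
  then obtain D where D: "D \<subseteq> X" "finite D" "X \<subseteq> (\<Union>x\<in>D. ball x (d x))"
    using compactE_image[OF X, of X "\<lambda>x. ball x (d x)"] by (metis open_ball)
  \<comment> \<open>At most every \<open>d x\<close>, so that the block around \<open>z\<close>
    stays within the neighbourhood of radius \<open>2 * d x\<close> that the core covers.\<close>
  define \<delta> where "\<delta> = Min (insert \<rho> (d ` D))"
  have \<delta>: "0 < \<delta>" "\<delta> \<le> \<rho>" "\<And>x. x \<in> D \<Longrightarrow> \<delta> \<le> d x"
    unfolding \<delta>_def using D(1,2) okD(1) rho_pos by (auto simp: Min_gr_iff)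
  have "X \<subseteq> (\<Union>x\<in>X. ball x (\<delta> / 2))" using \<delta>(1) by auto
  then obtain D' where D': "D' \<subseteq> X" "finite D'" "X \<subseteq> (\<Union>x\<in>D'. ball x (\<delta> / 2))"
    using compactE_image[OF X, of X "\<lambda>x. ball x (\<delta> / 2)"] by (metis open_ball)
  have "\<exists>q. big (fst q) (snd q) \<and> {fst q..snd q} = M \<inter> {x - \<delta> / 2..x + \<delta> / 2}" if h: "x \<in> X" for x
  proof -
    have "0 < \<delta> / 2" "\<delta> / 2 \<le> \<rho>" using \<delta>(1,2) by auto
    then obtain u v where "big u v" "{u..v} = M \<inter> {x - \<delta> / 2..x + \<delta> / 2}"
      using big_nbhd[OF XM(2)[OF h]] by metis
    then show ?thesis by (intro exI[of _ "(u, v)"]) simp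
  qed
  then obtain q where q: "\<And>x. x \<in> X \<Longrightarrow> big (fst (q x)) (snd (q x))"
    "\<And>x. x \<in> X \<Longrightarrow> {fst (q x)..snd (q x)} = M \<inter> {x - \<delta> / 2..x + \<delta> / 2}" by metis
  \<comment> \<open>Besides the walls, \<open>R\<close> contains finitely many intervals such that
    the \<open>\<delta>\<close>-neighbourhood of every point of \<open>X\<close> contains one of
    them. They bound the return time if the radius reaches \<open>\<delta>\<close> with no wall
    covered.\<close>
  define R where "R = (\<Union>x\<in>D. P x) \<union> q ` D'"
  have finR: "finite R" unfolding R_def using D(1,2) D'(2) okD(5) by auto
  have bigR: "\<forall>(s, t)\<in>R. big s t"
  proof (intro ballI, clarify)
    fix s t assume "(s, t) \<in> R"
    then show "big s t"
    proof (unfold R_def, elim UnE)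
      assume "(s, t) \<in> (\<Union>x\<in>D. P x)"
      then obtain x where "x \<in> D" "(s, t) \<in> P x" by blast
      then show "big s t" using okD(6)[of x] D(1) by blast
    next
      assume "(s, t) \<in> q ` D'"
      then obtain x where "x \<in> D'" "q x = (s, t)" by (metis imageE)
      then show "big s t" using q(1)[of x] D'(1) by auto
    qed
  qed
  obtain G1 where G1: "\<forall>(s, t)\<in>R. \<exists>n\<le>G1. {c1..c2} \<subseteq> (f ^^ n) ` {s..t}"
    using reach_C_finite[OF finR bigR] by blast
  define G where "G = Max (insert 0 (n ` D)) + G1 + r"
  have nG: "n x \<le> G" if "x \<in> D" for x
  proof -
    have "n x \<le> Max (insert 0 (n ` D))" using that D(2) by (intro Max_ge) auto
    then show ?thesis unfolding G_def by simp
  qed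
  have "\<exists>u v a b. big u v \<and> {u..v} \<subseteq> (f ^^ a) ` {c1..c2} \<and> {c1..c2} \<subseteq> (f ^^ b) ` {u..v} \<and>
    a \<le> G \<and> N \<le> b \<and> b \<le> N + G \<and>
    (\<forall>y\<in>{u..v}. \<forall>i<N. (f ^^ i) z \<notin> O' \<longrightarrow> \<bar>(f ^^ i) y - (f ^^ i) z\<bar> \<le> 2 * \<epsilon>)" if z: "z \<in> X" for N z
  proof -
    have Rlt: "s < t" if "(s, t) \<in> R" for s t using bigR that unfolding big_def by auto
    obtain \<tau> where \<tau>: "0 < \<tau>" "\<tau> \<le> \<delta>"
      "\<tau> = \<delta> \<or> (\<exists>i\<le>N. \<exists>(s, t)\<in>R. {s..t} \<subseteq> (f ^^ i) ` (M \<inter> {z - \<tau>..z + \<tau>}))"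
      and nj: "\<forall>y\<in>M \<inter> {z - \<tau>..z + \<tau>}. \<forall>i\<le>N. \<forall>(s, t)\<in>R.
        \<not> ((f ^^ i) z < s \<and> t < (f ^^ i) y) \<and> \<not> ((f ^^ i) y < s \<and> t < (f ^^ i) z)"
      using critical_radius[OF XM(1)[OF z] \<delta>(1,2) finR Rlt, of N] by blast
    have \<tau>r: "\<tau> \<le> \<rho>" using \<tau>(2) \<delta>(2) by simp
    obtain u v where uv: "big u v" "u \<le> z" "z \<le> v" "{u..v} = M \<inter> {z - \<tau>..z + \<tau>}"
      using big_nbhd[OF XM(2)[OF z] \<tau>(1) \<tau>r] .
    obtain x where x: "x \<in> D" "\<bar>z - x\<bar> < d x" using D(3) z by (force simp: dist_real_def)
    have "M \<inter> {z - \<tau>..z + \<tau>} \<subseteq> M \<inter> {x - 2 * d x..x + 2 * d x}"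
      using x(2) \<delta>(3)[OF x(1)] \<tau>(2) by (auto simp: abs_if split: if_splits)
    then have acc: "{u..v} \<subseteq> (f ^^ n x) ` {c1..c2}"
      unfolding uv(4) using okD(4)[of x] x(1) D(1) by (meson order_trans subsetD)
    have "\<exists>s t i. (s, t) \<in> R \<and> i \<le> N \<and> {s..t} \<subseteq> (f ^^ i) ` {u..v}"
      using \<tau>(3)
    proof
      assume eq: "\<tau> = \<delta>"
      obtain x' where "x' \<in> D'" "z \<in> ball x' (\<delta> / 2)" using D'(3) z by blast
      then have x': "x' \<in> D'" "\<bar>z - x'\<bar> < \<delta> / 2"
        by (simp_all add: dist_real_def abs_minus_commute)
      have "{fst (q x')..snd (q x')} \<subseteq> {u..v}"
        unfolding uv(4) eq q(2)[OF subsetD[OF D'(1) x'(1)]] using x'(2) by (auto simp: abs_if split: if_splits)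
      moreover have "(fst (q x'), snd (q x')) \<in> R" unfolding R_def using x'(1) by simp
      ultimately show ?thesis
        by (intro exI[of _ "fst (q x')"] exI[of _ "snd (q x')"] exI[of _ 0]) simp
    next
      assume "\<exists>i\<le>N. \<exists>(s, t)\<in>R. {s..t} \<subseteq> (f ^^ i) ` (M \<inter> {z - \<tau>..z + \<tau>})"
      then show ?thesis unfolding uv(4) by blast
    qed
    then obtain s t i where st: "(s, t) \<in> R" "i \<le> N" "{s..t} \<subseteq> (f ^^ i) ` {u..v}" by blast
    obtain m where m: "m \<le> G1" "{c1..c2} \<subseteq> (f ^^ m) ` {s..t}" using G1 st(1) by blast
    obtain b where b: "N \<le> b" "b \<le> N + G1 + r" "{c1..c2} \<subseteq> (f ^^ b) ` {u..v}"
      using leave_block[OF st(3) m(2,1) st(2)] by blast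
    have "\<bar>(f ^^ i) y - (f ^^ i) z\<bar> \<le> 2 * \<epsilon>" if y: "y \<in> {u..v}" and i: "i < N" and zi: "(f ^^ i) z \<notin> O'" for y i
    proof -
      have "(f ^^ i) z \<in> X" unfolding X_def using zi fn_B[OF XM(2)[OF z]] by blast
      then obtain x where x: "x \<in> D" "\<bar>(f ^^ i) z - x\<bar> < d x" using D(3) by (force simp: dist_real_def)
      have xX: "x \<in> X" using x(1) D(1) by blast
      have "\<bar>(f ^^ i) y - x\<bar> \<le> \<epsilon>"
      proof (rule ccontr)
        assume "\<not> ?thesis"
        then obtain s t where st: "(s, t) \<in> P x"
          "(f ^^ i) z < s \<and> t < (f ^^ i) y \<or> (f ^^ i) y < s \<and> t < (f ^^ i) z"
          using okD(7)[OF xX x(2), of "(f ^^ i) y"] by auto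
        have "(s, t) \<in> R" unfolding R_def using st(1) x(1) by blast
        moreover have "y \<in> M \<inter> {z - \<tau>..z + \<tau>}" using y uv(4) by blast
        ultimately show False using nj st(2) less_imp_le[OF i] by blast
      qed
      then show ?thesis using x(2) okD(2)[OF xX] by linarith
    qed
    moreover have "n x \<le> G" "b \<le> N + G" using nG[OF x(1)] b(2) unfolding G_def by auto
    ultimately show ?thesis using uv(1) acc b(1,3) by blast
  qed
  then show ?thesis unfolding X_def by blast
qed

text \<open>Leaving from the core and coming back to it, links can be concatenated in any order.\<close>

definition link :: "real \<Rightarrow> real \<Rightarrow> nat \<Rightarrow> nat \<Rightarrow> bool" where
  "link u v a b \<longleftrightarrow> big u v \<and> {u..v} \<subseteq> (f ^^ a) ` {c1..c2} \<and> {c1..c2} \<subseteq> (f ^^ b) ` {u..v}"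

text \<open>A point of \<open>B\<close> off \<open>F\<close> inside the interval is accessible from
  the core, and a short big interval at it returns to the core.\<close>

lemma link_visit:
  assumes "big u v"
  shows "\<exists>u' v' a b. {u'..v'} \<subseteq> {u..v} \<and> link u' v' a b"
proof -
  have "infinite (B \<inter> {u..v} - F)" using big_infinite[OF assms] F_finite by (simp add: Diff_infinite_finite)
  from infinite_subset_card[OF this, of 1] obtain T s e where T: "T \<subseteq> B \<inter> {u..v} - F" "s \<in> B \<inter> {u..v} - F" "e \<in> B \<inter> {u..v} - F" "finite T" "card T = 1" "s < e" "T \<subseteq> {s<..<e}"
    by blast
  obtain x where x: "T = {x}" using T(5) by (rule card_1_singletonE)
  have "x \<in> B" "x \<notin> F" using T(1) unfolding x by simp_all
  moreover have "x \<in> {s<..<e}" "u \<le> s" "e \<le> v" using T(2,3,7) unfolding x by simp_all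
  ultimately have xB: "x \<in> B" "x \<in> M - F" "u < x" "x < v" using subsetD[OF B_sub_M, of x] by simp_all
  obtain d n where d: "0 < d" "d \<le> \<rho>" "M \<inter> {x - d..x + d} \<subseteq> (f ^^ n) ` {c1..c2}"
    using accessible[OF xB(2)] by blast
  define d' where "d' = min d (min (x - u) (v - x))"
  have d': "0 < d'" "d' \<le> d" "d' \<le> \<rho>" "d' \<le> x - u" "d' \<le> v - x" unfolding d'_def using d xB by auto
  obtain u' v' where uv: "big u' v'" "{u'..v'} = M \<inter> {x - d'..x + d'}"
    using big_nbhd[OF xB(1) d'(1,3)] by metis
  obtain b where b: "{c1..c2} \<subseteq> (f ^^ b) ` {u'..v'}" using reach_C[OF uv(1)] by blast
  have "M \<inter> {x - d'..x + d'} \<subseteq> M \<inter> {x - d..x + d}" using d'(2) by auto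
  then have "{u'..v'} \<subseteq> (f ^^ n) ` {c1..c2}" unfolding uv(2) using d(3) by (rule order_trans)
  then have "link u' v' n b" unfolding link_def using uv(1) b by blast
  moreover have "{u'..v'} \<subseteq> {u..v}" unfolding uv(2) using d'(4,5) by auto
  ultimately show ?thesis by blast
qed

definition start :: "(nat \<Rightarrow> nat) \<Rightarrow> (nat \<Rightarrow> nat) \<Rightarrow> nat \<Rightarrow> nat" where
  "start a b j = (\<Sum>i<j. a i + b i)"

lemma start_Suc: "start a b (Suc j) = start a b j + (a j + b j)" unfolding start_def by simp

text \<open>Chains of links visit the core at even positions and the blocks at odd ones, with
  \<open>a j\<close> steps out and \<open>b j\<close> steps back.\<close>

definition weave :: "(nat \<Rightarrow> 'c) \<Rightarrow> (nat \<Rightarrow> 'c) \<Rightarrow> nat \<Rightarrow> 'c" where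
  "weave a b i = (if even i then a (i div 2) else b (i div 2))"

lemma weave_simps [simp]:
  "weave a b (2 * j) = a j" "weave a b (Suc (2 * j)) = b j" unfolding weave_def by simp_all

lemma weave_sum:
  "(\<Sum>i<2 * j. weave a b i) = start a b j" "(\<Sum>i<Suc (2 * j). weave a b i) = start a b j + a j"
proof -
  show "(\<Sum>i<2 * j. weave a b i) = start a b j" by (induction j) (simp_all add: start_def)
  then show "(\<Sum>i<Suc (2 * j). weave a b i) = start a b j + a j" by simp
qed

lemma periodic_links:
  assumes "\<And>j. j < J \<Longrightarrow> link (u j) (v j) (a j) (b j)"
  shows "\<exists>y\<in>B. (f ^^ (2 * start a b J)) y = y \<and> (\<forall>j<J. (f ^^ (start a b j + a j)) y \<in> {u j..v j} \<and>
    (f ^^ (start a b J + (start a b j + a j))) y \<in> {u j..v j})"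
proof -
  \<comment> \<open>Padding by the core beyond \<open>J\<close>, because
    \<open>periodic_chain\<close> wants big intervals at all indices.\<close>
  define u' v' where "u' j = (if j < J then u j else c1)" and "v' j = (if j < J then v j else c2)" for j
  define U V where "U = weave (\<lambda>_. c1) u'" and "V = weave (\<lambda>_. c2) v'"
  have big': "big (u' j) (v' j)" for j
    unfolding u'_def v'_def using assms[of j] C_big unfolding link_def by auto
  have "big (U i) (V i)" for i unfolding U_def V_def weave_def using big' C_big by auto
  moreover have "{U (Suc i)..V (Suc i)} \<subseteq> (f ^^ weave a b i) ` {U i..V i}" if "i < 2 * J" for i
  proof (cases "even i")
    case True
    then obtain j where j: "i = 2 * j" by blast
    then have "j < J" using that by simp
    then show ?thesis using assms[of j] unfolding j U_def V_def weave_simps link_def u'_def v'_def by simp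
  next
    case False
    then obtain j where j: "i = Suc (2 * j)" by (metis oddE Suc_eq_plus1)
    then have "j < J" using that by simp
    moreover have "Suc (Suc (2 * j)) = 2 * Suc j" by simp
    ultimately show ?thesis using assms[of j] unfolding j U_def V_def link_def u'_def v'_def
      by (simp only: weave_simps if_True)
  qed
  moreover have "U 0 = c1" "V 0 = c2" "U (2 * J) = c1" "V (2 * J) = c2"
    unfolding U_def V_def by (simp_all add: weave_def)
  ultimately obtain y where y: "y \<in> B" "(f ^^ (2 * (\<Sum>i<2*J. weave a b i))) y = y"
    "\<And>i. i \<le> 2 * J \<Longrightarrow> (f ^^ (\<Sum>i<i. weave a b i)) y \<in> {U i..V i} \<and>
      (f ^^ ((\<Sum>i<2*J. weave a b i) + (\<Sum>i<i. weave a b i))) y \<in> {U i..V i}"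
    using periodic_chain[of U V "2 * J" "weave a b"] by blast
  have "(f ^^ (start a b j + a j)) y \<in> {u j..v j} \<and> (f ^^ (start a b J + (start a b j + a j))) y \<in> {u j..v j}"
    if "j < J" for j
  proof -
    have "Suc (2 * j) \<le> 2 * J" using that by simp
    from y(3)[OF this] show ?thesis
      unfolding weave_sum U_def V_def weave_simps u'_def v'_def using that by simp
  qed
  then show ?thesis using y(1,2) unfolding weave_sum by blast
qed

lemma infinite_links:
  assumes big0: "big u0 v0" and b0: "{c1..c2} \<subseteq> (f ^^ b0) ` {u0..v0}"
    and links: "\<And>j. link (u j) (v j) (a j) (b j)"
  shows "\<exists>y\<in>B \<inter> {u0..v0}. \<forall>j. (f ^^ (b0 + start a b j + a j)) y \<in> {u j..v j}"
proof -
  define U V where "U = case_nat u0 (weave (\<lambda>_. c1) u)" and "V = case_nat v0 (weave (\<lambda>_. c2) v)"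
  define n where "n = case_nat b0 (weave a b)"
  have "big (weave (\<lambda>_. c1) u i) (weave (\<lambda>_. c2) v i)" for i
    unfolding weave_def using links C_big unfolding link_def by auto
  then have "big (U i) (V i)" for i unfolding U_def V_def using big0 by (cases i) auto
  moreover have "{U (Suc i)..V (Suc i)} \<subseteq> (f ^^ n i) ` {U i..V i}" for i
  proof (cases i)
    case 0
    then show ?thesis unfolding U_def V_def n_def using b0 by (simp add: weave_def)
  next
    case (Suc i')
    have "{weave (\<lambda>_. c1) u (Suc i')..weave (\<lambda>_. c2) v (Suc i')} \<subseteq>
      (f ^^ weave a b i') ` {weave (\<lambda>_. c1) u i'..weave (\<lambda>_. c2) v i'}"
    proof (cases "even i'")
      case True
      then obtain j where j: "i' = 2 * j" by blast
      then show ?thesis using links[of j] unfolding j weave_simps link_def by simp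
    next
      case False
      then obtain j where j: "i' = Suc (2 * j)" by (metis oddE Suc_eq_plus1)
      moreover have "Suc (Suc (2 * j)) = 2 * Suc j" by simp
      ultimately show ?thesis using links[of j] unfolding j link_def by (simp only: weave_simps)
    qed
    then show ?thesis unfolding Suc U_def V_def n_def by simp
  qed
  ultimately obtain y where y: "y \<in> B \<inter> {U 0..V 0}" "\<And>i. (f ^^ (\<Sum>i<i. n i)) y \<in> {U i..V i}"
    using infinite_chain[of U V n] by blast
  have sum_n: "(\<Sum>i<Suc m. n i) = b0 + (\<Sum>i<m. weave a b i)" for m
    unfolding n_def by (induction m) simp_all
  have "(f ^^ (b0 + start a b j + a j)) y \<in> {u j..v j}" for j
    using y(2)[of "Suc (Suc (2 * j))"] unfolding sum_n weave_sum
    by (simp add: U_def V_def add.assoc)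
  moreover have "y \<in> B \<inter> {u0..v0}" using y(1) unfolding U_def V_def by simp
  ultimately show ?thesis by blast
qed

text \<open>The factor 2 arises because the orbit from \<open>periodic_links\<close> passes through every block twice.\<close>

lemma periodic_block_sums:
  assumes links: "\<And>j. j < J \<Longrightarrow> link (u j) (v j) (a j) (b j)" and len: "\<And>j. j < J \<Longrightarrow> k j + N j \<le> b j"
  shows "\<exists>y\<in>B. (f ^^ (2 * start a b J)) y = y \<and> (\<forall>j<J. \<exists>i. (f ^^ i) y \<in> {u j..v j}) \<and>
    (\<forall>\<phi> K g. (\<forall>x\<in>B. - K \<le> \<phi> x) \<longrightarrow>
       (\<forall>j<J. \<forall>x\<in>B \<inter> {u j..v j}. \<forall>i<N j. g j i \<le> \<phi> ((f ^^ (k j + i)) x)) \<longrightarrow>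
       2 * (\<Sum>j<J. \<Sum>i<N j. g j i) - K * (2 * real (start a b J) - 2 * (\<Sum>j<J. real (N j)))
         \<le> (\<Sum>i<2 * start a b J. \<phi> ((f ^^ i) y)))"
proof -
  obtain y where y: "y \<in> B" "(f ^^ (2 * start a b J)) y = y"
    "\<And>j. j < J \<Longrightarrow> (f ^^ (start a b j + a j)) y \<in> {u j..v j}"
    "\<And>j. j < J \<Longrightarrow> (f ^^ (start a b J + (start a b j + a j))) y \<in> {u j..v j}"
    using periodic_links[of J u v a b] links by blast
  define T where "T = start a b J"
  \<comment> \<open>Window \<open>j\<close> opens \<open>k j\<close> steps after the arrival in
    block \<open>j\<close>; the value \<open>T\<close> at \<open>J\<close> marks the end of the
    run.\<close>
  define s where "s j = (if j < J then start a b j + a j + k j else T)" for j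
  have sJ: "s J = T" unfolding s_def by simp
  have sep: "s j + N j \<le> s (Suc j)" if "j < J" for j
  proof (cases "Suc j < J")
    case True
    then show ?thesis using len[OF that] that unfolding s_def start_Suc by simp
  next
    case False
    then have "Suc j = J" using that by simp
    then have "T = start a b j + (a j + b j)" unfolding T_def using start_Suc[of a b j] by simp
    then show ?thesis using len[OF that] that \<open>Suc j = J\<close> unfolding s_def by simp
  qed
  have main: "2 * (\<Sum>j<J. \<Sum>i<N j. g j i) - K * (2 * real T - 2 * (\<Sum>j<J. real (N j))) \<le> (\<Sum>i<2 * T. \<phi> ((f ^^ i) y))"
    if low: "\<And>x. x \<in> B \<Longrightarrow> - K \<le> \<phi> x"
      and g: "\<And>j x i. j < J \<Longrightarrow> x \<in> B \<Longrightarrow> x \<in> {u j..v j} \<Longrightarrow> i < N j \<Longrightarrow> g j i \<le> \<phi> ((f ^^ (k j + i)) x)" for \<phi> K g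
  proof -
    \<comment> \<open>The two runs through the itinerary start at offsets 0 and \<open>T\<close> and
      are estimated separately.\<close>
    have half: "(\<Sum>j<J. \<Sum>i<N j. g j i) - K * (real T - (\<Sum>j<J. real (N j))) \<le> (\<Sum>i<T. \<phi> ((f ^^ (off + i)) y))"
      if off: "\<And>j. j < J \<Longrightarrow> (f ^^ (off + (start a b j + a j))) y \<in> {u j..v j}" for off
    proof -
      have "(\<Sum>j<J. \<Sum>i<N j. g j i) - K * (real (s J) - (\<Sum>j<J. real (N j))) \<le> (\<Sum>i<s J. \<phi> ((f ^^ (off + i)) y))"
      proof (rule window_sum_lower[where h = "\<lambda>i. \<phi> ((f ^^ (off + i)) y)" and s = s and g = g and N = N and J = J and K = K])
        show "s j + N j \<le> s (Suc j)" if "j < J" for j using that by (rule sep)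
        show "- K \<le> \<phi> ((f ^^ (off + i)) y)" for i using low fn_B[OF y(1)] by blast
        show "g j i \<le> \<phi> ((f ^^ (off + (s j + i))) y)" if "j < J" "i < N j" for j i
        proof -
          have "off + (s j + i) = off + (start a b j + a j) + (k j + i)" using that(1) unfolding s_def by simp
          then have "(f ^^ (off + (s j + i))) y = (f ^^ (k j + i)) ((f ^^ (off + (start a b j + a j))) y)"
            by (simp only: funpow_add_apply)
          then show ?thesis using g[OF that(1) fn_B[OF y(1)] off[OF that(1)] that(2)] by simp
        qed
      qed
      then show ?thesis unfolding sJ .
    qed
    have "(\<Sum>i<2 * T. \<phi> ((f ^^ i) y)) = (\<Sum>i<T. \<phi> ((f ^^ (0 + i)) y)) + (\<Sum>i<T. \<phi> ((f ^^ (T + i)) y))"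
      unfolding mult_2 sum_lessThan_add by simp
    moreover have "(\<Sum>j<J. \<Sum>i<N j. g j i) - K * (real T - (\<Sum>j<J. real (N j))) \<le> (\<Sum>i<T. \<phi> ((f ^^ (0 + i)) y))"
      by (rule half) (use y(3) in simp)
    moreover have "(\<Sum>j<J. \<Sum>i<N j. g j i) - K * (real T - (\<Sum>j<J. real (N j))) \<le> (\<Sum>i<T. \<phi> ((f ^^ (T + i)) y))"
      by (rule half) (use y(4) in \<open>simp add: T_def\<close>)
    ultimately show ?thesis by (simp add: algebra_simps)
  qed
  show ?thesis
  proof (rule bexI[OF _ y(1)], intro conjI allI impI)
    show "(f ^^ (2 * start a b J)) y = y" by (rule y(2))
    show "\<exists>i. (f ^^ i) y \<in> {u j..v j}" if "j < J" for j by (rule exI, rule y(3)[OF that])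
    fix \<phi> :: "real \<Rightarrow> real" and K :: real and g :: "nat \<Rightarrow> nat \<Rightarrow> real"
    assume low: "\<forall>x\<in>B. - K \<le> \<phi> x"
      and g: "\<forall>j<J. \<forall>x\<in>B \<inter> {u j..v j}. \<forall>i<N j. g j i \<le> \<phi> ((f ^^ (k j + i)) x)"
    show "2 * (\<Sum>j<J. \<Sum>i<N j. g j i) - K * (2 * real (start a b J) - 2 * (\<Sum>j<J. real (N j)))
         \<le> (\<Sum>i<2 * start a b J. \<phi> ((f ^^ i) y))" unfolding T_def[symmetric]
    proof (rule main)
      show "- K \<le> \<phi> x" if "x \<in> B" for x using low that by blast
      show "g j i \<le> \<phi> ((f ^^ (k j + i)) x)" if "j < J" "x \<in> B" "x \<in> {u j..v j}" "i < N j" for j x i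
        using g that by blast
    qed
  qed
qed

end

section \<open>From periodic intervals to core systems\<close>

locale interval_cycle =
  fixes f :: "real \<Rightarrow> real" and a b :: real and m :: nat
  assumes contf: "continuous_on {0..1} f" and self: "f ` {0..1} \<subseteq> {0..1}"
    and ab: "{a..b} \<subseteq> {0..1}" and m: "0 < m"
    and disj: "disjoint_family_on (\<lambda>i. (f ^^ i) ` {a..b}) {..<m}"
    and return: "(f ^^ m) ` {a..b} = {a..b}"
    and infin: "infinite (basic_points f (\<Union>i<m. (f ^^ i) ` {a..b}))"
begin

definition I where "I i = (f ^^ i) ` {a..b}"
definition M where "M = (\<Union>i<m. I i)"

lemma I_add: "I (n + k) = (f ^^ n) ` I k" unfolding I_def by (rule funpow_image_add)

lemma I_mod: "I n = I (n mod m)"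
proof -
  have "I (q * m) = I 0" for q by (induction q) (simp_all add: I_add[of m], simp add: I_def return)
  then have "I (n mod m + n div m * m) = (f ^^ (n mod m)) ` I 0" by (simp only: I_add)
  then show ?thesis by (simp add: I_def)
qed

lemma I_01: "I i \<subseteq> {0..1}"
  unfolding I_def using funpow_image_subset[OF self] ab by (meson image_mono order_trans)

lemma cont_fn: "continuous_on {0..1} (f ^^ n)" by (rule funpow_continuous_on[OF contf self])

lemma I_return: "(f ^^ m) ` I i = I i" using I_add[of m i] I_mod[of "m + i"] I_mod[of i] by simp

lemma M_mod: "I i \<subseteq> M"
  unfolding M_def using I_mod[of i] m by (simp only:) (rule UN_upper, simp)

lemma infinite_M: "infinite M"
proof -
  have "basic_points f M \<subseteq> M" unfolding basic_points_def by blast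
  then show ?thesis using infin finite_subset unfolding M_def I_def by blast
qed

lemma I_interval: "\<exists>u v. u < v \<and> I i = {u..v}"
proof -
  have inf0: "infinite (I j)" for j
  proof
    assume fin: "finite (I j)"
    have "finite (I k)" for k
    proof -
      have "j * 1 \<le> j * m" by (rule mult_le_mono2) (use m in simp)
      then have "j \<le> k + j * m" by linarith
      then have "I (k + j * m) = (f ^^ (k + j * m - j)) ` I j" using I_add[of "k + j * m - j" j] by simp
      then show ?thesis using fin I_mod[of "k + j * m"] I_mod[of k] by simp
    qed
    then show False using infinite_M unfolding M_def by simp
  qed
  have "a \<le> b" using inf0[of 0] unfolding I_def by (cases "a \<le> b") auto
  moreover have "continuous_on {a..b} (f ^^ i)" by (rule continuous_on_subset[OF cont_fn ab])
  ultimately obtain u v where uv: "I i = {u..v}" "u \<le> v"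
    unfolding I_def using continuous_image_closed_interval by blast
  then have "u \<noteq> v" using inf0[of i] by auto
  then show ?thesis using uv by (intro exI[of _ u] exI[of _ v]) auto
qed

lemma I_compact: "compact (I i)" using I_interval[of i] by auto

lemma f_I: "f ` I i = I (Suc i)" using I_add[of 1 i] by simp

lemma f_M: "f ` M = M"
proof
  show "f ` M \<subseteq> M" unfolding M_def image_UN f_I using M_mod unfolding M_def by blast
  show "M \<subseteq> f ` M"
  proof
    fix x assume "x \<in> M"
    then obtain i where "x \<in> I i" unfolding M_def by blast
    then have "x \<in> I (i + m)" using I_mod[of i] I_mod[of "i + m"] by simp
    moreover have "i + m = Suc (i + m - 1)" using m by simp
    ultimately have "x \<in> f ` I (i + m - 1)" unfolding f_I by simp
    then show "x \<in> f ` M" using M_mod by blast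
  qed
qed

lemma M_compact: "compact M" unfolding M_def by (intro compact_UN) (auto intro: I_compact)

lemma M_01: "M \<subseteq> {0..1}" unfolding M_def using I_01 by blast

lemma M_cont: "continuous_on M f" by (rule continuous_on_subset[OF contf M_01])

definition rest where "rest i = (\<Union>j\<in>{..<m} - {i}. I j)"

lemma rest: "closed (rest i)" "i < m \<Longrightarrow> M = I i \<union> rest i" "i < m \<Longrightarrow> I i \<inter> rest i = {}"
proof -
  show "closed (rest i)" unfolding rest_def by (intro closed_UN) (auto intro: compact_imp_closed I_compact)
  show "i < m \<Longrightarrow> M = I i \<union> rest i" unfolding M_def rest_def by blast
  show "i < m \<Longrightarrow> I i \<inter> rest i = {}"
    unfolding rest_def using disj unfolding disjoint_family_on_def I_def by blast
qed

lemma connected_in_one: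
  assumes "connected A" "A \<subseteq> M" "A \<noteq> {}"
  shows "\<exists>i<m. A \<subseteq> I i"
proof -
  obtain x where "x \<in> A" using assms(3) by blast
  then obtain i where i: "i < m" "x \<in> I i" using assms(2) unfolding M_def by blast
  have "I i \<inter> A = {} \<or> rest i \<inter> A = {}" by (rule connected_closedD[OF assms(1)])
      (use rest[of i] i assms(2) compact_imp_closed[OF I_compact] in auto)
  then have "rest i \<inter> A = {}" using \<open>x \<in> A\<close> i by blast
  then show ?thesis using i(1) rest(2)[OF i(1)] assms(2) by blast
qed

lemma separation: "\<exists>\<rho>>0. \<forall>i<m. \<forall>x\<in>I i. \<forall>y\<in>rest i. \<rho> < dist x y"
proof -
  have "\<exists>d>0. \<forall>x\<in>I i. \<forall>y\<in>rest i. d \<le> dist x y" if "i < m" for i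
    by (rule separate_compact_closed[OF I_compact rest(1) rest(3)[OF that]])
  then obtain d where d: "\<And>i. i < m \<Longrightarrow> d i > 0" "\<And>i x y. i < m \<Longrightarrow> x \<in> I i \<Longrightarrow> y \<in> rest i \<Longrightarrow> d i \<le> dist x y"
    by metis
  define \<rho> where "\<rho> = Min (d ` {..<m}) / 2"
  have pos: "Min (d ` {..<m}) > 0" using d(1) m by (subst Min_gr_iff) auto
  have less: "\<rho> < d i" if "i < m" for i
  proof -
    have "Min (d ` {..<m}) \<le> d i" using that by (intro Min_le) auto
    then show ?thesis using pos unfolding \<rho>_def by linarith
  qed
  have "\<rho> < dist x y" if "i < m" "x \<in> I i" "y \<in> rest i" for i x y
    using less[OF that(1)] d(2)[OF that] by linarith
  moreover have "\<rho> > 0" unfolding \<rho>_def using pos by simp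
  ultimately show ?thesis by blast
qed

lemma iterate_interval:
  assumes "u < v" "{u..v} \<subseteq> M" "closure (orb f {u..v}) = M"
  shows "\<exists>u' v'. u' < v' \<and> (f ^^ s) ` {u..v} = {u'..v'}"
proof (induction s)
  case 0
  then show ?case using assms(1) by auto
next
  case (Suc s)
  then obtain u' v' where u'v': "u' < v'" "(f ^^ s) ` {u..v} = {u'..v'}" by blast
  have sub: "{u'..v'} \<subseteq> M" unfolding u'v'(2)[symmetric]
    using funpow_image_subset[of f M s] f_M assms(2) by (metis image_mono order_refl order_trans)
  have dense: "closure (orb f {u'..v'}) = M"
    unfolding u'v'(2)[symmetric] by (rule tail_dense[OF compact_imp_closed[OF M_compact] M_cont f_M assms(2,3)])
  have eq: "(f ^^ Suc s) ` {u..v} = f ` {u'..v'}" unfolding u'v'(2)[symmetric] by (simp add: image_comp)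
  obtain u2 v2 where 2: "f ` {u'..v'} = {u2..v2}" "u2 \<le> v2"
    using continuous_image_closed_interval[of u' v' f] u'v'(1) continuous_on_subset[OF M_cont sub] by auto
  have "f ` {u'..v'} \<noteq> {u2}"
    by (rule image_not_degenerate[OF compact_imp_closed[OF M_compact] infinite_M M_cont f_M sub u'v'(1) dense])
  then have "u2 < v2" using 2 by (cases "u2 = v2") auto
  then show ?case using eq 2(1) by (intro exI[of _ u2] exI[of _ v2]) simp
qed

text \<open>The components are disjoint and permuted cyclically, so the orbit of \<open>A\<close>
  visits \<open>I j\<close> only at multiples of \<open>m\<close>; these visits form the orbit under
  \<open>f ^^ m\<close>.\<close>

lemma orbit_dense_in_component:
  assumes j: "j < m" and A: "A \<subseteq> I j" and dense: "closure (orb f A) = M"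
  shows "closure (orb (f ^^ m) A) = I j"
proof
  have "orb (f ^^ m) A \<subseteq> I j" by (rule orb_invariant_subset[OF _ A]) (simp add: I_return)
  then show "closure (orb (f ^^ m) A) \<subseteq> I j"
    by (rule closure_minimal[OF _ compact_imp_closed[OF I_compact]])
  show "I j \<subseteq> closure (orb (f ^^ m) A)"
  proof
    fix x assume x: "x \<in> I j"
    show "x \<in> closure (orb (f ^^ m) A)"
    proof (rule in_closureI)
      fix U assume U: "open U" "x \<in> U"
      have "open (U \<inter> - rest j)" using U(1) rest(1) by (intro open_Int open_Compl)
      moreover have "x \<in> U \<inter> - rest j" "x \<in> M" using U x rest(2,3)[OF j] by auto
      ultimately obtain y where y: "y \<in> orb f A" "y \<in> U" "y \<notin> rest j"
        using dense_meets_open[OF dense] by blast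
      then obtain n z where n: "z \<in> A" "y = (f ^^ n) z" unfolding orb_def by blast
      define k where "k = (n + j) mod m"
      have "y \<in> (f ^^ n) ` I j" using n A by blast
      then have "y \<in> I k" unfolding I_add[symmetric] k_def using I_mod by blast
      moreover have "k < m" unfolding k_def using m by simp
      ultimately have "k = j" using y(3) unfolding rest_def by blast
      have "(n + j) mod m = j mod m" using \<open>k = j\<close> j unfolding k_def by simp
      then have "m dvd n" using mod_eq_dvd_iff_nat[of j "n + j" m] by simp
      then obtain q where "n = m * q" ..
      then have "y \<in> ((f ^^ m) ^^ q) ` A" using n by (simp add: funpow_mult)
      then show "\<exists>y\<in>orb (f ^^ m) A. y \<in> U" using y(2) unfolding orb_def by blast
    qed
  qed
qed

lemma basic_system_exists: "\<exists>F \<rho>. basic_system f M F \<rho>"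
proof -
  obtain \<rho> where \<rho>: "\<rho> > 0" "\<And>i x y. i < m \<Longrightarrow> x \<in> I i \<Longrightarrow> y \<in> rest i \<Longrightarrow> \<rho> < dist x y"
    using separation by blast
  obtain l h where lh: "\<And>i. l i < h i" "\<And>i. I i = {l i..h i}" using I_interval by metis
  have "\<exists>F. finite F \<and> (\<forall>u v l1 l2. u < v \<longrightarrow> {u..v} \<subseteq> {l i..h i} \<longrightarrow> closure (orb (f ^^ m) {u..v}) = {l i..h i}
           \<longrightarrow> l1 \<le> l2 \<longrightarrow> {l1..l2} \<subseteq> {l i<..<h i} - F \<longrightarrow> (\<exists>n. {l1..l2} \<subseteq> ((f ^^ m) ^^ n) ` {u..v}))" for i
  proof (rule covers_off_finite_set[OF lh(1)])
    show "continuous_on {l i..h i} (f ^^ m)"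
      unfolding lh(2)[symmetric] by (rule continuous_on_subset[OF cont_fn I_01])
    show "(f ^^ m) ` {l i..h i} = {l i..h i}" unfolding lh(2)[symmetric] by (rule I_return)
  qed
  then obtain F where F: "\<And>i. finite (F i)"
    "\<And>i u v l1 l2. u < v \<Longrightarrow> {u..v} \<subseteq> I i \<Longrightarrow> closure (orb (f ^^ m) {u..v}) = I i
           \<Longrightarrow> l1 \<le> l2 \<Longrightarrow> {l1..l2} \<subseteq> {l i<..<h i} - F i \<Longrightarrow> \<exists>n. {l1..l2} \<subseteq> ((f ^^ m) ^^ n) ` {u..v}"
    unfolding lh(2) by metis
  \<comment> \<open>The covering result for one component speaks of its open interval, so the
    endpoints of all components join the exceptional set.\<close>
  define FF where "FF = (\<Union>i<m. F i \<union> {l i, h i})"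
  have "basic_system f M FF \<rho>"
  proof
    show "compact M" "M \<subseteq> {0..1}" "continuous_on M f" "f ` M = M" "0 < \<rho>"
      using M_compact M_01 M_cont f_M \<rho>(1) by simp_all
    show "finite FF" unfolding FF_def using F(1) by simp
    show "infinite (basic_points f M)" using infin unfolding M_def I_def .
    show "\<exists>u v. u < v \<and> u \<le> x \<and> x \<le> v \<and> M \<inter> {x - d..x + d} = {u..v}" if x: "x \<in> M" "0 < d" "d \<le> \<rho>" for x d
    proof -
      obtain i where i: "i < m" "x \<in> I i" using x(1) unfolding M_def by blast
      have "y \<notin> {x - d..x + d}" if "y \<in> rest i" for y
        using \<rho>(2)[OF i that] x(3) by (auto simp: dist_real_def abs_if split: if_splits)
      then have "M \<inter> {x - d..x + d} = I i \<inter> {x - d..x + d}" using rest(2)[OF i(1)] by blast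
      also have "\<dots> = {max (l i) (x - d)..min (h i) (x + d)}" unfolding lh(2) by auto
      finally show ?thesis using i(2) x(2) lh(1)[of i] unfolding lh(2)
        by (intro exI[of _ "max (l i) (x - d)"] exI[of _ "min (h i) (x + d)"]) auto
    qed
    show "\<exists>n. {l1..l2} \<subseteq> (f ^^ n) ` {u..v}"
      if uv: "u < v" "{u..v} \<subseteq> M" "closure (orb f {u..v}) = M" and L: "l1 \<le> l2" "{l1..l2} \<subseteq> M - FF" for u v l1 l2
    proof -
      obtain i where i: "i < m" "{u..v} \<subseteq> I i" using connected_in_one[of "{u..v}"] uv by auto
      obtain j where j: "j < m" "{l1..l2} \<subseteq> I j" using connected_in_one[of "{l1..l2}"] L by auto
      \<comment> \<open>Moves component \<open>i\<close> to component \<open>j\<close>; adding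
        \<open>m\<close> keeps the natural subtraction from being truncated.\<close>
      define s where "s = j + m - i"
      obtain u' v' where u'v': "u' < v'" "(f ^^ s) ` {u..v} = {u'..v'}" using iterate_interval[OF uv] by blast
      have "(f ^^ s) ` {u..v} \<subseteq> I (s + i)" unfolding I_add by (rule image_mono[OF i(2)])
      moreover have "I (s + i) = I j" using I_mod[of "s + i"] I_mod[of j] i(1) unfolding s_def by simp
      ultimately have sub: "{u'..v'} \<subseteq> I j" unfolding u'v'(2) by simp
      have "closure (orb f {u'..v'}) = M"
        unfolding u'v'(2)[symmetric] by (rule tail_dense[OF compact_imp_closed[OF M_compact] M_cont f_M uv(2,3)])
      from orbit_dense_in_component[OF j(1) sub this]
      have dense: "closure (orb (f ^^ m) {u'..v'}) = I j" .
      have "{l1..l2} \<subseteq> {l j<..<h j} - F j"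
      proof
        fix x assume x: "x \<in> {l1..l2}"
        then have "x \<in> {l j..h j}" "x \<notin> FF" using j(2) L(2) unfolding lh(2) by blast+
        then show "x \<in> {l j<..<h j} - F j" unfolding FF_def using j(1) by force
      qed
      from F(2)[OF u'v'(1) sub dense L(1) this] obtain n where "{l1..l2} \<subseteq> ((f ^^ m) ^^ n) ` {u'..v'}" by blast
      then have "{l1..l2} \<subseteq> (f ^^ (m * n + s)) ` {u..v}"
        unfolding funpow_mult u'v'(2)[symmetric] funpow_image_add .
      then show ?thesis by blast
    qed
  qed
  then show ?thesis by blast
qed

end

lemma core_system_of_basic_set:
  assumes "continuous_on {0..1} f" "f ` {0..1} \<subseteq> {0..1}" "basic_set f X"
  shows "\<exists>M F \<rho> c1 c2 r. core_system f M F \<rho> c1 c2 r \<and> X = basic_points f M"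
proof -
  obtain J m where J: "periodic_interval f J m" "X = basic_points f (\<Union>i<m. (f ^^ i) ` J)" "infinite X"
    using assms(3) unfolding basic_set_def by blast
  then obtain a b where Jab: "J = {a..b}" unfolding periodic_interval_def by blast
  interpret interval_cycle f a b m
    using assms(1,2) J unfolding Jab periodic_interval_def by unfold_locales auto
  have X: "X = basic_points f M" unfolding M_def I_def Jab[symmetric] by (rule J(2))
  obtain F \<rho> where sys: "basic_system f M F \<rho>" using basic_system_exists by blast
  obtain c1 c2 r where c: "{c1..c2} \<subseteq> M - F" "c2 \<in> basic_system.B f M" "basic_system.lbig f M c2"
    "basic_system.big f M c1 c2" "0 < r" "{c1..c2} \<subseteq> (f ^^ r) ` {c1..c2}"
    using basic_system.core_exists[OF sys] by blast
  have "core_system f M F \<rho> c1 c2 r"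
    by (rule core_system.intro[OF sys core_system_axioms.intro[OF c]])
  then show ?thesis using X by blast
qed

section \<open>Measures, moments and the weak topology\<close>

text \<open>Coefficients are rational and listed by increasing degree, so these test functions are
  countably many, as the Baire category arguments require.\<close>

definition rat_poly :: "rat list \<Rightarrow> real \<Rightarrow> real" where
  "rat_poly l x = (\<Sum>i<length l. of_rat (l ! i) * x ^ i)"

lemma continuous_on_rat_poly: "continuous_on S (rat_poly l)"
  unfolding rat_poly_def by (intro continuous_intros)

lemma rat_poly_approx:
  fixes \<phi> :: "real \<Rightarrow> real"
  assumes "compact S" "S \<subseteq> {0..1}" "continuous_on S \<phi>" "0 < e"
  shows "\<exists>l. \<forall>x\<in>S. \<bar>\<phi> x - rat_poly l x\<bar> < e"
proof -
  obtain g where g: "real_polynomial_function g" "\<And>x. x \<in> S \<Longrightarrow> \<bar>\<phi> x - g x\<bar> < e / 2"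
    using Stone_Weierstrass_real_polynomial_function[OF assms(1,3), of "e/2"] assms(4) by auto
  obtain a n where an: "g = (\<lambda>x. \<Sum>i\<le>n. a i * x ^ i)" using g(1) unfolding real_polynomial_function_iff_sum by blast
  have "\<exists>q. \<bar>a i - of_rat q\<bar> < e / (2 * (n + 1))" for i
  proof -
    have "e / (2 * (n + 1)) > 0" using assms(4) by simp
    then obtain q where "a i - e / (2 * (n + 1)) < of_rat q" "of_rat q < a i"
      using of_rat_dense[of "a i - e / (2 * (n + 1))" "a i"] by auto
    then show ?thesis by (intro exI[of _ q]) (simp add: abs_if)
  qed
  then obtain q where q: "\<And>i. \<bar>a i - of_rat (q i)\<bar> < e / (2 * (n + 1))" by metis
  define l where "l = map q [0..<Suc n]"
  have l: "rat_poly l x = (\<Sum>i\<le>n. of_rat (q i) * x ^ i)" for x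
    unfolding rat_poly_def l_def lessThan_Suc_atMost[symmetric]
    by (intro sum.cong) (simp_all del: upt_Suc)
  have "\<bar>\<phi> x - rat_poly l x\<bar> < e" if x: "x \<in> S" for x
  proof -
    have x01: "0 \<le> x" "x \<le> 1" using x assms(2) by auto
    have "g x - rat_poly l x = (\<Sum>i\<le>n. (a i - of_rat (q i)) * x ^ i)"
      unfolding an l by (simp add: sum_subtractf left_diff_distrib)
    also have "\<bar>\<dots>\<bar> \<le> (\<Sum>i\<le>n. e / (2 * (n + 1)))"
    proof (rule order_trans[OF sum_abs sum_mono])
      fix i
      have "\<bar>(a i - of_rat (q i)) * x ^ i\<bar> = \<bar>a i - of_rat (q i)\<bar> * x ^ i" using x01 by (simp add: abs_mult)
      also have "\<dots> \<le> \<bar>a i - of_rat (q i)\<bar> * 1" using x01 by (intro mult_left_mono power_le_one) auto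
      finally show "\<bar>(a i - of_rat (q i)) * x ^ i\<bar> \<le> e / (2 * (n + 1))" using q[of i] by simp
    qed
    also have "\<dots> = e / 2" by (simp add: field_simps)
    finally show ?thesis using g(2)[OF x] by linarith
  qed
  then show ?thesis by blast
qed

locale compact_dynamics =
  fixes f :: "real \<Rightarrow> real" and B :: "real set"
  assumes B_compact: "compact B" and B_01: "B \<subseteq> {0..1}" and B_ne: "B \<noteq> {}"
    and f_cont: "continuous_on B f" and f_self: "f ` B \<subseteq> B"
begin

abbreviation R where "R \<equiv> restrict_space borel B"

abbreviation (input) Prob ("\<P>") where "\<P> \<equiv> prob_measures_on B"

abbreviation (input) Inv ("\<M>") where "\<M> \<equiv> invariant_measures f B"

abbreviation (input) Inv_space ("\<X>") where "\<X> \<equiv> invariant_space f B"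

lemma B_closed: "closed B" using B_compact by (rule compact_imp_closed)

lemma B_borel: "B \<in> sets borel" using B_closed by simp

lemma sets_R: "A \<in> sets R \<longleftrightarrow> A \<subseteq> B \<and> A \<in> sets borel"
  using sets_restrict_space_iff[of B borel A] B_borel by simp

lemma space_R: "space R = B" by (simp add: space_restrict_space)

lemma prob_measures_D:
  assumes "\<mu> \<in> \<P>"
  shows "prob_space \<mu>" "sets \<mu> = sets R" "space \<mu> = B"
  using assms sets_eq_imp_space_eq[of \<mu> R] space_R unfolding prob_measures_on_def by auto

lemma measurable_cont:
  assumes "continuous_on B \<phi>" "sets \<mu> = sets R"
  shows "\<phi> \<in> borel_measurable \<mu>"
  using borel_measurable_continuous_on_restrict[OF assms(1)] measurable_cong_sets[OF assms(2) refl] by blast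

lemma cont_bounded:
  assumes "continuous_on B (\<phi> :: real \<Rightarrow> real)"
  shows "\<exists>K>0. \<forall>x\<in>B. \<bar>\<phi> x\<bar> \<le> K"
proof -
  have "bounded (\<phi> ` B)" by (intro compact_imp_bounded compact_continuous_image assms B_compact)
  then show ?thesis unfolding bounded_pos by auto
qed

lemma integrable_cont:
  assumes \<mu>: "\<mu> \<in> \<P>" and \<phi>: "continuous_on B (\<phi> :: real \<Rightarrow> real)"
  shows "integrable \<mu> \<phi>"
proof -
  interpret prob_space \<mu> by (rule prob_measures_D[OF \<mu>])
  obtain K where "\<forall>x\<in>B. \<bar>\<phi> x\<bar> \<le> K" using cont_bounded[OF \<phi>] by blast
  then show ?thesis
    by (intro integrable_const_bound[where B = K] measurable_cont[OF \<phi>] prob_measures_D[OF \<mu>])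
      (auto simp: prob_measures_D[OF \<mu>])
qed

lemma integral_close:
  assumes \<mu>: "\<mu> \<in> \<P>"
    and \<phi>: "continuous_on B (\<phi> :: real \<Rightarrow> real)" and \<psi>: "continuous_on B \<psi>"
    and e: "\<And>x. x \<in> B \<Longrightarrow> \<bar>\<phi> x - \<psi> x\<bar> \<le> e"
  shows "\<bar>(\<integral>x. \<phi> x \<partial>\<mu>) - (\<integral>x. \<psi> x \<partial>\<mu>)\<bar> \<le> e"
proof -
  interpret prob_space \<mu> by (rule prob_measures_D[OF \<mu>])
  have int: "integrable \<mu> \<phi>" "integrable \<mu> \<psi>" using integrable_cont[OF \<mu>] \<phi> \<psi> by blast+
  have "\<bar>(\<integral>x. \<phi> x \<partial>\<mu>) - (\<integral>x. \<psi> x \<partial>\<mu>)\<bar> = \<bar>\<integral>x. \<phi> x - \<psi> x \<partial>\<mu>\<bar>" using int by simp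
  also have "\<dots> \<le> (\<integral>x. \<bar>\<phi> x - \<psi> x\<bar> \<partial>\<mu>)" by (rule integral_abs_bound)
  also have "\<dots> \<le> (\<integral>x. e \<partial>\<mu>)"
    by (intro integral_mono) (use int e prob_measures_D[OF \<mu>] in auto)
  finally show ?thesis by (simp add: prob_space)
qed

definition mom :: "real measure \<Rightarrow> nat \<Rightarrow> real" where "mom \<mu> k = (\<integral>x. x ^ k \<partial>\<mu>)"

lemma integral_rat_poly:
  assumes "\<mu> \<in> \<P>"
  shows "(\<integral>x. rat_poly l x \<partial>\<mu>) = (\<Sum>i<length l. of_rat (l ! i) * mom \<mu> i)"
proof -
  have "integrable \<mu> (\<lambda>x. x ^ i)" for i by (intro integrable_cont assms continuous_intros)
  then show ?thesis unfolding rat_poly_def mom_def by simp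
qed

text \<open>Approximate \<open>\<phi>\<close> on \<open>B\<close> by a polynomial. Three quarters of
  \<open>e\<close> are spent on the two approximation errors and on the finitely many moments
  involved.\<close>

lemma moments_close_integral_close:
  assumes \<mu>: "\<mu> \<in> \<P>" and \<phi>: "continuous_on B (\<phi> :: real \<Rightarrow> real)" and e: "e > 0"
  shows "\<exists>n d. d > 0 \<and> (\<forall>\<nu>\<in>\<P>. (\<forall>k<n. \<bar>mom \<nu> k - mom \<mu> k\<bar> < d) \<longrightarrow>
    \<bar>(\<integral>x. \<phi> x \<partial>\<nu>) - (\<integral>x. \<phi> x \<partial>\<mu>)\<bar> < e)"
proof -
  obtain l where l: "\<And>x. x \<in> B \<Longrightarrow> \<bar>\<phi> x - rat_poly l x\<bar> < e / 4"
    using rat_poly_approx[OF B_compact B_01 \<phi>, of "e/4"] e by auto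
  define S0 where "S0 = (\<Sum>i<length l. \<bar>real_of_rat (l ! i)\<bar>)"
  \<comment> \<open>The added 1 avoids division by zero for the zero polynomial.\<close>
  define S where "S = S0 + 1"
  have "S0 \<ge> 0" unfolding S0_def by (intro sum_nonneg) simp
  then have S: "S > 0" unfolding S_def by simp
  have "\<bar>(\<integral>x. \<phi> x \<partial>\<nu>) - (\<integral>x. \<phi> x \<partial>\<mu>)\<bar> < e"
    if \<nu>: "\<nu> \<in> \<P>" and close: "\<forall>k<length l. \<bar>mom \<nu> k - mom \<mu> k\<bar> < e / (4 * S)" for \<nu>
  proof -
    have 1: "\<bar>(\<integral>x. \<phi> x \<partial>\<nu>) - (\<integral>x. rat_poly l x \<partial>\<nu>)\<bar> \<le> e / 4"
      by (rule integral_close[OF \<nu> \<phi> continuous_on_rat_poly]) (use l in \<open>auto intro: less_imp_le\<close>)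
    have 2: "\<bar>(\<integral>x. \<phi> x \<partial>\<mu>) - (\<integral>x. rat_poly l x \<partial>\<mu>)\<bar> \<le> e / 4"
      by (rule integral_close[OF \<mu> \<phi> continuous_on_rat_poly]) (use l in \<open>auto intro: less_imp_le\<close>)
    have "(\<integral>x. rat_poly l x \<partial>\<nu>) - (\<integral>x. rat_poly l x \<partial>\<mu>) = (\<Sum>i<length l. of_rat (l ! i) * (mom \<nu> i - mom \<mu> i))"
      unfolding integral_rat_poly[OF \<nu>] integral_rat_poly[OF \<mu>] by (simp add: sum_subtractf right_diff_distrib)
    also have "\<bar>\<dots>\<bar> \<le> (\<Sum>i<length l. \<bar>real_of_rat (l ! i)\<bar> * (e / (4 * S)))"
    proof (rule order_trans[OF sum_abs sum_mono])
      fix i assume "i \<in> {..<length l}"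
      then show "\<bar>of_rat (l ! i) * (mom \<nu> i - mom \<mu> i)\<bar> \<le> \<bar>real_of_rat (l ! i)\<bar> * (e / (4 * S))"
        unfolding abs_mult by (intro mult_left_mono) (use close in \<open>auto intro: less_imp_le\<close>)
    qed
    also have "\<dots> = S0 * (e / (4 * S))" unfolding S0_def by (rule sum_distrib_right[symmetric])
    also have "\<dots> \<le> S * (e / (4 * S))" using S e by (intro mult_right_mono) (auto simp: S_def)
    also have "\<dots> = e / 4" using S by simp
    finally show ?thesis using 1 2 e by linarith
  qed
  moreover have "e / (4 * S) > 0" using e S by simp
  ultimately show ?thesis by blast
qed

lemma topspace_weak: "topspace (weak_topology B) = \<P>"
proof -
  have "\<P> \<in> {{\<mu> \<in> \<P>. (\<integral>x. \<phi> x \<partial>\<mu>) \<in> W} | (\<phi> :: real \<Rightarrow> real) W.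
        continuous_on B \<phi> \<and> bounded (\<phi> ` B) \<and> open W}"
    by (rule CollectI, intro exI[of _ "\<lambda>_. 0"] exI[of _ UNIV]) (auto simp: image_constant_conv)
  then show ?thesis unfolding weak_topology_def topology_generated_by_topspace by blast
qed

lemma openin_weak_integral:
  assumes \<phi>: "continuous_on B (\<phi> :: real \<Rightarrow> real)" and "open W"
  shows "openin (weak_topology B) {\<mu> \<in> \<P>. (\<integral>x. \<phi> x \<partial>\<mu>) \<in> W}"
proof -
  have "bounded (\<phi> ` B)" by (intro compact_imp_bounded compact_continuous_image \<phi> B_compact)
  then show ?thesis unfolding weak_topology_def
    by (intro topology_generated_by_Basis) (use assms in blast)
qed

text \<open>Induction over the generated topology; for a subbasic set, finitely many moments control
  the integral.\<close>

lemma openin_weak_moment_box: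
  assumes "openin (weak_topology B) U" "\<mu> \<in> U"
  shows "\<exists>n d. d > 0 \<and> (\<forall>\<nu>\<in>\<P>. (\<forall>k<n. \<bar>mom \<nu> k - mom \<mu> k\<bar> < d) \<longrightarrow> \<nu> \<in> U)"
  using assms unfolding weak_topology_def openin_topology_generated_by_iff
proof (induction rule: generate_topology_on.induct)
  case Empty
  then show ?case by simp
next
  case (Int a b)
  obtain n d where 1: "d > 0" "\<forall>\<nu>\<in>\<P>. (\<forall>k<n. \<bar>mom \<nu> k - mom \<mu> k\<bar> < d) \<longrightarrow> \<nu> \<in> a" using Int by blast
  obtain n' d' where 2: "d' > 0" "\<forall>\<nu>\<in>\<P>. (\<forall>k<n'. \<bar>mom \<nu> k - mom \<mu> k\<bar> < d') \<longrightarrow> \<nu> \<in> b" using Int by blast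
  show ?case by (intro exI[of _ "max n n'"] exI[of _ "min d d'"]) (use 1 2 in auto)
next
  case (UN K)
  then show ?case by (meson UnionE UnionI)
next
  case (Basis s)
  then obtain \<phi> :: "real \<Rightarrow> real" and W where \<phi>: "continuous_on B \<phi>" "open W" "s = {\<mu> \<in> \<P>. (\<integral>x. \<phi> x \<partial>\<mu>) \<in> W}"
    by blast
  then obtain e where e: "e > 0" "ball (\<integral>x. \<phi> x \<partial>\<mu>) e \<subseteq> W" using Basis by (auto elim: openE)
  have \<mu>: "\<mu> \<in> \<P>" using Basis \<phi> by blast
  obtain n d where nd: "d > 0" "\<forall>\<nu>\<in>\<P>. (\<forall>k<n. \<bar>mom \<nu> k - mom \<mu> k\<bar> < d) \<longrightarrow>
    \<bar>(\<integral>x. \<phi> x \<partial>\<nu>) - (\<integral>x. \<phi> x \<partial>\<mu>)\<bar> < e"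
    using moments_close_integral_close[OF \<mu> \<phi>(1) e(1)] by blast
  have "\<nu> \<in> s" if "\<nu> \<in> \<P>" "\<forall>k<n. \<bar>mom \<nu> k - mom \<mu> k\<bar> < d" for \<nu>
  proof -
    have "\<bar>(\<integral>x. \<phi> x \<partial>\<nu>) - (\<integral>x. \<phi> x \<partial>\<mu>)\<bar> < e" using nd(2) that by blast
    then have "(\<integral>x. \<phi> x \<partial>\<nu>) \<in> ball (\<integral>x. \<phi> x \<partial>\<mu>) e" by (simp add: dist_real_def abs_minus_commute)
    then show ?thesis unfolding \<phi>(3) using that e(2) by blast
  qed
  then show ?case using nd(1) by blast
qed

text \<open>The offset \<open>n0\<close> is there for empirical measures, which are probability
  measures only for positive length.\<close>

lemma limitin_weak_iff:
  assumes "\<And>n. n \<ge> n0 \<Longrightarrow> \<nu> n \<in> \<P>"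
  shows "limitin (weak_topology B) \<nu> \<mu> sequentially \<longleftrightarrow>
    \<mu> \<in> \<P> \<and> (\<forall>k. (\<lambda>n. mom (\<nu> n) k) \<longlonglongrightarrow> mom \<mu> k)"
proof
  assume lim: "limitin (weak_topology B) \<nu> \<mu> sequentially"
  then have \<mu>: "\<mu> \<in> \<P>" unfolding limitin_def topspace_weak by blast
  have "(\<lambda>n. mom (\<nu> n) k) \<longlonglongrightarrow> mom \<mu> k" for k
  proof (rule topological_tendstoI)
    fix W assume W: "open W" "mom \<mu> k \<in> W"
    have "openin (weak_topology B) {\<mu> \<in> \<P>. (\<integral>x. x ^ k \<partial>\<mu>) \<in> W}"
      by (intro openin_weak_integral continuous_intros W(1))
    moreover have "\<mu> \<in> {\<mu> \<in> \<P>. (\<integral>x. x ^ k \<partial>\<mu>) \<in> W}" using \<mu> W(2) unfolding mom_def by simp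
    ultimately have "eventually (\<lambda>n. \<nu> n \<in> {\<mu> \<in> \<P>. (\<integral>x. x ^ k \<partial>\<mu>) \<in> W}) sequentially"
      using lim unfolding limitin_def by blast
    then show "eventually (\<lambda>n. mom (\<nu> n) k \<in> W) sequentially"
      by eventually_elim (simp add: mom_def)
  qed
  then show "\<mu> \<in> \<P> \<and> (\<forall>k. (\<lambda>n. mom (\<nu> n) k) \<longlonglongrightarrow> mom \<mu> k)" using \<mu> by blast
next
  assume *: "\<mu> \<in> \<P> \<and> (\<forall>k. (\<lambda>n. mom (\<nu> n) k) \<longlonglongrightarrow> mom \<mu> k)"
  have "eventually (\<lambda>n. \<nu> n \<in> U) sequentially" if U: "openin (weak_topology B) U" "\<mu> \<in> U" for U
  proof -
    obtain m d where md: "d > 0" "\<forall>\<nu>\<in>\<P>. (\<forall>k<m. \<bar>mom \<nu> k - mom \<mu> k\<bar> < d) \<longrightarrow> \<nu> \<in> U"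
      using openin_weak_moment_box[OF U] by blast
    have "eventually (\<lambda>n. \<bar>mom (\<nu> n) k - mom \<mu> k\<bar> < d) sequentially" for k
      using tendstoD[OF conjunct2[OF *, rule_format] md(1), of k] by (simp add: dist_real_def)
    then have "eventually (\<lambda>n. \<forall>k\<in>{..<m}. \<bar>mom (\<nu> n) k - mom \<mu> k\<bar> < d) sequentially"
      by (intro eventually_ball_finite) auto
    moreover have "eventually (\<lambda>n. \<nu> n \<in> \<P>) sequentially"
      using assms eventually_sequentially by blast
    ultimately show ?thesis by eventually_elim (use md(2) in auto)
  qed
  then show "limitin (weak_topology B) \<nu> \<mu> sequentially"
    unfolding limitin_def topspace_weak using * by blast
qed

text \<open>Measures on \<open>B\<close> are pushed to the line, where uniqueness by characteristic
  functions and Helly selection are at hand.\<close>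

lemma ext_real_distribution:
  assumes "\<mu> \<in> \<P>"
  shows "real_distribution (distr \<mu> borel (\<lambda>x. x))"
proof -
  interpret prob_space \<mu> by (rule prob_measures_D[OF assms])
  show ?thesis
    by (rule real_distribution_distr) (rule measurable_cont[OF continuous_on_id prob_measures_D(2)[OF assms]])
qed

lemma id_measurable: "\<mu> \<in> \<P> \<Longrightarrow> (\<lambda>x. x) \<in> borel_measurable \<mu>"
  by (rule measurable_cont[OF continuous_on_id prob_measures_D(2)])

lemma integral_ext:
  assumes "\<mu> \<in> \<P>" "g \<in> borel_measurable borel"
  shows "(\<integral>x. g x \<partial>distr \<mu> borel (\<lambda>x. x)) = (\<integral>x. (g x :: 'a::{banach,second_countable_topology}) \<partial>\<mu>)"
  by (rule integral_distr[OF id_measurable[OF assms(1)] assms(2)])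

text \<open>Cosine and sine are continuous test functions, so the characteristic functions of the
  extensions to the line agree.\<close>

lemma measures_eqI_integrals:
  assumes \<mu>: "\<mu> \<in> \<P>" and \<nu>: "\<nu> \<in> \<P>"
    and eq: "\<And>\<phi>. continuous_on B (\<phi> :: real \<Rightarrow> real) \<Longrightarrow> (\<integral>x. \<phi> x \<partial>\<mu>) = (\<integral>x. \<phi> x \<partial>\<nu>)"
  shows "\<mu> = \<nu>"
proof -
  have "char (distr \<mu> borel (\<lambda>x. x)) t = char (distr \<nu> borel (\<lambda>x. x)) t" for t
  proof -
    have c: "(\<integral>x. iexp (t * x) \<partial>\<kappa>) = Complex (\<integral>x. cos (t * x) \<partial>\<kappa>) (\<integral>x. sin (t * x) \<partial>\<kappa>)"
      if \<kappa>: "\<kappa> \<in> \<P>" for \<kappa>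
    proof -
      interpret prob_space \<kappa> by (rule prob_measures_D[OF \<kappa>])
      have "integrable \<kappa> (\<lambda>x. cos (t * x))" "integrable \<kappa> (\<lambda>x. sin (t * x))"
        by (intro integrable_cont \<kappa> continuous_intros)+
      then have "integrable \<kappa> (\<lambda>x. complex_of_real (cos (t * x)))" "integrable \<kappa> (\<lambda>x. \<i> * complex_of_real (sin (t * x)))"
        by auto
      note int = this
      have E: "iexp (t * x) = complex_of_real (cos (t * x)) + \<i> * complex_of_real (sin (t * x))" for x
        by (simp add: cis_conv_exp[symmetric] complex_eq_iff del: of_real_mult)
      have "(\<integral>x. iexp (t * x) \<partial>\<kappa>) = (\<integral>x. complex_of_real (cos (t * x)) \<partial>\<kappa>) + (\<integral>x. \<i> * complex_of_real (sin (t * x)) \<partial>\<kappa>)"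
        unfolding E by (rule Bochner_Integration.integral_add[OF int])
      then show ?thesis by (simp add: complex_eq_iff)
    qed
    have "(\<integral>x. iexp (t * x) \<partial>\<mu>) = (\<integral>x. iexp (t * x) \<partial>\<nu>)"
      unfolding c[OF \<mu>] c[OF \<nu>] by (simp add: eq continuous_intros)
    then show ?thesis unfolding char_def by (subst (1 2) integral_ext) (use \<mu> \<nu> in auto)
  qed
  then have ext: "distr \<mu> borel (\<lambda>x. x) = distr \<nu> borel (\<lambda>x. x)"
    by (intro Levy_uniqueness ext_real_distribution \<mu> \<nu> ext)
  show ?thesis
  proof (rule measure_eqI)
    show "sets \<mu> = sets \<nu>" using prob_measures_D[OF \<mu>] prob_measures_D[OF \<nu>] by simp
    fix A assume "A \<in> sets \<mu>"
    then have A: "A \<subseteq> B" "A \<in> sets borel" using sets_R prob_measures_D[OF \<mu>] by auto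
    have "emeasure (distr \<kappa> borel (\<lambda>x. x)) A = emeasure \<kappa> A" if \<kappa>: "\<kappa> \<in> \<P>" for \<kappa>
    proof -
      have "(\<lambda>x. x) -` A \<inter> space \<kappa> = A" using A(1) prob_measures_D(3)[OF \<kappa>] by auto
      then show ?thesis by (simp add: emeasure_distr[OF id_measurable[OF \<kappa>] A(2)])
    qed
    from this[OF \<mu>] this[OF \<nu>] show "emeasure \<mu> A = emeasure \<nu> A" using ext by simp
  qed
qed

lemma measures_eqI:
  assumes \<mu>: "\<mu> \<in> \<P>" and \<nu>: "\<nu> \<in> \<P>" and eq: "\<And>k. mom \<mu> k = mom \<nu> k"
  shows "\<mu> = \<nu>"
proof (rule measures_eqI_integrals[OF \<mu> \<nu>])
  fix \<phi> :: "real \<Rightarrow> real" assume \<phi>: "continuous_on B \<phi>"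
  have "\<bar>(\<integral>x. \<phi> x \<partial>\<mu>) - (\<integral>x. \<phi> x \<partial>\<nu>)\<bar> < e" if "e > 0" for e
    using moments_close_integral_close[OF \<nu> \<phi> that] \<mu> eq by fastforce
  then show "(\<integral>x. \<phi> x \<partial>\<mu>) = (\<integral>x. \<phi> x \<partial>\<nu>)"
    by (metis abs_not_less_zero eq_iff_diff_eq_0 less_irrefl zero_less_abs_iff)
qed

lemma invariant_D:
  assumes "\<mu> \<in> \<M>"
  shows "\<mu> \<in> \<P>" "f \<in> measurable \<mu> \<mu>" "distr \<mu> \<mu> f = \<mu>"
  using assms unfolding invariant_measures_def by auto

lemma f_measurable:
  assumes "sets \<mu> = sets R"
  shows "f \<in> measurable \<mu> \<mu>"
proof -
  have "f \<in> measurable R R"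
    by (rule measurable_restrict_space2) (use f_self space_R borel_measurable_continuous_on_restrict[OF f_cont] in auto)
  then show ?thesis using measurable_cong_sets[OF assms assms] by blast
qed

lemma invariant_if_moments:
  assumes \<mu>: "\<mu> \<in> \<P>" and inv: "\<And>k. (\<integral>x. f x ^ k \<partial>\<mu>) = (\<integral>x. x ^ k \<partial>\<mu>)"
  shows "\<mu> \<in> \<M>"
proof -
  interpret prob_space \<mu> by (rule prob_measures_D[OF \<mu>])
  have m: "f \<in> measurable \<mu> \<mu>" by (rule f_measurable[OF prob_measures_D(2)[OF \<mu>]])
  have d: "distr \<mu> \<mu> f \<in> \<P>"
    unfolding prob_measures_on_def using prob_space_distr[OF m] prob_measures_D(2)[OF \<mu>] by simp
  have "mom (distr \<mu> \<mu> f) k = mom \<mu> k" for k unfolding mom_def inv[symmetric]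
    by (rule integral_distr[OF m measurable_cont[OF _ prob_measures_D(2)[OF \<mu>]]]) (intro continuous_intros)
  then have "distr \<mu> \<mu> f = \<mu>" by (rule measures_eqI[OF d \<mu>])
  then show ?thesis unfolding invariant_measures_def using \<mu> m by blast
qed

lemma invariant_integral:
  assumes \<mu>: "\<mu> \<in> \<M>" and m: "(g :: real \<Rightarrow> real) \<in> borel_measurable \<mu>"
  shows "(\<integral>x. g (f x) \<partial>\<mu>) = (\<integral>x. g x \<partial>\<mu>)"
  using integral_distr[OF invariant_D(2)[OF \<mu>] m] invariant_D(3)[OF \<mu>] by simp

text \<open>Helly selection on the line: all extensions live in \<open>{-1<..1}\<close>, hence are
  tight. The limit charges only \<open>B\<close> and is restricted to it; test functions on
  \<open>B\<close> are extended to the line by Tietze's theorem.\<close>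

lemma moment_limit_measure:
  assumes \<mu>: "\<And>n. \<mu> n \<in> \<P>"
  shows "\<exists>r \<nu>. strict_mono (r :: nat \<Rightarrow> nat) \<and> \<nu> \<in> \<P> \<and>
    (\<forall>\<phi>. continuous_on B (\<phi> :: real \<Rightarrow> real) \<longrightarrow> (\<lambda>n. \<integral>x. \<phi> x \<partial>\<mu> (r n)) \<longlonglongrightarrow> (\<integral>x. \<phi> x \<partial>\<nu>))"
proof -
  define \<eta> where "\<eta> n = distr (\<mu> n) borel (\<lambda>x. x)" for n
  have rd: "real_distribution (\<eta> n)" for n unfolding \<eta>_def by (rule ext_real_distribution[OF \<mu>])
  have one: "measure (\<eta> n) {-1<..1} = 1" for n
  proof -
    interpret prob_space "\<mu> n" by (rule prob_measures_D[OF \<mu>])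
    have "(\<lambda>x. x) -` {-1<..1} \<inter> space (\<mu> n) = space (\<mu> n)"
      using B_01 prob_measures_D(3)[OF \<mu>] by force
    then show ?thesis unfolding \<eta>_def
      by (subst measure_distr[OF id_measurable[OF \<mu>]]) (simp_all add: prob_space)
  qed
  have "tight \<eta>"
    unfolding tight_def using rd one by (intro conjI allI impI exI[of _ "-1"] exI[of _ 1]) auto
  then obtain r M where r: "strict_mono r" "real_distribution M" "weak_conv_m (\<eta> \<circ> id \<circ> r) M"
    using tight_imp_convergent_subsubsequence[of \<eta> id] by (auto simp: strict_mono_def)
  interpret M: real_distribution M by (rule r(2))
  have conv: "(\<lambda>n. \<integral>x. g x \<partial>\<mu> (r n)) \<longlonglongrightarrow> (\<integral>x. g x \<partial>M)"
    if g: "\<And>x. isCont g x" "\<And>x. norm (g x) \<le> K" for g :: "real \<Rightarrow> real" and K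
  proof -
    have "(\<lambda>n. integral\<^sup>L ((\<eta> \<circ> id \<circ> r) n) g) \<longlonglongrightarrow> integral\<^sup>L M g"
      by (rule weak_conv_imp_integral_bdd_continuous_conv[OF _ r(2,3) g]) (simp add: rd)
    moreover have "g \<in> borel_measurable borel"
      using g(1) by (intro borel_measurable_continuous_onI) (simp add: continuous_at_imp_continuous_on)
    ultimately show ?thesis by (simp add: \<eta>_def integral_ext[OF \<mu>])
  qed
  \<comment> \<open>A continuous function vanishing exactly on the closed set \<open>B\<close>. Its
    integrals are 0 along the sequence, hence also for the limit, which is therefore concentrated on
    \<open>B\<close>.\<close>
  define h where "h x = min 1 (infdist x B)" for x
  have h_cont: "isCont h x" for x unfolding h_def by (intro continuous_intros)
  have h_bd: "norm (h x) \<le> 1" "0 \<le> h x" for x unfolding h_def by (auto simp: infdist_nonneg)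
  have "(\<integral>x. h x \<partial>\<mu> n) = 0" for n
  proof -
    have "(\<integral>x. h x \<partial>\<mu> n) = (\<integral>x. 0 \<partial>\<mu> n)"
      by (rule Bochner_Integration.integral_cong) (simp_all add: prob_measures_D(3)[OF \<mu>] h_def)
    then show ?thesis by simp
  qed
  then have "(\<lambda>n. 0) \<longlonglongrightarrow> (\<integral>x. h x \<partial>M)" using conv[OF h_cont h_bd(1)] by simp
  then have h0: "(\<integral>x. h x \<partial>M) = 0" using LIMSEQ_unique tendsto_const by blast
  have h_meas: "h \<in> borel_measurable borel"
    using h_cont by (intro borel_measurable_continuous_onI) (simp add: continuous_at_imp_continuous_on)
  have "integrable M h" by (rule M.integrable_const_bound[where B = 1]) (use h_bd h_meas in auto)
  then have "AE x in M. h x = 0" using integral_nonneg_eq_0_iff_AE[of M h] h0 h_bd(2) by simp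
  then have aeB: "AE x in M. x \<in> B"
  proof eventually_elim
    case (elim x)
    then have "infdist x B = 0" unfolding h_def by (simp add: min_def split: if_splits)
    then show ?case using in_closed_iff_infdist_zero[OF B_closed B_ne] by blast
  qed
  define \<nu> where "\<nu> = restrict_space M B"
  have sets\<nu>: "sets \<nu> = sets R" unfolding \<nu>_def by (rule sets_restrict_space_cong) simp
  have BM: "B \<in> sets M" using B_borel by simp
  have "emeasure M B = 1" using M.emeasure_eq_1_AE[of B] aeB BM by simp
  then have "prob_space \<nu>"
    unfolding \<nu>_def by (intro prob_spaceI) (use BM in \<open>simp add: space_restrict_space emeasure_restrict_space[of B M B]\<close>)
  then have \<nu>: "\<nu> \<in> \<P>" unfolding prob_measures_on_def using sets\<nu> by simp
  have "(\<lambda>n. \<integral>x. \<phi> x \<partial>\<mu> (r n)) \<longlonglongrightarrow> (\<integral>x. \<phi> x \<partial>\<nu>)" if \<phi>: "continuous_on B (\<phi> :: real \<Rightarrow> real)" for \<phi>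
  proof -
    obtain K where K: "K > 0" "\<forall>x\<in>B. \<bar>\<phi> x\<bar> \<le> K" using cont_bounded[OF \<phi>] by blast
    obtain g where g: "continuous_on UNIV g" "\<And>x. x \<in> B \<Longrightarrow> g x = \<phi> x" "\<And>x. norm (g x) \<le> K"
      using Tietze[of B \<phi> UNIV K] \<phi> K B_closed by (auto simp: closedin_closed_eq)
    have gc: "isCont g x" for x using g(1) continuous_on_eq_continuous_at open_UNIV by blast
    have "(\<integral>x. g x \<partial>\<mu> (r n)) = (\<integral>x. \<phi> x \<partial>\<mu> (r n))" for n
      by (rule Bochner_Integration.integral_cong) (simp_all add: prob_measures_D(3)[OF \<mu>] g(2))
    moreover have "(\<integral>x. g x \<partial>M) = (\<integral>x. \<phi> x \<partial>\<nu>)"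
    proof -
      have "(\<integral>x. g x \<partial>M) = (\<integral>x. indicator B x *\<^sub>R g x \<partial>M)"
      proof (rule integral_cong_AE)
        show "g \<in> borel_measurable M" using borel_measurable_continuous_onI[OF g(1)] by simp
        then show "(\<lambda>x. indicator B x *\<^sub>R g x) \<in> borel_measurable M" using BM by simp
        show "AE x in M. g x = indicator B x *\<^sub>R g x" using aeB by eventually_elim simp
      qed
      also have "\<dots> = (\<integral>x. g x \<partial>\<nu>)"
        unfolding \<nu>_def by (rule integral_restrict_space[symmetric]) (use BM in simp)
      also have "\<dots> = (\<integral>x. \<phi> x \<partial>\<nu>)"
        by (rule Bochner_Integration.integral_cong) (simp_all add: prob_measures_D(3)[OF \<nu>] g(2))
      finally show ?thesis .
    qed
    ultimately show ?thesis using conv[OF gc g(3)] by simp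
  qed
  then show ?thesis using r(1) \<nu> by blast
qed

lemma invariant_limit:
  assumes \<mu>: "\<And>n. \<mu> n \<in> \<P>" and \<nu>: "\<nu> \<in> \<P>"
    and lim: "\<And>\<phi>. continuous_on B (\<phi> :: real \<Rightarrow> real) \<Longrightarrow> (\<lambda>n. \<integral>x. \<phi> x \<partial>\<mu> n) \<longlonglongrightarrow> (\<integral>x. \<phi> x \<partial>\<nu>)"
    and inv: "\<And>k. (\<lambda>n. (\<integral>x. f x ^ k \<partial>\<mu> n) - (\<integral>x. x ^ k \<partial>\<mu> n)) \<longlonglongrightarrow> 0"
  shows "\<nu> \<in> \<M>"
proof (rule invariant_if_moments[OF \<nu>])
  fix k
  have 1: "(\<lambda>n. \<integral>x. x ^ k \<partial>\<mu> n) \<longlonglongrightarrow> (\<integral>x. x ^ k \<partial>\<nu>)" by (intro lim continuous_intros)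
  have 2: "(\<lambda>n. \<integral>x. f x ^ k \<partial>\<mu> n) \<longlonglongrightarrow> (\<integral>x. f x ^ k \<partial>\<nu>)" by (intro lim continuous_intros f_cont)
  have "(\<lambda>n. (\<integral>x. f x ^ k \<partial>\<mu> n) - (\<integral>x. x ^ k \<partial>\<mu> n)) \<longlonglongrightarrow> (\<integral>x. f x ^ k \<partial>\<nu>) - (\<integral>x. x ^ k \<partial>\<nu>)"
    by (rule tendsto_diff[OF 2 1])
  then have "(\<integral>x. f x ^ k \<partial>\<nu>) - (\<integral>x. x ^ k \<partial>\<nu>) = 0" using inv LIMSEQ_unique by blast
  then show "(\<integral>x. f x ^ k \<partial>\<nu>) = (\<integral>x. x ^ k \<partial>\<nu>)" by simp
qed

text \<open>As an image of the uniform measure on \<open>{..<N}\<close>, the empirical measure has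
  integrals that are plain orbit averages.\<close>

lemma empirical_eq_distr:
  assumes x: "x \<in> B" and N: "N > 0"
  shows "empirical_measure f B x N = distr (uniform_count_measure {..<N}) R (\<lambda>j. (f ^^ j) x)"
    (is "_ = ?D")
proof -
  have orbit: "(f ^^ j) x \<in> B" for j by (rule funpow_mem[OF f_self x])
  have meas: "(\<lambda>j. (f ^^ j) x) \<in> measurable (uniform_count_measure {..<N}) R"
    by (rule measurableI) (use orbit space_R in auto)
  have fm: "f ^^ j \<in> measurable R R" for j
    using measurable_compose_n[OF f_measurable[of R]] by simp
  have eq: "inverse (of_nat N) * (\<Sum>j<N. emeasure (distr (return R x) R (f ^^ j)) A) = emeasure ?D A"
    if A: "A \<in> sets R" for A
  proof -
    have "emeasure (distr (return R x) R (f ^^ j)) A = indicator A ((f ^^ j) x)" for j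
    proof -
      have "(f ^^ j) -` A \<inter> B \<in> sets R" using measurable_sets[OF fm A] unfolding space_R by blast
      then show ?thesis using fm A x
        by (subst emeasure_distr) (auto simp: space_R emeasure_return indicator_def)
    qed
    then have l: "(\<Sum>j<N. emeasure (distr (return R x) R (f ^^ j)) A) = of_nat (card {j\<in>{..<N}. (f ^^ j) x \<in> A})"
      by (simp add: indicator_def sum.If_cases Int_def conj_commute)
    have "emeasure ?D A = emeasure (uniform_count_measure {..<N}) {j\<in>{..<N}. (f ^^ j) x \<in> A}"
      by (subst emeasure_distr[OF meas A]) (auto intro!: arg_cong2[where f = emeasure] simp: space_uniform_count_measure)
    also have "\<dots> = of_nat (card {j\<in>{..<N}. (f ^^ j) x \<in> A}) / of_nat N"
      by (subst emeasure_uniform_count_measure) (auto simp: ennreal_of_nat_eq_real_of_nat divide_ennreal N)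
    finally show ?thesis unfolding l by (simp add: divide_ennreal_def mult.commute)
  qed
  have "empirical_measure f B x N = measure_of B (sets R) (emeasure ?D)"
    unfolding empirical_measure_def Let_def
    by (rule measure_of_eq) (use sets.space_closed[of R] space_R eq sets.sigma_sets_eq[of R] in auto)
  also have "\<dots> = ?D" using measure_of_of_measure[of ?D] space_R by simp
  finally show ?thesis .
qed

lemma empirical_prob:
  assumes x: "x \<in> B" and N: "N > 0"
  shows "empirical_measure f B x N \<in> \<P>"
proof -
  have orbit: "(f ^^ j) x \<in> B" for j by (rule funpow_mem[OF f_self x])
  have meas: "(\<lambda>j. (f ^^ j) x) \<in> measurable (uniform_count_measure {..<N}) R"
    by (rule measurableI) (use orbit space_R in auto)
  interpret prob_space "uniform_count_measure {..<N}"
    by (rule prob_space_uniform_count_measure) (use N in auto)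
  show ?thesis unfolding prob_measures_on_def empirical_eq_distr[OF x N]
    using prob_space_distr[OF meas] by simp
qed

lemma empirical_integral:
  assumes x: "x \<in> B" and N: "N > 0" and \<phi>: "(\<phi> :: real \<Rightarrow> real) \<in> borel_measurable R"
  shows "(\<integral>y. \<phi> y \<partial>empirical_measure f B x N) = (\<Sum>j<N. \<phi> ((f ^^ j) x)) / N"
proof -
  have orbit: "(f ^^ j) x \<in> B" for j by (rule funpow_mem[OF f_self x])
  have meas: "(\<lambda>j. (f ^^ j) x) \<in> measurable (uniform_count_measure {..<N}) R"
    by (rule measurableI) (use orbit space_R in auto)
  show ?thesis unfolding empirical_eq_distr[OF x N] integral_distr[OF meas \<phi>]
    by (simp add: integral_uniform_count_measure)
qed

end

section \<open>Moment sequences in the product topology and compactness of the space of invariant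
  measures\<close>

lemma open_fun_box:
  fixes U :: "(nat \<Rightarrow> real) set"
  assumes "open U" "x \<in> U"
  shows "\<exists>n d. d > 0 \<and> (\<forall>y. (\<forall>k<n. \<bar>y k - x k\<bar> < d) \<longrightarrow> y \<in> U)"
proof -
  obtain X where X: "x \<in> Pi\<^sub>E UNIV X" "\<And>i. open (X i)" "finite {i. X i \<noteq> UNIV}" "Pi\<^sub>E UNIV X \<subseteq> U"
    using product_topology_open_contains_basis[of "\<lambda>i. euclidean" UNIV U x] assms unfolding open_fun_def by auto
  have "\<exists>d>0. ball (x i) d \<subseteq> X i" for i
    using X(1,2) by (metis PiE_mem UNIV_I open_contains_ball)
  then obtain d where d: "\<And>i. d i > 0" "\<And>i. ball (x i) (d i) \<subseteq> X i" by metis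
  obtain n where n: "\<And>i. X i \<noteq> UNIV \<Longrightarrow> i < n"
    using X(3) finite_nat_set_iff_bounded[of "{i. X i \<noteq> UNIV}"] by auto
  define e where "e = Min (insert 1 (d ` {..<n}))"
  have e: "e > 0" "\<And>i. i < n \<Longrightarrow> e \<le> d i" unfolding e_def using d(1) by (auto simp: Min_gr_iff)
  have "y \<in> U" if y: "\<forall>k<n. \<bar>y k - x k\<bar> < e" for y
  proof -
    have "y i \<in> X i" for i
    proof (cases "X i = UNIV")
      case False
      then have "i < n" by (rule n)
      then have "\<bar>y i - x i\<bar> < d i" using y e(2)[of i] by force
      then have "y i \<in> ball (x i) (d i)" by (simp add: dist_real_def abs_minus_commute)
      then show ?thesis using d(2) by blast
    qed simp
    then show ?thesis using X(4) by (auto simp: PiE_iff)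
  qed
  then show ?thesis using e(1) by blast
qed

lemma open_fun_coordinate_box: "open {y :: nat \<Rightarrow> real. \<forall>k<n. \<bar>y k - x k\<bar> < d}"
proof -
  have "open {y :: nat \<Rightarrow> real. \<bar>y k - x k\<bar> < d}" for k
    by (intro open_Collect_less continuous_intros continuous_on_product_coordinates)
  then have "open (\<Inter>k\<in>{..<n}. {y :: nat \<Rightarrow> real. \<bar>y k - x k\<bar> < d})" by (intro open_INT) auto
  moreover have "(\<Inter>k\<in>{..<n}. {y :: nat \<Rightarrow> real. \<bar>y k - x k\<bar> < d}) = {y. \<forall>k<n. \<bar>y k - x k\<bar> < d}" by auto
  ultimately show ?thesis by simp
qed

lemma tendsto_fun_if_pointwise:
  fixes X :: "nat \<Rightarrow> nat \<Rightarrow> real"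
  assumes "\<And>k. (\<lambda>n. X n k) \<longlonglongrightarrow> L k"
  shows "X \<longlonglongrightarrow> L"
proof (rule topological_tendstoI)
  fix U :: "(nat \<Rightarrow> real) set" assume "open U" "L \<in> U"
  then obtain n d where nd: "d > 0" "\<forall>y. (\<forall>k<n. \<bar>y k - L k\<bar> < d) \<longrightarrow> y \<in> U"
    using open_fun_box by blast
  have "eventually (\<lambda>m. \<bar>X m k - L k\<bar> < d) sequentially" for k
    using tendstoD[OF assms nd(1), of k] by (simp add: dist_real_def)
  then have "eventually (\<lambda>m. \<forall>k\<in>{..<n}. \<bar>X m k - L k\<bar> < d) sequentially"
    by (intro eventually_ball_finite) auto
  then show "eventually (\<lambda>m. X m \<in> U) sequentially"
    by eventually_elim (use nd(2) in auto)
qed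

lemma residual_inI:
  assumes "countable \<G>" "\<G> \<noteq> {}" "\<And>T. T \<in> \<G> \<Longrightarrow> openin X T"
    and "X closure_of \<Inter>\<G> = topspace X" "\<Inter>\<G> \<subseteq> S" "S \<subseteq> topspace X"
  shows "residual_in X S"
proof -
  have "gdelta_in X (\<Inter>\<G>)"
    by (intro gdelta_in_Inter assms(1,2) open_imp_gdelta_in assms(3))
  moreover have "dense_in X (\<Inter>\<G>)" unfolding dense_in_def using assms(4-6) by auto
  ultimately show ?thesis unfolding residual_in_def using assms(5,6) by blast
qed

context compact_dynamics
begin

lemma moments_tendsto_integral:
  assumes \<mu>: "\<mu> \<in> \<P>" and \<nu>: "\<And>n. \<nu> n \<in> \<P>"
    and lim: "\<And>k. (\<lambda>n. mom (\<nu> n) k) \<longlonglongrightarrow> mom \<mu> k" and \<phi>: "continuous_on B (\<phi> :: real \<Rightarrow> real)"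
  shows "(\<lambda>n. \<integral>x. \<phi> x \<partial>\<nu> n) \<longlonglongrightarrow> (\<integral>x. \<phi> x \<partial>\<mu>)"
proof (rule tendstoI)
  fix e :: real assume "e > 0"
  obtain m d where md: "d > 0" "\<forall>\<nu>\<in>\<P>. (\<forall>k<m. \<bar>mom \<nu> k - mom \<mu> k\<bar> < d) \<longrightarrow>
    \<bar>(\<integral>x. \<phi> x \<partial>\<nu>) - (\<integral>x. \<phi> x \<partial>\<mu>)\<bar> < e"
    using moments_close_integral_close[OF \<mu> \<phi> \<open>e > 0\<close>] by blast
  have "eventually (\<lambda>n. \<bar>mom (\<nu> n) k - mom \<mu> k\<bar> < d) sequentially" for k
    using tendstoD[OF lim md(1), of k] by (simp add: dist_real_def)
  then have "eventually (\<lambda>n. \<forall>k\<in>{..<m}. \<bar>mom (\<nu> n) k - mom \<mu> k\<bar> < d) sequentially"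
    by (intro eventually_ball_finite) auto
  then show "eventually (\<lambda>n. dist (\<integral>x. \<phi> x \<partial>\<nu> n) (\<integral>x. \<phi> x \<partial>\<mu>) < e) sequentially"
    by eventually_elim (use md(2) \<nu> in \<open>auto simp: dist_real_def\<close>)
qed

lemma empirical_mom:
  assumes "x \<in> B" "N > 0"
  shows "mom (empirical_measure f B x N) k = (\<Sum>j<N. ((f ^^ j) x) ^ k) / N"
  unfolding mom_def by (rule empirical_integral[OF assms measurable_cont]) (auto intro!: continuous_intros)

lemma limit_measures_iff:
  assumes x: "x \<in> B"
  shows "\<mu> \<in> limit_measures f B x \<longleftrightarrow> \<mu> \<in> \<P> \<and>
    (\<exists>r. strict_mono r \<and> (\<forall>k. (\<lambda>n. (\<Sum>j<r n. ((f ^^ j) x) ^ k) / real (r n)) \<longlonglongrightarrow> mom \<mu> k))"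
proof -
  have *: "limitin (weak_topology B) (\<lambda>n. empirical_measure f B x (r n)) \<mu> sequentially \<longleftrightarrow>
    \<mu> \<in> \<P> \<and> (\<forall>k. (\<lambda>n. (\<Sum>j<r n. ((f ^^ j) x) ^ k) / real (r n)) \<longlonglongrightarrow> mom \<mu> k)"
    if r: "strict_mono r" for r
  proof -
    have pos: "r n > 0" if "n \<ge> 1" for n using strict_mono_imp_increasing[OF r, of n] that by simp
    have "limitin (weak_topology B) (\<lambda>n. empirical_measure f B x (r n)) \<mu> sequentially \<longleftrightarrow>
      \<mu> \<in> \<P> \<and> (\<forall>k. (\<lambda>n. mom (empirical_measure f B x (r n)) k) \<longlonglongrightarrow> mom \<mu> k)"
      by (rule limitin_weak_iff[of 1]) (use pos empirical_prob[OF x] in auto)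
    moreover have "((\<lambda>n. mom (empirical_measure f B x (r n)) k) \<longlonglongrightarrow> mom \<mu> k) \<longleftrightarrow>
      ((\<lambda>n. (\<Sum>j<r n. ((f ^^ j) x) ^ k) / real (r n)) \<longlonglongrightarrow> mom \<mu> k)" for k
      by (rule filterlim_cong[OF refl refl])
        (use pos empirical_mom[OF x] in \<open>auto simp: eventually_sequentially intro!: exI[of _ 1]\<close>)
    ultimately show ?thesis by simp
  qed
  show ?thesis unfolding limit_measures_def using * by blast
qed

lemma orbit_sum_shift:
  fixes \<phi> :: "real \<Rightarrow> real"
  shows "(\<Sum>j<N. \<phi> (f ((f ^^ j) x))) - (\<Sum>j<N. \<phi> ((f ^^ j) x)) = \<phi> ((f ^^ N) x) - \<phi> x"
  by (induction N) auto

text \<open>The integrals of \<open>x ^ k\<close> and of its composition with \<open>f\<close>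
  differ by a telescoping sum, in which two terms in [0,1] remain, divided by the length.\<close>

lemma limit_measures_invariant:
  assumes x: "x \<in> B" and \<mu>: "\<mu> \<in> limit_measures f B x"
  shows "\<mu> \<in> \<M>"
proof -
  obtain r where r: "strict_mono r" "\<And>k. (\<lambda>n. (\<Sum>j<r n. ((f ^^ j) x) ^ k) / real (r n)) \<longlonglongrightarrow> mom \<mu> k"
    and \<mu>p: "\<mu> \<in> \<P>" using \<mu> limit_measures_iff[OF x] by blast
  \<comment> \<open>The index is shifted because \<open>r 0\<close> may be 0.\<close>
  have pos: "r (Suc n) > 0" for n using strict_mono_imp_increasing[OF r(1), of "Suc n"] by simp
  define \<nu> where "\<nu> n = empirical_measure f B x (r (Suc n))" for n
  have \<nu>: "\<nu> n \<in> \<P>" for n unfolding \<nu>_def by (rule empirical_prob[OF x pos])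
  have lim: "(\<lambda>n. mom (\<nu> n) k) \<longlonglongrightarrow> mom \<mu> k" for k
    unfolding \<nu>_def empirical_mom[OF x pos] using LIMSEQ_Suc[OF r(2)] by simp
  show ?thesis
  proof (rule invariant_limit[OF \<nu> \<mu>p moments_tendsto_integral[OF \<mu>p \<nu> lim]])
    fix k
    have orbit: "(f ^^ j) x \<in> {0..1}" for j using funpow_mem[OF f_self x, of j] B_01 by blast
    have eq: "(\<integral>x. f x ^ k \<partial>\<nu> n) - (\<integral>x. x ^ k \<partial>\<nu> n) = (((f ^^ r (Suc n)) x) ^ k - x ^ k) / real (r (Suc n))" for n
    proof -
      have "(\<integral>y. f y ^ k \<partial>\<nu> n) = (\<Sum>j<r (Suc n). f ((f ^^ j) x) ^ k) / real (r (Suc n))"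
        unfolding \<nu>_def by (rule empirical_integral[OF x pos measurable_cont]) (auto intro!: continuous_intros f_cont)
      moreover have "(\<integral>y. y ^ k \<partial>\<nu> n) = (\<Sum>j<r (Suc n). ((f ^^ j) x) ^ k) / real (r (Suc n))"
        unfolding \<nu>_def by (rule empirical_integral[OF x pos measurable_cont]) (auto intro!: continuous_intros)
      ultimately show ?thesis
        using orbit_sum_shift[of "\<lambda>y. y ^ k" x "r (Suc n)"] by (simp add: diff_divide_distrib[symmetric])
    qed
    have "\<bar>((f ^^ r (Suc n)) x) ^ k - x ^ k\<bar> \<le> 1" for n
    proof -
      have "0 \<le> ((f ^^ r (Suc n)) x) ^ k" "((f ^^ r (Suc n)) x) ^ k \<le> 1" "0 \<le> x ^ k" "x ^ k \<le> 1"
        using orbit[of "r (Suc n)"] orbit[of 0] by (auto intro!: power_le_one)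
      then show ?thesis by (simp add: abs_le_iff)
    qed
    moreover have "real (Suc n) \<le> real (r (Suc n))" for n
      using strict_mono_imp_increasing[OF r(1), of "Suc n"] by simp
    ultimately have bd: "\<bar>(((f ^^ r (Suc n)) x) ^ k - x ^ k) / real (r (Suc n))\<bar> \<le> 1 / real (Suc n)" for n
      unfolding abs_divide by (intro frac_le) auto
    show "(\<lambda>n. (\<integral>x. f x ^ k \<partial>\<nu> n) - (\<integral>x. x ^ k \<partial>\<nu> n)) \<longlonglongrightarrow> 0"
      unfolding eq by (rule Lim_null_comparison[OF _ LIMSEQ_Suc[OF lim_1_over_n]]) (use bd in auto)
  qed
qed

lemma invariant_seq_compact:
  assumes \<mu>: "\<And>n. \<mu> n \<in> \<M>"
  shows "\<exists>r \<nu>. strict_mono (r :: nat \<Rightarrow> nat) \<and> \<nu> \<in> \<M> \<and> (\<forall>k. (\<lambda>n. mom (\<mu> (r n)) k) \<longlonglongrightarrow> mom \<nu> k)"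
proof -
  have \<mu>p: "\<mu> n \<in> \<P>" for n using invariant_D[OF \<mu>] by blast
  obtain r \<nu> where r: "strict_mono (r :: nat \<Rightarrow> nat)" "\<nu> \<in> \<P>"
    "\<And>\<phi>. continuous_on B (\<phi> :: real \<Rightarrow> real) \<Longrightarrow> (\<lambda>n. \<integral>x. \<phi> x \<partial>\<mu> (r n)) \<longlonglongrightarrow> (\<integral>x. \<phi> x \<partial>\<nu>)"
    using moment_limit_measure[of \<mu>, OF \<mu>p] by blast
  have "\<nu> \<in> \<M>"
  proof (rule invariant_limit[OF _ r(2,3)])
    show "\<mu> (r n) \<in> \<P>" for n by (rule \<mu>p)
    have "(\<integral>x. f x ^ k \<partial>\<mu> (r n)) = (\<integral>x. x ^ k \<partial>\<mu> (r n))" for n k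
      by (rule invariant_integral[OF \<mu>]) (auto intro!: measurable_cont continuous_intros prob_measures_D \<mu>p)
    then show "(\<lambda>n. (\<integral>x. f x ^ k \<partial>\<mu> (r n)) - (\<integral>x. x ^ k \<partial>\<mu> (r n))) \<longlonglongrightarrow> 0" for k by simp
  qed
  moreover have "(\<lambda>n. mom (\<mu> (r n)) k) \<longlonglongrightarrow> mom \<nu> k" for k
    unfolding mom_def by (intro r(3) continuous_intros)
  ultimately show ?thesis using r(1) by blast
qed

lemma topspace_invariant: "topspace \<X> = \<M>"
  unfolding invariant_space_def topspace_subtopology topspace_weak invariant_measures_def by blast

lemma openin_invariant_box:
  assumes "openin \<X> U" "\<mu> \<in> U"
  shows "\<exists>n d. d > 0 \<and> (\<forall>\<nu>\<in>\<M>. (\<forall>k<n. \<bar>mom \<nu> k - mom \<mu> k\<bar> < d) \<longrightarrow> \<nu> \<in> U)"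
proof -
  obtain W where W: "openin (weak_topology B) W" "U = W \<inter> \<M>"
    using assms(1) unfolding invariant_space_def openin_subtopology by blast
  obtain n d where "d > 0" "\<forall>\<nu>\<in>\<P>. (\<forall>k<n. \<bar>mom \<nu> k - mom \<mu> k\<bar> < d) \<longrightarrow> \<nu> \<in> W"
    using openin_weak_moment_box[OF W(1)] assms(2) W(2) by blast
  then show ?thesis using W(2) invariant_D(1) by blast
qed

lemma openin_invariant_integral:
  assumes "continuous_on B (\<phi> :: real \<Rightarrow> real)" "open W"
  shows "openin \<X> {\<mu> \<in> \<M>. (\<integral>x. \<phi> x \<partial>\<mu>) \<in> W}"
proof -
  have "openin \<X> ({\<mu> \<in> \<P>. (\<integral>x. \<phi> x \<partial>\<mu>) \<in> W} \<inter> \<M>)"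
    unfolding invariant_space_def by (rule openin_subtopology_Int[OF openin_weak_integral[OF assms]])
  moreover have "{\<mu> \<in> \<P>. (\<integral>x. \<phi> x \<partial>\<mu>) \<in> W} \<inter> \<M> =
    {\<mu> \<in> \<M>. (\<integral>x. \<phi> x \<partial>\<mu>) \<in> W}" using invariant_D(1) by blast
  ultimately show ?thesis by simp
qed

lemma continuous_map_integral:
  assumes "continuous_on B (\<phi> :: real \<Rightarrow> real)"
  shows "continuous_map \<X> euclideanreal (\<lambda>\<mu>. \<integral>x. \<phi> x \<partial>\<mu>)"
  unfolding continuous_map_def topspace_invariant
  using openin_invariant_integral[OF assms] by (simp add: open_openin[symmetric])

lemma invariant_moments_compact: "compact (mom ` \<M>)"
  unfolding compact_eq_seq_compact_metric seq_compact_def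
proof (intro allI impI)
  fix z :: "nat \<Rightarrow> nat \<Rightarrow> real" assume "\<forall>n. z n \<in> mom ` \<M>"
  then have "\<forall>n. \<exists>\<mu>. \<mu> \<in> \<M> \<and> z n = mom \<mu>" by blast
  then obtain \<mu> where "\<forall>n. \<mu> n \<in> \<M> \<and> z n = mom (\<mu> n)" by (rule choice[THEN exE])
  then have \<mu>: "\<And>n. \<mu> n \<in> \<M>" "\<And>n. z n = mom (\<mu> n)" by auto
  obtain r \<nu> where r: "strict_mono (r :: nat \<Rightarrow> nat)" "\<nu> \<in> \<M>" "\<And>k. (\<lambda>n. mom (\<mu> (r n)) k) \<longlonglongrightarrow> mom \<nu> k"
    using invariant_seq_compact[of \<mu>, OF \<mu>(1)] by blast
  have "(z \<circ> r) \<longlonglongrightarrow> mom \<nu>"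
    by (rule tendsto_fun_if_pointwise) (use r(3) \<mu>(2) in simp)
  then show "\<exists>l\<in>mom ` \<M>. \<exists>r. strict_mono r \<and> (z \<circ> r) \<longlonglongrightarrow> l"
    using r(1,2) by blast
qed

lemma continuous_map_mom: "continuous_map \<X> euclidean mom"
proof -
  have "openin \<X> {\<mu> \<in> \<M>. mom \<mu> \<in> U}" if U: "open U" for U
  proof (subst openin_subopen, intro ballI)
    fix \<mu> assume "\<mu> \<in> {\<mu> \<in> \<M>. mom \<mu> \<in> U}"
    then have \<mu>: "\<mu> \<in> \<M>" "mom \<mu> \<in> U" by auto
    obtain n d where nd: "d > 0" "\<forall>y. (\<forall>k<n. \<bar>y k - mom \<mu> k\<bar> < d) \<longrightarrow> y \<in> U"
      using open_fun_box[OF U \<mu>(2)] by blast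
    define S where "S k = {\<nu> \<in> \<M>. (\<integral>x. x ^ k \<partial>\<nu>) \<in> ball (mom \<mu> k) d}" for k
    define T where "T = (\<Inter>k\<in>{..<n}. S k) \<inter> topspace \<X>"
    have "openin \<X> (S k)" for k
      unfolding S_def by (rule openin_invariant_integral) (intro continuous_intros, rule open_ball)
    then have "openin \<X> T" unfolding T_def by (intro openin_INT) auto
    moreover have "\<mu> \<in> T" unfolding T_def S_def topspace_invariant using \<mu> nd(1) by (auto simp: mom_def)
    moreover have "T \<subseteq> {\<mu> \<in> \<M>. mom \<mu> \<in> U}"
    proof
      fix \<nu> assume \<nu>: "\<nu> \<in> T"
      then have "\<forall>k<n. \<bar>mom \<nu> k - mom \<mu> k\<bar> < d" unfolding T_def S_def
        by (auto simp: mom_def dist_real_def abs_minus_commute)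
      then show "\<nu> \<in> {\<mu> \<in> \<M>. mom \<mu> \<in> U}" using nd(2) \<nu> unfolding T_def topspace_invariant by auto
    qed
    ultimately show "\<exists>T. openin \<X> T \<and> \<mu> \<in> T \<and> T \<subseteq> {\<mu> \<in> \<M>. mom \<mu> \<in> U}" by blast
  qed
  then show ?thesis unfolding continuous_map_def topspace_invariant by (simp add: open_openin[symmetric])
qed

lemma mom_inj: "\<mu> \<in> \<M> \<Longrightarrow> \<nu> \<in> \<M> \<Longrightarrow> mom \<mu> = mom \<nu> \<Longrightarrow> \<mu> = \<nu>"
  using measures_eqI[of \<mu> \<nu>] invariant_D(1) by metis

text \<open>Moments map the invariant measures injectively onto a compact set of sequences. The
  inverse map is continuous because every neighbourhood contains a moment box, so the space is a
  continuous image of a compact set.\<close>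

lemma compact_invariant_space: "compact_space \<X>"
proof -
  define Z where "Z = mom ` \<M>"
  define \<Psi> where "\<Psi> = inv_into (\<M>) mom"
  have \<Psi>: "\<Psi> (mom \<mu>) = \<mu>" if "\<mu> \<in> \<M>" for \<mu>
    unfolding \<Psi>_def by (rule inv_into_f_f[OF _ that]) (meson mom_inj inj_onI)
  have cont: "continuous_map (top_of_set Z) \<X> \<Psi>"
    unfolding continuous_map_def topspace_invariant
  proof (intro conjI allI impI)
    show "\<Psi> \<in> topspace (top_of_set Z) \<rightarrow> \<M>" unfolding Z_def using \<Psi> by auto
    fix U assume U: "openin \<X> U"
    show "openin (top_of_set Z) {z \<in> topspace (top_of_set Z). \<Psi> z \<in> U}"
    proof (subst openin_subopen, intro ballI)
      fix z assume "z \<in> {z \<in> topspace (top_of_set Z). \<Psi> z \<in> U}"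
      then obtain \<mu> where \<mu>: "\<mu> \<in> \<M>" "z = mom \<mu>" "\<mu> \<in> U" unfolding Z_def using \<Psi> by auto
      obtain n d where nd: "d > 0" "\<forall>\<nu>\<in>\<M>. (\<forall>k<n. \<bar>mom \<nu> k - mom \<mu> k\<bar> < d) \<longrightarrow> \<nu> \<in> U"
        using openin_invariant_box[OF U \<mu>(3)] by blast
      have "openin (top_of_set Z) (Z \<inter> {y. \<forall>k<n. \<bar>y k - z k\<bar> < d})"
        by (rule openin_open_Int[OF open_fun_coordinate_box])
      moreover have "z \<in> Z \<inter> {y. \<forall>k<n. \<bar>y k - z k\<bar> < d}" using \<mu> nd(1) unfolding Z_def by auto
      moreover have "Z \<inter> {y. \<forall>k<n. \<bar>y k - z k\<bar> < d} \<subseteq> {z \<in> topspace (top_of_set Z). \<Psi> z \<in> U}"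
        using nd(2) \<Psi> unfolding Z_def \<mu>(2) by auto
      ultimately show "\<exists>T. openin (top_of_set Z) T \<and> z \<in> T \<and> T \<subseteq> {z \<in> topspace (top_of_set Z). \<Psi> z \<in> U}" by blast
    qed
  qed
  have "compactin (top_of_set Z) Z"
    using invariant_moments_compact unfolding Z_def by (simp add: compactin_subtopology)
  then have "compactin \<X> (\<Psi> ` Z)" by (rule image_compactin[OF _ cont])
  moreover have "\<Psi> ` Z = \<M>" unfolding Z_def image_image using \<Psi> by auto
  ultimately show ?thesis unfolding compact_space_def topspace_invariant by simp
qed

lemma Hausdorff_invariant_space: "Hausdorff_space \<X>"
  unfolding Hausdorff_space_def topspace_invariant
proof (intro allI impI, elim conjE)
  fix \<mu> \<nu> assume *: "\<mu> \<in> \<M>" "\<nu> \<in> \<M>" "\<mu> \<noteq> \<nu>"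
  then obtain k where k: "mom \<mu> k \<noteq> mom \<nu> k" using mom_inj by (metis ext)
  then obtain U V where UV: "open U" "open V" "mom \<mu> k \<in> U" "mom \<nu> k \<in> V" "U \<inter> V = {}"
    by (meson hausdorff)
  show "\<exists>U V. openin \<X> U \<and> openin \<X> V \<and> \<mu> \<in> U \<and> \<nu> \<in> V \<and> disjnt U V"
  proof (intro exI conjI)
    show "openin \<X> {\<mu> \<in> \<M>. (\<integral>x. x ^ k \<partial>\<mu>) \<in> U}"
      "openin \<X> {\<mu> \<in> \<M>. (\<integral>x. x ^ k \<partial>\<mu>) \<in> V}"
      by (intro openin_invariant_integral continuous_intros UV)+
  qed (use * UV in \<open>auto simp: mom_def disjnt_def\<close>)
qed

text \<open>A compact Hausdorff space is locally compact and regular, hence a Baire space.\<close>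

lemma residual_invariant:
  assumes "countable \<G>" "\<G> \<noteq> {}" "\<And>T. T \<in> \<G> \<Longrightarrow> openin \<X> T"
    and "\<And>T. T \<in> \<G> \<Longrightarrow> \<X> closure_of T = \<M>"
    and "\<Inter>\<G> \<subseteq> S" "S \<subseteq> \<M>"
  shows "residual_in \<X> S"
proof (rule residual_inI[OF assms(1-3) _ assms(5)])
  have "locally_compact_space \<X> \<and> regular_space \<X>"
    using compact_imp_locally_compact_space compact_Hausdorff_imp_regular_space
      compact_invariant_space Hausdorff_invariant_space by blast
  then show "\<X> closure_of \<Inter>\<G> = topspace \<X>"
    by (intro Baire_category assms(1)) (use assms(3,4) topspace_invariant in auto)
qed (use assms(6) topspace_invariant in auto)

lemma invariant_closure_of_eq:
  assumes S: "S \<subseteq> \<M>"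
    and near: "\<And>\<mu> n d. \<mu> \<in> \<M> \<Longrightarrow> d > 0 \<Longrightarrow> \<exists>\<nu>\<in>S. \<forall>k<n. \<bar>mom \<nu> k - mom \<mu> k\<bar> < d"
  shows "\<X> closure_of S = \<M>"
proof -
  have "S \<inter> T \<noteq> {}" if T: "openin \<X> T" "T \<noteq> {}" for T
  proof -
    obtain \<mu> where \<mu>: "\<mu> \<in> T" using T(2) by blast
    then have \<mu>i: "\<mu> \<in> \<M>" using openin_subset[OF T(1)] topspace_invariant by blast
    obtain n d where nd: "d > 0" "\<forall>\<nu>\<in>\<M>. (\<forall>k<n. \<bar>mom \<nu> k - mom \<mu> k\<bar> < d) \<longrightarrow> \<nu> \<in> T"
      using openin_invariant_box[OF T(1) \<mu>] by blast
    then show ?thesis using near[OF \<mu>i nd(1), of n] S by blast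
  qed
  then have "\<X> closure_of S = topspace \<X>" unfolding dense_intersects_open by blast
  then show ?thesis by (simp add: topspace_invariant)
qed

end

section \<open>Cycle measures and residual properties\<close>

definition avg :: "(real \<Rightarrow> real) \<Rightarrow> (real \<Rightarrow> real) \<Rightarrow> nat \<Rightarrow> real \<Rightarrow> real" where
  "avg f \<phi> N x = (\<Sum>j<N. \<phi> ((f ^^ j) x)) / N"

lemma openin_less:
  fixes F G :: "'a \<Rightarrow> real"
  assumes "continuous_map X euclideanreal F" "continuous_map X euclideanreal G"
  shows "openin X {x \<in> topspace X. F x < G x}"
proof -
  have "openin X {x \<in> topspace X. G x - F x \<in> {0<..}}"
    by (rule openin_continuous_map_preimage[OF continuous_map_diff[OF assms(2,1)]]) (simp add: open_openin[symmetric])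
  then show ?thesis by simp
qed

lemma minimal_period_exists:
  assumes "(g ^^ p) x = x" "p > 0"
  shows "\<exists>q. minimal_period g x q \<and> q dvd p"
proof -
  define q where "q = (LEAST q. q > 0 \<and> (g ^^ q) x = x)"
  have q: "q > 0" "(g ^^ q) x = x"
    using LeastI[of "\<lambda>q. q > 0 \<and> (g ^^ q) x = x" p] assms unfolding q_def by auto
  have least: "(g ^^ r) x \<noteq> x" if "0 < r" "r < q" for r
    using not_less_Least[of r "\<lambda>q. q > 0 \<and> (g ^^ q) x = x"] that unfolding q_def by auto
  have "(g ^^ (p mod q)) x = x" using funpow_mod_eq[OF q(2), of p] assms(1) by simp
  then have "p mod q = 0" using least[of "p mod q"] q(1) by (cases "p mod q = 0") auto
  then show ?thesis unfolding minimal_period_def using q least by (intro exI[of _ q]) auto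
qed

lemma minimal_period_inj:
  assumes "minimal_period g x p"
  shows "inj_on (\<lambda>i. (g ^^ i) x) {..<p}"
proof -
  have False if ij: "i < j" "j < p" "(g ^^ i) x = (g ^^ j) x" for i j
  proof -
    have p: "(g ^^ p) x = x" using assms unfolding minimal_period_def by simp
    have 1: "(g ^^ (p - j + j)) x = x" using p ij(2) by simp
    have "(g ^^ (p - j + i)) x = (g ^^ (p - j)) ((g ^^ j) x)"
      unfolding funpow_add comp_apply ij(3) ..
    also have "\<dots> = x" using 1 unfolding funpow_add comp_apply .
    finally have "(g ^^ (p - j + i)) x = x" .
    moreover have "0 < p - j + i" "p - j + i < p" using ij by auto
    ultimately show False using assms unfolding minimal_period_def by blast
  qed
  then show ?thesis by (intro inj_onI) (metis lessThan_iff linorder_neqE_nat)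
qed

lemma avg_multiple:
  assumes "(f ^^ p) x = x" "m > 0"
  shows "avg f \<phi> (p * m) x = avg f \<phi> p x"
proof -
  have "(\<Sum>j<p * m. \<phi> ((f ^^ j) x)) = m * (\<Sum>j<p. \<phi> ((f ^^ j) x))"
  proof (induction m)
    case (Suc m)
    have e: "(f ^^ (p * m + j)) x = (f ^^ j) x" for j
    proof -
      have "((f ^^ p) ^^ m) x = x" using assms(1) by (induction m) auto
      then have "(f ^^ (p * m)) x = x" by (simp add: funpow_mult)
      then show ?thesis by (subst add.commute) (simp add: funpow_add)
    qed
    have "(\<Sum>j<p * m + p. \<phi> ((f ^^ j) x)) = (\<Sum>j<p * m. \<phi> ((f ^^ j) x)) + (\<Sum>j<p. \<phi> ((f ^^ j) x))"
      unfolding sum_lessThan_add e ..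
    then show ?case using Suc by (simp add: algebra_simps)
  qed simp
  then show ?thesis unfolding avg_def using assms(2) by simp
qed

context compact_dynamics
begin

lemma iterate_mem: "x \<in> B \<Longrightarrow> (f ^^ j) x \<in> B" by (rule funpow_mem[OF f_self])

lemma iterate_cont: "continuous_on B (f ^^ j)"
proof (induction j)
  case (Suc j)
  have "(f ^^ j) ` B \<subseteq> B" using iterate_mem by blast
  then have "continuous_on B (\<lambda>x. f ((f ^^ j) x))" by (rule continuous_on_compose2[OF f_cont Suc])
  then show ?case by (simp add: comp_def)
qed (simp add: continuous_on_id)

lemma cont_iterate: "continuous_on B \<phi> \<Longrightarrow> continuous_on B (\<lambda>x. \<phi> ((f ^^ j) x))" for \<phi> :: "real \<Rightarrow> real"
  by (rule continuous_on_compose2[OF _ iterate_cont]) (use iterate_mem in auto)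

lemma avg_cont: "continuous_on B \<phi> \<Longrightarrow> continuous_on B (avg f \<phi> N)"
  unfolding avg_def divide_inverse by (intro continuous_intros cont_iterate)

lemma invariant_iterate:
  assumes \<mu>: "\<mu> \<in> \<M>" and m: "(g :: real \<Rightarrow> real) \<in> borel_measurable \<mu>"
  shows "(\<integral>x. g ((f ^^ j) x) \<partial>\<mu>) = (\<integral>x. g x \<partial>\<mu>)"
proof (induction j)
  case (Suc j)
  have "f ^^ j \<in> measurable \<mu> \<mu>"
    by (rule measurable_compose_n[OF invariant_D(2)[OF \<mu>]])
  then have "(\<lambda>x. g ((f ^^ j) x)) \<in> borel_measurable \<mu>" by (rule measurable_compose[OF _ m])
  from invariant_integral[OF \<mu> this] Suc show ?case by (simp add: funpow_swap1)
qed simp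

lemma avg_integral:
  assumes \<mu>: "\<mu> \<in> \<M>" and \<phi>: "continuous_on B \<phi>" and N: "N > 0"
  shows "(\<integral>x. avg f \<phi> N x \<partial>\<mu>) = (\<integral>x. \<phi> x \<partial>\<mu>)"
proof -
  have "(\<integral>x. \<phi> ((f ^^ j) x) \<partial>\<mu>) = (\<integral>x. \<phi> x \<partial>\<mu>)" for j
    by (rule invariant_iterate[OF \<mu> measurable_cont[OF \<phi>]]) (use invariant_D(1)[OF \<mu>] prob_measures_D in blast)
  moreover have "integrable \<mu> (\<lambda>x. \<phi> ((f ^^ j) x))" for j
    by (rule integrable_cont[OF invariant_D(1)[OF \<mu>] cont_iterate[OF \<phi>]])
  ultimately show ?thesis unfolding avg_def using N by simp
qed

abbreviation cycle_measure where "cycle_measure y p \<equiv> empirical_measure f B y p"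

lemma cycle_integral:
  assumes "y \<in> B" "0 < p" "continuous_on B \<phi>"
  shows "(\<integral>x. \<phi> x \<partial>cycle_measure y p) = avg f \<phi> p y"
  unfolding avg_def by (rule empirical_integral[OF assms(1,2) measurable_cont[OF assms(3) refl]])

lemma cycle_mom: "y \<in> B \<Longrightarrow> 0 < p \<Longrightarrow> mom (cycle_measure y p) k = avg f (\<lambda>x. x ^ k) p y"
  unfolding avg_def by (rule empirical_mom)

lemma cycle_invariant:
  assumes y: "y \<in> B" and p: "0 < p" "(f ^^ p) y = y"
  shows "cycle_measure y p \<in> \<M>"
proof (rule invariant_if_moments[OF empirical_prob[OF y p(1)]])
  fix k
  have 1: "(\<integral>x. f x ^ k \<partial>cycle_measure y p) = avg f (\<lambda>x. f x ^ k) p y"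
    by (rule cycle_integral[OF y p(1)]) (intro continuous_intros f_cont)
  have 2: "(\<integral>x. x ^ k \<partial>cycle_measure y p) = avg f (\<lambda>x. x ^ k) p y"
    by (rule cycle_integral[OF y p(1)]) (intro continuous_intros)
  show "(\<integral>x. f x ^ k \<partial>cycle_measure y p) = (\<integral>x. x ^ k \<partial>cycle_measure y p)"
    unfolding 1 2 avg_def using orbit_sum_shift[of "\<lambda>x. x ^ k" y p] p(2) by simp
qed

lemma cycle_measure_measure:
  assumes "y \<in> B" "0 < p" "A \<in> sets R"
  shows "measure (cycle_measure y p) A = (\<Sum>j<p. indicator A ((f ^^ j) y)) / p"
proof -
  have sp: "sets (cycle_measure y p) = sets R" "space (cycle_measure y p) = B"
    using prob_measures_D[OF empirical_prob[OF assms(1,2)]] by auto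
  have "A \<inter> B = A" using assms(3) sets_R by blast
  then have "measure (cycle_measure y p) A = (\<integral>x. indicator A x \<partial>cycle_measure y p)"
    unfolding Bochner_Integration.integral_indicator sp(2) by simp
  also have "\<dots> = (\<Sum>j<p. indicator A ((f ^^ j) y)) / p"
    by (rule empirical_integral[OF assms(1,2)]) (use assms(3) in simp)
  finally show ?thesis .
qed

lemma cycle_CO:
  assumes y: "y \<in> B" and p: "minimal_period f y p"
  shows "CO_measure f B p (cycle_measure y p)"
proof -
  have p': "0 < p" "(f ^^ p) y = y" using p unfolding minimal_period_def by auto
  define C where "C = (\<lambda>i. (f ^^ i) y) ` {..<p}"
  have CB: "C \<subseteq> B" unfolding C_def using iterate_mem[OF y] by blast
  have P: "prob_space (cycle_measure y p)" "space (cycle_measure y p) = B"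
    using prob_measures_D[OF empirical_prob[OF y p'(1)]] by auto
  interpret prob_space "cycle_measure y p" by (rule P)
  have pos: "emeasure (cycle_measure y p) (U \<inter> B) > 0 \<longleftrightarrow> (\<exists>j<p. (f ^^ j) y \<in> U)" if "open U" for U
  proof -
    have "U \<inter> B \<in> sets R" unfolding sets_R using that B_borel by auto
    then have m: "measure (cycle_measure y p) (U \<inter> B) = (\<Sum>j<p. indicator (U \<inter> B) ((f ^^ j) y)) / p"
      by (rule cycle_measure_measure[OF y p'(1)])
    have "(\<Sum>j<p. indicator (U \<inter> B) ((f ^^ j) y) :: real) > 0 \<longleftrightarrow> (\<exists>j<p. (f ^^ j) y \<in> U)"
    proof
      assume "(\<Sum>j<p. indicator (U \<inter> B) ((f ^^ j) y) :: real) > 0"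
      then obtain j where "j \<in> {..<p}" "indicator (U \<inter> B) ((f ^^ j) y) \<noteq> (0 :: real)"
        by (rule sum.not_neutral_contains_not_neutral[OF less_imp_neq[THEN not_sym]])
      then show "\<exists>j<p. (f ^^ j) y \<in> U" by (auto simp: indicator_def split: if_splits)
    next
      assume "\<exists>j<p. (f ^^ j) y \<in> U"
      then obtain j where "j < p" "(f ^^ j) y \<in> U" by blast
      then show "(\<Sum>j<p. indicator (U \<inter> B) ((f ^^ j) y) :: real) > 0"
        using iterate_mem[OF y, of j] by (intro sum_pos2[of _ j]) auto
    qed
    then show ?thesis unfolding emeasure_eq_measure m using p'(1) by (simp add: zero_less_divide_iff)
  qed
  have "supp (cycle_measure y p) = C"
  proof (intro subset_antisym subsetI)
    fix x assume x: "x \<in> supp (cycle_measure y p)"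
    show "x \<in> C"
    proof (rule ccontr)
      assume "x \<notin> C"
      moreover have "open (- C)" unfolding C_def by (intro open_Compl finite_imp_closed) auto
      ultimately have "emeasure (cycle_measure y p) (- C \<inter> B) > 0" using x unfolding supp_def P(2) by blast
      then have "\<exists>j<p. (f ^^ j) y \<in> - C" using pos[OF \<open>open (- C)\<close>] by blast
      then show False unfolding C_def by auto
    qed
  next
    fix x assume x: "x \<in> C"
    have "emeasure (cycle_measure y p) (U \<inter> B) > 0" if "open U" "x \<in> U" for U
      unfolding pos[OF that(1)] using x that(2) unfolding C_def by auto
    then show "x \<in> supp (cycle_measure y p)" unfolding supp_def P(2) using x CB by auto
  qed
  then show ?thesis unfolding CO_measure_def C_def using cycle_invariant[OF y p'] p by blast
qed

text \<open>The measure conditioned on \<open>A\<close> has the same integrals as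
  \<open>\<mu>\<close>, hence equals \<open>\<mu>\<close>; but it gives \<open>A\<close> full
  mass.\<close>

lemma integral_set_eq_imp_full:
  assumes \<mu>: "\<mu> \<in> \<P>" and A: "A \<in> sets \<mu>" "measure \<mu> A > 0"
    and eq: "\<And>\<phi>. continuous_on B (\<phi> :: real \<Rightarrow> real) \<Longrightarrow> (\<integral>x. indicator A x * \<phi> x \<partial>\<mu>) = measure \<mu> A * (\<integral>x. \<phi> x \<partial>\<mu>)"
  shows "measure \<mu> A = 1"
proof -
  interpret prob_space \<mu> by (rule prob_measures_D[OF \<mu>])
  define g :: "real \<Rightarrow> real" where "g x = indicator A x / measure \<mu> A" for x
  define \<nu> where "\<nu> = uniform_measure \<mu> A"
  have \<nu>_eq: "\<nu> = density \<mu> (\<lambda>x. ennreal (g x))"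
    unfolding \<nu>_def uniform_measure_def g_def by (rule arg_cong[where f = "density \<mu>"])
      (use A in \<open>auto simp: fun_eq_iff indicator_def emeasure_eq_measure divide_ennreal[symmetric]\<close>)
  have "prob_space \<nu>" unfolding \<nu>_def by (rule prob_space_uniform_measure) (use A in \<open>auto simp: emeasure_eq_measure\<close>)
  then have \<nu>: "\<nu> \<in> \<P>"
    unfolding prob_measures_on_def \<nu>_def using prob_measures_D(2)[OF \<mu>] by simp
  have "\<nu> = \<mu>"
  proof (rule measures_eqI_integrals[OF \<nu> \<mu>])
    fix \<phi> :: "real \<Rightarrow> real" assume \<phi>: "continuous_on B \<phi>"
    have "(\<integral>x. \<phi> x \<partial>\<nu>) = (\<integral>x. g x *\<^sub>R \<phi> x \<partial>\<mu>)"
      unfolding \<nu>_eq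
      by (rule integral_density) (use A measurable_cont[OF \<phi> prob_measures_D(2)[OF \<mu>]] in \<open>auto simp: g_def\<close>)
    also have "\<dots> = (\<integral>x. (indicator A x * \<phi> x) / measure \<mu> A \<partial>\<mu>)" unfolding g_def by simp
    also have "\<dots> = (\<integral>x. \<phi> x \<partial>\<mu>)" unfolding integral_divide_zero eq[OF \<phi>] using A(2) by simp
    finally show "(\<integral>x. \<phi> x \<partial>\<nu>) = (\<integral>x. \<phi> x \<partial>\<mu>)" .
  qed
  then have "measure \<mu> A = measure \<nu> A" by simp
  also have "\<dots> = 1" unfolding \<nu>_def using A by (simp add: emeasure_eq_measure)
  finally show ?thesis .
qed

text \<open>On invariant measures and for \<open>N > 0\<close> this is the variance of the orbit
  averages. Written as a difference of integrals, it is visibly continuous in the measure.\<close>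

definition avg_variance :: "(real \<Rightarrow> real) \<Rightarrow> nat \<Rightarrow> real measure \<Rightarrow> real" where
  "avg_variance \<phi> N \<mu> = (\<integral>x. (avg f \<phi> N x)\<^sup>2 \<partial>\<mu>) - (\<integral>x. \<phi> x \<partial>\<mu>)\<^sup>2"

lemma avg_variance_eq:
  assumes \<mu>: "\<mu> \<in> \<M>" and \<phi>: "continuous_on B \<phi>" and N: "N > 0"
  shows "avg_variance \<phi> N \<mu> = (\<integral>x. (avg f \<phi> N x - (\<integral>x. \<phi> x \<partial>\<mu>))\<^sup>2 \<partial>\<mu>)"
proof -
  interpret prob_space \<mu> by (rule prob_measures_D[OF invariant_D(1)[OF \<mu>]])
  define c where "c = (\<integral>x. \<phi> x \<partial>\<mu>)"
  have i1: "integrable \<mu> (avg f \<phi> N)" and i2: "integrable \<mu> (\<lambda>x. (avg f \<phi> N x)\<^sup>2)"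
    by (intro integrable_cont invariant_D(1)[OF \<mu>] continuous_intros avg_cont \<phi>)+
  have "(\<integral>x. (avg f \<phi> N x - c)\<^sup>2 \<partial>\<mu>) = (\<integral>x. (avg f \<phi> N x)\<^sup>2 - 2 * c * avg f \<phi> N x + c\<^sup>2 \<partial>\<mu>)"
    by (rule Bochner_Integration.integral_cong) (simp_all add: power2_diff algebra_simps)
  also have "\<dots> = (\<integral>x. (avg f \<phi> N x)\<^sup>2 \<partial>\<mu>) - 2 * c * c + c\<^sup>2"
    using i1 i2 avg_integral[OF \<mu> \<phi> N] by (simp add: c_def prob_space)
  finally show ?thesis unfolding avg_variance_def c_def by (simp add: power2_eq_square)
qed

text \<open>For an invariant set \<open>A\<close>, replacing a test function by its orbit averages
  does not change the integral over \<open>A\<close>. These averages are close to a constant in the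
  mean, so the integral over \<open>A\<close> splits into a product. Rational polynomials suffice by
  approximation.\<close>

lemma ergodic_if_avg_variance:
  assumes \<mu>: "\<mu> \<in> \<M>"
    and small: "\<And>l n. \<exists>N>0. avg_variance (rat_poly l) N \<mu> < 1 / Suc n"
  shows "ergodic f \<mu>" unfolding ergodic_def
proof (intro ballI impI)
  fix A assume A: "A \<in> sets \<mu>" "f -` A \<inter> space \<mu> = A"
  have \<mu>p: "\<mu> \<in> \<P>" by (rule invariant_D[OF \<mu>])
  interpret prob_space \<mu> by (rule prob_measures_D[OF \<mu>p])
  have inA: "indicator A (f x) = (indicator A x :: real)" if "x \<in> B" for x
    using A(2) that prob_measures_D(3)[OF \<mu>p] by (auto simp: indicator_def)
  have inA': "indicator A ((f ^^ j) x) = (indicator A x :: real)" if "x \<in> B" for x j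
    using that by (induction j) (auto simp: inA iterate_mem)
  have intA: "integrable \<mu> (\<lambda>x. indicator A x * \<phi> x)" if "continuous_on B \<phi>" for \<phi> :: "real \<Rightarrow> real"
    using integrable_real_mult_indicator[OF A(1) integrable_cont[OF \<mu>p that]] by (simp add: mult.commute)
  have avgA: "(\<integral>x. indicator A x * avg f \<phi> N x \<partial>\<mu>) = (\<integral>x. indicator A x * \<phi> x \<partial>\<mu>)"
    if \<phi>: "continuous_on B \<phi>" and N: "N > 0" for \<phi> N
  proof -
    have m: "(\<lambda>x. indicator A x * \<phi> x) \<in> borel_measurable \<mu>"
      using measurable_cont[OF \<phi> prob_measures_D(2)[OF \<mu>p]] A(1) by measurable
    have "(\<integral>x. indicator A x * \<phi> ((f ^^ j) x) \<partial>\<mu>) = (\<integral>x. indicator A x * \<phi> x \<partial>\<mu>)" for j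
    proof -
      have "(\<integral>x. indicator A x * \<phi> ((f ^^ j) x) \<partial>\<mu>) = (\<integral>x. indicator A ((f ^^ j) x) * \<phi> ((f ^^ j) x) \<partial>\<mu>)"
        by (rule Bochner_Integration.integral_cong) (simp_all add: prob_measures_D(3)[OF \<mu>p] inA')
      also have "\<dots> = (\<integral>x. indicator A x * \<phi> x \<partial>\<mu>)" by (rule invariant_iterate[OF \<mu> m])
      finally show ?thesis .
    qed
    moreover have "integrable \<mu> (\<lambda>x. indicator A x * \<phi> ((f ^^ j) x))" for j
      by (intro intA cont_iterate \<phi>)
    ultimately show ?thesis
      unfolding avg_def times_divide_eq_right integral_divide_zero sum_distrib_left
      by (subst Bochner_Integration.integral_sum) (use N in simp_all)
  qed
  have poly: "\<bar>(\<integral>x. indicator A x * rat_poly l x \<partial>\<mu>) - measure \<mu> A * (\<integral>x. rat_poly l x \<partial>\<mu>)\<bar> \<le> 2 * d"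
    if d: "d > 0" for l d
  proof -
    define P where "P = rat_poly l"
    have P: "continuous_on B P" unfolding P_def by (rule continuous_on_rat_poly)
    define c where "c = (\<integral>x. P x \<partial>\<mu>)"
    obtain n where n: "1 / real (Suc n) < d\<^sup>2" using d nat_approx_posE[of "d\<^sup>2"] by auto
    obtain N where N: "N > 0" "avg_variance P N \<mu> < 1 / Suc n" using small[of l n] unfolding P_def by blast
    define t where "t x = avg f P N x - c" for x
    have tc: "continuous_on B t" unfolding t_def by (intro continuous_intros avg_cont P)
    have it: "integrable \<mu> (\<lambda>x. \<bar>t x\<bar>)" "integrable \<mu> (\<lambda>x. (t x)\<^sup>2)"
      by (intro integrable_cont \<mu>p continuous_intros tc)+
    have V: "(\<integral>x. (t x)\<^sup>2 \<partial>\<mu>) < d\<^sup>2"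
      using N(2) n unfolding avg_variance_eq[OF \<mu> P N(1)] t_def c_def by simp
    have "(\<integral>x. indicator A x * t x \<partial>\<mu>) = (\<integral>x. indicator A x * avg f P N x - indicator A x * c \<partial>\<mu>)"
      by (rule Bochner_Integration.integral_cong) (auto simp: t_def algebra_simps)
    also have "\<dots> = (\<integral>x. indicator A x * P x \<partial>\<mu>) - (\<integral>x. indicator A x * c \<partial>\<mu>)"
      using avgA[OF P N(1)] intA[OF avg_cont[OF P]] intA[of "\<lambda>_. c"] by simp
    also have "(\<integral>x. indicator A x * c \<partial>\<mu>) = measure \<mu> A * c"
      using A(1) sets.sets_into_space[OF A(1)] by (simp add: Int_absorb2)
    finally have eq: "(\<integral>x. indicator A x * t x \<partial>\<mu>) = (\<integral>x. indicator A x * P x \<partial>\<mu>) - measure \<mu> A * c" .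
    \<comment> \<open>Replaces the Cauchy-Schwarz inequality in passing from the quadratic to the
      linear mean.\<close>
    have pw: "\<bar>s\<bar> \<le> d + s\<^sup>2 / d" for s :: real
    proof (cases "\<bar>s\<bar> \<le> d")
      case True
      have "s\<^sup>2 / d \<ge> 0" using d by simp
      then show ?thesis using True by linarith
    next
      case False
      have "\<bar>s\<bar> * d \<le> \<bar>s\<bar> * \<bar>s\<bar>" using False by (intro mult_left_mono) auto
      then have "\<bar>s\<bar> \<le> s\<^sup>2 / d" using d by (simp add: pos_le_divide_eq power2_eq_square)
      then show ?thesis using d by linarith
    qed
    have "\<bar>\<integral>x. indicator A x * t x \<partial>\<mu>\<bar> \<le> (\<integral>x. \<bar>indicator A x * t x\<bar> \<partial>\<mu>)" by (rule integral_abs_bound)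
    also have "\<dots> \<le> (\<integral>x. d + (t x)\<^sup>2 / d \<partial>\<mu>)"
    proof (rule integral_mono)
      show "integrable \<mu> (\<lambda>x. \<bar>indicator A x * t x\<bar>)" using intA[OF tc] by simp
      show "integrable \<mu> (\<lambda>x. d + (t x)\<^sup>2 / d)" using it(2) by simp
      fix x
      show "\<bar>indicator A x * t x\<bar> \<le> d + (t x)\<^sup>2 / d"
      proof (rule order_trans[OF _ pw[of "t x"]])
        show "\<bar>indicator A x * t x\<bar> \<le> \<bar>t x\<bar>" by (simp add: indicator_def)
      qed
    qed
    also have "\<dots> = d + (\<integral>x. (t x)\<^sup>2 \<partial>\<mu>) / d" using it(2) by (simp add: prob_space)
    also have "\<dots> \<le> d + d\<^sup>2 / d" using V d by (intro add_left_mono divide_right_mono) auto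
    also have "\<dots> = 2 * d" using d by (simp add: power2_eq_square)
    finally show ?thesis unfolding eq c_def P_def .
  qed
  have split: "(\<integral>x. indicator A x * \<phi> x \<partial>\<mu>) = measure \<mu> A * (\<integral>x. \<phi> x \<partial>\<mu>)" if \<phi>: "continuous_on B \<phi>" for \<phi>
  proof -
    have close: "\<bar>(\<integral>x. indicator A x * \<phi> x \<partial>\<mu>) - measure \<mu> A * (\<integral>x. \<phi> x \<partial>\<mu>)\<bar> \<le> e" if e: "e > 0" for e
    proof -
      obtain l where l: "\<And>x. x \<in> B \<Longrightarrow> \<bar>\<phi> x - rat_poly l x\<bar> < e / 4"
        using rat_poly_approx[OF B_compact B_01 \<phi>, of "e/4"] e by auto
      have P: "continuous_on B (rat_poly l)" by (rule continuous_on_rat_poly)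
      have "\<bar>(\<integral>x. \<phi> x \<partial>\<mu>) - (\<integral>x. rat_poly l x \<partial>\<mu>)\<bar> \<le> e / 4"
        by (rule integral_close[OF \<mu>p \<phi> P]) (use l in force)
      then have 1: "\<bar>measure \<mu> A * (\<integral>x. \<phi> x \<partial>\<mu>) - measure \<mu> A * (\<integral>x. rat_poly l x \<partial>\<mu>)\<bar> \<le> 1 * (e / 4)"
        unfolding right_diff_distrib[symmetric] abs_mult by (intro mult_mono) auto
      have "\<bar>(\<integral>x. indicator A x * \<phi> x \<partial>\<mu>) - (\<integral>x. indicator A x * rat_poly l x \<partial>\<mu>)\<bar> =
        \<bar>\<integral>x. indicator A x * \<phi> x - indicator A x * rat_poly l x \<partial>\<mu>\<bar>"
        using intA[OF \<phi>] intA[OF P] by simp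
      also have "\<dots> \<le> (\<integral>x. \<bar>indicator A x * \<phi> x - indicator A x * rat_poly l x\<bar> \<partial>\<mu>)" by (rule integral_abs_bound)
      also have "\<dots> \<le> (\<integral>x. e / 4 \<partial>\<mu>)"
        by (rule integral_mono) (use intA[OF \<phi>] intA[OF P] l e prob_measures_D(3)[OF \<mu>p] in \<open>auto simp: indicator_def less_imp_le\<close>)
      finally have 2: "\<bar>(\<integral>x. indicator A x * \<phi> x \<partial>\<mu>) - (\<integral>x. indicator A x * rat_poly l x \<partial>\<mu>)\<bar> \<le> e / 4"
        by (simp add: prob_space)
      show ?thesis using 1 2 poly[of "e/4" l] e by linarith
    qed
    have "\<bar>(\<integral>x. indicator A x * \<phi> x \<partial>\<mu>) - measure \<mu> A * (\<integral>x. \<phi> x \<partial>\<mu>)\<bar> \<le> 0"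
      by (rule field_le_epsilon) (simp only: add_0 close)
    then show ?thesis by simp
  qed
  have "measure \<mu> A = 1" if "measure \<mu> A > 0"
    by (rule integral_set_eq_imp_full[OF \<mu>p A(1) that split])
  then show "measure \<mu> A = 0 \<or> measure \<mu> A = 1" using measure_nonneg[of \<mu> A] by linarith
qed

end

text \<open>For \<open>k > 0\<close>, a hat of height 1 centred at \<open>j / k\<close> and
  vanishing outside of radius \<open>1 / k\<close>. The hats with \<open>j \<le> k\<close> cover the
  unit interval, so uniformly small integrals rule out large atoms.\<close>

definition tent :: "nat \<Rightarrow> nat \<Rightarrow> real \<Rightarrow> real" where "tent k j x = max 0 (1 - \<bar>real k * x - real j\<bar>)"

lemma finite_set_gap:
  assumes "finite (C :: real set)"
  shows "\<exists>d>0. \<forall>x\<in>C. \<forall>y\<in>C. x \<noteq> y \<longrightarrow> d \<le> \<bar>x - y\<bar>"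
proof -
  define D where "D = insert 1 ((\<lambda>(x, y). \<bar>x - y\<bar>) ` (C \<times> C) - {0})"
  have fin: "finite D" unfolding D_def using assms by simp
  have "Min D > 0" unfolding D_def using assms by (subst Min_gr_iff) auto
  moreover have "Min D \<le> \<bar>x - y\<bar>" if "x \<in> C" "y \<in> C" "x \<noteq> y" for x y
    by (rule Min_le[OF fin]) (use that in \<open>auto simp: D_def\<close>)
  ultimately show ?thesis by blast
qed

context compact_dynamics
begin

lemma continuous_map_avg_variance:
  assumes "continuous_on B \<phi>"
  shows "continuous_map \<X> euclideanreal (avg_variance \<phi> N)"
  unfolding avg_variance_def power2_eq_square
  by (intro continuous_map_diff continuous_map_real_mult continuous_map_integral continuous_on_mult avg_cont assms)

text \<open>Along a cycle, averages over the full period are constant.\<close>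

lemma cycle_avg_variance:
  assumes y: "y \<in> B" "0 < p" "(f ^^ p) y = y" and \<phi>: "continuous_on B \<phi>"
  shows "avg_variance \<phi> p (cycle_measure y p) = 0"
proof -
  have "avg f \<phi> p ((f ^^ j) y) = avg f \<phi> p y" for j
  proof (induction j)
    case (Suc j)
    have per: "(f ^^ p) ((f ^^ j) y) = (f ^^ j) y" by (metis add.commute comp_apply funpow_add y(3))
    have "avg f \<phi> p (f ((f ^^ j) y)) = avg f \<phi> p ((f ^^ j) y)"
      unfolding avg_def using orbit_sum_shift[of \<phi> "(f ^^ j) y" p] per by (simp add: funpow_swap1)
    then show ?case using Suc by simp
  qed simp
  then have "avg f (\<lambda>x. (avg f \<phi> p x)\<^sup>2) p y = (avg f \<phi> p y)\<^sup>2"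
    unfolding avg_def[of f "\<lambda>x. (avg f \<phi> p x)\<^sup>2"] using y(2) by simp
  then show ?thesis unfolding avg_variance_def cycle_integral[OF y(1,2) \<phi>]
    by (subst cycle_integral[OF y(1,2)]) (intro continuous_intros avg_cont \<phi>, simp)
qed

lemma tent_cont: "continuous_on B (tent k j)" unfolding tent_def by (intro continuous_intros)

lemma cycle_tent_small:
  assumes y: "y \<in> B" and p: "minimal_period f y p"
  shows "\<exists>k. \<forall>j\<le>k. (\<integral>x. tent k j x \<partial>cycle_measure y p) \<le> 1 / p"
proof -
  have p': "0 < p" using p unfolding minimal_period_def by auto
  obtain d where d: "d > 0" "\<forall>x\<in>(\<lambda>i. (f ^^ i) y) ` {..<p}. \<forall>x'\<in>(\<lambda>i. (f ^^ i) y) ` {..<p}. x \<noteq> x' \<longrightarrow> d \<le> \<bar>x - x'\<bar>"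
    using finite_set_gap[of "(\<lambda>i. (f ^^ i) y) ` {..<p}"] by auto
  \<comment> \<open>The support of a hat, of length \<open>2 / k\<close>, becomes shorter than the
    smallest distance between points of the cycle, so each hat sees at most one of them.\<close>
  obtain k where k: "2 / d < real k" using reals_Archimedean2 by blast
  have "(\<integral>x. tent k j x \<partial>cycle_measure y p) \<le> 1 / p" for j
  proof -
    have "(\<Sum>i<p. tent k j ((f ^^ i) y)) \<le> 1"
    proof (cases "\<exists>i<p. tent k j ((f ^^ i) y) \<noteq> 0")
      case True
      then obtain i where i: "i < p" "tent k j ((f ^^ i) y) \<noteq> 0" by blast
      have "tent k j ((f ^^ i') y) = 0" if i': "i' < p" "i' \<noteq> i" for i'
      proof (rule ccontr)
        assume ne: "tent k j ((f ^^ i') y) \<noteq> 0"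
        have "(f ^^ i') y \<noteq> (f ^^ i) y" using inj_onD[OF minimal_period_inj[OF p], of i' i] i(1) i' by auto
        then have "d \<le> \<bar>(f ^^ i') y - (f ^^ i) y\<bar>" using d(2) i(1) i'(1) by blast
        then have "real k * d \<le> real k * \<bar>(f ^^ i') y - (f ^^ i) y\<bar>" by (intro mult_left_mono) auto
        also have "\<dots> = \<bar>(real k * (f ^^ i') y - real j) - (real k * (f ^^ i) y - real j)\<bar>"
          by (simp add: right_diff_distrib[symmetric] abs_mult)
        also have "\<dots> < 2" using i(2) ne unfolding tent_def by (auto simp: max_def split: if_splits)
        finally show False using k d(1) by (simp add: pos_divide_less_eq)
      qed
      then have "(\<Sum>i'\<in>{..<p} - {i}. tent k j ((f ^^ i') y)) = 0" by (intro sum.neutral) auto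
      then have "(\<Sum>i<p. tent k j ((f ^^ i) y)) = tent k j ((f ^^ i) y)"
        using sum.remove[of "{..<p}" i "\<lambda>i. tent k j ((f ^^ i) y)"] i(1) by simp
      also have "\<dots> \<le> 1" unfolding tent_def by simp
      finally show ?thesis .
    next
      case False
      then have "(\<Sum>i<p. tent k j ((f ^^ i) y)) = 0" by (intro sum.neutral) auto
      then show ?thesis by simp
    qed
    then show ?thesis unfolding cycle_integral[OF y p' tent_cont] avg_def by (intro divide_right_mono) auto
  qed
  then show ?thesis by blast
qed

lemma non_atomic_if_tents:
  assumes \<mu>: "\<mu> \<in> \<P>"
    and small: "\<And>n. \<exists>k. \<forall>j\<le>k. (\<integral>x. tent k j x \<partial>\<mu>) < 1 / Suc n"
  shows "non_atomic \<mu>" unfolding non_atomic_def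
proof
  fix b assume "b \<in> space \<mu>"
  then have b: "b \<in> B" using prob_measures_D(3)[OF \<mu>] by blast
  interpret prob_space \<mu> by (rule prob_measures_D[OF \<mu>])
  have b01: "0 \<le> b" "b \<le> 1" using b B_01 by auto
  have "measure \<mu> {b} \<le> 2 / Suc n" for n
  proof -
    obtain k where k: "\<forall>j\<le>k. (\<integral>x. tent k j x \<partial>\<mu>) < 1 / Suc n" using small by blast
    \<comment> \<open>Index of the grid point nearest to \<open>b\<close>, whose hat is at least
      \<open>1 / 2\<close> at \<open>b\<close>.\<close>
    define j where "j = nat (round (real k * b))"
    have "real k * b \<le> real k * 1" by (intro mult_left_mono b01) simp
    then have "round (real k * b) \<le> round (real k)" by (intro round_mono) simp
    then have j: "j \<le> k" unfolding j_def by simp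
    have "round (real k * b) \<ge> round (0 :: real)" using b01 by (intro round_mono) simp
    then have "real j = of_int (round (real k * b))" unfolding j_def by simp
    then have "\<bar>real k * b - real j\<bar> \<le> 1 / 2" using of_int_round_abs_le[of "real k * b"] by (simp add: abs_minus_commute)
    then have tb: "tent k j b \<ge> 1 / 2" unfolding tent_def by simp
    have sb: "{b} \<in> sets \<mu>" using b prob_measures_D(2)[OF \<mu>] sets_R by auto
    have "measure \<mu> {b} = (\<integral>x. indicator {b} x \<partial>\<mu>)" using b prob_measures_D(3)[OF \<mu>] by simp
    also have "\<dots> \<le> (\<integral>x. 2 * tent k j x \<partial>\<mu>)"
    proof (rule integral_mono)
      show "integrable \<mu> (\<lambda>x. indicator {b} x :: real)"
        by (rule integrable_const_bound[where B = 1]) (use sb in auto)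
      show "integrable \<mu> (\<lambda>x. 2 * tent k j x)" using integrable_cont[OF \<mu> tent_cont] by simp
      show "indicator {b} x \<le> 2 * tent k j x" for x
      proof (cases "x = b")
        case False
        then show ?thesis by (simp add: tent_def)
      qed (use tb in simp)
    qed
    also have "\<dots> = 2 * (\<integral>x. tent k j x \<partial>\<mu>)" by simp
    also have "\<dots> \<le> 2 * (1 / Suc n)" using k j by (intro mult_left_mono less_imp_le) auto
    finally show ?thesis by simp
  qed
  moreover have "(\<lambda>n. 2 / real (Suc n)) \<longlonglongrightarrow> 0"
    using tendsto_mult_left[OF LIMSEQ_Suc[OF lim_1_over_n], of 2] by simp
  ultimately have "measure \<mu> {b} \<le> 0" by (intro LIMSEQ_le_const[of _ 0]) auto
  then show "measure \<mu> {b} = 0" using measure_nonneg[of \<mu> "{b}"] by linarith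
qed

text \<open>A hat of radius \<open>1 / Suc n\<close> at \<open>q\<close>; rational centres give a
  countable family that detects all nonempty relatively open sets.\<close>

definition bump :: "real \<Rightarrow> nat \<Rightarrow> real \<Rightarrow> real" where "bump q n x = max 0 (1 / Suc n - \<bar>x - q\<bar>)"

lemma bump_cont: "continuous_on B (bump q n)" unfolding bump_def by (intro continuous_intros)

lemma measure_pos_if_bump:
  assumes \<mu>: "\<mu> \<in> \<P>" and A: "A \<in> sets \<mu>" "\<And>x. x \<in> B \<Longrightarrow> \<bar>x - q\<bar> < 1 / Suc n \<Longrightarrow> x \<in> A"
    and pos: "(\<integral>x. bump q n x \<partial>\<mu>) > 0"
  shows "emeasure \<mu> A > 0"
proof (rule ccontr)
  assume "\<not> emeasure \<mu> A > 0"
  then have null: "emeasure \<mu> A = 0" by simp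
  have "AE y in \<mu>. bump q n y = 0"
  proof (rule AE_I[OF _ null A(1)])
    show "{y \<in> space \<mu>. bump q n y \<noteq> 0} \<subseteq> A"
      unfolding bump_def using A(2) prob_measures_D(3)[OF \<mu>] by (auto simp: max_def split: if_splits)
  qed
  then have "(\<integral>y. bump q n y \<partial>\<mu>) = 0" by (rule integral_eq_zero_AE)
  then show False using pos by simp
qed

lemma full_supp_if_bumps:
  assumes \<mu>: "\<mu> \<in> \<P>"
    and pos: "\<And>(q :: rat) n x. x \<in> B \<Longrightarrow> bump (of_rat q) n x > 0 \<Longrightarrow> (\<integral>x. bump (of_rat q) n x \<partial>\<mu>) > 0"
  shows "supp \<mu> = B"
proof -
  have "emeasure \<mu> (U \<inter> B) > 0" if U: "open U" "x \<in> U" "x \<in> B" for U x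
  proof -
    have sU: "U \<inter> B \<in> sets \<mu>" using U(1) prob_measures_D(2)[OF \<mu>] sets_R B_borel by auto
    obtain e where e: "e > 0" "ball x e \<subseteq> U" using U(1,2) open_contains_ball by blast
    obtain n where n: "1 / real (Suc n) < e / 2" using nat_approx_posE[of "e/2"] e(1) by auto
    obtain q where q: "x - 1 / Suc n < of_rat q" "of_rat q < x" using of_rat_dense[of "x - 1 / Suc n" x] by auto
    have "bump (of_rat q) n x > 0" unfolding bump_def using q by auto
    note pos[OF U(3) this]
    then show ?thesis
    proof (rule measure_pos_if_bump[OF \<mu> sU, rotated])
      fix y assume y: "y \<in> B" "\<bar>y - of_rat q\<bar> < 1 / Suc n"
      then have "\<bar>x - y\<bar> < e" using q n by linarith
      then have "y \<in> ball x e" by (simp add: dist_real_def)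
      then show "y \<in> U \<inter> B" using e(2) y(1) by blast
    qed
  qed
  then show ?thesis unfolding supp_def prob_measures_D(3)[OF \<mu>] by auto
qed

text \<open>If \<open>f ^^ n\<close> is close to the identity in the mean, few points of \<open>{..s}\<close> are sent to \<open>{t..}\<close>.\<close>

lemma mixing_rigid_null:
  assumes \<mu>: "\<mu> \<in> \<M>" and mix: "strongly_mixing f \<mu>" and st: "s < t"
    and rigid: "\<And>m. \<exists>n\<ge>m. (\<integral>x. \<bar>(f ^^ n) x - x\<bar> \<partial>\<mu>) < 1 / Suc m"
  shows "measure \<mu> ({..s} \<inter> B) * measure \<mu> ({t..} \<inter> B) = 0"
proof (rule ccontr)
  have \<mu>p: "\<mu> \<in> \<P>" by (rule invariant_D[OF \<mu>])
  interpret prob_space \<mu> by (rule prob_measures_D[OF \<mu>p])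
  note sp = prob_measures_D(3)[OF \<mu>p]
  define A C where "A = {..s} \<inter> B" and "C = {t..} \<inter> B"
  define L where "L = measure \<mu> A * measure \<mu> C"
  define H where "H n = A \<inter> ((f ^^ n) -` C \<inter> space \<mu>)" for n
  assume "\<not> ?thesis"
  then have "0 < L" using measure_nonneg[of \<mu> A] measure_nonneg[of \<mu> C] unfolding L_def A_def C_def
    by (simp add: less_le)
  then have L: "0 < L / 2" by simp
  have S: "A \<in> sets \<mu>" "C \<in> sets \<mu>"
    unfolding prob_measures_D(2)[OF \<mu>p] sets_R A_def C_def using B_borel by auto
  have "(\<lambda>n. measure \<mu> (H n)) \<longlonglongrightarrow> L" using mix S unfolding strongly_mixing_def L_def H_def by blast
  then have "eventually (\<lambda>n. L / 2 < measure \<mu> (H n)) sequentially" using order_tendstoD(1)[of _ L _ "L / 2"] L by simp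
  then obtain m where m: "\<And>n. n \<ge> m \<Longrightarrow> L / 2 < measure \<mu> (H n)" unfolding eventually_sequentially by blast
  have "0 < (t - s) * (L / 2)" using st L by (intro mult_pos_pos) auto
  then obtain m' where m': "1 / real (Suc m') < (t - s) * (L / 2)" using nat_approx_posE by blast
  obtain n where n: "n \<ge> max m m'" "(\<integral>x. \<bar>(f ^^ n) x - x\<bar> \<partial>\<mu>) < 1 / Suc (max m m')" using rigid by blast
  have Hs: "H n \<in> sets \<mu>"
    unfolding H_def using S measurable_sets[OF measurable_compose_n[OF invariant_D(2)[OF \<mu>]] S(2)] by blast
  have "(t - s) * measure \<mu> (H n) = (\<integral>x. (t - s) * indicator (H n) x \<partial>\<mu>)"
    using sets.sets_into_space[OF Hs] by (simp add: Int_absorb2)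
  also have "\<dots> \<le> (\<integral>x. \<bar>(f ^^ n) x - x\<bar> \<partial>\<mu>)"
  proof (rule integral_mono)
    show "integrable \<mu> (\<lambda>x. (t - s) * indicator (H n) x)"
      by (rule integrable_const_bound[where B = "t - s"]) (use Hs st in \<open>auto simp: indicator_def\<close>)
    show "integrable \<mu> (\<lambda>x. \<bar>(f ^^ n) x - x\<bar>)" by (intro integrable_cont \<mu>p continuous_intros iterate_cont)
    show "(t - s) * indicator (H n) x \<le> \<bar>(f ^^ n) x - x\<bar>" for x
      using st unfolding H_def A_def C_def by (auto simp: indicator_def)
  qed
  also have "\<dots> < 1 / real (Suc (max m m'))" by (rule n(2))
  also have "\<dots> \<le> 1 / real (Suc m')" by (intro divide_left_mono) auto
  finally have "(t - s) * measure \<mu> (H n) < (t - s) * (L / 2)" using m' by simp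
  then have "measure \<mu> (H n) < L / 2" using st by simp
  then show False using m[of n] n(1) by simp
qed

end

text \<open>All that the residual statements take from the interval dynamics. Approximation of
  moments gives density, long periods give small atoms, and visits near \<open>b\<close> give mass
  near \<open>b\<close>.\<close>

locale cycle_rich = compact_dynamics +
  assumes rich: "\<lbrakk>\<mu> \<in> invariant_measures f B; d > 0; b \<in> B\<rbrakk> \<Longrightarrow>
    \<exists>y p. y \<in> B \<and> minimal_period f y p \<and> l \<le> p \<and> (\<exists>i. \<bar>(f ^^ i) y - b\<bar> < d) \<and>
      (\<forall>k<n. \<bar>avg f (\<lambda>x. x ^ k) p y - mom \<mu> k\<bar> < d)"
begin

lemma closure_of_cycles:
  assumes "T \<subseteq> \<M>" "b \<in> B" "e > 0"
    and cyc: "\<And>y p. \<lbrakk>y \<in> B; minimal_period f y p; l \<le> p; \<exists>i. \<bar>(f ^^ i) y - b\<bar> < e\<rbrakk> \<Longrightarrow> cycle_measure y p \<in> T"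
  shows "\<X> closure_of T = \<M>"
proof (rule invariant_closure_of_eq[OF assms(1)])
  fix \<mu> n and d :: real assume \<mu>: "\<mu> \<in> \<M>" and d: "d > 0"
  have "min d e > 0" using d assms(3) by simp
  then obtain y p where y: "y \<in> B" "minimal_period f y p" "l \<le> p" "\<exists>i. \<bar>(f ^^ i) y - b\<bar> < min d e"
    "\<forall>k<n. \<bar>avg f (\<lambda>x. x ^ k) p y - mom \<mu> k\<bar> < min d e"
    using rich[OF \<mu> _ assms(2), of "min d e" l n] by blast
  have p: "0 < p" using y(2) unfolding minimal_period_def by simp
  have "cycle_measure y p \<in> T" by (rule cyc[OF y(1-3)]) (use y(4) in auto)
  moreover have "\<forall>k<n. \<bar>mom (cycle_measure y p) k - mom \<mu> k\<bar> < d"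
    unfolding cycle_mom[OF y(1) p] using y(5) by auto
  ultimately show "\<exists>\<nu>\<in>T. \<forall>k<n. \<bar>mom \<nu> k - mom \<mu> k\<bar> < d" by blast
qed

lemma cycle_D:
  assumes "minimal_period f y p"
  shows "0 < p" "(f ^^ p) y = y" using assms unfolding minimal_period_def by auto

lemma CO_dense:
  "dense_in \<X> {\<mu> \<in> \<M>. \<exists>p\<ge>l. CO_measure f B p \<mu>}"
proof -
  obtain b where b: "b \<in> B" using B_ne by blast
  have "\<X> closure_of {\<mu> \<in> \<M>. \<exists>p\<ge>l. CO_measure f B p \<mu>} = \<M>"
  proof (rule closure_of_cycles[where l = l, OF _ b zero_less_one])
    fix y p assume y: "y \<in> B" "minimal_period f y p" "l \<le> p"
    show "cycle_measure y p \<in> {\<mu> \<in> \<M>. \<exists>p\<ge>l. CO_measure f B p \<mu>}"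
      using cycle_invariant[OF y(1) cycle_D[OF y(2)]] cycle_CO[OF y(1,2)] y(3) by blast
  qed blast
  then show ?thesis unfolding dense_in_def topspace_invariant by blast
qed

lemma bump_open: "openin \<X> {\<mu> \<in> \<M>. 0 < (\<integral>x. bump q n x \<partial>\<mu>)}"
proof -
  have "openin \<X> {\<mu> \<in> topspace \<X>. 0 < (\<integral>x. bump q n x \<partial>\<mu>)}"
    by (intro openin_less continuous_map_integral bump_cont) simp
  then show ?thesis unfolding topspace_invariant .
qed

lemma bump_dense:
  assumes b: "b \<in> B" "bump q n b > 0"
  shows "\<X> closure_of {\<mu> \<in> \<M>. 0 < (\<integral>x. bump q n x \<partial>\<mu>)} = \<M>"
proof -
  define e where "e = 1 / Suc n - \<bar>b - q\<bar>"
  have e: "e > 0" using b(2) unfolding e_def bump_def by (simp add: max_def split: if_splits)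
  show ?thesis
  proof (rule closure_of_cycles[where l = 0, OF _ b(1) e])
    fix y p assume y: "y \<in> B" "minimal_period f y p" "\<exists>i. \<bar>(f ^^ i) y - b\<bar> < e"
    note p = cycle_D[OF y(2)]
    obtain i where i: "\<bar>(f ^^ i) y - b\<bar> < e" using y(3) by blast
    have "(f ^^ (i mod p)) y = (f ^^ i) y" by (rule funpow_mod_eq[OF p(2)])
    moreover have "\<bar>(f ^^ i) y - q\<bar> < 1 / Suc n" using i unfolding e_def by linarith
    ultimately have "bump q n ((f ^^ (i mod p)) y) > 0" unfolding bump_def by (simp add: max_def)
    then have "0 < (\<Sum>j<p. bump q n ((f ^^ j) y))"
      by (intro sum_pos2[of _ "i mod p"]) (use p(1) in \<open>auto simp: bump_def\<close>)
    then have "0 < (\<integral>x. bump q n x \<partial>cycle_measure y p)"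
      unfolding cycle_integral[OF y(1) p(1) bump_cont] avg_def using p(1) by simp
    then show "cycle_measure y p \<in> {\<mu> \<in> \<M>. 0 < (\<integral>x. bump q n x \<partial>\<mu>)}" using cycle_invariant[OF y(1) p] by simp
  qed auto
qed

lemma ergodic_full_residual:
  "residual_in \<X>
    {\<mu> \<in> \<M>. ergodic f \<mu> \<and> non_atomic \<mu> \<and> supp \<mu> = B}"
proof -
  \<comment> \<open>\<open>E\<close> stands for ergodicity, \<open>T\<close> for absence of atoms,
    \<open>S\<close> for full support; \<open>Q\<close> restricts the hats to those that see
    \<open>B\<close>, since the others have integral 0.\<close>
  define E where "E = (\<lambda>(l, n). \<Union>N\<in>{0<..}. {\<mu> \<in> \<M>. avg_variance (rat_poly l) N \<mu> < 1 / real (Suc n)})"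
  define T where "T n = (\<Union>k. \<Inter>j\<in>{..k}. {\<mu> \<in> \<M>. (\<integral>x. tent k j x \<partial>\<mu>) < 1 / real (Suc n)})" for n
  define S where "S = (\<lambda>(q :: rat, n). {\<mu> \<in> \<M>. 0 < (\<integral>x. bump (of_rat q) n x \<partial>\<mu>)})"
  define Q where "Q = {(q :: rat, n). \<exists>b\<in>B. bump (of_rat q) n b > 0}"
  obtain b0 where b0: "b0 \<in> B" using B_ne by blast
  have E_open: "openin \<X> (E z)" for z
  proof (cases z)
    case (Pair l n)
    have "openin \<X> {\<mu> \<in> topspace \<X>. avg_variance (rat_poly l) N \<mu> < 1 / real (Suc n)}" for N
      by (intro openin_less continuous_map_avg_variance continuous_on_rat_poly) simp
    then show ?thesis unfolding Pair E_def topspace_invariant split by blast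
  qed
  have E_dense: "\<X> closure_of E z = \<M>" for z
  proof (cases z)
    case (Pair l n)
    show ?thesis unfolding Pair
    proof (rule closure_of_cycles[where l = 0, OF _ b0 zero_less_one])
      show "E (l, n) \<subseteq> \<M>" unfolding E_def by auto
      fix y p assume y: "y \<in> B" "minimal_period f y p"
      note p = cycle_D[OF y(2)]
      have "avg_variance (rat_poly l) p (cycle_measure y p) < 1 / real (Suc n)"
        using cycle_avg_variance[OF y(1) p continuous_on_rat_poly] by simp
      then show "cycle_measure y p \<in> E (l, n)"
        unfolding E_def split using p(1) cycle_invariant[OF y(1) p] by blast
    qed
  qed
  have T_open: "openin \<X> (T n)" for n
  proof -
    have "openin \<X> {\<mu> \<in> topspace \<X>. (\<integral>x. tent k j x \<partial>\<mu>) < 1 / real (Suc n)}" for k j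
      by (intro openin_less continuous_map_integral tent_cont) simp
    then have "openin \<X> (\<Inter>j\<in>{..k}. {\<mu> \<in> \<M>. (\<integral>x. tent k j x \<partial>\<mu>) < 1 / real (Suc n)})" for k
      unfolding topspace_invariant by (intro openin_INT2) auto
    then show ?thesis unfolding T_def by blast
  qed
  \<comment> \<open>A cycle of period \<open>p\<close> gives each sufficiently narrow hat at most
    \<open>1 / p\<close>, which is below \<open>1 / Suc n\<close> from \<open>p = n + 2\<close>
    on.\<close>
  have T_dense: "\<X> closure_of T n = \<M>" for n
  proof (rule closure_of_cycles[where l = "n + 2", OF _ b0 zero_less_one])
    show "T n \<subseteq> \<M>" unfolding T_def by auto
    fix y p assume y: "y \<in> B" "minimal_period f y p" "n + 2 \<le> p"
    obtain k where k: "\<forall>j\<le>k. (\<integral>x. tent k j x \<partial>cycle_measure y p) \<le> 1 / p"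
      using cycle_tent_small[OF y(1,2)] by blast
    have "1 / real p < 1 / real (Suc n)" using y(3) by (intro divide_strict_left_mono) auto
    then have "\<forall>j\<le>k. (\<integral>x. tent k j x \<partial>cycle_measure y p) < 1 / real (Suc n)" using k by (meson le_less_trans)
    then have "cycle_measure y p \<in> (\<Inter>j\<in>{..k}. {\<mu> \<in> \<M>. (\<integral>x. tent k j x \<partial>\<mu>) < 1 / real (Suc n)})"
      using cycle_invariant[OF y(1) cycle_D[OF y(2)]] by simp
    then show "cycle_measure y p \<in> T n" unfolding T_def by (rule UN_I[OF UNIV_I])
  qed
  have S_open: "openin \<X> (S z)" for z unfolding S_def by (cases z) (simp add: bump_open)
  have S_dense: "\<X> closure_of S z = \<M>" if "z \<in> Q" for z
    using that unfolding S_def Q_def by (cases z) (clarsimp simp only: bump_dense split)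
  show ?thesis
  proof (rule residual_invariant[of "range E \<union> range T \<union> S ` Q"])
    show "countable (range E \<union> range T \<union> S ` Q)" by simp
    show "openin \<X> V" if "V \<in> range E \<union> range T \<union> S ` Q" for V
      using that E_open T_open S_open by auto
    show "\<X> closure_of V = \<M>" if "V \<in> range E \<union> range T \<union> S ` Q" for V
      using that E_dense T_dense S_dense by auto
    show "\<Inter> (range E \<union> range T \<union> S ` Q) \<subseteq> {\<mu> \<in> \<M>. ergodic f \<mu> \<and> non_atomic \<mu> \<and> supp \<mu> = B}"
    proof
      fix \<mu> assume \<mu>: "\<mu> \<in> \<Inter> (range E \<union> range T \<union> S ` Q)"
      have \<mu>E: "\<mu> \<in> E z" for z using \<mu> by blast
      have \<mu>T: "\<mu> \<in> T n" for n using \<mu> by blast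
      have \<mu>S: "\<mu> \<in> S z" if "z \<in> Q" for z using \<mu> that by blast
      have \<mu>I: "\<mu> \<in> \<M>" using \<mu>E[of "([], 0)"] unfolding E_def by auto
      have "ergodic f \<mu>"
      proof (rule ergodic_if_avg_variance[OF \<mu>I])
        show "\<exists>N>0. avg_variance (rat_poly l) N \<mu> < 1 / Suc n" for l n
          using \<mu>E[of "(l, n)"] unfolding E_def by auto
      qed
      moreover have "non_atomic \<mu>"
      proof (rule non_atomic_if_tents[OF invariant_D(1)[OF \<mu>I]])
        show "\<exists>k. \<forall>j\<le>k. (\<integral>x. tent k j x \<partial>\<mu>) < 1 / Suc n" for n
          using \<mu>T[of n] unfolding T_def by auto
      qed
      moreover have "supp \<mu> = B"
      proof (rule full_supp_if_bumps[OF invariant_D(1)[OF \<mu>I]])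
        fix q n x assume "x \<in> B" "bump (real_of_rat q) n x > 0"
        then have "(q, n) \<in> Q" unfolding Q_def by blast
        then show "(\<integral>x. bump (of_rat q) n x \<partial>\<mu>) > 0" using \<mu>S[of "(q, n)"] unfolding S_def by simp
      qed
      ultimately show "\<mu> \<in> {\<mu> \<in> \<M>. ergodic f \<mu> \<and> non_atomic \<mu> \<and> supp \<mu> = B}" using \<mu>I by blast
    qed
  qed auto
qed

text \<open>Cycles are rigid: multiples of the period act on them as the identity. Being close to
  the identity in the mean at arbitrarily late times is thus residual, and hats at two points of
  \<open>B\<close> exclude the degenerate case that one of two separated sets has measure 0.\<close>

lemma not_mixing_residual: "residual_in \<X> {\<mu> \<in> \<M>. \<not> strongly_mixing f \<mu>}" if "infinite B"
proof -
  define U where "U m = (\<Union>n\<in>{m..}. {\<mu> \<in> \<M>. (\<integral>x. \<bar>(f ^^ n) x - x\<bar> \<partial>\<mu>) < 1 / Suc m})" for m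
  define S where "S b k = {\<mu> \<in> \<M>. 0 < (\<integral>x. bump b k x \<partial>\<mu>)}" for b k
  obtain b1 b2 where b: "b1 \<in> B" "b2 \<in> B" "b1 < b2"
  proof -
    obtain b1 where "b1 \<in> B" using B_ne by blast
    moreover obtain b2 where "b2 \<in> B - {b1}" using \<open>infinite B\<close> by (metis finite.emptyI infinite_remove ex_in_conv)
    ultimately show ?thesis using that[of b1 b2] that[of b2 b1] by fastforce
  qed
  have "0 < (b2 - b1) / 2" using b(3) by simp
  then obtain k where k: "1 / real (Suc k) < (b2 - b1) / 2" using nat_approx_posE by blast
  define \<G> where "\<G> = insert (S b1 k) (insert (S b2 k) (range U))"
  have "openin \<X> (U m)" for m
  proof -
    have "openin \<X> {\<mu> \<in> topspace \<X>. (\<integral>x. \<bar>(f ^^ n) x - x\<bar> \<partial>\<mu>) < 1 / Suc m}" for n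
      by (intro openin_less continuous_map_integral continuous_intros iterate_cont) simp
    then show ?thesis unfolding U_def topspace_invariant by blast
  qed
  moreover have "\<X> closure_of U m = \<M>" for m
  proof (rule closure_of_cycles[where l = 0, OF _ b(1) zero_less_one])
    show "U m \<subseteq> \<M>" unfolding U_def by auto
    fix y p assume y: "y \<in> B" "minimal_period f y p"
    note p = cycle_D[OF y(2)]
    have c: "continuous_on B (\<lambda>x. \<bar>(f ^^ (p * m)) x - x\<bar>)" by (intro continuous_intros iterate_cont)
    have "(f ^^ (p * m)) ((f ^^ j) y) = (f ^^ j) y" for j
    proof -
      have "((f ^^ p) ^^ m) y = y" using p(2) by (induction m) auto
      then show ?thesis by (metis add.commute comp_apply funpow_add funpow_mult)
    qed
    then have "(\<integral>x. \<bar>(f ^^ (p * m)) x - x\<bar> \<partial>cycle_measure y p) = 0"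
      unfolding cycle_integral[OF y(1) p(1) c] avg_def by simp
    moreover have "p * m \<in> {m..}" using p(1) by simp
    ultimately show "cycle_measure y p \<in> U m"
      unfolding U_def using cycle_invariant[OF y(1) p] by (intro UN_I[of "p * m"]) auto
  qed
  moreover have "bump b k b > 0" for b unfolding bump_def by simp
  ultimately have G: "openin \<X> T \<and> \<X> closure_of T = \<M>" if "T \<in> \<G>" for T
    using that bump_open bump_dense b(1,2) unfolding \<G>_def S_def by (elim insertE) auto
  show ?thesis
  proof (rule residual_invariant[of \<G>])
    show "\<Inter>\<G> \<subseteq> {\<mu> \<in> \<M>. \<not> strongly_mixing f \<mu>}"
    proof
      fix \<mu> assume "\<mu> \<in> \<Inter>\<G>"
      then have \<mu>: "\<mu> \<in> \<M>" and pos: "0 < (\<integral>x. bump b1 k x \<partial>\<mu>)" "0 < (\<integral>x. bump b2 k x \<partial>\<mu>)"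
        and U: "\<And>m. \<mu> \<in> U m" unfolding \<G>_def S_def by auto
      have \<mu>p: "\<mu> \<in> \<P>" by (rule invariant_D[OF \<mu>])
      interpret prob_space \<mu> by (rule prob_measures_D[OF \<mu>p])
      let ?s = "b1 + 1 / Suc k" and ?t = "b2 - 1 / Suc k"
      have S: "{..?s} \<inter> B \<in> sets \<mu>" "{?t..} \<inter> B \<in> sets \<mu>"
        unfolding prob_measures_D(2)[OF \<mu>p] sets_R using B_borel by auto
      have "emeasure \<mu> ({..?s} \<inter> B) > 0" by (rule measure_pos_if_bump[OF \<mu>p S(1) _ pos(1)]) auto
      moreover have "emeasure \<mu> ({?t..} \<inter> B) > 0" by (rule measure_pos_if_bump[OF \<mu>p S(2) _ pos(2)]) auto
      ultimately have "measure \<mu> ({..?s} \<inter> B) * measure \<mu> ({?t..} \<inter> B) \<noteq> 0" by (simp add: emeasure_eq_measure)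
      moreover have "?s < ?t" using k by simp
      moreover have "\<exists>n\<ge>m. (\<integral>x. \<bar>(f ^^ n) x - x\<bar> \<partial>\<mu>) < 1 / Suc m" for m using U[of m] unfolding U_def by auto
      ultimately have "\<not> strongly_mixing f \<mu>" using mixing_rigid_null[OF \<mu>] by blast
      then show "\<mu> \<in> {\<mu> \<in> \<M>. \<not> strongly_mixing f \<mu>}" using \<mu> by blast
    qed
  qed (use G in \<open>auto simp: \<G>_def\<close>)
qed

end

section \<open>Limit measures and penalised averages\<close>

lemma strict_mono_choice:
  assumes "\<And>n L. \<exists>N\<ge>L. P n (N :: nat)"
  shows "\<exists>r. strict_mono r \<and> (\<forall>n :: nat. P n (r n))"
proof -
  have "\<exists>r. \<forall>n. P n (r n) \<and> r n < r (Suc n)"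
  proof (rule dependent_nat_choice)
    show "\<exists>N. P 0 N" using assms by blast
    show "\<exists>N'. P (Suc n) N' \<and> N < N'" for N n using assms[of "Suc N" "Suc n"] by auto
  qed
  then show ?thesis by (meson strict_mono_Suc_iff)
qed

context compact_dynamics
begin

text \<open>A diagonal choice: at stage \<open>n\<close> the first \<open>n\<close> moments are
  within \<open>1 / Suc n\<close>.\<close>

lemma limit_measuresI:
  assumes x: "x \<in> B" and \<mu>: "\<mu> \<in> \<P>"
    and close: "\<And>e n L. e > 0 \<Longrightarrow> \<exists>N\<ge>L. \<forall>k<n. \<bar>avg f (\<lambda>x. x ^ k) N x - mom \<mu> k\<bar> < e"
  shows "\<mu> \<in> limit_measures f B x"
proof -
  have "\<exists>N\<ge>L. \<forall>k<n. \<bar>avg f (\<lambda>x. x ^ k) N x - mom \<mu> k\<bar> < 1 / Suc n" for n L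
    by (rule close) simp
  from strict_mono_choice[of "\<lambda>n N. \<forall>k<n. \<bar>avg f (\<lambda>x. x ^ k) N x - mom \<mu> k\<bar> < 1 / Suc n", OF this]
  obtain r where r: "strict_mono r" "\<And>n. \<forall>k<n. \<bar>avg f (\<lambda>x. x ^ k) (r n) x - mom \<mu> k\<bar> < 1 / Suc n"
    by blast
  have "(\<lambda>n. avg f (\<lambda>x. x ^ k) (r n) x) \<longlonglongrightarrow> mom \<mu> k" for k
  proof (rule LIM_zero_cancel, rule Lim_null_comparison[OF _ LIMSEQ_Suc[OF lim_1_over_n]])
    show "eventually (\<lambda>n. norm (avg f (\<lambda>x. x ^ k) (r n) x - mom \<mu> k) \<le> 1 / real (Suc n)) sequentially"
      unfolding eventually_sequentially real_norm_def
      by (intro exI[of _ "Suc k"] allI impI less_imp_le r(2)[rule_format]) simp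
  qed
  then show ?thesis unfolding limit_measures_iff[OF x] avg_def using r(1) \<mu> by blast
qed

lemma limit_measures_close:
  assumes x: "x \<in> B" and \<mu>: "\<mu> \<in> limit_measures f B x" and e: "e > 0"
  shows "\<exists>N\<ge>L. \<forall>k<n. \<bar>avg f (\<lambda>x. x ^ k) N x - mom \<mu> k\<bar> < e"
proof -
  obtain r where r: "strict_mono r" "\<And>k. (\<lambda>n. avg f (\<lambda>x. x ^ k) (r n) x) \<longlonglongrightarrow> mom \<mu> k"
    using \<mu> unfolding limit_measures_iff[OF x] avg_def by blast
  have "eventually (\<lambda>m. \<bar>avg f (\<lambda>x. x ^ k) (r m) x - mom \<mu> k\<bar> < e) sequentially" for k
    using tendstoD[OF r(2) e, of k] by (simp add: dist_real_def)
  then have "eventually (\<lambda>m. \<forall>k\<in>{..<n}. \<bar>avg f (\<lambda>x. x ^ k) (r m) x - mom \<mu> k\<bar> < e) sequentially"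
    by (intro eventually_ball_finite) auto
  then obtain m where "\<And>i. i \<ge> m \<Longrightarrow> \<forall>k\<in>{..<n}. \<bar>avg f (\<lambda>x. x ^ k) (r i) x - mom \<mu> k\<bar> < e"
    unfolding eventually_sequentially by blast
  then have "\<forall>k<n. \<bar>avg f (\<lambda>x. x ^ k) (r (max m L)) x - mom \<mu> k\<bar> < e" by auto
  moreover have "L \<le> r (max m L)" using strict_mono_imp_increasing[OF r(1), of "max m L"] by linarith
  ultimately show ?thesis by blast
qed

text \<open>Moments of invariant measures are approximated by rational vectors. The points whose
  averages come close to such a vector at some time from \<open>L\<close> on form a relatively open
  set, which is dense because it contains all generic points of one measure. There are countably
  many such sets.\<close>

lemma maximal_oscillation_residual:
  assumes gen: "\<And>\<mu>. \<mu> \<in> \<M> \<Longrightarrow> B \<subseteq> closure {x \<in> B. limit_measures f B x = {\<mu>}}"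
  shows "residual_in (top_of_set B) {x \<in> B. maximal_oscillation f B x}"
proof -
  define W where "W = (\<lambda>(q :: rat list, m, L). \<Union>N\<in>{L..}. (\<Inter>k\<in>{..<length q}.
    {x \<in> B. \<bar>avg f (\<lambda>x. x ^ k) N x - of_rat (q ! k)\<bar> < 1 / Suc m}) \<inter> B)"
  define Q where "Q = {(q :: rat list, m :: nat, L :: nat).
    \<exists>\<mu>\<in>\<M>. \<forall>k<length q. \<bar>mom \<mu> k - of_rat (q ! k)\<bar> < 1 / Suc m}"
  have op: "openin (top_of_set B) (W z)" for z
  proof (cases z)
    case (fields q m L)
    have "openin (top_of_set B) {x \<in> B. \<bar>avg f (\<lambda>x. x ^ k) N x - of_rat (q ! k)\<bar> < 1 / Suc m}" for k N
    proof -
      have "continuous_on B (\<lambda>x. \<bar>avg f (\<lambda>x. x ^ k) N x - of_rat (q ! k)\<bar>)"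
        by (intro continuous_intros avg_cont)
      then have "openin (top_of_set B) (B \<inter> (\<lambda>x. \<bar>avg f (\<lambda>x. x ^ k) N x - of_rat (q ! k)\<bar>) -` {..<1 / Suc m})"
        by (rule continuous_openin_preimage_gen) simp
      moreover have "B \<inter> (\<lambda>x. \<bar>avg f (\<lambda>x. x ^ k) N x - of_rat (q ! k)\<bar>) -` {..<1 / Suc m} =
        {x \<in> B. \<bar>avg f (\<lambda>x. x ^ k) N x - of_rat (q ! k)\<bar> < 1 / Suc m}" by auto
      ultimately show ?thesis by simp
    qed
    then have "openin (top_of_set B) ((\<Inter>k\<in>{..<length q}.
      {x \<in> B. \<bar>avg f (\<lambda>x. x ^ k) N x - of_rat (q ! k)\<bar> < 1 / Suc m}) \<inter> topspace (top_of_set B))" for N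
      by (intro openin_INT) auto
    then show ?thesis unfolding fields W_def split topspace_euclidean_subtopology by blast
  qed
  have dense: "B \<subseteq> closure (W z)" if z: "z \<in> Q" for z
  proof (cases z)
    case (fields q m L)
    then obtain \<mu> where \<mu>: "\<mu> \<in> \<M>" "\<forall>k<length q. \<bar>mom \<mu> k - of_rat (q ! k)\<bar> < 1 / Suc m"
      using z unfolding Q_def by auto
    \<comment> \<open>The slack left in the strict inequalities for \<open>\<mu>\<close>; the 1
      covers the empty list.\<close>
    define e where "e = Min (insert 1 ((\<lambda>k. 1 / Suc m - \<bar>mom \<mu> k - of_rat (q ! k)\<bar>) ` {..<length q}))"
    have e: "e > 0" unfolding e_def using \<mu>(2) by (subst Min_gr_iff) auto
    have e_le: "e \<le> 1 / Suc m - \<bar>mom \<mu> k - of_rat (q ! k)\<bar>" if "k < length q" for k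
      unfolding e_def by (rule Min_le) (use that in auto)
    have "{x \<in> B. limit_measures f B x = {\<mu>}} \<subseteq> W z"
    proof
      fix x assume "x \<in> {x \<in> B. limit_measures f B x = {\<mu>}}"
      then have x: "x \<in> B" "\<mu> \<in> limit_measures f B x" by auto
      obtain N where N: "N \<ge> L" "\<forall>k<length q. \<bar>avg f (\<lambda>x. x ^ k) N x - mom \<mu> k\<bar> < e"
        using limit_measures_close[OF x e, of L "length q"] by blast
      have "\<bar>avg f (\<lambda>x. x ^ k) N x - of_rat (q ! k)\<bar> < 1 / Suc m" if "k < length q" for k
        using N(2)[rule_format, OF that] e_le[OF that] by linarith
      then show "x \<in> W z" unfolding fields W_def split using x(1) N(1) by (intro UN_I[of N]) auto
    qed
    then show ?thesis using gen[OF \<mu>(1)] closure_mono order_trans by blast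
  qed
  show ?thesis
  proof (rule residual_inI[of "insert B (W ` Q)"])
    have cov: "openin (top_of_set B) T \<and> B \<subseteq> closure T" if T: "T \<in> insert B (W ` Q)" for T
    proof (cases "T = B")
      case False
      then obtain z where "T = W z" "z \<in> Q" using T by blast
      then show ?thesis using op dense by simp
    qed (simp add: closure_subset)
    show "openin (top_of_set B) T" if "T \<in> insert B (W ` Q)" for T using cov[OF that] by blast
    have "B \<subseteq> closure (\<Inter> (insert B (W ` Q)))"
      by (rule Baire[OF B_closed _ cov]) simp
    then show "top_of_set B closure_of \<Inter> (insert B (W ` Q)) = topspace (top_of_set B)"
      unfolding closure_of_subtopology by (simp add: Int_absorb1 Int_absorb2)
    show "\<Inter> (insert B (W ` Q)) \<subseteq> {x \<in> B. maximal_oscillation f B x}"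
    proof
      fix x assume x: "x \<in> \<Inter> (insert B (W ` Q))"
      then have xB: "x \<in> B" by blast
      have xW: "x \<in> W z" if "z \<in> Q" for z using x that by blast
      have "\<mu> \<in> limit_measures f B x" if \<mu>: "\<mu> \<in> \<M>" for \<mu>
      proof (rule limit_measuresI[OF xB invariant_D(1)[OF \<mu>]])
        fix e :: real and n L :: nat assume e: "e > 0"
        obtain m where m: "1 / real (Suc m) < e / 2" using nat_approx_posE[of "e/2"] e by auto
        have "\<exists>q. \<bar>mom \<mu> k - of_rat q\<bar> < 1 / Suc m" for k
        proof -
          obtain q where "mom \<mu> k - 1 / Suc m < of_rat q" "of_rat q < mom \<mu> k"
            using of_rat_dense[of "mom \<mu> k - 1 / Suc m" "mom \<mu> k"] by auto
          then show ?thesis by (intro exI[of _ q]) (simp add: abs_if)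
        qed
        then obtain h where h: "\<And>k. \<bar>mom \<mu> k - of_rat (h k)\<bar> < 1 / Suc m" by metis
        define q where "q = map h [0..<n]"
        have q: "length q = n" "\<And>k. k < n \<Longrightarrow> q ! k = h k" unfolding q_def by auto
        have "(q, m, L) \<in> Q" unfolding Q_def using \<mu> h q by auto
        then have "x \<in> W (q, m, L)" by (rule xW)
        then obtain N where N: "N \<ge> L" "\<forall>k<n. \<bar>avg f (\<lambda>x. x ^ k) N x - of_rat (q ! k)\<bar> < 1 / Suc m"
          unfolding W_def split q(1) by auto
        have "\<bar>avg f (\<lambda>x. x ^ k) N x - mom \<mu> k\<bar> < e" if "k < n" for k
          using N(2)[rule_format, OF that] h[of k] m unfolding q(2)[OF that] by linarith
        then show "\<exists>N\<ge>L. \<forall>k<n. \<bar>avg f (\<lambda>x. x ^ k) N x - mom \<mu> k\<bar> < e" using N(1) by blast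
      qed
      then have "limit_measures f B x = \<M>" using limit_measures_invariant[OF xB] by blast
      then show "x \<in> {x \<in> B. maximal_oscillation f B x}" unfolding maximal_oscillation_def using xB by blast
    qed
  qed auto
qed

lemma measure_preimage:
  assumes \<mu>: "\<mu> \<in> \<M>" and A: "A \<in> sets \<mu>"
  shows "(f ^^ n) -` A \<inter> B \<in> sets \<mu>" "measure \<mu> ((f ^^ n) -` A \<inter> B) = measure \<mu> A"
proof -
  note sp = prob_measures_D(3)[OF invariant_D(1)[OF \<mu>]]
  have fm: "f ^^ n \<in> measurable \<mu> \<mu>" by (rule measurable_compose_n[OF invariant_D(2)[OF \<mu>]])
  show S: "(f ^^ n) -` A \<inter> B \<in> sets \<mu>" using measurable_sets[OF fm A] unfolding sp .
  have im: "(\<lambda>x. indicator A x :: real) \<in> borel_measurable \<mu>" using A by simp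
  have "measure \<mu> ((f ^^ n) -` A \<inter> B) = (\<integral>x. indicator ((f ^^ n) -` A \<inter> B) x \<partial>\<mu>)"
    using sp by (simp add: Int_assoc)
  also have "\<dots> = (\<integral>x. indicator A ((f ^^ n) x) \<partial>\<mu>)"
    by (rule Bochner_Integration.integral_cong) (auto simp: sp indicator_def)
  also have "\<dots> = (\<integral>x. indicator A x \<partial>\<mu>)" by (rule invariant_iterate[OF \<mu> im])
  also have "\<dots> = measure \<mu> A" using sets.sets_into_space[OF A] by (simp add: Int_absorb2)
  finally show "measure \<mu> ((f ^^ n) -` A \<inter> B) = measure \<mu> A" .
qed

text \<open>The preimages of a nonperiodic point under different iterates are disjoint and have
  equal measure.\<close>

lemma nonperiodic_null:
  assumes \<mu>: "\<mu> \<in> \<M>" and e: "e \<in> B" and np: "\<And>p. p > 0 \<Longrightarrow> (f ^^ p) e \<noteq> e"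
  shows "measure \<mu> {e} = 0"
proof -
  interpret prob_space \<mu> by (rule prob_measures_D[OF invariant_D(1)[OF \<mu>]])
  have es: "{e} \<in> sets \<mu>" using e prob_measures_D(2)[OF invariant_D(1)[OF \<mu>]] sets_R by auto
  define A where "A n = (f ^^ n) -` {e} \<inter> B" for n
  have no: False if "n < m" "x \<in> A n" "x \<in> A m" for n m x
  proof -
    have "(f ^^ (m - n + n)) x = (f ^^ (m - n)) ((f ^^ n) x)" unfolding funpow_add comp_apply ..
    then have "(f ^^ (m - n)) ((f ^^ n) x) = (f ^^ m) x" using that(1) by simp
    then have "(f ^^ (m - n)) e = e" using that(2,3) unfolding A_def by simp
    then show False using np[of "m - n"] that(1) by simp
  qed
  have dis: "disjoint_family_on A {..<N}" for N
    unfolding disjoint_family_on_def by (meson disjoint_iff linorder_neqE_nat no)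
  have "range A \<subseteq> sets \<mu>" unfolding A_def using measure_preimage(1)[OF \<mu> es] by blast
  then have "measure \<mu> (\<Union>n<N. A n) = (\<Sum>n<N. measure \<mu> (A n))" for N
    by (intro finite_measure_finite_Union dis) auto
  then have bd: "real N * measure \<mu> {e} \<le> 1" for N
    using prob_le_1[of "\<Union>n<N. A n"] measure_preimage(2)[OF \<mu> es] unfolding A_def by simp
  show ?thesis
  proof (rule ccontr)
    assume "measure \<mu> {e} \<noteq> 0"
    then have pos: "measure \<mu> {e} > 0" by (simp add: zero_less_measure_iff)
    obtain N where "1 / measure \<mu> {e} < real N" using reals_Archimedean2 by blast
    then show False using bd[of N] pos by (simp add: pos_divide_less_eq)
  qed
qed

text \<open>Neighbourhoods shrinking to the finite set have measures tending to that of the set.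
  \<open>Q\<close> is taken out because its points may be atoms.\<close>

lemma null_neighbourhood:
  assumes \<mu>: "\<mu> \<in> \<P>" and fin: "finite S" "finite Q"
    and null: "\<And>e. e \<in> S \<inter> B - Q \<Longrightarrow> measure \<mu> {e} = 0" and d: "d > 0"
  shows "\<exists>O'. open O' \<and> S \<subseteq> O' \<and> O' \<inter> B - Q \<in> sets \<mu> \<and> measure \<mu> (O' \<inter> B - Q) < d"
proof -
  interpret prob_space \<mu> by (rule prob_measures_D[OF \<mu>])
  define U where "U n = (\<Union>e\<in>S. ball e (1 / Suc n))" for n
  have U: "open (U n)" "S \<subseteq> U n" for n unfolding U_def by auto
  have sets: "U n \<inter> B - Q \<in> sets \<mu>" for n
    unfolding prob_measures_D(2)[OF \<mu>] sets_R
    using borel_open[OF U(1)[of n]] B_borel borel_closed[OF finite_imp_closed[OF fin(2)]] by blast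
  have dec: "decseq (\<lambda>n. U n \<inter> B - Q)"
  proof (rule decseq_SucI)
    fix n
    have "1 / real (Suc (Suc n)) \<le> 1 / real (Suc n)" by (intro divide_left_mono) auto
    then have "ball e (1 / Suc (Suc n)) \<subseteq> ball e (1 / Suc n)" for e :: real by (rule subset_ball)
    then show "U (Suc n) \<inter> B - Q \<subseteq> U n \<inter> B - Q" unfolding U_def by blast
  qed
  have "(\<Inter>n. U n \<inter> B - Q) \<subseteq> S \<inter> B - Q"
  proof
    fix x assume x: "x \<in> (\<Inter>n. U n \<inter> B - Q)"
    have "x \<in> S"
    proof (rule ccontr)
      assume "x \<notin> S"
      then obtain e where e: "e > 0" "ball x e \<inter> S = {}"
        using open_contains_ball_eq[OF open_Compl[OF finite_imp_closed[OF fin(1)]], of x] by auto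
      obtain n where n: "1 / real (Suc n) < e" using nat_approx_posE[OF e(1)] by auto
      obtain s where "s \<in> S" "x \<in> ball s (1 / Suc n)" using x unfolding U_def by auto
      then have "s \<in> ball x e" using n by (simp add: dist_commute)
      then show False using e(2) \<open>s \<in> S\<close> by blast
    qed
    then show "x \<in> S \<inter> B - Q" using x by auto
  qed
  moreover have "measure \<mu> (S \<inter> B - Q) = 0"
  proof -
    have "measure \<mu> (\<Union>e\<in>S \<inter> B - Q. {e}) \<le> (\<Sum>e\<in>S \<inter> B - Q. measure \<mu> {e})"
    proof (rule finite_measure_subadditive_finite)
      show "(\<lambda>e. {e}) ` (S \<inter> B - Q) \<subseteq> sets \<mu>" unfolding prob_measures_D(2)[OF \<mu>] by (auto simp: sets_R)
    qed (use fin(1) in simp)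
    also have "\<dots> = 0" using null by (intro sum.neutral) blast
    finally show ?thesis using measure_nonneg[of \<mu> "S \<inter> B - Q"] by simp
  qed
  moreover have "S \<inter> B - Q \<in> sets \<mu>"
    unfolding prob_measures_D(2)[OF \<mu>] sets_R using borel_closed[OF finite_imp_closed[of "S \<inter> B - Q"]] fin(1) by auto
  ultimately have "measure \<mu> (\<Inter>n. U n \<inter> B - Q) = 0"
    using finite_measure_mono[of "\<Inter>n. U n \<inter> B - Q" "S \<inter> B - Q"] measure_nonneg[of \<mu> "\<Inter>n. U n \<inter> B - Q"] by linarith
  then have "(\<lambda>n. measure \<mu> (U n \<inter> B - Q)) \<longlonglongrightarrow> 0"
    using finite_Lim_measure_decseq[OF _ dec] sets by auto
  then obtain n where "measure \<mu> (U n \<inter> B - Q) < d"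
    using order_tendstoD(2)[OF _ d] eventually_happens'[OF sequentially_bot] by blast
  then show ?thesis using U sets by blast
qed

text \<open>A point with a good penalised average: the orbit is charged for entering \<open>D\<close>, and the starting
  point for lying in \<open>D\<close> or for being mapped into \<open>Q\<close> from outside, a null event.\<close>

lemma penalised_point:
  assumes \<mu>: "\<mu> \<in> \<M>" and \<phi>: "continuous_on B \<phi>"
    and K: "K > 0" "\<And>x. x \<in> B \<Longrightarrow> \<bar>\<phi> x\<bar> \<le> K"
    and Q: "finite Q" "Q \<subseteq> B" "f ` Q \<subseteq> Q" and D: "D \<in> sets \<mu>" "measure \<mu> D < 1 / 3" and N: "N > 0"
  shows "\<exists>z\<in>B. z \<notin> D \<and> (z \<in> Q \<or> (\<forall>i<N. (f ^^ i) z \<notin> Q)) \<and>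
    N * ((\<integral>x. \<phi> x \<partial>\<mu>) - 6 * K * measure \<mu> D) \<le> (\<Sum>i<N. \<phi> ((f ^^ i) z) - 2 * K * indicator D ((f ^^ i) z))"
proof -
  have \<mu>p: "\<mu> \<in> \<P>" by (rule invariant_D[OF \<mu>])
  interpret prob_space \<mu> by (rule prob_measures_D[OF \<mu>p])
  note sp = prob_measures_D(3)[OF \<mu>p]
  have QB: "Q \<in> sets \<mu>" unfolding prob_measures_D(2)[OF \<mu>p] sets_R
    using Q(2) borel_closed[OF finite_imp_closed[OF Q(1)]] by blast
  \<comment> \<open>\<open>Q\<close> is contained in its preimages and has the same measure, so
    entering \<open>Q\<close> from outside has probability 0.\<close>
  define P where "P i = ((f ^^ i) -` Q \<inter> B) - Q" for i
  have Ps: "P i \<in> sets \<mu>" for i unfolding P_def using measure_preimage(1)[OF \<mu> QB] QB by blast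
  have "measure \<mu> (P i) = 0" for i
  proof -
    have "Q \<subseteq> (f ^^ i) -` Q \<inter> B" using Q(2) funpow_mem[OF Q(3)] by auto
    then show ?thesis unfolding P_def
      using measure_preimage[OF \<mu> QB, of i] finite_measure_Diff[of "(f ^^ i) -` Q \<inter> B" Q] QB by simp
  qed
  then have P0: "measure \<mu> (\<Union>i<N. P i) = 0"
    using finite_measure_subadditive_finite[of "{..<N}" P] Ps measure_nonneg[of \<mu> "\<Union>i<N. P i"]
    by (auto intro!: antisym)
  define Z where "Z = D \<union> (\<Union>i<N. P i)"
  have Zs: "Z \<in> sets \<mu>" unfolding Z_def using D(1) Ps by auto
  have Z: "measure \<mu> Z \<le> measure \<mu> D"
    unfolding Z_def using measure_Un_le[OF D(1), of "\<Union>i<N. P i"] Ps P0 by auto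
  define \<psi> where "\<psi> x = \<phi> x - 2 * K * indicator D x" for x
  have \<psi>m: "\<psi> \<in> borel_measurable \<mu>"
    unfolding \<psi>_def using measurable_cont[OF \<phi> prob_measures_D(2)[OF \<mu>p]] D(1) by measurable
  have iD: "integrable \<mu> (\<lambda>x. indicator A x :: real)" if "A \<in> sets \<mu>" for A
    by (rule integrable_const_bound[where B = 1]) (use that in auto)
  have meas: "(\<integral>x. indicator A x \<partial>\<mu>) = measure \<mu> A" if "A \<in> sets \<mu>" for A
    using sets.sets_into_space[OF that] by (simp add: Int_absorb2)
  have fm: "f ^^ i \<in> measurable \<mu> \<mu>" for i by (rule measurable_compose_n[OF invariant_D(2)[OF \<mu>]])
  have \<psi>i: "integrable \<mu> (\<lambda>x. \<psi> ((f ^^ i) x))" for i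
  proof (rule integrable_const_bound[where B = "3 * K"])
    show "(\<lambda>x. \<psi> ((f ^^ i) x)) \<in> borel_measurable \<mu>" by (rule measurable_compose[OF fm \<psi>m])
    have "\<bar>\<psi> x\<bar> \<le> 3 * K" if "x \<in> B" for x
      using K(2)[OF that] K(1) unfolding \<psi>_def by (auto simp: indicator_def abs_le_iff)
    then show "AE x in \<mu>. norm (\<psi> ((f ^^ i) x)) \<le> 3 * K" using iterate_mem by (auto simp: sp)
  qed
  \<comment> \<open>The weights are such that the mean of \<open>h\<close> is at least
    \<open>c\<close>, while a start in \<open>Z\<close> forces
    \<open>h z \<le> N * (- 3 * K)\<close>, which is below \<open>c\<close> since
    \<open>measure \<mu> D < 1 / 3\<close>.\<close>
  define h where "h x = (\<Sum>i<N. \<psi> ((f ^^ i) x)) - N * (4 * K * indicator Z x)" for x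
  have hi: "integrable \<mu> h" unfolding h_def using \<psi>i iD[OF Zs] by (intro Bochner_Integration.integrable_diff Bochner_Integration.integrable_sum) auto
  have "(\<integral>x. \<psi> x \<partial>\<mu>) = (\<integral>x. \<phi> x \<partial>\<mu>) - 2 * K * measure \<mu> D"
    unfolding \<psi>_def using integrable_cont[OF \<mu>p \<phi>] iD[OF D(1)] meas[OF D(1)] by simp
  then have \<psi>I: "(\<integral>x. \<psi> ((f ^^ i) x) \<partial>\<mu>) = (\<integral>x. \<phi> x \<partial>\<mu>) - 2 * K * measure \<mu> D" for i
    using invariant_iterate[OF \<mu> \<psi>m] by simp
  define c where "c = N * ((\<integral>x. \<phi> x \<partial>\<mu>) - 6 * K * measure \<mu> D)"
  have "(\<integral>x. h x \<partial>\<mu>) = (\<Sum>i<N. \<integral>x. \<psi> ((f ^^ i) x) \<partial>\<mu>) - N * (4 * K * measure \<mu> Z)"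
    unfolding h_def using \<psi>i iD[OF Zs] meas[OF Zs] by simp
  also have "\<dots> = N * ((\<integral>x. \<phi> x \<partial>\<mu>) - 2 * K * measure \<mu> D - 4 * K * measure \<mu> Z)"
    unfolding \<psi>I by (simp add: algebra_simps)
  also have "\<dots> \<ge> c"
  proof -
    have "4 * K * measure \<mu> Z \<le> 4 * K * measure \<mu> D" using Z K(1) by (intro mult_left_mono) auto
    then show ?thesis unfolding c_def by (intro mult_left_mono) auto
  qed
  finally have hc: "c \<le> (\<integral>x. h x \<partial>\<mu>)" .
  have "\<exists>z\<in>B. c \<le> h z"
  proof (rule ccontr)
    assume "\<not> (\<exists>z\<in>B. c \<le> h z)"
    then have "AE x in \<mu>. h x < c" by (intro AE_I2) (auto simp: sp not_le)
    then show False using expectation_less[OF hi] hc by fastforce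
  qed
  then obtain z where z: "z \<in> B" "c \<le> h z" by blast
  have \<phi>K: "- K \<le> (\<integral>x. \<phi> x \<partial>\<mu>)"
  proof -
    have "(\<integral>x. - K \<partial>\<mu>) \<le> (\<integral>x. \<phi> x \<partial>\<mu>)"
      by (rule integral_mono) (use integrable_cont[OF \<mu>p \<phi>] K(2) in \<open>force simp: sp abs_le_iff\<close>)+
    then show ?thesis by (simp add: prob_space)
  qed
  have zZ: "z \<notin> Z"
  proof
    assume zZ: "z \<in> Z"
    have "\<psi> ((f ^^ i) z) \<le> K" for i
      using K(2)[OF iterate_mem[OF z(1)], of i] K(1) unfolding \<psi>_def by (auto simp: indicator_def)
    then have "(\<Sum>i<N. \<psi> ((f ^^ i) z)) \<le> (\<Sum>i<N. K)" by (intro sum_mono)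
    then have "h z \<le> N * (- 3 * K)" unfolding h_def using zZ by (simp add: algebra_simps)
    then have "N * ((\<integral>x. \<phi> x \<partial>\<mu>) - 6 * K * measure \<mu> D) \<le> N * (- 3 * K)" using z(2) unfolding c_def by linarith
    then have "(\<integral>x. \<phi> x \<partial>\<mu>) - 6 * K * measure \<mu> D \<le> - 3 * K"
      by (rule mult_left_le_imp_le) (use N in simp)
    moreover have "6 * K * measure \<mu> D < 6 * K * (1 / 3)" using D(2) K(1) by (intro mult_strict_left_mono) auto
    ultimately show False using \<phi>K by simp
  qed
  have "z \<in> Q \<or> (\<forall>i<N. (f ^^ i) z \<notin> Q)" using zZ z(1) unfolding Z_def P_def by auto
  moreover have "c \<le> (\<Sum>i<N. \<psi> ((f ^^ i) z))" using z(2) zZ unfolding h_def by simp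
  ultimately show ?thesis using z(1) zZ unfolding Z_def c_def \<psi>_def by blast
qed

end

section \<open>Approximation of invariant measures by cycles\<close>

lemma funpow_multiple_fixed:
  assumes "(g ^^ p) x = x" "p dvd N"
  shows "(g ^^ N) x = x"
proof -
  obtain m where N: "N = p * m" using assms(2) by blast
  have "((g ^^ p) ^^ m) x = x" using assms(1) by (induction m) auto
  then show ?thesis unfolding N by (simp add: funpow_mult)
qed

lemma average_lower_bound:
  fixes S m K :: real
  assumes N: "0 < N" "N \<le> T" "T \<le> N + H" and S: "N * m - K * (T - N) \<le> S" and K: "0 \<le> K"
    and small: "H * (K + \<bar>m\<bar>) \<le> \<eta> * N" and \<eta>: "0 \<le> \<eta>"
  shows "m - \<eta> \<le> S / T"
proof -
  have "(T - N) * (K + \<bar>m\<bar>) \<le> H * (K + \<bar>m\<bar>)" using N K by (intro mult_right_mono) auto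
  also have "\<dots> \<le> \<eta> * T" using small N(2) \<eta> by (meson mult_left_mono order_trans)
  finally have 1: "(T - N) * (K + \<bar>m\<bar>) \<le> \<eta> * T" .
  have "(T - N) * m \<le> (T - N) * \<bar>m\<bar>" using N by (intro mult_left_mono) auto
  then have "(m - \<eta>) * T \<le> S" using 1 S by (simp add: algebra_simps)
  then show ?thesis using N by (simp add: pos_le_divide_eq)
qed

lemma (in basic_system) dynamics_on_B: "compact_dynamics f B"
proof
  show "compact B" "B \<subseteq> {0..1}" "B \<noteq> {}" using B_compact B_sub_M M_sub infinite_B by auto
  show "continuous_on B f" using continuous_on_subset[OF cont B_sub_M] .
  show "f ` B \<subseteq> B" using f_B by blast
qed

sublocale basic_system \<subseteq> dyn: compact_dynamics f B by (rule dynamics_on_B)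

context core_system
begin

text \<open>Bad points for shadowing are those of \<open>F\<close> and the ends of long gaps of
  \<open>B\<close>. The nonperiodic ones have measure 0, hence a neighbourhood of small measure; the
  periodic ones are collected with their orbits in \<open>Q\<close>. A point with a good penalised
  average either lies in \<open>Q\<close> and is itself periodic, or its orbit avoids
  \<open>Q\<close> for the time considered and is followed by a generic block.\<close>

lemma cycle_above:
  assumes \<phi>: "continuous_on B \<phi>" and \<mu>: "\<mu> \<in> invariant_measures f B" and \<eta>: "\<eta> > 0"
  shows "\<exists>y\<in>B. \<exists>p>0. (f ^^ p) y = y \<and> (\<integral>x. \<phi> x \<partial>\<mu>) - 3 * \<eta> \<le> avg f \<phi> p y"
proof -
  have \<mu>p: "\<mu> \<in> prob_measures_on B" by (rule dyn.invariant_D[OF \<mu>])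
  obtain K where K: "K > 0" "\<And>x. x \<in> B \<Longrightarrow> \<bar>\<phi> x\<bar> \<le> K" using dyn.cont_bounded[OF \<phi>] by blast
  obtain \<epsilon>' where \<epsilon>': "\<epsilon>' > 0" "\<And>x x'. x \<in> B \<Longrightarrow> x' \<in> B \<Longrightarrow> \<bar>x' - x\<bar> < \<epsilon>' \<Longrightarrow> \<bar>\<phi> x' - \<phi> x\<bar> < \<eta>"
    using compact_uniformly_continuous[OF \<phi> B_compact] \<eta>
    unfolding uniformly_continuous_on_def dist_real_def by metis
  define \<epsilon> where "\<epsilon> = \<epsilon>' / 3"
  have \<epsilon>: "\<epsilon> > 0" "2 * \<epsilon> < \<epsilon>'" using \<epsilon>'(1) unfolding \<epsilon>_def by auto
  define E where "E = F \<inter> B \<union> {x \<in> B. B \<inter> {x<..<x + \<epsilon>} = {} \<or> B \<inter> {x - \<epsilon><..<x} = {}}"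
  have finE: "finite E" unfolding E_def using F_finite finite_gap_endpoints[OF \<epsilon>(1)] by simp
  have EB: "E \<subseteq> B" unfolding E_def by blast
  define P where "P = {e \<in> E. \<exists>p>0. (f ^^ p) e = e}"
  have finP: "finite P" unfolding P_def using finE by simp
  have "\<forall>e\<in>P. \<exists>p>0. (f ^^ p) e = e" unfolding P_def by blast
  then obtain p where p: "\<And>e. e \<in> P \<Longrightarrow> p e > 0 \<and> (f ^^ p e) e = e" by metis
  \<comment> \<open>A common period of all points of \<open>Q\<close>; taking \<open>N\<close> as a
    multiple of it makes an average over \<open>N\<close> steps the average over a cycle.\<close>
  define L where "L = prod p P"
  have L: "L > 0" unfolding L_def using p by (intro prod_pos) auto
  have PL: "(f ^^ L) e = e" if "e \<in> P" for e
    by (rule funpow_multiple_fixed[of "p e"]) (use p[OF that] dvd_prodI[OF finP that] in \<open>auto simp: L_def\<close>)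
  define Q where "Q = (\<Union>e\<in>P. (\<lambda>i. (f ^^ i) e) ` {..<L})"
  have PB: "P \<subseteq> B" unfolding P_def using EB by blast
  have Q: "finite Q" "Q \<subseteq> B" unfolding Q_def using finP PB fn_B by auto
  have QL: "(f ^^ L) x = x" if x: "x \<in> Q" for x
  proof -
    obtain e i where e: "e \<in> P" "x = (f ^^ i) e" using x unfolding Q_def by blast
    have "(f ^^ L) x = (f ^^ i) ((f ^^ L) e)" unfolding e(2) by (metis add.commute comp_apply funpow_add)
    then show ?thesis unfolding PL[OF e(1)] e(2) .
  qed
  have fQ: "f ` Q \<subseteq> Q"
  proof
    fix x' assume "x' \<in> f ` Q"
    then obtain e i where e: "e \<in> P" "i < L" "x' = f ((f ^^ i) e)" unfolding Q_def by auto
    show "x' \<in> Q"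
    proof (cases "Suc i < L")
      case True
      have "x' = (f ^^ Suc i) e" using e(3) by simp
      then show ?thesis unfolding Q_def using e(1) True by blast
    next
      case False
      then have "Suc i = L" using e(2) by simp
      then have "x' = (f ^^ 0) e" using e PL[OF e(1)] by auto
      then show ?thesis unfolding Q_def using e(1) L by blast
    qed
  qed
  have null: "measure \<mu> {e} = 0" if e: "e \<in> (E \<union> F) \<inter> B - Q" for e
  proof (rule dyn.nonperiodic_null[OF \<mu>])
    show "e \<in> B" using e by blast
    have "e \<in> E" using e unfolding E_def by blast
    moreover have "e \<notin> P"
    proof
      assume "e \<in> P"
      then have "(f ^^ 0) e \<in> Q" unfolding Q_def using L by blast
      then show False using e by simp
    qed
    ultimately show "(f ^^ p) e \<noteq> e" if "p > 0" for p unfolding P_def using that by blast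
  qed
  \<comment> \<open>The bound \<open>1 / 3\<close> is demanded by \<open>penalised_point\<close>;
    the other one makes its loss \<open>6 * K * measure \<mu> D\<close> at most
    \<open>\<eta>\<close>.\<close>
  define \<delta> where "\<delta> = min (1 / 3) (\<eta> / (6 * K))"
  have \<delta>: "\<delta> > 0" "\<delta> \<le> 1 / 3" "\<delta> \<le> \<eta> / (6 * K)" unfolding \<delta>_def using \<eta> K(1) by auto
  obtain O' where O': "open O'" "E \<union> F \<subseteq> O'" "O' \<inter> B - Q \<in> sets \<mu>" "measure \<mu> (O' \<inter> B - Q) < \<delta>"
    using dyn.null_neighbourhood[OF \<mu>p _ Q(1) null \<delta>(1), of "E \<union> F"] finE F_finite by auto
  define D where "D = O' \<inter> B - Q"
  have D: "D \<in> sets \<mu>" "measure \<mu> D < 1 / 3" unfolding D_def using O'(3,4) \<delta>(2) by auto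
  have "6 * K * measure \<mu> D \<le> 6 * K * (\<eta> / (6 * K))"
    using O'(4) \<delta>(3) K(1) unfolding D_def by (intro mult_left_mono) auto
  then have D\<eta>: "6 * K * measure \<mu> D \<le> \<eta>" using K(1) by simp
  have gap: "B \<inter> {x<..<x + \<epsilon>} \<noteq> {} \<and> B \<inter> {x - \<epsilon><..<x} \<noteq> {}" if x: "x \<in> B - O'" for x
  proof -
    have "x \<notin> E" using x O'(2) by blast
    then show ?thesis unfolding E_def using x by blast
  qed
  have FO: "F \<subseteq> O'" using O'(2) by blast
  obtain G where G: "\<forall>N. \<forall>z\<in>B - O'. \<exists>u v a b. big u v \<and> {u..v} \<subseteq> (f ^^ a) ` {c1..c2} \<and> {c1..c2} \<subseteq> (f ^^ b) ` {u..v} \<and>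
    a \<le> G \<and> N \<le> b \<and> b \<le> N + G \<and> (\<forall>y\<in>{u..v}. \<forall>i<N. (f ^^ i) z \<notin> O' \<longrightarrow> \<bar>(f ^^ i) y - (f ^^ i) z\<bar> \<le> 2 * \<epsilon>)"
    by (rule exE[OF generic_block[OF O'(1) FO \<epsilon>(1) gap]])
  define I where "I = (\<integral>x. \<phi> x \<partial>\<mu>)"
  define m where "m = I - 2 * \<eta>"
  \<comment> \<open>Long enough for the transit times, bounded in terms of \<open>G\<close>, to cost
    another \<open>\<eta>\<close> only; the third \<open>\<eta>\<close> is due to uniform
    continuity.\<close>
  obtain n where n: "2 * real G * (K + \<bar>m\<bar>) / \<eta> < real n" using reals_Archimedean2 by blast
  define N where "N = L * Suc n"
  have N: "N > 0" "L dvd N" "n \<le> N"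
    unfolding N_def using L mult_le_mono1[of 1 L "Suc n"] by auto
  have large: "2 * real G * (K + \<bar>m\<bar>) \<le> \<eta> * N"
  proof -
    have "2 * real G * (K + \<bar>m\<bar>) < \<eta> * real n" using n \<eta> by (simp add: pos_divide_less_eq mult.commute)
    also have "\<dots> \<le> \<eta> * N" using N(3) \<eta> by (intro mult_left_mono) auto
    finally show ?thesis by simp
  qed
  obtain z where z: "z \<in> B" "z \<notin> D" "z \<in> Q \<or> (\<forall>i<N. (f ^^ i) z \<notin> Q)"
    and zsum: "N * (I - 6 * K * measure \<mu> D) \<le> (\<Sum>i<N. \<phi> ((f ^^ i) z) - 2 * K * indicator D ((f ^^ i) z))"
    using dyn.penalised_point[OF \<mu> \<phi> K Q fQ D N(1)] unfolding I_def by blast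
  have zs: "N * (I - \<eta>) \<le> (\<Sum>i<N. \<phi> ((f ^^ i) z) - 2 * K * indicator D ((f ^^ i) z))"
    by (rule order_trans[OF _ zsum]) (use D\<eta> in \<open>intro mult_left_mono, auto\<close>)
  show ?thesis
  proof (cases "z \<in> Q")
    case True
    have "indicator D ((f ^^ i) z) = (0 :: real)" for i
      using funpow_mem[OF fQ True, of i] unfolding D_def by simp
    then have "N * (I - \<eta>) \<le> (\<Sum>i<N. \<phi> ((f ^^ i) z))" using zs by simp
    then have "I - \<eta> \<le> avg f \<phi> N z" unfolding avg_def using N(1) by (simp add: pos_le_divide_eq mult.commute)
    moreover have "(f ^^ N) z = z" by (rule funpow_multiple_fixed[OF QL[OF True] N(2)])
    ultimately show ?thesis using z(1) N(1) \<eta> unfolding I_def by (intro bexI[of _ z] exI[of _ N]) auto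
  next
    case False
    then have zQ: "\<And>i. i < N \<Longrightarrow> (f ^^ i) z \<notin> Q" using z(3) by blast
    have zO: "z \<in> B - O'" using z(1,2) False unfolding D_def by blast
    obtain u v a b where uv: "big u v" "{u..v} \<subseteq> (f ^^ a) ` {c1..c2}" "{c1..c2} \<subseteq> (f ^^ b) ` {u..v}"
      and ab: "a \<le> G" "N \<le> b" "b \<le> N + G"
      and track: "\<And>y i. y \<in> {u..v} \<Longrightarrow> i < N \<Longrightarrow> (f ^^ i) z \<notin> O' \<Longrightarrow> \<bar>(f ^^ i) y - (f ^^ i) z\<bar> \<le> 2 * \<epsilon>"
      using bspec[OF spec[OF G, of N] zO] by blast
    \<comment> \<open>A lower estimate of \<open>\<phi>\<close> along the shadowing orbit. While the
      orbit of \<open>z\<close> is in \<open>D\<close>, the penalty covers a drop of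
      \<open>\<phi>\<close> from \<open>K\<close> to \<open>- K\<close>; elsewhere uniform
      continuity costs \<open>\<eta>\<close>.\<close>
    define g where "g i = \<phi> ((f ^^ i) z) - 2 * K * indicator D ((f ^^ i) z) - \<eta>" for i
    have link: "link u v a b" unfolding link_def using uv by blast
    let ?s = "start (\<lambda>_. a) (\<lambda>_. b) 1"
    obtain y where y: "y \<in> B" and Y: "(f ^^ (2 * ?s)) y = y \<and> (\<forall>j<1::nat. \<exists>i. (f ^^ i) y \<in> {u..v}) \<and>
      (\<forall>\<phi> K g. (\<forall>x\<in>B. - K \<le> \<phi> x) \<longrightarrow>
         (\<forall>j<1::nat. \<forall>x\<in>B \<inter> {u..v}. \<forall>i<N. g j i \<le> \<phi> ((f ^^ (0 + i)) x)) \<longrightarrow>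
         2 * (\<Sum>j<1. \<Sum>i<N. g j i) - K * (2 * real ?s - 2 * (\<Sum>j<1::nat. real N))
         \<le> (\<Sum>i<2 * ?s. \<phi> ((f ^^ i) y)))"
    proof (rule bexE[OF periodic_block_sums[of 1 "\<lambda>_. u" "\<lambda>_. v" "\<lambda>_. a" "\<lambda>_. b" "\<lambda>_. 0" "\<lambda>_. N"]])
      show "link u v a b" "0 + N \<le> b" using link ab(2) by auto
    qed
    have st: "start (\<lambda>_. a) (\<lambda>_. b) 1 = a + b" unfolding start_def by simp
    have g_le: "g i \<le> \<phi> ((f ^^ i) x)" if x: "x \<in> B" "x \<in> {u..v}" and i: "i < N" for x i
    proof (cases "(f ^^ i) z \<in> O'")
      case True
      then have "indicator D ((f ^^ i) z) = (1 :: real)" unfolding D_def using fn_B[OF z(1)] zQ[OF i] by simp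
      then show ?thesis unfolding g_def
        using K(2)[OF fn_B[OF z(1), of i]] K(2)[OF fn_B[OF x(1), of i]] \<eta> by (simp add: abs_le_iff)
    next
      case False
      have "\<bar>(f ^^ i) x - (f ^^ i) z\<bar> < \<epsilon>'" using track[OF x(2) i False] \<epsilon>(2) by linarith
      then have "\<bar>\<phi> ((f ^^ i) x) - \<phi> ((f ^^ i) z)\<bar> < \<eta>" by (intro \<epsilon>'(2) fn_B z(1) x(1))
      moreover have "0 \<le> 2 * K * indicator D ((f ^^ i) z)" using K(1) by simp
      ultimately show ?thesis unfolding g_def by linarith
    qed
    have low: "\<forall>x\<in>B. - K \<le> \<phi> x" using K(2) by (force simp: abs_le_iff)
    have S: "2 * (\<Sum>i<N. g i) - K * (2 * real (a + b) - 2 * real N) \<le> (\<Sum>i<2 * (a + b). \<phi> ((f ^^ i) y))"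
    proof -
      have "2 * (\<Sum>j<1::nat. \<Sum>i<N. g i) - K * (2 * real ?s - 2 * (\<Sum>j<1::nat. real N)) \<le> (\<Sum>i<2 * ?s. \<phi> ((f ^^ i) y))"
        by (rule Y[THEN conjunct2, THEN conjunct2, THEN spec[of _ \<phi>], THEN spec[of _ K], THEN spec[of _ "\<lambda>_. g"],
              THEN mp, THEN mp]) (use low g_le in auto)
      then show ?thesis unfolding st by simp
    qed
    have "N * m \<le> (\<Sum>i<N. g i)"
    proof -
      have "(\<Sum>i<N. g i) = (\<Sum>i<N. \<phi> ((f ^^ i) z) - 2 * K * indicator D ((f ^^ i) z)) - N * \<eta>"
        unfolding g_def by (simp add: sum_subtractf)
      then show ?thesis using zs unfolding m_def by (simp add: algebra_simps)
    qed
    then have "real (2 * N) * m - K * (real (2 * (a + b)) - real (2 * N)) \<le> (\<Sum>i<2 * (a + b). \<phi> ((f ^^ i) y))"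
      using S by (simp add: algebra_simps)
    then have "m - \<eta> \<le> (\<Sum>i<2 * (a + b). \<phi> ((f ^^ i) y)) / real (2 * (a + b))"
    proof (rule average_lower_bound[rotated 3, where H = "4 * real G"])
      show "4 * real G * (K + \<bar>m\<bar>) \<le> \<eta> * real (2 * N)" using large by simp
    qed (use N(1) ab K(1) \<eta> in auto)
    then have "I - 3 * \<eta> \<le> avg f \<phi> (2 * (a + b)) y" unfolding avg_def m_def by simp
    moreover have "0 < 2 * (a + b)" using N(1) ab(2) by simp
    ultimately show ?thesis using y Y[THEN conjunct1] unfolding st I_def by blast
  qed
qed

end

lemma sum_multiple_period:
  assumes "(f ^^ p) x = x" "p > 0"
  shows "(\<Sum>j<p * m. \<phi> ((f ^^ j) x)) = real (p * m) * avg f \<phi> p x"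
proof (cases "m = 0")
  case False
  then have "avg f \<phi> (p * m) x = avg f \<phi> p x" by (intro avg_multiple[OF assms(1)]) simp
  then show ?thesis using False assms(2) unfolding avg_def[of f \<phi> "p * m"] by (simp add: field_simps)
qed simp

text \<open>\<open>S\<close> belongs to two runs of length \<open>T\<close>. \<open>H\<close> bounds
  the time of a run outside of the two long blocks and \<open>P\<close> the rounding of block
  lengths to multiples of periods; \<open>large\<close> makes both negligible.\<close>

lemma weighted_average_error:
  fixes S A1 A2 t e H P m :: real
  assumes T: "0 < T" "N1 + N2 \<le> T" "T \<le> N1 + N2 + H"
    and S: "\<bar>S - 2 * (N1 * A1 + N2 * A2)\<bar> \<le> 2 * e * (N1 + N2) + 2 * (T - (N1 + N2))"
    and N: "\<bar>N1 - t * m\<bar> \<le> P" "\<bar>N2 - (1 - t) * m\<bar> \<le> P"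
    and A: "0 \<le> A1" "A1 \<le> 1" "0 \<le> A2" "A2 \<le> 1" and t: "0 \<le> t" "t \<le> 1" and e: "0 \<le> e"
    and large: "2 * H + 4 * P \<le> e * T"
  shows "\<bar>S / (2 * T) - (t * A1 + (1 - t) * A2)\<bar> \<le> 2 * e"
proof -
  have mT: "\<bar>m - T\<bar> \<le> H + 2 * P"
  proof -
    have "(N1 - t * m) + (N2 - (1 - t) * m) = N1 + N2 - m" by (simp add: algebra_simps)
    then have "\<bar>N1 + N2 - m\<bar> \<le> 2 * P" using N by linarith
    then show ?thesis using T(2,3) by linarith
  qed
  have d: "\<bar>(N - s * T) * A\<bar> \<le> P + s * (H + 2 * P)" if "\<bar>N - s * m\<bar> \<le> P" "0 \<le> A" "A \<le> 1" "0 \<le> s" for N s A :: real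
  proof -
    have "\<bar>(N - s * T) * A\<bar> \<le> \<bar>N - s * T\<bar> * 1" unfolding abs_mult using that by (intro mult_left_mono) auto
    also have "\<dots> \<le> \<bar>N - s * m\<bar> + s * \<bar>m - T\<bar>"
    proof -
      have "N - s * T = (N - s * m) + s * (m - T)" by (simp add: algebra_simps)
      then show ?thesis using abs_triangle_ineq[of "N - s * m" "s * (m - T)"] that(4) by (simp add: abs_mult)
    qed
    also have "\<dots> \<le> P + s * (H + 2 * P)" using that mT by (intro add_mono mult_left_mono) auto
    finally show ?thesis by simp
  qed
  have split: "S - 2 * T * (t * A1 + (1 - t) * A2) =
    (S - 2 * (N1 * A1 + N2 * A2)) + 2 * ((N1 - t * T) * A1 + (N2 - (1 - t) * T) * A2)"
    by (simp add: algebra_simps)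
  have "t * (H + 2 * P) + (1 - t) * (H + 2 * P) = H + 2 * P" by (simp add: algebra_simps)
  then have 2: "\<bar>(N1 - t * T) * A1 + (N2 - (1 - t) * T) * A2\<bar> \<le> 4 * P + H"
    using d[OF N(1) A(1,2) t(1)] d[OF N(2) A(3,4)] t(2) by linarith
  have "e * (N1 + N2) \<le> e * T" using T(2) e by (intro mult_left_mono)
  then have "\<bar>S - 2 * T * (t * A1 + (1 - t) * A2)\<bar> \<le> 2 * e * T + 4 * H + 8 * P"
  proof -
    have tri: "\<bar>X + 2 * Y\<bar> \<le> \<bar>X\<bar> + 2 * \<bar>Y\<bar>" for X Y :: real by linarith
    have "2 * e * (N1 + N2) = 2 * (e * (N1 + N2))" "2 * e * T = 2 * (e * T)" by simp_all
    then show ?thesis unfolding split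
      using tri[of "S - 2 * (N1 * A1 + N2 * A2)" "(N1 - t * T) * A1 + (N2 - (1 - t) * T) * A2"]
        S 2 T(3) \<open>e * (N1 + N2) \<le> e * T\<close> by argo
  qed
  also have "\<dots> \<le> 2 * e * (2 * T)" using large by linarith
  finally have "\<bar>(S - 2 * T * (t * A1 + (1 - t) * A2)) / (2 * T)\<bar> \<le> 2 * e"
    unfolding abs_divide using T(1) by (simp add: pos_divide_le_eq)
  moreover have "(S - 2 * T * (t * A1 + (1 - t) * A2)) / (2 * T) = S / (2 * T) - (t * A1 + (1 - t) * A2)"
    using T(1) by (simp add: field_simps)
  ultimately show ?thesis by simp
qed

lemma multiple_near:
  assumes "0 < (p :: nat)" "0 \<le> (r :: real)"
  shows "\<exists>m. \<bar>real (p * m) - r\<bar> \<le> p"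
proof -
  define m where "m = nat \<lfloor>r / p\<rfloor>"
  have "0 \<le> r / p" using assms by simp
  then have "real m \<le> r / p" "r / p < real m + 1" unfolding m_def by linarith+
  then have "p * real m \<le> r" "r < p * (real m + 1)" using assms(1) by (simp_all add: field_simps)
  then show ?thesis by (intro exI[of _ m]) (simp add: algebra_simps abs_le_iff)
qed

section \<open>Mixing two cycles in a given proportion\<close>

context core_system
begin

text \<open>Two applications of the one-sided estimate: to \<open>\<phi>\<close> with lower bound 0
  and to the negative of \<open>\<phi>\<close> with lower bound -1.\<close>

lemma periodic_block_sums_close:
  assumes links: "\<And>j. j < J \<Longrightarrow> link (u j) (v j) (a j) (b j)" and len: "\<And>j. j < J \<Longrightarrow> k j + N j \<le> b j"
  shows "\<exists>y\<in>B. (f ^^ (2 * start a b J)) y = y \<and> (\<forall>j<J. \<exists>i. (f ^^ i) y \<in> {u j..v j}) \<and>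
    (\<forall>\<phi> e g. (\<forall>x\<in>B. 0 \<le> \<phi> x \<and> \<phi> x \<le> 1) \<longrightarrow>
       (\<forall>j<J. \<forall>x\<in>B \<inter> {u j..v j}. \<forall>i<N j. \<bar>\<phi> ((f ^^ (k j + i)) x) - g j i\<bar> \<le> e) \<longrightarrow>
       \<bar>(\<Sum>i<2 * start a b J. \<phi> ((f ^^ i) y)) - 2 * (\<Sum>j<J. \<Sum>i<N j. g j i)\<bar>
         \<le> 2 * e * (\<Sum>j<J. real (N j)) + 2 * (real (start a b J) - (\<Sum>j<J. real (N j))))"
proof -
  define T where "T = start a b J"
  define n where "n = (\<Sum>j<J. real (N j))"
  obtain y where y: "y \<in> B" and Y: "(f ^^ (2 * T)) y = y \<and> (\<forall>j<J. \<exists>i. (f ^^ i) y \<in> {u j..v j}) \<and>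
      (\<forall>\<phi> K g. (\<forall>x\<in>B. - K \<le> \<phi> x) \<longrightarrow>
         (\<forall>j<J. \<forall>x\<in>B \<inter> {u j..v j}. \<forall>i<N j. g j i \<le> \<phi> ((f ^^ (k j + i)) x)) \<longrightarrow>
         2 * (\<Sum>j<J. \<Sum>i<N j. g j i) - K * (2 * real T - 2 * n) \<le> (\<Sum>i<2 * T. \<phi> ((f ^^ i) y)))"
    unfolding T_def n_def by (rule bexE[OF periodic_block_sums[of J u v a b k N, OF links len]])
  have "\<bar>(\<Sum>i<2 * T. \<phi> ((f ^^ i) y)) - 2 * (\<Sum>j<J. \<Sum>i<N j. g j i)\<bar> \<le> 2 * e * n + 2 * (real T - n)"
    if \<phi>: "\<forall>x\<in>B. 0 \<le> \<phi> x \<and> \<phi> x \<le> 1"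
      and g: "\<forall>j<J. \<forall>x\<in>B \<inter> {u j..v j}. \<forall>i<N j. \<bar>\<phi> ((f ^^ (k j + i)) x) - g j i\<bar> \<le> e" for \<phi> e g
  proof -
    have 1: "2 * (\<Sum>j<J. \<Sum>i<N j. g j i - e) - 0 * (2 * real T - 2 * n) \<le> (\<Sum>i<2 * T. \<phi> ((f ^^ i) y))"
      by (rule Y[THEN conjunct2, THEN conjunct2, THEN spec[of _ \<phi>], THEN spec[of _ 0],
            THEN spec[of _ "\<lambda>j i. g j i - e"], THEN mp, THEN mp]) (use \<phi> g in \<open>force simp: abs_le_iff\<close>)+
    have 2: "2 * (\<Sum>j<J. \<Sum>i<N j. - g j i - e) - 1 * (2 * real T - 2 * n) \<le> (\<Sum>i<2 * T. - \<phi> ((f ^^ i) y))"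
      by (rule Y[THEN conjunct2, THEN conjunct2, THEN spec[of _ "\<lambda>x. - \<phi> x"], THEN spec[of _ 1],
            THEN spec[of _ "\<lambda>j i. - g j i - e"], THEN mp, THEN mp]) (use \<phi> g in \<open>force simp: abs_le_iff\<close>)+
    have s: "(\<Sum>j<J. \<Sum>i<N j. g j i - e) = (\<Sum>j<J. \<Sum>i<N j. g j i) - e * n"
      "(\<Sum>j<J. \<Sum>i<N j. - g j i - e) = - (\<Sum>j<J. \<Sum>i<N j. g j i) - e * n"
      unfolding n_def by (simp_all add: sum_subtractf sum_negf sum_distrib_left mult.commute)
    have "0 \<le> real T - n"
    proof -
      have "N j \<le> a j + b j" if "j < J" for j using len[OF that] by simp
      then have "(\<Sum>j<J. N j) \<le> T" unfolding T_def start_def by (intro sum_mono) simp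
      then show ?thesis unfolding n_def by (simp add: of_nat_sum[symmetric] del: of_nat_sum)
    qed
    then show ?thesis using 1 2 unfolding s sum_negf by (simp add: abs_le_iff algebra_simps)
  qed
  then show ?thesis using y Y unfolding T_def n_def by (intro bexI[of _ y]) simp_all
qed

lemma cycle_avg_bounds:
  assumes "y \<in> B"
  shows "0 \<le> avg f (\<lambda>x. x ^ k) p y" "avg f (\<lambda>x. x ^ k) p y \<le> 1"
proof -
  have x01: "0 \<le> (f ^^ j) y" "(f ^^ j) y \<le> 1" for j using fn_B[OF assms, of j] dyn.B_01 by auto
  show "0 \<le> avg f (\<lambda>x. x ^ k) p y" unfolding avg_def by (intro divide_nonneg_nonneg sum_nonneg zero_le_power x01) simp
  have "(\<Sum>j<p. ((f ^^ j) y) ^ k) \<le> (\<Sum>j<p. 1)" by (intro sum_mono power_le_one x01)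
  then show "avg f (\<lambda>x. x ^ k) p y \<le> 1" unfolding avg_def by (cases "p = 0") (auto simp: divide_le_eq)
qed

text \<open>The outcome of \<open>periodic_block\<close>: the bounds \<open>G\<close> and
  \<open>k\<close> are fixed before the duration \<open>N\<close>.\<close>

definition blocks :: "real \<Rightarrow> real \<Rightarrow> nat \<Rightarrow> nat \<Rightarrow> bool" where
  "blocks w \<epsilon> G k \<longleftrightarrow> (\<forall>N. \<exists>u v a b. link u v a b \<and> a \<le> G \<and> k + N \<le> b \<and> b \<le> N + G \<and>
    (\<forall>y\<in>B \<inter> {u..v}. \<forall>i<N. \<bar>(f ^^ (k + i)) y - (f ^^ i) w\<bar> \<le> \<epsilon>))"

lemma blocks_exist:
  assumes "w \<in> B" "0 < p" "(f ^^ p) w = w" "\<epsilon> > 0"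
  shows "\<exists>G k. blocks w \<epsilon> G k"
  unfolding blocks_def link_def conj_assoc by (rule periodic_block[OF assms])

text \<open>Follow the first cycle for about \<open>t * m\<close> steps and the second for about
  \<open>(1 - t) * m\<close>, then visit the prescribed big intervals. All transit times are bounded
  independently of \<open>m\<close>, so a large \<open>m\<close> makes them negligible.\<close>

lemma mix_cycles:
  fixes q n :: nat
  assumes y1: "y1 \<in> B" "0 < p1" "(f ^^ p1) y1 = y1" and y2: "y2 \<in> B" "0 < p2" "(f ^^ p2) y2 = y2"
    and t: "0 \<le> t" "t \<le> 1" and d: "d > 0" and bigs: "\<And>j. j < q \<Longrightarrow> big (U j) (V j)"
  shows "\<exists>y\<in>B. \<exists>p>0. (f ^^ p) y = y \<and> (\<forall>j<q. \<exists>i. (f ^^ i) y \<in> {U j..V j}) \<and>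
    (\<forall>k<n. \<bar>avg f (\<lambda>x. x ^ k) p y - (t * avg f (\<lambda>x. x ^ k) p1 y1 + (1 - t) * avg f (\<lambda>x. x ^ k) p2 y2)\<bar> \<le> d)"
proof -
  define e where "e = d / 2"
  define \<epsilon> where "\<epsilon> = e / (real n + 1)"
  have e: "e > 0" "\<epsilon> > 0" "n * \<epsilon> \<le> e" using d unfolding e_def \<epsilon>_def by (auto simp: field_simps)
  have pw: "\<bar>x ^ k - x' ^ k\<bar> \<le> e" if "x \<in> B" "x' \<in> B" "\<bar>x - x'\<bar> \<le> \<epsilon>" "k < n" for x x' :: real and k
  proof -
    have "\<bar>x\<bar> \<le> 1" "\<bar>x'\<bar> \<le> 1" using that(1,2) dyn.B_01 by auto
    then have "\<bar>x ^ k - x' ^ k\<bar> \<le> k * \<bar>x - x'\<bar>" using norm_power_diff[of x x' k] by simp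
    also have "\<dots> \<le> n * \<epsilon>" using that(3,4) by (intro mult_mono) auto
    finally show ?thesis using e(3) by simp
  qed
  have "\<forall>j. \<exists>u v a b. j < q \<longrightarrow> {u..v} \<subseteq> {U j..V j} \<and> link u v a b" using link_visit bigs by blast
  then obtain u' v' a' b' where vis: "\<And>j. j < q \<Longrightarrow> {u' j..v' j} \<subseteq> {U j..V j} \<and> link (u' j) (v' j) (a' j) (b' j)" by metis
  obtain G1 k1 where blk1: "blocks y1 \<epsilon> G1 k1" using blocks_exist[OF y1 e(2)] by blast
  obtain G2 k2 where blk2: "blocks y2 \<epsilon> G2 k2" using blocks_exist[OF y2 e(2)] by blast
  define H where "H = 2 * G1 + 2 * G2 + start a' b' q"
  define P where "P = p1 + p2"
  \<comment> \<open>The margin \<open>2 * P\<close> accounts for rounding, so that the length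
    \<open>T\<close> of a run also exceeds the quotient required by
    \<open>weighted_average_error\<close>.\<close>
  obtain m :: nat where m: "(2 * real H + 4 * real P) / e + 2 * real P + 1 < real m" using reals_Archimedean2 by blast
  obtain m1 where m1: "\<bar>real (p1 * m1) - t * m\<bar> \<le> p1" using multiple_near[OF y1(2), of "t * m"] t by auto
  obtain m2 where m2: "\<bar>real (p2 * m2) - (1 - t) * m\<bar> \<le> p2" using multiple_near[OF y2(2), of "(1 - t) * m"] t by auto
  define N1 N2 where "N1 = p1 * m1" and "N2 = p2 * m2"
  have N12: "\<bar>real N1 - t * m\<bar> \<le> P" "\<bar>real N2 - (1 - t) * m\<bar> \<le> P" using m1 m2 unfolding N1_def N2_def P_def by auto
  obtain u1 v1 a1 b1 where uv1: "link u1 v1 a1 b1" "a1 \<le> G1" "k1 + N1 \<le> b1" "b1 \<le> N1 + G1"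
    "\<forall>y\<in>B \<inter> {u1..v1}. \<forall>i<N1. \<bar>(f ^^ (k1 + i)) y - (f ^^ i) y1\<bar> \<le> \<epsilon>"
    using blk1[unfolded blocks_def, THEN spec[of _ N1]] by blast
  obtain u2 v2 a2 b2 where uv2: "link u2 v2 a2 b2" "a2 \<le> G2" "k2 + N2 \<le> b2" "b2 \<le> N2 + G2"
    "\<forall>y\<in>B \<inter> {u2..v2}. \<forall>i<N2. \<bar>(f ^^ (k2 + i)) y - (f ^^ i) y2\<bar> \<le> \<epsilon>"
    using blk2[unfolded blocks_def, THEN spec[of _ N2]] by blast
  \<comment> \<open>Indices 0 and 1 are the long blocks, the others the short visits with empty
    windows.\<close>
  define pick :: "real \<Rightarrow> real \<Rightarrow> (nat \<Rightarrow> real) \<Rightarrow> nat \<Rightarrow> real" where "pick x1 x2 x j = (case j of 0 \<Rightarrow> x1 | Suc 0 \<Rightarrow> x2 | Suc (Suc i) \<Rightarrow> x i)" for x1 x2 x j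
  define npick :: "nat \<Rightarrow> nat \<Rightarrow> (nat \<Rightarrow> nat) \<Rightarrow> nat \<Rightarrow> nat" where "npick x1 x2 x j = (case j of 0 \<Rightarrow> x1 | Suc 0 \<Rightarrow> x2 | Suc (Suc i) \<Rightarrow> x i)" for x1 x2 x j
  have pick_simps [simp]: "pick x1 x2 x 0 = x1" "pick x1 x2 x (Suc 0) = x2" "pick x1 x2 x (Suc (Suc i)) = x i" for x1 x2 x i
    unfolding pick_def by simp_all
  have npick_simps [simp]: "npick x1 x2 x 0 = x1" "npick x1 x2 x (Suc 0) = x2" "npick x1 x2 x (Suc (Suc i)) = x i" for x1 x2 x i
    unfolding npick_def by simp_all
  define u v where "u = pick u1 u2 u'" and "v = pick v1 v2 v'"
  define a b kk NN where "a = npick a1 a2 a'" and "b = npick b1 b2 b'" and "kk = npick k1 k2 (\<lambda>_. 0)" and "NN = npick N1 N2 (\<lambda>_. 0)"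
  note defs = u_def v_def a_def b_def kk_def NN_def
  have three: "Q j" if "Q 0" "Q (Suc 0)" "\<And>i. i < q \<Longrightarrow> Q (Suc (Suc i))" "j < Suc (Suc q)" for Q j
    using that by (cases j rule: nat.exhaust; cases "j - 1") auto
  have links: "link (u j) (v j) (a j) (b j)" if j: "j < Suc (Suc q)" for j
  proof (rule three[OF _ _ _ j])
    show "link (u 0) (v 0) (a 0) (b 0)" "link (u (Suc 0)) (v (Suc 0)) (a (Suc 0)) (b (Suc 0))"
      unfolding defs using uv1(1) uv2(1) by simp_all
    show "link (u (Suc (Suc i))) (v (Suc (Suc i))) (a (Suc (Suc i))) (b (Suc (Suc i)))" if "i < q" for i
      unfolding defs using vis[OF that] by simp
  qed
  have len: "kk j + NN j \<le> b j" if j: "j < Suc (Suc q)" for j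
    by (rule three[OF _ _ _ j]) (use uv1(3) uv2(3) in \<open>simp_all add: defs\<close>)
  define T where "T = start a b (Suc (Suc q))"
  have shift: "(\<Sum>j<Suc (Suc q). h j) = h 0 + (h (Suc 0) + (\<Sum>j<q. h (Suc (Suc j))))" for h :: "nat \<Rightarrow> 'z :: comm_monoid_add"
    by (simp add: sum.lessThan_Suc_shift del: sum.lessThan_Suc)
  have T: "T = a1 + b1 + (a2 + b2 + start a' b' q)" unfolding T_def start_def shift defs by simp
  obtain y where y: "y \<in> B" and Y: "(f ^^ (2 * T)) y = y \<and> (\<forall>j<Suc (Suc q). \<exists>i. (f ^^ i) y \<in> {u j..v j}) \<and>
    (\<forall>\<phi> e g. (\<forall>x\<in>B. 0 \<le> \<phi> x \<and> \<phi> x \<le> 1) \<longrightarrow>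
       (\<forall>j<Suc (Suc q). \<forall>x\<in>B \<inter> {u j..v j}. \<forall>i<NN j. \<bar>\<phi> ((f ^^ (kk j + i)) x) - g j i\<bar> \<le> e) \<longrightarrow>
       \<bar>(\<Sum>i<2 * T. \<phi> ((f ^^ i) y)) - 2 * (\<Sum>j<Suc (Suc q). \<Sum>i<NN j. g j i)\<bar>
         \<le> 2 * e * (\<Sum>j<Suc (Suc q). real (NN j)) + 2 * (real T - (\<Sum>j<Suc (Suc q). real (NN j))))"
    unfolding T_def by (rule bexE[OF periodic_block_sums_close[of "Suc (Suc q)" u v a b kk NN, OF links len]])
  have NNs: "(\<Sum>j<Suc (Suc q). real (NN j)) = real N1 + real N2" unfolding shift defs by simp
  have TN: "real N1 + real N2 \<le> real T" "real T \<le> real N1 + real N2 + real H"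
    unfolding T H_def using uv1(2-4) uv2(2-4) by linarith+
  have mle: "real m \<le> real T + 2 * real P"
  proof -
    have "(real N1 - t * m) + (real N2 - (1 - t) * m) = real N1 + real N2 - real m" by (simp add: algebra_simps)
    then show ?thesis using N12 TN(1) by linarith
  qed
  then have "(2 * real H + 4 * real P) / e < real T" using m by linarith
  then have large: "2 * real H + 4 * real P \<le> e * real T" using e(1) by (simp add: pos_divide_less_eq mult.commute)
  have Tpos: "T > 0"
  proof -
    have "0 \<le> (2 * real H + 4 * real P) / e" using e(1) by simp
    then have "0 < real T" using \<open>(2 * real H + 4 * real P) / e < real T\<close> by linarith
    then show ?thesis by simp
  qed
  have close: "\<bar>avg f (\<lambda>x. x ^ k) (2 * T) y - (t * avg f (\<lambda>x. x ^ k) p1 y1 + (1 - t) * avg f (\<lambda>x. x ^ k) p2 y2)\<bar> \<le> d"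
    if k: "k < n" for k
  proof -
    define g where "g j i = (if j = 0 then ((f ^^ i) y1) ^ k else ((f ^^ i) y2) ^ k)" for j i :: nat
    have "\<bar>(\<Sum>i<2 * T. ((f ^^ i) y) ^ k) - 2 * (\<Sum>j<Suc (Suc q). \<Sum>i<NN j. g j i)\<bar>
      \<le> 2 * e * (\<Sum>j<Suc (Suc q). real (NN j)) + 2 * (real T - (\<Sum>j<Suc (Suc q). real (NN j)))"
    proof (rule Y[THEN conjunct2, THEN conjunct2, THEN spec[of _ "\<lambda>x. x ^ k"], THEN spec[of _ e], THEN spec[of _ g], THEN mp, THEN mp])
      show "\<forall>x\<in>B. 0 \<le> x ^ k \<and> x ^ k \<le> 1" using dyn.B_01 by (auto intro!: power_le_one)
      have w1: "\<bar>((f ^^ (k1 + i)) x) ^ k - ((f ^^ i) y1) ^ k\<bar> \<le> e" if "x \<in> B \<inter> {u1..v1}" "i < N1" for x i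
        by (rule pw[OF fn_B fn_B _ k]) (use that uv1(5) y1(1) in auto)
      have w2: "\<bar>((f ^^ (k2 + i)) x) ^ k - ((f ^^ i) y2) ^ k\<bar> \<le> e" if "x \<in> B \<inter> {u2..v2}" "i < N2" for x i
        by (rule pw[OF fn_B fn_B _ k]) (use that uv2(5) y2(1) in auto)
      have "\<forall>x\<in>B \<inter> {u j..v j}. \<forall>i<NN j. \<bar>((f ^^ (kk j + i)) x) ^ k - g j i\<bar> \<le> e" if j: "j < Suc (Suc q)" for j
        by (rule three[OF _ _ _ j]) (unfold defs g_def, use w1 w2 in simp_all)
      then show "\<forall>j<Suc (Suc q). \<forall>x\<in>B \<inter> {u j..v j}. \<forall>i<NN j. \<bar>((f ^^ (kk j + i)) x) ^ k - g j i\<bar> \<le> e" by blast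
    qed
    moreover have "(\<Sum>j<Suc (Suc q). \<Sum>i<NN j. g j i) = real N1 * avg f (\<lambda>x. x ^ k) p1 y1 + real N2 * avg f (\<lambda>x. x ^ k) p2 y2"
      unfolding shift defs g_def N1_def N2_def
      using sum_multiple_period[OF y1(3,2), of "\<lambda>x. x ^ k" m1] sum_multiple_period[OF y2(3,2), of "\<lambda>x. x ^ k" m2] by simp
    ultimately have "\<bar>(\<Sum>i<2 * T. ((f ^^ i) y) ^ k) - 2 * (real N1 * avg f (\<lambda>x. x ^ k) p1 y1 + real N2 * avg f (\<lambda>x. x ^ k) p2 y2)\<bar>
      \<le> 2 * e * (real N1 + real N2) + 2 * (real T - (real N1 + real N2))" unfolding NNs by simp
    then have "\<bar>(\<Sum>i<2 * T. ((f ^^ i) y) ^ k) / (2 * real T) - (t * avg f (\<lambda>x. x ^ k) p1 y1 + (1 - t) * avg f (\<lambda>x. x ^ k) p2 y2)\<bar> \<le> 2 * e"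
      by (intro weighted_average_error[OF _ TN _ N12 cycle_avg_bounds[OF y1(1)] cycle_avg_bounds[OF y2(1)] t _ large])
        (use Tpos e(1) in auto)
    then show ?thesis unfolding avg_def[of f _ "2 * T"] e_def by simp
  qed
  have "\<exists>i. (f ^^ i) y \<in> {U j..V j}" if j: "j < q" for j
  proof -
    have "Suc (Suc j) < Suc (Suc q)" using j by simp
    then have "\<exists>i. (f ^^ i) y \<in> {u (Suc (Suc j))..v (Suc (Suc j))}" using Y[THEN conjunct2, THEN conjunct1] by blast
    then obtain i where "(f ^^ i) y \<in> {u' j..v' j}" unfolding defs pick_simps by blast
    then show ?thesis using vis[OF j] by blast
  qed
  then show ?thesis using y Y[THEN conjunct1] close Tpos by (intro bexI[of _ y] exI[of _ "2 * T"]) simp_all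
qed

end

context core_system
begin

lemma mom_bounds:
  assumes "\<mu> \<in> invariant_measures f B"
  shows "0 \<le> dyn.mom \<mu> k" "dyn.mom \<mu> k \<le> 1"
proof -
  have \<mu>p: "\<mu> \<in> prob_measures_on B" by (rule dyn.invariant_D[OF assms])
  interpret P: prob_space \<mu> by (rule dyn.prob_measures_D[OF \<mu>p])
  have x01: "0 \<le> x ^ k \<and> x ^ k \<le> 1" if "x \<in> space \<mu>" for x :: real
  proof -
    have "x \<in> {0..1}" using that dyn.prob_measures_D(3)[OF \<mu>p] dyn.B_01 by blast
    then show ?thesis by (simp add: power_le_one)
  qed
  have int: "integrable \<mu> (\<lambda>x. x ^ k)" by (intro dyn.integrable_cont \<mu>p continuous_intros)
  show "0 \<le> dyn.mom \<mu> k" unfolding dyn.mom_def by (rule Bochner_Integration.integral_nonneg) (use x01 in auto)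
  have "dyn.mom \<mu> k \<le> (\<integral>x. 1 \<partial>\<mu>)" unfolding dyn.mom_def by (rule integral_mono[OF int]) (use x01 in auto)
  then show "dyn.mom \<mu> k \<le> 1" by (simp add: P.prob_space)
qed

text \<open>A Frank-Wolfe step: mixing a nearly optimal cycle with one that does not lie behind \<open>\<mu>\<close>
  in the direction of the error strictly improves the approximation.\<close>

lemma cycle_near:
  fixes n :: nat
  assumes \<mu>: "\<mu> \<in> invariant_measures f B" and d: "d > 0"
  shows "\<exists>y\<in>B. \<exists>p>0. (f ^^ p) y = y \<and> (\<Sum>k<n. (avg f (\<lambda>x. x ^ k) p y - dyn.mom \<mu> k)\<^sup>2) < d"
proof (rule ccontr)
  define cyc where "cyc y p \<longleftrightarrow> y \<in> B \<and> 0 < p \<and> (f ^^ p) y = y" for y p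
  define er where "er y p k = avg f (\<lambda>x. x ^ k) p y - dyn.mom \<mu> k" for y p k
  assume "\<not> ?thesis"
  then have far: "d \<le> (\<Sum>k<n. (er y p k)\<^sup>2)" if "cyc y p" for y p using that unfolding cyc_def er_def by force
  \<comment> \<open>If no cycle is close, the infimum \<open>E\<close> of the squared errors is
    positive; a cycle with squared error below \<open>E\<close> is the contradiction aimed
    at.\<close>
  define S where "S = {(\<Sum>k<n. (er y p k)\<^sup>2) | y p. cyc y p}"
  define E where "E = Inf S"
  have one: "continuous_on B (\<lambda>_. 1 :: real)" by simp
  obtain y0 p0 where c0: "cyc y0 p0" using cycle_above[OF one \<mu> zero_less_one] unfolding cyc_def by blast
  have ne: "S \<noteq> {}" unfolding S_def using c0 by blast
  have bdd: "bdd_below S" unfolding S_def by (intro bdd_belowI[of _ d]) (use far in blast)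
  have E_le: "E \<le> (\<Sum>k<n. (er y p k)\<^sup>2)" if "cyc y p" for y p
    unfolding E_def by (rule cInf_lower[OF _ bdd]) (use that in \<open>auto simp: S_def\<close>)
  have Ed: "d \<le> E" unfolding E_def by (rule cInf_greatest[OF ne]) (use far in \<open>auto simp: S_def\<close>)
  have er1: "\<bar>er y p k\<bar> \<le> 1" if "cyc y p" for y p k
    using cycle_avg_bounds[of y k p] mom_bounds[OF \<mu>, of k] that unfolding er_def cyc_def by (auto simp: abs_le_iff)
  have er2: "(er y p k)\<^sup>2 \<le> 1" if "cyc y p" for y p k
    using er1[OF that, of k] by (simp add: abs_square_le_1)
  define n' where "n' = real n + 1"
  have n': "n' \<ge> 1" "real n \<le> n'" unfolding n'_def by auto
  have En: "E \<le> n'"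
  proof -
    have "(\<Sum>k<n. (er y0 p0 k)\<^sup>2) \<le> (\<Sum>k<n. 1)" by (intro sum_mono er2 c0)
    then show ?thesis using E_le[OF c0] n'(2) by simp
  qed
  \<comment> \<open>The step size balances the gain \<open>s * E\<close>, linear in
    \<open>s\<close>, against the quadratic loss \<open>s\<^sup>2 * n' = s * E / 4\<close>.\<close>
  define s where "s = E / (4 * n')"
  have s: "0 < s" "s \<le> 1" unfolding s_def using Ed d n' En by (auto simp: divide_simps)
  have sn: "s\<^sup>2 * n' = s * E / 4" unfolding s_def power2_eq_square using n' by simp
  have sE: "s * E > 0" using s Ed d by simp
  have "Inf S < E + s * E / 4" using sE unfolding E_def[symmetric] by simp
  then obtain w where w: "w \<in> S" "w < E + s * E / 4" using cInf_less_iff[OF ne bdd] by blast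
  obtain y1 p1 where c1: "cyc y1 p1" and w_eq: "w = (\<Sum>k<n. (er y1 p1 k)\<^sup>2)" using w(1) unfolding S_def by blast
  define a where "a k = er y1 p1 k" for k
  \<comment> \<open>A large average of \<open>\<phi>\<close> means a small component in the
    direction of the error \<open>a\<close>. The value \<open>E / 24\<close> used below turns the
    loss \<open>3 * \<eta>\<close> of \<open>cycle_above\<close> into \<open>E / 8\<close>.\<close>
  define \<phi> where "\<phi> x = - (\<Sum>k<n. a k * x ^ k)" for x :: real
  have \<phi>c: "continuous_on B \<phi>" unfolding \<phi>_def by (intro continuous_intros)
  have "E / 24 > 0" using Ed d by simp
  then obtain y2 p2 where c2': "y2 \<in> B" "p2 > 0" "(f ^^ p2) y2 = y2" "(\<integral>x. \<phi> x \<partial>\<mu>) - 3 * (E / 24) \<le> avg f \<phi> p2 y2"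
    using cycle_above[OF \<phi>c \<mu>] by blast
  have c2: "cyc y2 p2" unfolding cyc_def using c2' by blast
  define b where "b k = er y2 p2 k" for k
  have ab: "(\<Sum>k<n. a k * b k) \<le> E / 8"
  proof -
    have int: "integrable \<mu> (\<lambda>x. x ^ k)" for k
      by (intro dyn.integrable_cont dyn.invariant_D[OF \<mu>] continuous_intros)
    have "(\<integral>x. \<phi> x \<partial>\<mu>) = - (\<Sum>k<n. a k * dyn.mom \<mu> k)" unfolding \<phi>_def dyn.mom_def using int by simp
    moreover have "avg f \<phi> p2 y2 = - (\<Sum>k<n. a k * avg f (\<lambda>x. x ^ k) p2 y2)"
    proof -
      have "(\<Sum>j<p2. \<Sum>k<n. a k * ((f ^^ j) y2) ^ k) = (\<Sum>k<n. a k * (\<Sum>j<p2. ((f ^^ j) y2) ^ k))"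
        unfolding sum_distrib_left by (rule sum.swap)
      then show ?thesis unfolding avg_def \<phi>_def sum_negf times_divide_eq_right sum_divide_distrib[symmetric] by simp
    qed
    ultimately have "(\<Sum>k<n. a k * avg f (\<lambda>x. x ^ k) p2 y2) - (\<Sum>k<n. a k * dyn.mom \<mu> k) \<le> E / 8" using c2'(4) by simp
    then show ?thesis unfolding b_def er_def by (simp add: sum_subtractf right_diff_distrib)
  qed
  \<comment> \<open>A mixing error of size \<open>\<delta>\<close> changes each square by at most
    \<open>3 * \<delta>\<close>, in total at most \<open>3 * (s * E) / 16\<close>.\<close>
  define \<delta> where "\<delta> = min 1 (s * E / (16 * n'))"
  have \<delta>: "\<delta> > 0" "\<delta> \<le> 1" "\<delta> \<le> s * E / (16 * n')" unfolding \<delta>_def using sE n' by auto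
  obtain y p where yp: "y \<in> B" "p > 0" "(f ^^ p) y = y"
    "\<forall>k<n. \<bar>avg f (\<lambda>x. x ^ k) p y - ((1 - s) * avg f (\<lambda>x. x ^ k) p1 y1 + (1 - (1 - s)) * avg f (\<lambda>x. x ^ k) p2 y2)\<bar> \<le> \<delta>"
    using mix_cycles[of y1 p1 y2 p2 "1 - s" \<delta> 0 "\<lambda>_. 0" "\<lambda>_. 0" n] c1 c2 s \<delta>(1) unfolding cyc_def by auto
  have c: "cyc y p" unfolding cyc_def using yp by blast
  define c where "c k = (1 - s) * a k + s * b k" for k
  have close: "\<bar>er y p k - c k\<bar> \<le> \<delta>" if "k < n" for k
    using yp(4)[rule_format, OF that] unfolding c_def a_def b_def er_def by (simp add: algebra_simps)
  have c_le: "\<bar>c k\<bar> \<le> 1" for k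
  proof -
    have "\<bar>c k\<bar> \<le> (1 - s) * \<bar>a k\<bar> + s * \<bar>b k\<bar>"
      unfolding c_def using abs_triangle_ineq[of "(1 - s) * a k" "s * b k"] s by (simp add: abs_mult)
    also have "\<dots> \<le> (1 - s) * 1 + s * 1"
      using er1[OF c1] er1[OF c2] s unfolding a_def b_def by (intro add_mono mult_left_mono) auto
    finally show ?thesis by simp
  qed
  have "(er y p k)\<^sup>2 \<le> (c k)\<^sup>2 + 3 * \<delta>" if k: "k < n" for k
  proof -
    define z where "z = er y p k - c k"
    have z: "\<bar>z\<bar> \<le> \<delta>" using close[OF k] unfolding z_def .
    have "(er y p k)\<^sup>2 = (c k)\<^sup>2 + (2 * c k + z) * z" unfolding z_def by (simp add: power2_eq_square algebra_simps)
    also have "(2 * c k + z) * z \<le> \<bar>2 * c k + z\<bar> * \<bar>z\<bar>" by (metis abs_ge_self abs_mult)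
    also have "\<dots> \<le> 3 * \<delta>" using z c_le[of k] \<delta>(2) by (intro mult_mono) auto
    finally show ?thesis by simp
  qed
  then have "(\<Sum>k<n. (er y p k)\<^sup>2) \<le> (\<Sum>k<n. (c k)\<^sup>2 + 3 * \<delta>)" by (intro sum_mono) auto
  also have "\<dots> = (\<Sum>k<n. (c k)\<^sup>2) + real n * (3 * \<delta>)" by (simp add: sum.distrib)
  also have "real n * (3 * \<delta>) \<le> n' * (3 * (s * E / (16 * n')))" using n' \<delta> by (intro mult_mono) auto
  also have "n' * (3 * (s * E / (16 * n'))) = 3 * (s * E) / 16" using n' by simp
  finally have 1: "(\<Sum>k<n. (er y p k)\<^sup>2) \<le> (\<Sum>k<n. (c k)\<^sup>2) + 3 * (s * E) / 16" by simp
  \<comment> \<open>Budget in units of \<open>s * E\<close>: a start less than 1/4 above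
    \<open>E\<close>, a gain of 1, losses of 1/4 by the mixed term, 1/4 by the quadratic term and
    3/16 by \<open>\<delta>\<close>. The result is more than 1/16 below \<open>E\<close>.\<close>
  have "(\<Sum>k<n. (c k)\<^sup>2) = (1 - s)\<^sup>2 * w + 2 * s * (1 - s) * (\<Sum>k<n. a k * b k) + s\<^sup>2 * (\<Sum>k<n. (b k)\<^sup>2)"
    unfolding c_def w_eq a_def[symmetric]
    by (simp add: power2_eq_square algebra_simps sum.distrib sum_distrib_left sum_subtractf)
  moreover have "(1 - s)\<^sup>2 * w \<le> w - s * E"
  proof -
    have "w \<ge> 0" unfolding w_eq by (intro sum_nonneg) simp
    have "(1 - s)\<^sup>2 * w \<le> (1 - s) * w"
      unfolding power2_eq_square using s \<open>w \<ge> 0\<close> by (intro mult_right_mono mult_left_le) auto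
    also have "\<dots> = w - s * w" by (simp add: algebra_simps)
    also have "\<dots> \<le> w - s * E" using E_le[OF c1] s(1) unfolding w_eq by (simp add: mult_left_mono)
    finally show ?thesis .
  qed
  moreover have "2 * s * (1 - s) * (\<Sum>k<n. a k * b k) \<le> s * E / 4"
  proof -
    have "2 * s * (1 - s) * (\<Sum>k<n. a k * b k) \<le> 2 * s * (1 - s) * (E / 8)" using ab s by (intro mult_left_mono) auto
    also have "\<dots> \<le> 2 * s * 1 * (E / 8)" using s Ed d by (intro mult_right_mono mult_left_mono) auto
    finally show ?thesis by (simp add: mult.commute)
  qed
  moreover have "s\<^sup>2 * (\<Sum>k<n. (b k)\<^sup>2) \<le> s * E / 4"
  proof -
    have "(\<Sum>k<n. (b k)\<^sup>2) \<le> (\<Sum>k<n. 1)" unfolding b_def by (intro sum_mono er2 c2)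
    then have "s\<^sup>2 * (\<Sum>k<n. (b k)\<^sup>2) \<le> s\<^sup>2 * n'" using n'(2) by (intro mult_left_mono) auto
    then show ?thesis unfolding sn .
  qed
  ultimately show False using 1 w(2) E_le[OF c] sE by linarith
qed

section \<open>Cycles of large minimal period near a given measure and a given point\<close>

lemma disjoint_bigs:
  fixes l :: nat
  shows "\<exists>U V. (\<forall>j<l. big (U j) (V j)) \<and> (\<forall>i<l. \<forall>j<l. i \<noteq> j \<longrightarrow> {U i..V i} \<inter> {U j..V j} = {})"
proof -
  obtain s e T where T: "{s..e} \<subseteq> M - F" "T \<subseteq> B" "finite T" "card T = l" "T \<subseteq> {s<..<e}"
    using many_B_in_interval[of l] by blast
  have "finite (insert s (insert e T))" using T(3) by simp
  from finite_set_gap[OF this] obtain d where d: "d > 0"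
    "\<forall>x\<in>insert s (insert e T). \<forall>y\<in>insert s (insert e T). x \<noteq> y \<longrightarrow> d \<le> \<bar>x - y\<bar>" by (elim exE conjE) (rule that)
  obtain h where h: "bij_betw h {..<l} T"
    using ex_bij_betw_nat_finite[OF T(3)] unfolding T(4) atLeast0LessThan by (elim exE) (rule that)
  have hT: "h j \<in> T" if "j < l" for j using h that unfolding bij_betw_def by blast
  have big: "big (h j - d / 3) (h j + d / 3)" if j: "j < l" for j
  proof (rule big_around)
    show "h j \<in> B" using hT[OF j] T(2) by blast
    have "s < h j" "h j < e" using hT[OF j] T(5) by auto
    then have "d \<le> h j - s" "d \<le> e - h j"
      using d(2)[rule_format, of "h j" s] d(2)[rule_format, of "h j" e] hT[OF j] by auto
    then have "{h j - d / 3..h j + d / 3} \<subseteq> {s..e}" using d(1) by auto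
    then show "{h j - d / 3..h j + d / 3} \<subseteq> M" using T(1) by blast
  qed (use d(1) in auto)
  have "{h i - d / 3..h i + d / 3} \<inter> {h j - d / 3..h j + d / 3} = {}" if ij: "i < l" "j < l" "i \<noteq> j" for i j
  proof -
    have "h i \<noteq> h j" using bij_betw_imp_inj_on[OF h] ij by (auto dest: inj_onD)
    then have dd: "d \<le> \<bar>h i - h j\<bar>" using d(2) hT ij by blast
    have False if "z \<in> {h i - d / 3..h i + d / 3}" "z \<in> {h j - d / 3..h j + d / 3}" for z
    proof -
      have "h i - d / 3 \<le> z" "z \<le> h i + d / 3" "h j - d / 3 \<le> z" "z \<le> h j + d / 3" using that by auto
      then show False using dd d(1) by linarith
    qed
    then show ?thesis by blast
  qed
  then show ?thesis
    using big by (intro exI[of _ "\<lambda>j. h j - d / 3"] exI[of _ "\<lambda>j. h j + d / 3"] conjI allI impI)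
qed

text \<open>The visited sets are disjoint, so the visiting times are different modulo
  \<open>p\<close>.\<close>

lemma minimal_period_ge:
  fixes l :: nat
  assumes p: "minimal_period f y p" and dis: "\<forall>i<l. \<forall>j<l. i \<noteq> j \<longrightarrow> A i \<inter> A j = {}"
    and vis: "\<forall>j<l. \<exists>i. (f ^^ i) y \<in> A j"
  shows "l \<le> p"
proof -
  have p': "0 < p" "(f ^^ p) y = y" using p unfolding minimal_period_def by auto
  have "\<forall>j. \<exists>i. j < l \<longrightarrow> (f ^^ i) y \<in> A j" using vis by blast
  then obtain h where h: "\<And>j. j < l \<Longrightarrow> (f ^^ h j) y \<in> A j" by metis
  have mem: "(f ^^ (h j mod p)) y \<in> A j" if "j < l" for j
    using h[OF that] funpow_mod_eq[OF p'(2), of "h j"] by simp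
  have "inj_on (\<lambda>j. h j mod p) {..<l}"
  proof (rule inj_onI)
    fix i j assume ij: "i \<in> {..<l}" "j \<in> {..<l}" "h i mod p = h j mod p"
    then have "(f ^^ (h i mod p)) y \<in> A i \<inter> A j" using mem[of i] mem[of j] by simp
    then show "i = j" using dis ij(1,2) by auto
  qed
  moreover have "(\<lambda>j. h j mod p) ` {..<l} \<subseteq> {..<p}" using p'(1) by auto
  ultimately show ?thesis using card_inj_on_le[of "\<lambda>j. h j mod p" "{..<l}" "{..<p}"] by simp
qed

text \<open>A close cycle may be short. It is therefore mixed with itself while visiting
  \<open>l\<close> disjoint big intervals, which pushes the minimal period up to \<open>l\<close>,
  and one more interval near \<open>b\<close>. Averages over the minimal period and over the period
  found agree.\<close>

lemma cycles_rich:
  fixes l n :: nat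
  assumes \<mu>: "\<mu> \<in> invariant_measures f B" and d: "d > 0" and b: "b \<in> B"
  shows "\<exists>y p. y \<in> B \<and> minimal_period f y p \<and> l \<le> p \<and> (\<exists>i. \<bar>(f ^^ i) y - b\<bar> < d) \<and>
      (\<forall>k<n. \<bar>avg f (\<lambda>x. x ^ k) p y - dyn.mom \<mu> k\<bar> < d)"
proof -
  have d2: "(d / 2)\<^sup>2 > 0" using d by simp
  obtain y0 p0 where y0: "y0 \<in> B" "p0 > 0" "(f ^^ p0) y0 = y0"
    "(\<Sum>k<n. (avg f (\<lambda>x. x ^ k) p0 y0 - dyn.mom \<mu> k)\<^sup>2) < (d / 2)\<^sup>2"
    using cycle_near[OF \<mu> d2] by blast
  have y0c: "\<bar>avg f (\<lambda>x. x ^ k) p0 y0 - dyn.mom \<mu> k\<bar> < d / 2" if "k < n" for k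
  proof -
    have "(avg f (\<lambda>x. x ^ k) p0 y0 - dyn.mom \<mu> k)\<^sup>2 \<le> (\<Sum>k<n. (avg f (\<lambda>x. x ^ k) p0 y0 - dyn.mom \<mu> k)\<^sup>2)"
      by (rule member_le_sum) (use that in auto)
    then have "(avg f (\<lambda>x. x ^ k) p0 y0 - dyn.mom \<mu> k)\<^sup>2 < (d / 2)\<^sup>2" using y0(4) by linarith
    then have "\<bar>avg f (\<lambda>x. x ^ k) p0 y0 - dyn.mom \<mu> k\<bar> < \<bar>d / 2\<bar>" by (simp only: abs_le_square_iff not_le[symmetric] not_False_eq_True)
    then show ?thesis using d by simp
  qed
  obtain U V where UV: "\<forall>j<l. big (U j) (V j)" "\<forall>i<l. \<forall>j<l. i \<noteq> j \<longrightarrow> {U i..V i} \<inter> {U j..V j} = {}"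
    using disjoint_bigs[of l] by (elim exE conjE) (rule that)
  have "d / 2 > 0" using d by simp
  then obtain ub vb where ub: "big ub vb" "{ub..vb} = M \<inter> {b - min \<rho> (d / 2)..b + min \<rho> (d / 2)}"
    using near_big[OF b] by blast
  define U' V' where "U' = U(l := ub)" and "V' = V(l := vb)"
  have big': "big (U' j) (V' j)" if "j < Suc l" for j
    using UV(1) ub(1) that unfolding U'_def V'_def by (cases "j = l") auto
  have t1: "0 \<le> (1 :: real)" "(1 :: real) \<le> 1" by auto
  obtain y p where y: "y \<in> B" "p > 0" "(f ^^ p) y = y" "\<forall>j<Suc l. \<exists>i. (f ^^ i) y \<in> {U' j..V' j}"
    "\<forall>k<n. \<bar>avg f (\<lambda>x. x ^ k) p y - (1 * avg f (\<lambda>x. x ^ k) p0 y0 + (1 - 1) * avg f (\<lambda>x. x ^ k) p0 y0)\<bar> \<le> d / 2"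
    using mix_cycles[OF y0(1-3) y0(1-3) t1 \<open>d / 2 > 0\<close>, of "Suc l" U' V' n] big' by blast
  obtain q where q: "minimal_period f y q" "q dvd p" using minimal_period_exists[OF y(3,2)] by blast
  obtain m where pm: "p = q * m" using q(2) by blast
  have qf: "(f ^^ q) y = y" using q(1) unfolding minimal_period_def by simp
  have "avg f \<phi> q y = avg f \<phi> p y" for \<phi> unfolding pm using avg_multiple[OF qf] y(2) pm by simp
  then have same: "avg f (\<lambda>x. x ^ k) q y = avg f (\<lambda>x. x ^ k) p y" for k .
  have "\<bar>avg f (\<lambda>x. x ^ k) q y - dyn.mom \<mu> k\<bar> < d" if "k < n" for k
    using y(5)[rule_format, OF that] y0c[OF that] unfolding same by argo
  moreover have "l \<le> q"
  proof (rule minimal_period_ge[OF q(1) UV(2)])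
    have "\<exists>i. (f ^^ i) y \<in> {U j..V j}" if "j < l" for j
      using y(4)[rule_format, of j] that unfolding U'_def V'_def by simp
    then show "\<forall>j<l. \<exists>i. (f ^^ i) y \<in> {U j..V j}" by blast
  qed
  moreover have "\<exists>i. \<bar>(f ^^ i) y - b\<bar> < d"
  proof -
    obtain i where "(f ^^ i) y \<in> {ub..vb}" using y(4)[rule_format, of l] unfolding U'_def V'_def by auto
    then have "b - min \<rho> (d / 2) \<le> (f ^^ i) y" "(f ^^ i) y \<le> b + min \<rho> (d / 2)" unfolding ub(2) by auto
    then have "\<bar>(f ^^ i) y - b\<bar> < d" using d by linarith
    then show ?thesis by blast
  qed
  ultimately show ?thesis using y(1) q(1) by blast
qed

lemma cycle_rich_B: "cycle_rich f B"
  by (intro cycle_rich.intro cycle_rich_axioms.intro dynamics_on_B cycles_rich)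

end

section \<open>Prescribed limit sets\<close>

lemma interval_index:
  fixes S :: "nat \<Rightarrow> nat"
  assumes "strict_mono S" "S 0 \<le> t"
  shows "\<exists>j. S j \<le> t \<and> t < S (Suc j)"
proof -
  define j where "j = (LEAST j. t < S (Suc j))"
  have "t < S (Suc t)" using strict_mono_imp_increasing[OF assms(1), of "Suc t"] by simp
  then have 1: "t < S (Suc j)" unfolding j_def by (rule LeastI)
  have "S j \<le> t"
  proof (cases j)
    case (Suc i)
    then have "\<not> t < S (Suc i)" using not_less_Least[of i "\<lambda>j. t < S (Suc j)"] unfolding j_def by simp
    then show ?thesis using Suc by simp
  qed (use assms(2) in simp)
  then show ?thesis using 1 by blast
qed

text \<open>Serves to choose window lengths that dominate the total of all earlier ones.\<close>

lemma partial_sum_recursion: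
  fixes h :: "nat \<Rightarrow> nat \<Rightarrow> nat"
  shows "\<exists>N. \<forall>j. N j = h j (\<Sum>i<j. N i)"
proof -
  define M where "M = rec_nat 0 (\<lambda>j m. m + h j m)"
  have M: "M 0 = 0" "M (Suc j) = M j + h j (M j)" for j unfolding M_def by simp_all
  have "(\<Sum>i<j. h i (M i)) = M j" for j by (induction j) (simp_all add: M)
  then show ?thesis by (intro exI[of _ "\<lambda>j. h j (M j)"]) simp
qed

text \<open>\<open>h\<close> is read along an orbit; window \<open>j\<close> has mean nearly
  \<open>c j\<close>, with rate error \<open>e j\<close> and boundary error \<open>q j\<close>. For
  \<open>T\<close> between the starts of windows \<open>j + 1\<close> and \<open>j + 2\<close>, the
  time before window \<open>j\<close> and the gaps are negligible by \<open>long\<close>. Window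
  \<open>j\<close> counts with \<open>c j\<close>, which differs little from
  \<open>c (Suc j)\<close>, and window \<open>j + 1\<close> may be cut anywhere.\<close>

lemma window_average_limit:
  fixes h c e :: "nat \<Rightarrow> real" and s N q :: "nat \<Rightarrow> nat"
  assumes h: "\<And>i. 0 \<le> h i" "\<And>i. h i \<le> 1" and c: "\<And>j. 0 \<le> c j" "\<And>j. c j \<le> 1" and e: "\<And>j. 0 \<le> e j"
    and sep: "\<And>j. s j + N j \<le> s (Suc j)"
    and win: "\<And>j L. L \<le> N j \<Longrightarrow> \<bar>(\<Sum>i<L. h (s j + i)) - L * c j\<bar> \<le> e j * L + q j"
    and long: "\<And>j. Suc j * (s j + q j + q (Suc j) + (s (Suc j) - s j - N j)) \<le> N j"
    and lim: "e \<longlonglongrightarrow> 0" "(\<lambda>j. c (Suc j) - c j) \<longlonglongrightarrow> 0" and \<epsilon>: "\<epsilon> > 0"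
  shows "\<exists>J. \<forall>j\<ge>J. \<forall>T. s (Suc j) \<le> T \<and> T \<le> s (Suc (Suc j)) \<longrightarrow> \<bar>(\<Sum>i<T. h i) - T * c (Suc j)\<bar> \<le> \<epsilon> * T"
proof -
  define err where "err j = 2 * (1 / real (Suc j)) + e j + \<bar>c (Suc j) - c j\<bar> + e (Suc j)" for j
  have "err \<longlonglongrightarrow> 2 * 0 + 0 + \<bar>0\<bar> + 0" unfolding err_def
    by (intro tendsto_add tendsto_mult_left tendsto_rabs LIMSEQ_Suc[OF lim_1_over_n] LIMSEQ_Suc[OF lim(1)] lim)
  then have "eventually (\<lambda>j. err j < \<epsilon>) sequentially" using order_tendstoD(2)[of err 0 sequentially \<epsilon>] \<epsilon> by simp
  then obtain J where J: "\<And>j. j \<ge> J \<Longrightarrow> err j < \<epsilon>" unfolding eventually_sequentially by blast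
  have "\<bar>(\<Sum>i<T. h i) - T * c (Suc j)\<bar> \<le> \<epsilon> * T" if j: "j \<ge> J" and T: "s (Suc j) \<le> T" "T \<le> s (Suc (Suc j))" for j T
  proof -
    define g where "g = s (Suc j) - s j - N j"
    define L where "L = min (T - s (Suc j)) (N (Suc j))"
    define g' where "g' = T - s (Suc j) - L"
    have s1: "s (Suc j) = s j + N j + g" unfolding g_def using sep[of j] by simp
    have TT: "T = s (Suc j) + L + g'" unfolding g'_def L_def using T(1) by simp
    have LN: "L \<le> N (Suc j)" unfolding L_def by simp
    define D where "D a l = (\<Sum>i<l. h (a + i)) - l * c (Suc j)" for a l
    have triv: "\<bar>D a l\<bar> \<le> l" for a l
    proof -
      have "(\<Sum>i<l. h (a + i)) \<le> (\<Sum>i<l. 1)" by (intro sum_mono h)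
      moreover have "0 \<le> (\<Sum>i<l. h (a + i))" by (intro sum_nonneg h)
      moreover have "real l * c (Suc j) \<le> real l * 1" by (intro mult_left_mono c) simp
      moreover have "0 \<le> l * c (Suc j)" by (intro mult_nonneg_nonneg c) simp
      ultimately show ?thesis unfolding D_def by simp
    qed
    have split: "(\<Sum>i<T. h i) - T * c (Suc j) = D 0 (s j) + D (s j) (N j) + D (s j + N j) g + D (s (Suc j)) L + D (s (Suc j) + L) g'"
      unfolding D_def TT s1 sum_lessThan_add[of h] by (simp add: algebra_simps)
    have d2: "\<bar>D (s j) (N j)\<bar> \<le> e j * T + q j + \<bar>c (Suc j) - c j\<bar> * T"
    proof -
      have "D (s j) (N j) = ((\<Sum>i<N j. h (s j + i)) - N j * c j) - N j * (c (Suc j) - c j)"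
        unfolding D_def by (simp add: algebra_simps)
      then have "\<bar>D (s j) (N j)\<bar> \<le> (e j * N j + q j) + \<bar>N j * (c (Suc j) - c j)\<bar>" using win[OF order_refl, of j] by linarith
      also have "\<dots> \<le> (e j * T + q j) + T * \<bar>c (Suc j) - c j\<bar>"
        unfolding abs_mult using e s1 TT by (intro add_mono mult_left_mono mult_right_mono order_refl) auto
      finally show ?thesis by (simp add: mult.commute)
    qed
    have "\<bar>D (s (Suc j)) L\<bar> \<le> e (Suc j) * L + q (Suc j)" unfolding D_def by (rule win[OF LN])
    also have "\<dots> \<le> e (Suc j) * T + q (Suc j)" using e TT by (intro add_right_mono mult_left_mono) auto
    finally have d4: "\<bar>D (s (Suc j)) L\<bar> \<le> e (Suc j) * T + q (Suc j)" .
    \<comment> \<open>A remainder after window \<open>j + 1\<close> occurs only if that window is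
      complete, and then \<open>long\<close> makes it negligible.\<close>
    have gap: "g' \<le> 1 / real (Suc j) * T"
    proof (cases "g' = 0")
      case False
      then have "L = N (Suc j)" unfolding g'_def L_def by (simp add: min_def split: if_splits)
      then have "g' \<le> s (Suc (Suc j)) - s (Suc j) - N (Suc j)" "N (Suc j) \<le> T" using TT T(2) by auto
      moreover have "Suc j * (s (Suc (Suc j)) - s (Suc j) - N (Suc j)) \<le> N (Suc j)"
        by (rule order_trans[OF mult_le_mono long[of "Suc j"]]) auto
      ultimately have "Suc j * g' \<le> T" by (meson mult_le_mono2 order_trans)
      then have "real (Suc j) * real g' \<le> real T" by (metis of_nat_le_iff of_nat_mult)
      then show ?thesis by (simp add: field_simps)
    qed simp
    have "Suc j * (s j + q j + q (Suc j) + g) \<le> T" using long[of j] s1 TT unfolding g_def by linarith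
    then have "real (Suc j) * real (s j + q j + q (Suc j) + g) \<le> real T" by (metis of_nat_le_iff of_nat_mult)
    then have rest: "real (s j + q j + q (Suc j) + g) \<le> 1 / real (Suc j) * T" by (simp add: field_simps)
    have "\<bar>(\<Sum>i<T. h i) - T * c (Suc j)\<bar> \<le> s j + (e j * T + q j + \<bar>c (Suc j) - c j\<bar> * T) + g + (e (Suc j) * T + q (Suc j)) + g'"
    proof -
      have tri: "\<bar>A1 + A2 + A3 + A4 + A5\<bar> \<le> b1 + b2 + b3 + b4 + b5"
        if "\<bar>A1\<bar> \<le> b1" "\<bar>A2\<bar> \<le> b2" "\<bar>A3\<bar> \<le> b3" "\<bar>A4\<bar> \<le> b4" "\<bar>A5\<bar> \<le> b5" for A1 A2 A3 A4 A5 b1 b2 b3 b4 b5 :: real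
        using that by (simp add: abs_le_iff)
      show ?thesis unfolding split by (rule tri[OF triv d2 triv d4 triv])
    qed
    also have "\<dots> \<le> 1 / real (Suc j) * T + 1 / real (Suc j) * T + e j * T + \<bar>c (Suc j) - c j\<bar> * T + e (Suc j) * T"
      using rest gap by simp
    also have "\<dots> = err j * T" unfolding err_def by (simp add: algebra_simps)
    also have "\<dots> \<le> \<epsilon> * T" using J[OF j] by (intro mult_right_mono) auto
    finally show ?thesis .
  qed
  then show ?thesis by blast
qed

text \<open>A countable dense subset is enumerated with infinite repetition, and consecutive terms
  are joined by chains whose steps are smaller than \<open>1 / Suc m\<close> in the first
  \<open>m\<close> coordinates. Such chains exist because chain-connectedness is an equivalence
  relation with open classes.\<close>

lemma chain_sequence:
  fixes Z :: "(nat \<Rightarrow> real) set"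
  assumes "connected Z" "Z \<noteq> {}"
  shows "\<exists>x. (\<forall>j. x j \<in> Z) \<and> (\<forall>k. (\<lambda>j. x (Suc j) k - x j k) \<longlonglongrightarrow> 0) \<and>
    (\<forall>z\<in>Z. \<forall>n e J. 0 < e \<longrightarrow> (\<exists>j\<ge>J. \<forall>k<n. \<bar>x j k - z k\<bar> < e))"
proof -
  obtain T where T: "countable T" "T \<subseteq> Z" "Z \<subseteq> closure T" by (rule separable)
  have Tne: "T \<noteq> {}" using T(3) assms(2) by auto
  \<comment> \<open>Decoding pairs and dropping the second component repeats every element of
    \<open>T\<close> infinitely often.\<close>
  define d where "d m = from_nat_into T (fst (prod_decode m))" for m
  have dZ: "d m \<in> Z" for m unfolding d_def using from_nat_into[OF Tne] T(2) by blast
  define R where "R m = {(a, b). a \<in> Z \<and> b \<in> Z \<and> (\<forall>k<m. \<bar>b k - a k\<bar> < 1 / Suc m)}" for m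
  have "(a, b) \<in> (R m)\<^sup>*" if "a \<in> Z" "b \<in> Z" for a b m
  proof (rule connected_equivalence_relation[OF assms(1) that, where R = "\<lambda>a b. (a, b) \<in> (R m)\<^sup>*"])
    have "sym (R m)" unfolding R_def sym_def by (simp add: abs_minus_commute)
    then show "(y, x) \<in> (R m)\<^sup>*" if "(x, y) \<in> (R m)\<^sup>*" for x y using that sym_rtrancl symD by metis
    show "(x, z) \<in> (R m)\<^sup>*" if "(x, y) \<in> (R m)\<^sup>*" "(y, z) \<in> (R m)\<^sup>*" for x y z using that by (rule rtrancl_trans)
    fix a assume a: "a \<in> Z"
    have "openin (top_of_set Z) (Z \<inter> {y. \<forall>k<m. \<bar>y k - a k\<bar> < 1 / Suc m})"
      by (rule openin_open_Int[OF open_fun_coordinate_box])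
    moreover have "(a, y) \<in> (R m)\<^sup>*" if "y \<in> Z \<inter> {y. \<forall>k<m. \<bar>y k - a k\<bar> < 1 / Suc m}" for y
      by (rule r_into_rtrancl) (use that a in \<open>simp add: R_def\<close>)
    ultimately show "\<exists>T. openin (top_of_set Z) T \<and> a \<in> T \<and> (\<forall>y\<in>T. (a, y) \<in> (R m)\<^sup>*)"
      using a by (intro exI[of _ "Z \<inter> {y. \<forall>k<m. \<bar>y k - a k\<bar> < 1 / Suc m}"]) simp
  qed
  then have "\<exists>n P. 0 < n \<and> P 0 = d m \<and> P n = d (Suc m) \<and> (\<forall>i<n. (P i, P (Suc i)) \<in> R m)" for m
  proof -
    have "(d m, d (Suc m)) \<in> (R m)\<^sup>*" using \<open>\<And>a b m. a \<in> Z \<Longrightarrow> b \<in> Z \<Longrightarrow> (a, b) \<in> (R m)\<^sup>*\<close> dZ by blast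
    then obtain n where "(d m, d (Suc m)) \<in> R m ^^ n" using rtrancl_imp_relpow by blast
    \<comment> \<open>A trivial step gives every chain positive length, so that \<open>S\<close> is
      strictly increasing.\<close>
    moreover have "(d m, d m) \<in> R m" unfolding R_def using dZ by simp
    ultimately have "(d m, d (Suc m)) \<in> R m ^^ Suc n" by (intro relpow_Suc_I2)
    then show ?thesis unfolding relpow_fun_conv by blast
  qed
  then obtain n P where n: "\<And>m. 0 < n m" and P: "\<And>m. P m 0 = d m" "\<And>m. P m (n m) = d (Suc m)"
    "\<And>m i. i < n m \<Longrightarrow> (P m i, P m (Suc i)) \<in> R m" by metis
  define S where "S m = (\<Sum>i<m. n i)" for m
  have S: "S 0 = 0" "S (Suc m) = S m + n m" for m unfolding S_def by simp_all
  have mono: "strict_mono S" unfolding strict_mono_Suc_iff using S(2) n by simp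
  have "\<forall>j. \<exists>m. S m \<le> j \<and> j < S (Suc m)" using interval_index[OF mono] S(1) by simp
  then obtain idx where idx: "\<And>j. S (idx j) \<le> j" "\<And>j. j < S (Suc (idx j))" by metis
  have idx_eq: "idx j = m" if "S m \<le> j" "j < S (Suc m)" for j m
  proof -
    have "S m < S (Suc (idx j))" "S (idx j) < S (Suc m)" using that idx[of j] by linarith+
    then have "m < Suc (idx j)" "idx j < Suc m" using strict_mono_less[OF mono] by blast+
    then show ?thesis by simp
  qed
  \<comment> \<open>Concatenation of the chains: \<open>idx j\<close> is the chain that contains
    position \<open>j\<close>.\<close>
  define x where "x j = P (idx j) (j - S (idx j))" for j
  have xS: "x (S m) = d m" for m unfolding x_def using idx_eq[of m "S m"] S(2) n P(1) by simp
  have step: "(x j, x (Suc j)) \<in> R (idx j)" for j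
  proof -
    let ?m = "idx j"
    have lt: "j - S ?m < n ?m" using idx[of j] S(2)[of ?m] by linarith
    have "x (Suc j) = P ?m (Suc (j - S ?m))"
    proof (cases "Suc j < S (Suc ?m)")
      case True
      then have "idx (Suc j) = ?m" using idx(1)[of j] by (intro idx_eq) auto
      then show ?thesis unfolding x_def using idx(1)[of j] by (simp add: Suc_diff_le)
    next
      case False
      then have j: "Suc j = S (Suc ?m)" using idx(2)[of j] by simp
      then have "Suc (j - S ?m) = n ?m" using S(2)[of ?m] idx(1)[of j] by linarith
      then show ?thesis unfolding j xS P(2)[symmetric] by simp
    qed
    then show ?thesis using P(3)[OF lt] unfolding x_def[of j] by simp
  qed
  have xZ: "x j \<in> Z" for j using step[of j] unfolding R_def by simp
  have "(\<lambda>j. x (Suc j) k - x j k) \<longlonglongrightarrow> 0" for k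
  proof (rule LIMSEQ_I)
    fix e :: real assume "e > 0"
    then obtain m where m: "1 / real (Suc m) < e" using nat_approx_posE by blast
    have "norm (x (Suc j) k - x j k - 0) < e" if j: "j \<ge> S (max m (Suc k))" for j
    proof -
      have "S (max m (Suc k)) < S (Suc (idx j))" using j idx(2)[of j] by linarith
      then have "max m (Suc k) < Suc (idx j)" using strict_mono_less[OF mono] by blast
      then have i: "m \<le> idx j" "k < idx j" by auto
      have "\<bar>x (Suc j) k - x j k\<bar> < 1 / real (Suc (idx j))" using step[of j] i(2) unfolding R_def by simp
      also have "\<dots> \<le> 1 / real (Suc m)" using i(1) by (intro divide_left_mono) auto
      finally show ?thesis using m by simp
    qed
    then show "\<exists>J. \<forall>j\<ge>J. norm (x (Suc j) k - x j k - 0) < e" by blast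
  qed
  moreover have "\<exists>j\<ge>J. \<forall>k<l. \<bar>x j k - z k\<bar> < e" if z: "z \<in> Z" and e: "0 < e" for z l e J
  proof -
    have "z \<in> closure T" using z T(3) by blast
    moreover have "z \<in> {y. \<forall>k<l. \<bar>y k - z k\<bar> < e}" using e by simp
    ultimately have "T \<inter> {y. \<forall>k<l. \<bar>y k - z k\<bar> < e} \<noteq> {}"
      using open_Int_closure_eq_empty[OF open_fun_coordinate_box[of l z e], of T] by blast
    then obtain y where y: "y \<in> T" "\<forall>k<l. \<bar>y k - z k\<bar> < e" by blast
    obtain i where i: "from_nat_into T i = y" using from_nat_into_surj[OF T(1) y(1)] by blast
    define m where "m = prod_encode (i, J)"
    have "x (S m) = y" unfolding xS d_def m_def using i by simp
    moreover have "J \<le> S m"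
      using le_prod_encode_2[of J i] strict_mono_imp_increasing[OF mono, of m] unfolding m_def by linarith
    ultimately show ?thesis using y(2) by blast
  qed
  ultimately show ?thesis using xZ by (intro exI[of _ x]) blast
qed

text \<open>Complete periods contribute exactly their average; fewer than \<open>p\<close> terms
  remain.\<close>

lemma partial_period_sum:
  fixes \<phi> :: "real \<Rightarrow> real"
  assumes p: "0 < p" "(f ^^ p) w = w" and \<phi>: "\<And>i. 0 \<le> \<phi> ((f ^^ i) w)" "\<And>i. \<phi> ((f ^^ i) w) \<le> 1"
  shows "\<bar>(\<Sum>i<L. \<phi> ((f ^^ i) w)) - L * avg f \<phi> p w\<bar> \<le> p"
proof -
  define r where "r = L mod p"
  have L: "L = p * (L div p) + r" unfolding r_def by simp
  have rp: "r < p" unfolding r_def using p(1) by simp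
  define A where "A = avg f \<phi> p w"
  have A: "0 \<le> A" "A \<le> 1"
  proof -
    show "0 \<le> A" unfolding A_def avg_def by (intro divide_nonneg_nonneg sum_nonneg \<phi>) simp
    have "(\<Sum>j<p. \<phi> ((f ^^ j) w)) \<le> (\<Sum>j<p. 1)" by (intro sum_mono \<phi>)
    then show "A \<le> 1" unfolding A_def avg_def using p(1) by (simp add: divide_le_eq)
  qed
  have "(\<Sum>i<L. \<phi> ((f ^^ i) w)) - L * A =
    ((\<Sum>i<p * (L div p). \<phi> ((f ^^ i) w)) - real (p * (L div p)) * A) + ((\<Sum>i<r. \<phi> ((f ^^ (p * (L div p) + i)) w)) - r * A)"
    by (subst (1 2) L) (unfold sum_lessThan_add of_nat_add distrib_right, linarith)
  also have "\<dots> = (\<Sum>i<r. \<phi> ((f ^^ (p * (L div p) + i)) w)) - r * A"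
    using sum_multiple_period[OF p(2,1), of \<phi> "L div p"] unfolding A_def by simp
  finally have eq: "(\<Sum>i<L. \<phi> ((f ^^ i) w)) - L * A = (\<Sum>i<r. \<phi> ((f ^^ (p * (L div p) + i)) w)) - r * A" .
  have "(\<Sum>i<r. \<phi> ((f ^^ (p * (L div p) + i)) w)) \<le> (\<Sum>i<r. 1)" by (intro sum_mono \<phi>)
  moreover have "0 \<le> (\<Sum>i<r. \<phi> ((f ^^ (p * (L div p) + i)) w))" by (intro sum_nonneg \<phi>)
  moreover have "real r * A \<le> real r * 1" by (intro mult_left_mono A) simp
  moreover have "0 \<le> r * A" by (intro mult_nonneg_nonneg A) simp
  ultimately have "\<bar>(\<Sum>i<L. \<phi> ((f ^^ i) w)) - L * A\<bar> \<le> r" unfolding eq by simp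
  then show ?thesis using rp unfolding A_def by linarith
qed

section \<open>Orbits that follow a sequence of cycles, and their limit measures\<close>

context core_system
begin

text \<open>Every cycle is followed so long that all earlier times and the transit to the next cycle
  are negligible. This is possible since the delays \<open>G j\<close> and \<open>k j\<close> are
  fixed before the durations.\<close>

lemma follow_cycles:
  assumes z: "z \<in> B" "\<delta> > 0" and w: "\<And>j. w j \<in> B" "\<And>j. 0 < p j" "\<And>j. (f ^^ p j) (w j) = w j"
    and \<epsilon>: "\<And>j. \<epsilon> j > 0"
  shows "\<exists>y\<in>B. \<bar>y - z\<bar> \<le> \<delta> \<and> (\<exists>s N. (\<forall>j. s j + N j \<le> s (Suc j)) \<and>
    (\<forall>j. Suc j * (s j + p j + p (Suc j) + (s (Suc j) - s j - N j)) \<le> N j) \<and>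
    (\<forall>j. \<forall>i<N j. \<bar>(f ^^ (s j + i)) y - (f ^^ i) (w j)\<bar> \<le> \<epsilon> j))"
proof -
  obtain u0 v0 where uv0: "big u0 v0" "{u0..v0} = M \<inter> {z - min \<rho> \<delta>..z + min \<rho> \<delta>}" using near_big[OF z] by blast
  obtain b0 where b0: "{c1..c2} \<subseteq> (f ^^ b0) ` {u0..v0}" using reach_C[OF uv0(1)] by blast
  have "\<forall>j. \<exists>G k. blocks (w j) (\<epsilon> j) G k" using blocks_exist[OF w \<epsilon>] by blast
  then obtain G k where blk: "\<And>j. blocks (w j) (\<epsilon> j) (G j) (k j)" by metis
  \<comment> \<open>The last sum includes the index \<open>Suc j\<close>, because the transit after
    window \<open>j\<close> contains the approach to block \<open>j + 1\<close>.\<close>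
  obtain N where N: "\<And>j. N j = Suc j * (b0 + (\<Sum>i<j. N i) + (\<Sum>i<Suc (Suc j). 2 * G i + k i + p i))"
    using partial_sum_recursion[of "\<lambda>j m. Suc j * (b0 + m + (\<Sum>i<Suc (Suc j). 2 * G i + k i + p i))"] by blast
  have "\<forall>j. \<exists>u v a b. link u v a b \<and> a \<le> G j \<and> k j + N j \<le> b \<and> b \<le> N j + G j \<and>
    (\<forall>y\<in>B \<inter> {u..v}. \<forall>i<N j. \<bar>(f ^^ (k j + i)) y - (f ^^ i) (w j)\<bar> \<le> \<epsilon> j)"
    by (rule allI, rule blk[unfolded blocks_def, THEN spec])
  then obtain u v a b where link: "\<And>j. link (u j) (v j) (a j) (b j)"
    and ab: "\<And>j. a j \<le> G j" "\<And>j. k j + N j \<le> b j" "\<And>j. b j \<le> N j + G j"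
    and track: "\<And>j. \<forall>y\<in>B \<inter> {u j..v j}. \<forall>i<N j. \<bar>(f ^^ (k j + i)) y - (f ^^ i) (w j)\<bar> \<le> \<epsilon> j" by metis
  obtain y where y: "y \<in> B \<inter> {u0..v0}" "\<forall>j. (f ^^ (b0 + start a b j + a j)) y \<in> {u j..v j}"
    by (rule bexE[OF infinite_links[of u0 v0 b0 u v a b, OF uv0(1) b0 link]])
  define s where "s j = b0 + start a b j + a j + k j" for j
  have gap: "s (Suc j) = s j + (b j - k j) + a (Suc j) + k (Suc j)" for j
    unfolding s_def start_Suc using ab(2)[of j] by simp
  have sep: "s j + N j \<le> s (Suc j)" for j using gap[of j] ab(2)[of j] by linarith
  have long: "Suc j * (s j + p j + p (Suc j) + (s (Suc j) - s j - N j)) \<le> N j" for j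
  proof -
    have "start a b j \<le> (\<Sum>i<j. (2 * G i + k i + p i) + N i)" unfolding start_def
    proof (intro sum_mono)
      fix i show "a i + b i \<le> (2 * G i + k i + p i) + N i" using ab(1)[of i] ab(3)[of i] by linarith
    qed
    then have "start a b j \<le> (\<Sum>i<j. 2 * G i + k i + p i) + (\<Sum>i<j. N i)" unfolding sum.distrib by simp
    moreover have "s (Suc j) - s j - N j \<le> G j + G (Suc j) + k (Suc j)"
      using gap[of j] ab(2)[of j] ab(3)[of j] ab(1)[of "Suc j"] by linarith
    ultimately have "s j + p j + p (Suc j) + (s (Suc j) - s j - N j) \<le>
      b0 + (\<Sum>i<j. N i) + ((\<Sum>i<j. 2 * G i + k i + p i) + (2 * G j + k j + p j) + (2 * G (Suc j) + k (Suc j) + p (Suc j)))"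
      unfolding s_def using ab(1)[of j] by linarith
    then have "s j + p j + p (Suc j) + (s (Suc j) - s j - N j) \<le>
      b0 + (\<Sum>i<j. N i) + (\<Sum>i<Suc (Suc j). 2 * G i + k i + p i)" by simp
    then show ?thesis by (subst N) (intro mult_le_mono2)
  qed
  have "\<bar>(f ^^ (s j + i)) y - (f ^^ i) (w j)\<bar> \<le> \<epsilon> j" if i: "i < N j" for j i
  proof -
    let ?t = "b0 + start a b j + a j"
    have "(f ^^ ?t) y \<in> B \<inter> {u j..v j}" using y fn_B by blast
    then have tr: "\<bar>(f ^^ (k j + i)) ((f ^^ ?t) y) - (f ^^ i) (w j)\<bar> \<le> \<epsilon> j" using track i by blast
    have st: "s j + i = ?t + (k j + i)" unfolding s_def by simp
    show ?thesis using tr unfolding st funpow_add_apply[of ?t "k j + i" y] .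
  qed
  moreover have "\<bar>y - z\<bar> \<le> \<delta>"
  proof -
    have "z - min \<rho> \<delta> \<le> y" "y \<le> z + min \<rho> \<delta>" using y(1) unfolding uv0(2) by auto
    then show ?thesis by linarith
  qed
  ultimately show ?thesis using y(1) sep long by blast
qed

text \<open>At late times \<open>T\<close> the orbit averages are close to the moments of the member
  of \<open>V\<close> assigned to the window around \<open>T\<close>. The chosen sequence comes back
  near every element of \<open>V\<close>, which gives one inclusion; closedness of \<open>V\<close>
  gives the other.\<close>

lemma limit_set_realised:
  assumes V: "V \<noteq> {}" "closedin (invariant_space f B) V" "connectedin (invariant_space f B) V"
    and z: "z \<in> B" "\<delta> > 0"
  shows "\<exists>y\<in>B. \<bar>y - z\<bar> \<le> \<delta> \<and> limit_measures f B y = V"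
proof -
  have VI: "V \<subseteq> invariant_measures f B" using closedin_subset[OF V(2)] dyn.topspace_invariant by simp
  have "connected (dyn.mom ` V)"
    using connectedin_continuous_map_image[OF dyn.continuous_map_mom V(3)] by simp
  from chain_sequence[OF this] obtain x where x: "\<forall>j. x j \<in> dyn.mom ` V"
    "\<forall>k. (\<lambda>j. x (Suc j) k - x j k) \<longlonglongrightarrow> 0"
    "\<forall>m\<in>dyn.mom ` V. \<forall>n e J. 0 < e \<longrightarrow> (\<exists>j\<ge>J. \<forall>k<n. \<bar>x j k - m k\<bar> < e)" using V(1) by blast
  have "\<forall>j. \<exists>\<nu>. \<nu> \<in> V \<and> x j = dyn.mom \<nu>" using x(1) by blast
  then obtain \<nu> where \<nu>: "\<And>j. \<nu> j \<in> V" "\<And>j. x j = dyn.mom (\<nu> j)" by metis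
  have \<nu>I: "\<nu> j \<in> invariant_measures f B" for j using \<nu>(1) VI by blast
  define \<epsilon> where "\<epsilon> j = 1 / real (Suc j)" for j
  have \<epsilon>: "\<epsilon> j > 0" for j unfolding \<epsilon>_def by simp
  have \<epsilon>_lim: "\<epsilon> \<longlonglongrightarrow> 0" unfolding \<epsilon>_def by (rule LIMSEQ_Suc[OF lim_1_over_n])
  \<comment> \<open>Stage \<open>j\<close> controls only the first \<open>j + 1\<close> moments;
    each fixed moment is controlled eventually.\<close>
  have "\<exists>w p. w \<in> B \<and> 0 < p \<and> (f ^^ p) w = w \<and> (\<forall>k<Suc j. \<bar>avg f (\<lambda>x. x ^ k) p w - x j k\<bar> < \<epsilon> j)" for j
    using cycles_rich[OF \<nu>I \<epsilon> z(1), where l = 0 and n = "Suc j"] unfolding \<nu>(2) minimal_period_def by blast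
  then obtain w p where w: "\<And>j. w j \<in> B" "\<And>j. 0 < p j" "\<And>j. (f ^^ p j) (w j) = w j"
    and near: "\<And>j k. k < Suc j \<Longrightarrow> \<bar>avg f (\<lambda>x. x ^ k) (p j) (w j) - x j k\<bar> < \<epsilon> j" by metis
  obtain y s N where y: "y \<in> B" "\<bar>y - z\<bar> \<le> \<delta>" and sN: "\<forall>j. s j + N j \<le> s (Suc j)"
    "\<forall>j. Suc j * (s j + p j + p (Suc j) + (s (Suc j) - s j - N j)) \<le> N j"
    "\<forall>j. \<forall>i<N j. \<bar>(f ^^ (s j + i)) y - (f ^^ i) (w j)\<bar> \<le> \<epsilon> j"
    using follow_cycles[of z \<delta> w p \<epsilon>, OF z w \<epsilon>] by (elim bexE conjE exE) (rule that)
  note sep = sN(1)[rule_format] and long = sN(2)[rule_format] and track = sN(3)[rule_format]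
  have Npos: "0 < N j" for j using long[of j] w(2)[of j] by (cases "N j") auto
  have mono: "strict_mono s" unfolding strict_mono_Suc_iff using sep Npos by (meson less_add_same_cancel1 less_le_trans)
  have y01: "0 \<le> (f ^^ i) y" "(f ^^ i) y \<le> 1" for i using fn_B[OF y(1), of i] dyn.B_01 by auto
  have w01: "0 \<le> (f ^^ i) (w j)" "(f ^^ i) (w j) \<le> 1" for i j using fn_B[OF w(1), of i j] dyn.B_01 by auto
  have conv: "\<exists>J. \<forall>j\<ge>J. \<forall>T. s (Suc j) \<le> T \<and> T \<le> s (Suc (Suc j)) \<longrightarrow> \<bar>avg f (\<lambda>x. x ^ k) T y - x (Suc j) k\<bar> \<le> e"
    if e: "e > 0" for k e
  proof -
    define c where "c j = avg f (\<lambda>x. x ^ k) (p j) (w j)" for j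
    have cx: "(\<lambda>j. c j - x j k) \<longlonglongrightarrow> 0"
    proof (rule Lim_null_comparison[OF _ \<epsilon>_lim])
      show "eventually (\<lambda>j. norm (c j - x j k) \<le> \<epsilon> j) sequentially"
        unfolding eventually_sequentially c_def real_norm_def
        by (intro exI[of _ k] allI impI less_imp_le near) simp
    qed
    have "(\<lambda>j. (c (Suc j) - x (Suc j) k) - (c j - x j k) + (x (Suc j) k - x j k)) \<longlonglongrightarrow> 0 - 0 + 0"
      by (intro tendsto_intros LIMSEQ_Suc[OF cx] cx x(2)[rule_format])
    then have clim: "(\<lambda>j. c (Suc j) - c j) \<longlonglongrightarrow> 0" by simp
    have klim: "(\<lambda>j. k * \<epsilon> j) \<longlonglongrightarrow> 0" using tendsto_mult_left[OF \<epsilon>_lim, of "real k"] by simp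
    have win: "\<bar>(\<Sum>i<L. ((f ^^ (s j + i)) y) ^ k) - L * c j\<bar> \<le> k * \<epsilon> j * L + p j" if L: "L \<le> N j" for j L
    proof -
      have "\<bar>(\<Sum>i<L. ((f ^^ (s j + i)) y) ^ k) - (\<Sum>i<L. ((f ^^ i) (w j)) ^ k)\<bar> \<le> (\<Sum>i<L. k * \<epsilon> j)"
        unfolding sum_subtractf[symmetric]
      proof (rule order_trans[OF sum_abs sum_mono])
        fix i assume i: "i \<in> {..<L}"
        have "\<bar>(f ^^ (s j + i)) y\<bar> \<le> 1" "\<bar>(f ^^ i) (w j)\<bar> \<le> 1" using y01[of "s j + i"] w01[of i j] by auto
        then have "\<bar>((f ^^ (s j + i)) y) ^ k - ((f ^^ i) (w j)) ^ k\<bar> \<le> k * \<bar>(f ^^ (s j + i)) y - (f ^^ i) (w j)\<bar>"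
          using norm_power_diff[of "(f ^^ (s j + i)) y" "(f ^^ i) (w j)" k] by simp
        also have "\<dots> \<le> k * \<epsilon> j" by (intro mult_left_mono track) (use i L in auto)
        finally show "\<bar>((f ^^ (s j + i)) y) ^ k - ((f ^^ i) (w j)) ^ k\<bar> \<le> k * \<epsilon> j" .
      qed
      moreover have "\<bar>(\<Sum>i<L. ((f ^^ i) (w j)) ^ k) - L * c j\<bar> \<le> p j"
        unfolding c_def by (rule partial_period_sum[OF w(2,3)]) (intro zero_le_power power_le_one w01)+
      moreover have "(\<Sum>i<L. k * \<epsilon> j) = k * \<epsilon> j * L" by simp
      ultimately show ?thesis by linarith
    qed
    have e2: "e / 2 > 0" using e by simp
    obtain J1 where J1: "\<forall>j\<ge>J1. \<forall>T. s (Suc j) \<le> T \<and> T \<le> s (Suc (Suc j)) \<longrightarrow>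
      \<bar>(\<Sum>i<T. ((f ^^ i) y) ^ k) - T * c (Suc j)\<bar> \<le> e / 2 * T"
      using window_average_limit[of "\<lambda>i. ((f ^^ i) y) ^ k" c "\<lambda>j. k * \<epsilon> j" s N p "e / 2",
          OF _ _ _ _ _ sep win long klim clim e2]
      using y01 cycle_avg_bounds[OF w(1)] \<epsilon> by (auto simp: c_def power_le_one less_imp_le)
    obtain J2 where J2: "\<And>j. j \<ge> J2 \<Longrightarrow> \<bar>c j - x j k\<bar> < e / 2"
      using LIMSEQ_D[OF cx e2] by auto
    have "\<bar>avg f (\<lambda>x. x ^ k) T y - x (Suc j) k\<bar> \<le> e"
      if j: "j \<ge> max J1 J2" and T: "s (Suc j) \<le> T" "T \<le> s (Suc (Suc j))" for j T
    proof -
      have Tpos: "0 < T" using T(1) strict_monoD[OF mono, of j "Suc j"] by simp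
      have "\<bar>(\<Sum>i<T. ((f ^^ i) y) ^ k) - T * c (Suc j)\<bar> \<le> e / 2 * T" using J1 j T by simp
      moreover have "(\<Sum>i<T. ((f ^^ i) y) ^ k) - T * c (Suc j) = T * (avg f (\<lambda>x. x ^ k) T y - c (Suc j))"
        unfolding avg_def using Tpos by (simp add: right_diff_distrib)
      ultimately have "T * \<bar>avg f (\<lambda>x. x ^ k) T y - c (Suc j)\<bar> \<le> T * (e / 2)" by (simp add: abs_mult mult.commute)
      then have "\<bar>avg f (\<lambda>x. x ^ k) T y - c (Suc j)\<bar> \<le> e / 2" using Tpos by simp
      then show ?thesis using J2[of "Suc j"] j by linarith
    qed
    then show ?thesis by blast
  qed
  have conv_all: "\<exists>J. \<forall>j\<ge>J. \<forall>T. s (Suc j) \<le> T \<and> T \<le> s (Suc (Suc j)) \<longrightarrow>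
    (\<forall>k<n. \<bar>avg f (\<lambda>x. x ^ k) T y - x (Suc j) k\<bar> \<le> e)" if e: "e > 0" for n e
  proof -
    obtain J where J: "\<And>k. \<forall>j\<ge>J k. \<forall>T. s (Suc j) \<le> T \<and> T \<le> s (Suc (Suc j)) \<longrightarrow> \<bar>avg f (\<lambda>x. x ^ k) T y - x (Suc j) k\<bar> \<le> e"
      using conv[OF e] by metis
    have "J k \<le> (\<Sum>k<n. J k)" if "k < n" for k by (rule member_le_sum) (use that in auto)
    then show ?thesis using J by (intro exI[of _ "\<Sum>k<n. J k"]) (meson order_trans)
  qed
  have "limit_measures f B y = V"
  proof (intro subset_antisym subsetI)
    fix \<mu> assume \<mu>: "\<mu> \<in> V"
    then have \<mu>I: "\<mu> \<in> invariant_measures f B" using VI by blast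
    show "\<mu> \<in> limit_measures f B y"
    proof (rule dyn.limit_measuresI[OF y(1) dyn.invariant_D(1)[OF \<mu>I]])
      fix e :: real and n L :: nat assume e: "e > 0"
      then have e2: "e / 2 > 0" by simp
      obtain J where J: "\<forall>j\<ge>J. \<forall>T. s (Suc j) \<le> T \<and> T \<le> s (Suc (Suc j)) \<longrightarrow>
        (\<forall>k<n. \<bar>avg f (\<lambda>x. x ^ k) T y - x (Suc j) k\<bar> \<le> e / 2)" using conv_all[OF e2] by blast
      obtain i where i: "i \<ge> Suc (max J L)" "\<forall>k<n. \<bar>x i k - dyn.mom \<mu> k\<bar> < e / 2"
        using x(3) \<mu> e2 by blast
      obtain j where j: "i = Suc j" using i(1) by (cases i) auto
      have "\<bar>avg f (\<lambda>x. x ^ k) (s i) y - dyn.mom \<mu> k\<bar> < e" if "k < n" for k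
      proof -
        have "\<bar>avg f (\<lambda>x. x ^ k) (s i) y - x i k\<bar> \<le> e / 2"
          using J[rule_format, of j "s i" k] i(1) that strict_mono_less_eq[OF mono, of "Suc j" "Suc (Suc j)"] unfolding j by simp
        then show ?thesis using i(2)[rule_format, OF that] by linarith
      qed
      moreover have "L \<le> s i" using strict_mono_imp_increasing[OF mono, of i] i(1) by linarith
      ultimately show "\<exists>N\<ge>L. \<forall>k<n. \<bar>avg f (\<lambda>x. x ^ k) N y - dyn.mom \<mu> k\<bar> < e" by blast
    qed
  next
    fix \<mu> assume \<mu>: "\<mu> \<in> limit_measures f B y"
    then have \<mu>I: "\<mu> \<in> invariant_measures f B" by (rule dyn.limit_measures_invariant[OF y(1)])
    show "\<mu> \<in> V"
    proof (rule ccontr)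
      assume "\<mu> \<notin> V"
      then have out: "\<mu> \<in> topspace (invariant_space f B) - V" using \<mu>I dyn.topspace_invariant by simp
      have "openin (invariant_space f B) (topspace (invariant_space f B) - V)" using V(2) by blast
      from dyn.openin_invariant_box[OF this out] obtain n d where nd: "d > 0"
        "\<forall>\<nu>\<in>invariant_measures f B. (\<forall>k<n. \<bar>dyn.mom \<nu> k - dyn.mom \<mu> k\<bar> < d) \<longrightarrow> \<nu> \<in> topspace (invariant_space f B) - V"
        by blast
      have d2: "d / 2 > 0" using nd(1) by simp
      obtain J where J: "\<forall>j\<ge>J. \<forall>T. s (Suc j) \<le> T \<and> T \<le> s (Suc (Suc j)) \<longrightarrow>
        (\<forall>k<n. \<bar>avg f (\<lambda>x. x ^ k) T y - x (Suc j) k\<bar> \<le> d / 2)" using conv_all[OF d2] by blast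
      obtain T where T: "T \<ge> s (Suc J)" "\<forall>k<n. \<bar>avg f (\<lambda>x. x ^ k) T y - dyn.mom \<mu> k\<bar> < d / 2"
        using dyn.limit_measures_close[OF y(1) \<mu> d2] by blast
      have "s 0 \<le> T" using T(1) strict_mono_less_eq[OF mono, of 0 "Suc J"] by simp
      \<comment> \<open>\<open>T\<close> falls between the starts of windows \<open>i\<close> and
        \<open>i + 1\<close>, where the average is near the moments of
        \<open>\<nu> i \<in> V\<close>; so \<open>\<nu> i\<close> enters the neighbourhood of
        \<open>\<mu>\<close> that misses \<open>V\<close>.\<close>
      then obtain i where i: "s i \<le> T" "T < s (Suc i)" using interval_index[OF mono] by blast
      have "s (Suc J) < s (Suc i)" using T(1) i(2) by simp
      then have "Suc J \<le> i" using strict_mono_less[OF mono] by simp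
      then obtain j where j: "i = Suc j" "J \<le> j" by (cases i) auto
      have "\<bar>dyn.mom (\<nu> i) k - dyn.mom \<mu> k\<bar> < d" if "k < n" for k
      proof -
        have "\<bar>avg f (\<lambda>x. x ^ k) T y - x i k\<bar> \<le> d / 2"
          using J[rule_format, of j T k] j i that unfolding j by simp
        then show ?thesis using T(2)[rule_format, OF that] unfolding \<nu>(2)[symmetric] by linarith
      qed
      then have "\<nu> i \<notin> V" using nd(2) \<nu>I by blast
      then show False using \<nu>(1) by blast
    qed
  qed
  then show ?thesis using y by blast
qed

end

context core_system
begin

lemma limit_set_dense:
  assumes V: "V \<noteq> {}" "closedin (invariant_space f B) V" "connectedin (invariant_space f B) V"
  shows "B \<subseteq> closure {x \<in> B. limit_measures f B x = V}"
proof
  fix z assume z: "z \<in> B"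
  show "z \<in> closure {x \<in> B. limit_measures f B x = V}" unfolding closure_approachable
  proof (intro allI impI)
    fix e :: real assume e: "0 < e"
    then have "e / 2 > 0" by simp
    then obtain y where y: "y \<in> B" "\<bar>y - z\<bar> \<le> e / 2" "limit_measures f B y = V"
      using limit_set_realised[OF V z] by blast
    then have "dist y z < e" using e by (simp add: dist_real_def)
    then show "\<exists>y\<in>{x \<in> B. limit_measures f B x = V}. dist y z < e" using y by blast
  qed
qed

text \<open>A point is connected and, in a Hausdorff space, closed, so genericity is a special case
  of prescribed limit sets.\<close>

lemma singleton_dense:
  assumes "\<mu> \<in> invariant_measures f B"
  shows "B \<subseteq> closure {x \<in> B. limit_measures f B x = {\<mu>}}"
proof (rule limit_set_dense)
  show "closedin (invariant_space f B) {\<mu>}"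
    using closedin_Hausdorff_singleton[OF dyn.Hausdorff_invariant_space] assms dyn.topspace_invariant by blast
  show "connectedin (invariant_space f B) {\<mu>}" using assms dyn.topspace_invariant by simp
qed simp

end

theorem theorem10p3:
  fixes f :: "real \<Rightarrow> real" and B :: "real set"
  assumes "continuous_on {0..1} f"
    and "f ` {0..1} \<subseteq> {0..1}"
    and "basic_set f B"
  shows
    "(\<forall>l::nat. dense_in (invariant_space f B)
        {\<mu> \<in> invariant_measures f B. \<exists>p\<ge>l. CO_measure f B p \<mu>}) \<and>
     residual_in (invariant_space f B)
        {\<mu> \<in> invariant_measures f B. ergodic f \<mu> \<and> non_atomic \<mu> \<and> supp \<mu> = B} \<and>
     residual_in (invariant_space f B)
        {\<mu> \<in> invariant_measures f B. \<not> strongly_mixing f \<mu>} \<and>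
     ((\<forall>V. V \<noteq> {} \<and> closedin (invariant_space f B) V \<and> connectedin (invariant_space f B) V \<longrightarrow>
          dense_in (top_of_set B) {x \<in> B. limit_measures f B x = V}) \<and>
      (\<forall>\<mu>\<in>invariant_measures f B. \<exists>x. generic_point f B \<mu> x)) \<and>
     residual_in (top_of_set B) {x \<in> B. maximal_oscillation f B x}"
proof -
  obtain M F \<rho> c1 c2 r where sys: "core_system f M F \<rho> c1 c2 r" and B: "B = basic_points f M"
    using core_system_of_basic_set[OF assms] by blast
  interpret core_system f M F \<rho> c1 c2 r by (rule sys)
  have BB: "basic_system.B f M = B" unfolding B B_def ..
  interpret cycle_rich f B using cycle_rich_B unfolding BB .
  have dense: "dense_in (top_of_set B) {x \<in> B. limit_measures f B x = V}"
    if "V \<noteq> {}" "closedin (invariant_space f B) V" "connectedin (invariant_space f B) V" for V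
    using limit_set_dense[unfolded BB, OF that]
    unfolding dense_in_def closure_of_subtopology by (auto simp: Int_absorb1)
  have generic: "\<exists>x. generic_point f B \<mu> x" if "\<mu> \<in> invariant_measures f B" for \<mu>
  proof -
    have "closure {x \<in> B. limit_measures f B x = {\<mu>}} \<noteq> {}"
      using singleton_dense[unfolded BB, OF that] B_ne by (metis subset_empty)
    then show ?thesis unfolding closure_eq_empty generic_point_def by blast
  qed
  show ?thesis
    using CO_dense ergodic_full_residual not_mixing_residual[OF infinite_B[unfolded BB]] dense generic
      maximal_oscillation_residual[OF singleton_dense[unfolded BB]] by blast
qed

end
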